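(* Let $\sigma:Z\to W$ be a purely odd submersion of smooth superschemes over $S$. Then the categories $\mathcal D_Z\text{-mod}$ and $\mathcal D_W\text{-mod}$ of $\mathcal D$-modules on $Z$ and $W$ are equivalent. Specifically, the functors $\sigma^*:\mathcal D_W\text{-mod}\to\mathcal D_Z\text{-mod}$ and $\sigma_+:\mathcal D_Z\text{-mod}\to\mathcal D_W\text{-mod}$ are inverse equivalences.
   Context: Base: $S=\operatorname{Spec}(\Lambda)$, where $\Lambda$ is a fixed supercommutative finite-dimensional nilpotent extension of $\mathbb C$. Superschemes and morphisms are over $S$; dimensions, tangent sheaves, differentials and differential operators are relative to $S$. One may work in the Zariski or the complex topology. $\mathcal D$-modules: for $Z$ smooth over $S$, $\mathcal O_Z$ is the structure sheaf, $\mathcal T_Z$ the tangent sheaf, $\mathcal D_Z$ the sheaf of linear differential operators on $\mathcal O_Z$. A $\mathcal D_Z$-module is a ($\mathbb Z_2$-graded) sheaf of $\mathcal O_Z$-modules $\mathcal F$ with a flat connection $\nabla$, equivalently a sheaf of left $\mathcal D_Z$-modules; $\nabla_v$ denotes the action of a vector field $v$. No coherence is assumed. A submersion $\sigma:Z\to W$ is purely odd if its fibers have dimension $(0|n)$ for some $n$; $Z$ and $W$ then have the same underlying topological space, $\sigma$ is the identity on it, and locally $\mathcal O_Z=\mathcal O_W[\theta_1,\dots,\theta_n]$ with odd fiber coordinates $\theta_i$. Functors: $\sigma^*(\mathcal G)=\mathcal O_Z\otimes_{\mathcal O_W}\mathcal G$ with the pulled-back connection. Let $\mathcal T_\sigma\subset\mathcal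 T_Z$ be the vertical tangent sheaf (kernel of $\mathcal T_Z\to\sigma^*\mathcal T_W$). Then $\sigma_+(\mathcal F)=\sigma_*(\operatorname{ann}(\mathcal T_\sigma))$, where $\operatorname{ann}(\mathcal T_\sigma)\subset\mathcal F$ is the subsheaf of sections killed by $\nabla_v$ for all $v\in\mathcal T_\sigma$; a vector field on $W$ acts on it through any local lift to a vector field on $Z$. *)

theory Defs
  imports
    "HOL-Analysis.Analysis"
    "HOL-Algebra.Ideal"
    "HOL-Algebra.RingHom"
    "HOL-Algebra.Module"
    "HOL-Algebra.Subrings"
    "HOL-Combinatorics.Permutations"
    "HOL-Library.Poly_Mapping"
begin

section \<open>Superalgebra\<close>

text \<open>Parities are Booleans (\<^term>\<open>False\<close> is even, \<^term>\<open>True\<close> is odd), so addition of parities is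
  \<open>i \<noteq> j\<close>, and the Koszul sign of \<open>i\<close> and \<open>j\<close> is $-1$ iff \<open>i \<and> j\<close>.\<close>

definition koszul :: "('a, 'x) ring_scheme \<Rightarrow> bool \<Rightarrow> bool \<Rightarrow> 'a \<Rightarrow> 'a" where
  "koszul M i j x = (if i \<and> j then \<ominus>\<^bsub>M\<^esub> x else x)"

definition graded_group :: "('a, 'x) ring_scheme \<Rightarrow> (bool \<Rightarrow> 'a set) \<Rightarrow> bool" where
  "graded_group M gr \<longleftrightarrow>
     (\<forall>i. additive_subgroup (gr i) M) \<and>
     (\<forall>x\<in>carrier M. \<exists>!x0. x0 \<in> gr False \<and> x \<ominus>\<^bsub>M\<^esub> x0 \<in> gr True)"

record 'a superring = "'a ring" +
  grade :: "bool \<Rightarrow> 'a set"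

locale supercommutative_ring = ring R for R :: "('a, 'x) superring_scheme" (structure) +
  assumes graded: "graded_group R (grade R)"
    and one_even: "\<one> \<in> grade R False"
    and grade_mult: "\<And>i j a b. a \<in> grade R i \<Longrightarrow> b \<in> grade R j \<Longrightarrow> a \<otimes> b \<in> grade R (i \<noteq> j)"
    and supercommutative:
      "\<And>i j a b. a \<in> grade R i \<Longrightarrow> b \<in> grade R j \<Longrightarrow> a \<otimes> b = koszul R i j (b \<otimes> a)"

definition superring_hom ::
    "('a, 'x) superring_scheme \<Rightarrow> ('b, 'y) superring_scheme \<Rightarrow> ('a \<Rightarrow> 'b) set" where
  "superring_hom R S = {h \<in> ring_hom R S. \<forall>i. h ` grade R i \<subseteq> grade S i}"

text \<open>The parity involution $a_0 + a_1 \mapsto a_0 - a_1$.\<close>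

definition parity_inv :: "('a, 'x) superring_scheme \<Rightarrow> 'a \<Rightarrow> 'a" where
  "parity_inv R a =
     (THE b. \<exists>a0\<in>grade R False. \<exists>a1\<in>grade R True. a = a0 \<oplus>\<^bsub>R\<^esub> a1 \<and> b = a0 \<ominus>\<^bsub>R\<^esub> a1)"

text \<open>HOL-Algebra modules presuppose a commutative ring; the ring part of the record type
  \<^type>\<open>module\<close> is reused, its multiplication and unit being irrelevant.\<close>

record ('a, 'm) supermodule = "('a, 'm) module" +
  mgrade :: "bool \<Rightarrow> 'm set"

locale left_supermodule = R?: supercommutative_ring R + M?: abelian_group M
    for R :: "('a, 'x) superring_scheme" and M :: "('a, 'm, 'y) supermodule_scheme" (structure) +
  assumes smult_closed: "\<And>a s. a \<in> carrier R \<Longrightarrow> s \<in> carrier M \<Longrightarrow> a \<odot> s \<in> carrier M"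
    and smult_l_distr: "\<And>a b s. a \<in> carrier R \<Longrightarrow> b \<in> carrier R \<Longrightarrow> s \<in> carrier M \<Longrightarrow>
      (a \<oplus>\<^bsub>R\<^esub> b) \<odot> s = a \<odot> s \<oplus> b \<odot> s"
    and smult_r_distr: "\<And>a s t. a \<in> carrier R \<Longrightarrow> s \<in> carrier M \<Longrightarrow> t \<in> carrier M \<Longrightarrow>
      a \<odot> (s \<oplus> t) = a \<odot> s \<oplus> a \<odot> t"
    and smult_assoc: "\<And>a b s. a \<in> carrier R \<Longrightarrow> b \<in> carrier R \<Longrightarrow> s \<in> carrier M \<Longrightarrow>
      (a \<otimes>\<^bsub>R\<^esub> b) \<odot> s = a \<odot> (b \<odot> s)"
    and smult_one: "\<And>s. s \<in> carrier M \<Longrightarrow> \<one>\<^bsub>R\<^esub> \<odot> s = s"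
    and mgraded: "graded_group M (mgrade M)"
    and mgrade_smult: "\<And>i j a s. a \<in> grade R i \<Longrightarrow> s \<in> mgrade M j \<Longrightarrow> a \<odot> s \<in> mgrade M (i \<noteq> j)"

text \<open>\<open>basis_over R B X e\<close>: every element of \<open>R\<close> is uniquely $\sum_{x \in X} c_x e_x$ with $c_x \in B$.\<close>

definition basis_over :: "('a, 'x) ring_scheme \<Rightarrow> 'a set \<Rightarrow> 'i set \<Rightarrow> ('i \<Rightarrow> 'a) \<Rightarrow> bool" where
  "basis_over R B X e \<longleftrightarrow>
     finite X \<and> e \<in> X \<rightarrow> carrier R \<and> B \<subseteq> carrier R \<and>
     (\<forall>s\<in>carrier R. \<exists>!c. c \<in> X \<rightarrow>\<^sub>E B \<and> s = (\<Oplus>\<^bsub>R\<^esub>x\<in>X. c x \<otimes>\<^bsub>R\<^esub> e x))"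

text \<open>For odd elements $\theta_0,\dots,\theta_{n-1}$, the product $\theta_{i_1}\cdots\theta_{i_k}$
  over \<open>I\<close> $= \{i_1 < \dots < i_k\}$.\<close>

definition odd_monomial :: "('a, 'x) ring_scheme \<Rightarrow> 'a list \<Rightarrow> nat set \<Rightarrow> 'a" where
  "odd_monomial R ths I =
     foldr (\<lambda>i y. (ths ! i) \<otimes>\<^bsub>R\<^esub> y) (sorted_list_of_set I) \<one>\<^bsub>R\<^esub>"

section \<open>The base ring\<close>

definition complex_ring :: "complex ring" where
  "complex_ring = \<lparr>carrier = UNIV, mult = (*), one = 1, zero = 0, add = (+)\<rparr>"

record 'l complex_superalgebra = "'l superring" +
  of_cplx :: "complex \<Rightarrow> 'l"

locale nilpotent_extension = supercommutative_ring \<Lambda>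
    for \<Lambda> :: "'l complex_superalgebra" (structure) +
  assumes of_cplx_hom: "of_cplx \<Lambda> \<in> ring_hom complex_ring \<Lambda>"
    and of_cplx_even: "range (of_cplx \<Lambda>) \<subseteq> grade \<Lambda> False"
    and finite_dimensional: "\<exists>B. basis_over \<Lambda> (range (of_cplx \<Lambda>)) B (\<lambda>b. b)"
    and nilpotent_augmentation:
      "\<exists>\<epsilon>\<in>ring_hom \<Lambda> complex_ring. (\<forall>z. \<epsilon> (of_cplx \<Lambda> z) = z) \<and>
         (\<exists>k. \<forall>xs\<in>lists (a_kernel \<Lambda> complex_ring \<epsilon>). length xs = k \<longrightarrow> foldr (\<otimes>) xs \<one> = \<zero>)"

section \<open>Superspaces over the base\<close>

locale set_sheaf =
  fixes X :: "'p topology" and S :: "'p set \<Rightarrow> 's set" and r :: "'p set \<Rightarrow> 'p set \<Rightarrow> 's \<Rightarrow> 's"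
  assumes res_closed: "\<And>U V s. openin X U \<Longrightarrow> openin X V \<Longrightarrow> V \<subseteq> U \<Longrightarrow> s \<in> S U \<Longrightarrow> r U V s \<in> S V"
    and res_id: "\<And>U s. openin X U \<Longrightarrow> s \<in> S U \<Longrightarrow> r U U s = s"
    and res_trans: "\<And>U V N s. openin X U \<Longrightarrow> openin X V \<Longrightarrow> openin X N \<Longrightarrow> N \<subseteq> V \<Longrightarrow> V \<subseteq> U \<Longrightarrow>
      s \<in> S U \<Longrightarrow> r V N (r U V s) = r U N s"
    and glue: "\<And>\<V> f. (\<And>V. V \<in> \<V> \<Longrightarrow> openin X V) \<Longrightarrow> (\<And>V. V \<in> \<V> \<Longrightarrow> f V \<in> S V) \<Longrightarrow>
      (\<And>V N. V \<in> \<V> \<Longrightarrow> N \<in> \<V> \<Longrightarrow> r V (V \<inter> N) (f V) = r N (V \<inter> N) (f N)) \<Longrightarrow>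
      \<exists>!s. s \<in> S (\<Union>\<V>) \<and> (\<forall>V\<in>\<V>. r (\<Union>\<V>) V s = f V)"

text \<open>\<open>scalar Z U\<close> is the structure map from the base ring to the sections over \<open>U\<close>.\<close>

record ('p, 'l, 'a) superspace =
  base_top :: "'p topology"
  fun_ring :: "'p set \<Rightarrow> 'a superring"
  fun_res :: "'p set \<Rightarrow> 'p set \<Rightarrow> 'a \<Rightarrow> 'a"
  scalar :: "'p set \<Rightarrow> 'l \<Rightarrow> 'a"

locale superringed_space =
  fixes \<Lambda> :: "'l complex_superalgebra" and Z :: "('p, 'l, 'a) superspace"
  assumes fun_sheaf: "set_sheaf (base_top Z) (\<lambda>U. carrier (fun_ring Z U)) (fun_res Z)"
    and fun_supercomm: "\<And>U. openin (base_top Z) U \<Longrightarrow> supercommutative_ring (fun_ring Z U)"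
    and fun_res_hom: "\<And>U V. openin (base_top Z) U \<Longrightarrow> openin (base_top Z) V \<Longrightarrow> V \<subseteq> U \<Longrightarrow>
      fun_res Z U V \<in> superring_hom (fun_ring Z U) (fun_ring Z V)"
    and scalar_hom: "\<And>U. openin (base_top Z) U \<Longrightarrow> scalar Z U \<in> superring_hom \<Lambda> (fun_ring Z U)"
    and scalar_res: "\<And>U V x. openin (base_top Z) U \<Longrightarrow> openin (base_top Z) V \<Longrightarrow> V \<subseteq> U \<Longrightarrow>
      x \<in> carrier \<Lambda> \<Longrightarrow> fun_res Z U V (scalar Z U x) = scalar Z V x"

section \<open>Smooth superschemes over the base\<close>

text \<open>\<open>A\<close> below is a sheaf of even functions on the open set \<open>U\<close>, given as subsets of the sections
  of \<open>\<O>\<^sub>Z\<close>, such that \<open>\<O>\<^sub>Z = A \<otimes> \<Lambda>[\<theta>\<^sub>1,\<dots>,\<theta>\<^sub>n]\<close> on \<open>U\<close>.\<close>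

abbreviation sub_ring :: "('p, 'l, 'a) superspace \<Rightarrow> ('p set \<Rightarrow> 'a set) \<Rightarrow> 'p set \<Rightarrow> 'a superring" where
  "sub_ring Z A V \<equiv> (fun_ring Z V)\<lparr>carrier := A V\<rparr>"

abbreviation cplx_scalar ::
    "'l complex_superalgebra \<Rightarrow> ('p, 'l, 'a) superspace \<Rightarrow> 'p set \<Rightarrow> complex \<Rightarrow> 'a" where
  "cplx_scalar \<Lambda> Z V z \<equiv> scalar Z V (of_cplx \<Lambda> z)"

definition split_chart ::
    "'l complex_superalgebra \<Rightarrow> ('p, 'l, 'a) superspace \<Rightarrow> 'p set \<Rightarrow> ('p set \<Rightarrow> 'a set) \<Rightarrow> bool" where
  "split_chart \<Lambda> Z U A \<longleftrightarrow>
     openin (base_top Z) U \<and>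
     (\<forall>V. openin (base_top Z) V \<and> V \<subseteq> U \<longrightarrow>
        subring (A V) (fun_ring Z V) \<and> A V \<subseteq> grade (fun_ring Z V) False \<and>
        range (cplx_scalar \<Lambda> Z V) \<subseteq> A V \<and>
        (\<forall>N. openin (base_top Z) N \<and> N \<subseteq> V \<longrightarrow> fun_res Z V N ` A V \<subseteq> A N)) \<and>
     (\<exists>B ths. basis_over \<Lambda> (range (of_cplx \<Lambda>)) B (\<lambda>b. b) \<and> set ths \<subseteq> grade (fun_ring Z U) True \<and>
        (\<forall>V. openin (base_top Z) V \<and> V \<subseteq> U \<longrightarrow>
           basis_over (fun_ring Z V) (A V) (B \<times> Pow {..<length ths})
             (\<lambda>(b, I). scalar Z V b \<otimes>\<^bsub>fun_ring Z V\<^esub>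
                       odd_monomial (fun_ring Z V) (map (fun_res Z U V) ths) I)))"

subsection \<open>Zariski topology\<close>

text \<open>Complex polynomials in variables $x_0, x_1, \dots$.\<close>

type_synonym cpoly = "(nat \<Rightarrow>\<^sub>0 nat) \<Rightarrow>\<^sub>0 complex"

definition cpolys :: "nat \<Rightarrow> cpoly set" where
  "cpolys N = {f. \<forall>m\<in>Poly_Mapping.keys f. Poly_Mapping.keys m \<subseteq> {..<N}}"

definition cpoly_eval ::
    "('a, 'x) ring_scheme \<Rightarrow> (complex \<Rightarrow> 'a) \<Rightarrow> (nat \<Rightarrow> 'a) \<Rightarrow> cpoly \<Rightarrow> 'a" where
  "cpoly_eval R \<kappa> x f =
     (\<Oplus>\<^bsub>R\<^esub>m\<in>Poly_Mapping.keys f. \<kappa> (Poly_Mapping.lookup f m) \<otimes>\<^bsub>R\<^esub> (\<Otimes>\<^bsub>R\<^esub>i\<in>Poly_Mapping.keys m. x i [^]\<^bsub>R\<^esub> Poly_Mapping.lookup m i))"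

definition cpoly_pderiv :: "nat \<Rightarrow> cpoly \<Rightarrow> cpoly" where
  "cpoly_pderiv i f =
     (\<Sum>m\<in>Poly_Mapping.keys f. Poly_Mapping.single (m - Poly_Mapping.single i 1) (of_nat (Poly_Mapping.lookup m i) * Poly_Mapping.lookup f m))"

definition jacobian :: "nat \<Rightarrow> (nat \<Rightarrow> cpoly) \<Rightarrow> cpoly" where
  "jacobian k f = (\<Sum>\<pi> | \<pi> permutes {..<k}. of_int (sign \<pi>) * (\<Prod>j<k. cpoly_pderiv (\<pi> j) (f j)))"

text \<open>Standard smooth algebras $\mathbb C[x_1,\dots,x_N]/(f_1,\dots,f_k)$, with
  $\det(\partial f_j/\partial x_i)_{i,j\le k}$ a unit; every smooth algebra is locally of this form.\<close>

definition standard_smooth :: "('a, 'x) ring_scheme \<Rightarrow> (complex \<Rightarrow> 'a) \<Rightarrow> bool" where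
  "standard_smooth R \<kappa> \<longleftrightarrow>
     (\<exists>N k x f. k \<le> N \<and> x \<in> {..<N} \<rightarrow> carrier R \<and> f \<in> {..<k} \<rightarrow> cpolys N \<and>
        cpoly_eval R \<kappa> x ` cpolys N = carrier R \<and>
        (\<forall>g\<in>cpolys N. cpoly_eval R \<kappa> x g = \<zero>\<^bsub>R\<^esub> \<longleftrightarrow>
           (\<exists>q\<in>{..<k} \<rightarrow> cpolys N. g = (\<Sum>j<k. q j * f j))) \<and>
        cpoly_eval R \<kappa> x (jacobian k f) \<in> Units R)"

definition nonvanishing ::
    "('p, 'l, 'a) superspace \<Rightarrow> ('p set \<Rightarrow> 'a set) \<Rightarrow> 'p set \<Rightarrow> 'a \<Rightarrow> 'p set" where
  "nonvanishing Z A U f =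
     {p \<in> U. \<exists>V. openin (base_top Z) V \<and> p \<in> V \<and> V \<subseteq> U \<and> fun_res Z U V f \<in> Units (sub_ring Z A V)}"

text \<open>\<open>(U, A)\<close> is the prime spectrum of the ring of its global sections: points are the prime
  ideals, the sets $D(f)$ form a basis, and the sections over $D(f)$ are the localization at $f$.\<close>

definition affine_scheme ::
    "('p, 'l, 'a) superspace \<Rightarrow> 'p set \<Rightarrow> ('p set \<Rightarrow> 'a set) \<Rightarrow> bool" where
  "affine_scheme Z U A \<longleftrightarrow>
     bij_betw (\<lambda>p. {f \<in> A U. p \<notin> nonvanishing Z A U f}) U {P. primeideal P (sub_ring Z A U)} \<and>
     (\<forall>V p. openin (base_top Z) V \<and> V \<subseteq> U \<and> p \<in> V \<longrightarrow>
        (\<exists>f\<in>A U. p \<in> nonvanishing Z A U f \<and> nonvanishing Z A U f \<subseteq> V)) \<and>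
     (\<forall>f\<in>A U. \<forall>a\<in>A (nonvanishing Z A U f). \<exists>n::nat. \<exists>b\<in>A U.
        fun_res Z U (nonvanishing Z A U f) b =
        fun_res Z U (nonvanishing Z A U f) (f [^]\<^bsub>fun_ring Z U\<^esub> n)
          \<otimes>\<^bsub>fun_ring Z (nonvanishing Z A U f)\<^esub> a) \<and>
     (\<forall>f\<in>A U. \<forall>b\<in>A U.
        fun_res Z U (nonvanishing Z A U f) b = \<zero>\<^bsub>fun_ring Z (nonvanishing Z A U f)\<^esub> \<longrightarrow>
        (\<exists>n::nat. f [^]\<^bsub>fun_ring Z U\<^esub> n \<otimes>\<^bsub>fun_ring Z U\<^esub> b = \<zero>\<^bsub>fun_ring Z U\<^esub>))"

definition smooth_affine_chart ::
    "'l complex_superalgebra \<Rightarrow> ('p, 'l, 'a) superspace \<Rightarrow> 'p set \<Rightarrow> ('p set \<Rightarrow> 'a set) \<Rightarrow> bool" where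
  "smooth_affine_chart \<Lambda> Z U A \<longleftrightarrow>
     affine_scheme Z U A \<and> standard_smooth (sub_ring Z A U) (cplx_scalar \<Lambda> Z U)"

subsection \<open>Complex topology\<close>

text \<open>$\mathbb C^m$ consists of the extensional functions on \<open>{..<m}\<close>.\<close>

definition complex_space :: "nat \<Rightarrow> (nat \<Rightarrow> complex) topology" where
  "complex_space m = product_topology (\<lambda>_. euclidean) {..<m}"

text \<open>Complex differentiability at every point of the open set \<open>D\<close>.\<close>

definition holomorphic_in :: "nat \<Rightarrow> (nat \<Rightarrow> complex) set \<Rightarrow> ((nat \<Rightarrow> complex) \<Rightarrow> complex) \<Rightarrow> bool" where
  "holomorphic_in m D f \<longleftrightarrow>
     (\<forall>z\<in>D. \<exists>c :: nat \<Rightarrow> complex. \<forall>e>0. \<exists>d>0. \<forall>w\<in>D. (\<forall>i<m. cmod (w i - z i) < d) \<longrightarrow>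
        cmod (f w - f z - (\<Sum>i<m. c i * (w i - z i))) \<le> e * (\<Sum>i<m. cmod (w i - z i)))"

definition holomorphic_ring :: "nat \<Rightarrow> (nat \<Rightarrow> complex) set \<Rightarrow> ((nat \<Rightarrow> complex) \<Rightarrow> complex) ring" where
  "holomorphic_ring m D =
     \<lparr>carrier = {f \<in> extensional D. holomorphic_in m D f},
      mult = (\<lambda>f g. \<lambda>z\<in>D. f z * g z), one = (\<lambda>z\<in>D. 1),
      zero = (\<lambda>z\<in>D. 0), add = (\<lambda>f g. \<lambda>z\<in>D. f z + g z)\<rparr>"

definition holomorphic_chart ::
    "'l complex_superalgebra \<Rightarrow> ('p, 'l, 'a) superspace \<Rightarrow> 'p set \<Rightarrow> ('p set \<Rightarrow> 'a set) \<Rightarrow> bool" where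
  "holomorphic_chart \<Lambda> Z U A \<longleftrightarrow>
     (\<exists>m D \<phi> h. openin (complex_space m) D \<and>
        homeomorphic_map (subtopology (base_top Z) U) (subtopology (complex_space m) D) \<phi> \<and>
        (\<forall>V. openin (base_top Z) V \<and> V \<subseteq> U \<longrightarrow>
           h V \<in> ring_iso (sub_ring Z A V) (holomorphic_ring m (\<phi> ` V)) \<and>
           (\<forall>c. h V (cplx_scalar \<Lambda> Z V c) = (\<lambda>z\<in>\<phi> ` V. c)) \<and>
           (\<forall>N. openin (base_top Z) N \<and> N \<subseteq> V \<longrightarrow>
              (\<forall>a\<in>A V. h N (fun_res Z V N a) = restrict (h V a) (\<phi> ` N)))))"

subsection \<open>Smoothness\<close>

datatype setting = Zariski_topology | Complex_topology

fun smooth_chart ::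
    "setting \<Rightarrow> 'l complex_superalgebra \<Rightarrow> ('p, 'l, 'a) superspace \<Rightarrow> 'p set \<Rightarrow> ('p set \<Rightarrow> 'a set) \<Rightarrow> bool"
  where
    "smooth_chart Zariski_topology = smooth_affine_chart"
  | "smooth_chart Complex_topology = holomorphic_chart"

locale smooth_superscheme = superringed_space \<Lambda> Z
    for \<tau> :: setting and \<Lambda> :: "'l complex_superalgebra" and Z :: "('p, 'l, 'a) superspace" +
  assumes locally_smooth: "\<And>p. p \<in> topspace (base_top Z) \<Longrightarrow>
    \<exists>U A. p \<in> U \<and> split_chart \<Lambda> Z U A \<and> smooth_chart \<tau> \<Lambda> Z U A"

section \<open>Purely odd submersions\<close>

text \<open>The map on points is the identity, so a submersion is given by its comorphism
  \<open>\<sigma> U : \<O>\<^sub>W(U) \<rightarrow> \<O>\<^sub>Z(U)\<close>.\<close>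

locale purely_odd_submersion =
  fixes \<Lambda> :: "'l complex_superalgebra"
    and Z :: "('p, 'l, 'a) superspace" and W :: "('p, 'l, 'b) superspace"
    and \<sigma> :: "'p set \<Rightarrow> 'b \<Rightarrow> 'a"
  assumes same_space: "base_top Z = base_top W"
    and comorphism_hom: "\<And>U. openin (base_top W) U \<Longrightarrow>
      \<sigma> U \<in> superring_hom (fun_ring W U) (fun_ring Z U)"
    and comorphism_res: "\<And>U V b. openin (base_top W) U \<Longrightarrow> openin (base_top W) V \<Longrightarrow> V \<subseteq> U \<Longrightarrow>
      b \<in> carrier (fun_ring W U) \<Longrightarrow> fun_res Z U V (\<sigma> U b) = \<sigma> V (fun_res W U V b)"
    and comorphism_scalar: "\<And>U x. openin (base_top W) U \<Longrightarrow> x \<in> carrier \<Lambda> \<Longrightarrow>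
      \<sigma> U (scalar W U x) = scalar Z U x"
    and odd_fiber_coordinates: "\<exists>n. \<forall>p\<in>topspace (base_top W). \<exists>U ths.
      openin (base_top W) U \<and> p \<in> U \<and> length ths = n \<and> set ths \<subseteq> grade (fun_ring Z U) True \<and>
      (\<forall>V. openin (base_top W) V \<and> V \<subseteq> U \<longrightarrow>
         inj_on (\<sigma> V) (carrier (fun_ring W V)) \<and>
         basis_over (fun_ring Z V) (\<sigma> V ` carrier (fun_ring W V)) (Pow {..<n})
           (odd_monomial (fun_ring Z V) (map (fun_res Z U V) ths)))"

section \<open>Vector fields\<close>

text \<open>A vector field on \<open>U\<close> is a derivation of the restriction of \<open>\<O>\<^sub>Z\<close> to \<open>U\<close>: it acts on the
  sections over every open \<open>V \<subseteq> U\<close>. It is \<^term>\<open>undefined\<close> elsewhere.\<close>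

type_synonym ('p, 'a) vfield = "'p set \<Rightarrow> 'a \<Rightarrow> 'a"

definition vf_mk :: "('p, 'l, 'a) superspace \<Rightarrow> 'p set \<Rightarrow> ('p, 'a) vfield \<Rightarrow> ('p, 'a) vfield" where
  "vf_mk Z U h = (\<lambda>V f. if openin (base_top Z) V \<and> V \<subseteq> U \<and> f \<in> carrier (fun_ring Z V)
                        then h V f else undefined)"

definition vf_add ::
    "('p, 'l, 'a) superspace \<Rightarrow> 'p set \<Rightarrow> ('p, 'a) vfield \<Rightarrow> ('p, 'a) vfield \<Rightarrow> ('p, 'a) vfield" where
  "vf_add Z U v w = vf_mk Z U (\<lambda>V f. v V f \<oplus>\<^bsub>fun_ring Z V\<^esub> w V f)"

definition vf_smult :: "('p, 'l, 'a) superspace \<Rightarrow> 'p set \<Rightarrow> 'a \<Rightarrow> ('p, 'a) vfield \<Rightarrow> ('p, 'a) vfield" where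
  "vf_smult Z U g v = vf_mk Z U (\<lambda>V f. fun_res Z U V g \<otimes>\<^bsub>fun_ring Z V\<^esub> v V f)"

definition vf_bracket ::
    "('p, 'l, 'a) superspace \<Rightarrow> 'p set \<Rightarrow> bool \<Rightarrow> bool \<Rightarrow> ('p, 'a) vfield \<Rightarrow> ('p, 'a) vfield \<Rightarrow> ('p, 'a) vfield"
  where
  "vf_bracket Z U i j v w =
     vf_mk Z U (\<lambda>V f. v V (w V f) \<ominus>\<^bsub>fun_ring Z V\<^esub> koszul (fun_ring Z V) i j (w V (v V f)))"

definition vf_res :: "('p, 'l, 'a) superspace \<Rightarrow> 'p set \<Rightarrow> ('p, 'a) vfield \<Rightarrow> ('p, 'a) vfield" where
  "vf_res Z V v = vf_mk Z V v"

definition derivations ::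
    "'l complex_superalgebra \<Rightarrow> ('p, 'l, 'a) superspace \<Rightarrow> 'p set \<Rightarrow> bool \<Rightarrow> ('p, 'a) vfield set" where
  "derivations \<Lambda> Z U i = {v. v = vf_mk Z U v \<and>
     (\<forall>V. openin (base_top Z) V \<and> V \<subseteq> U \<longrightarrow>
        v V \<in> carrier (fun_ring Z V) \<rightarrow> carrier (fun_ring Z V) \<and>
        (\<forall>j. v V ` grade (fun_ring Z V) j \<subseteq> grade (fun_ring Z V) (i \<noteq> j)) \<and>
        (\<forall>f\<in>carrier (fun_ring Z V). \<forall>g\<in>carrier (fun_ring Z V).
           v V (f \<oplus>\<^bsub>fun_ring Z V\<^esub> g) = v V f \<oplus>\<^bsub>fun_ring Z V\<^esub> v V g) \<and>
        (\<forall>j. \<forall>f\<in>grade (fun_ring Z V) j. \<forall>g\<in>carrier (fun_ring Z V).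
           v V (f \<otimes>\<^bsub>fun_ring Z V\<^esub> g) =
           v V f \<otimes>\<^bsub>fun_ring Z V\<^esub> g \<oplus>\<^bsub>fun_ring Z V\<^esub>
           koszul (fun_ring Z V) i j (f \<otimes>\<^bsub>fun_ring Z V\<^esub> v V g)) \<and>
        (\<forall>x\<in>carrier \<Lambda>. v V (scalar Z V x) = \<zero>\<^bsub>fun_ring Z V\<^esub>) \<and>
        (\<forall>N f. openin (base_top Z) N \<and> N \<subseteq> V \<and> f \<in> carrier (fun_ring Z V) \<longrightarrow>
           fun_res Z V N (v V f) = v N (fun_res Z V N f)))}"

definition tangent ::
    "'l complex_superalgebra \<Rightarrow> ('p, 'l, 'a) superspace \<Rightarrow> 'p set \<Rightarrow> ('p, 'a) vfield set" where
  "tangent \<Lambda> Z U = {vf_add Z U v w |v w. v \<in> derivations \<Lambda> Z U False \<and> w \<in> derivations \<Lambda> Z U True}"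

section \<open>D-modules\<close>

record ('p, 'a, 'm) dmodule =
  mod_sec :: "'p set \<Rightarrow> ('a, 'm) supermodule"
  mod_res :: "'p set \<Rightarrow> 'p set \<Rightarrow> 'm \<Rightarrow> 'm"
  nabla :: "'p set \<Rightarrow> ('p, 'a) vfield \<Rightarrow> 'm \<Rightarrow> 'm"

locale D_module =
  fixes \<Lambda> :: "'l complex_superalgebra" and Z :: "('p, 'l, 'a) superspace"
    and F :: "('p, 'a, 'm) dmodule"
  assumes mod_sheaf: "set_sheaf (base_top Z) (\<lambda>U. carrier (mod_sec F U)) (mod_res F)"
    and mod_sections: "\<And>U. openin (base_top Z) U \<Longrightarrow> left_supermodule (fun_ring Z U) (mod_sec F U)"
    and mod_res_add: "\<And>U V s t. openin (base_top Z) U \<Longrightarrow> openin (base_top Z) V \<Longrightarrow> V \<subseteq> U \<Longrightarrow>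
      s \<in> carrier (mod_sec F U) \<Longrightarrow> t \<in> carrier (mod_sec F U) \<Longrightarrow>
      mod_res F U V (s \<oplus>\<^bsub>mod_sec F U\<^esub> t) = mod_res F U V s \<oplus>\<^bsub>mod_sec F V\<^esub> mod_res F U V t"
    and mod_res_smult: "\<And>U V f s. openin (base_top Z) U \<Longrightarrow> openin (base_top Z) V \<Longrightarrow> V \<subseteq> U \<Longrightarrow>
      f \<in> carrier (fun_ring Z U) \<Longrightarrow> s \<in> carrier (mod_sec F U) \<Longrightarrow>
      mod_res F U V (f \<odot>\<^bsub>mod_sec F U\<^esub> s) = fun_res Z U V f \<odot>\<^bsub>mod_sec F V\<^esub> mod_res F U V s"
    and mod_res_grade: "\<And>U V i. openin (base_top Z) U \<Longrightarrow> openin (base_top Z) V \<Longrightarrow> V \<subseteq> U \<Longrightarrow>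
      mod_res F U V ` mgrade (mod_sec F U) i \<subseteq> mgrade (mod_sec F V) i"
    and nabla_closed: "\<And>U v s. openin (base_top Z) U \<Longrightarrow> v \<in> tangent \<Lambda> Z U \<Longrightarrow>
      s \<in> carrier (mod_sec F U) \<Longrightarrow> nabla F U v s \<in> carrier (mod_sec F U)"
    and nabla_grade: "\<And>U i j v. openin (base_top Z) U \<Longrightarrow> v \<in> derivations \<Lambda> Z U i \<Longrightarrow>
      nabla F U v ` mgrade (mod_sec F U) j \<subseteq> mgrade (mod_sec F U) (i \<noteq> j)"
    and nabla_res: "\<And>U V v s. openin (base_top Z) U \<Longrightarrow> openin (base_top Z) V \<Longrightarrow> V \<subseteq> U \<Longrightarrow>
      v \<in> tangent \<Lambda> Z U \<Longrightarrow> s \<in> carrier (mod_sec F U) \<Longrightarrow>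
      mod_res F U V (nabla F U v s) = nabla F V (vf_res Z V v) (mod_res F U V s)"
    and nabla_add: "\<And>U v s t. openin (base_top Z) U \<Longrightarrow> v \<in> tangent \<Lambda> Z U \<Longrightarrow>
      s \<in> carrier (mod_sec F U) \<Longrightarrow> t \<in> carrier (mod_sec F U) \<Longrightarrow>
      nabla F U v (s \<oplus>\<^bsub>mod_sec F U\<^esub> t) = nabla F U v s \<oplus>\<^bsub>mod_sec F U\<^esub> nabla F U v t"
    and nabla_vf_add: "\<And>U v w s. openin (base_top Z) U \<Longrightarrow> v \<in> tangent \<Lambda> Z U \<Longrightarrow> w \<in> tangent \<Lambda> Z U \<Longrightarrow>
      s \<in> carrier (mod_sec F U) \<Longrightarrow>
      nabla F U (vf_add Z U v w) s = nabla F U v s \<oplus>\<^bsub>mod_sec F U\<^esub> nabla F U w s"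
    and nabla_vf_smult: "\<And>U f v s. openin (base_top Z) U \<Longrightarrow> f \<in> carrier (fun_ring Z U) \<Longrightarrow>
      v \<in> tangent \<Lambda> Z U \<Longrightarrow> s \<in> carrier (mod_sec F U) \<Longrightarrow>
      nabla F U (vf_smult Z U f v) s = f \<odot>\<^bsub>mod_sec F U\<^esub> nabla F U v s"
    and nabla_Leibniz: "\<And>U i j v f s. openin (base_top Z) U \<Longrightarrow> v \<in> derivations \<Lambda> Z U i \<Longrightarrow>
      f \<in> grade (fun_ring Z U) j \<Longrightarrow> s \<in> carrier (mod_sec F U) \<Longrightarrow>
      nabla F U v (f \<odot>\<^bsub>mod_sec F U\<^esub> s) =
      v U f \<odot>\<^bsub>mod_sec F U\<^esub> s \<oplus>\<^bsub>mod_sec F U\<^esub>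
      koszul (mod_sec F U) i j (f \<odot>\<^bsub>mod_sec F U\<^esub> nabla F U v s)"
    and nabla_flat: "\<And>U i j v w s. openin (base_top Z) U \<Longrightarrow> v \<in> derivations \<Lambda> Z U i \<Longrightarrow>
      w \<in> derivations \<Lambda> Z U j \<Longrightarrow> s \<in> carrier (mod_sec F U) \<Longrightarrow>
      nabla F U (vf_bracket Z U i j v w) s =
      nabla F U v (nabla F U w s) \<ominus>\<^bsub>mod_sec F U\<^esub>
      koszul (mod_sec F U) i j (nabla F U w (nabla F U v s))"

text \<open>Morphisms are even, and \<^term>\<open>undefined\<close> outside the sections over open sets.\<close>

type_synonym ('p, 'm) dmod_map = "'p set \<Rightarrow> 'm \<Rightarrow> 'm"

definition dmap_mk ::
    "('p, 'l, 'a) superspace \<Rightarrow> ('p, 'a, 'm) dmodule \<Rightarrow> ('p, 'm) dmod_map \<Rightarrow> ('p, 'm) dmod_map" where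
  "dmap_mk Z F h = (\<lambda>U s. if openin (base_top Z) U \<and> s \<in> carrier (mod_sec F U) then h U s else undefined)"

definition dmod_hom ::
    "'l complex_superalgebra \<Rightarrow> ('p, 'l, 'a) superspace \<Rightarrow>
     ('p, 'a, 'm) dmodule \<Rightarrow> ('p, 'a, 'm) dmodule \<Rightarrow> ('p, 'm) dmod_map set" where
  "dmod_hom \<Lambda> Z F G = {h. h = dmap_mk Z F h \<and>
     (\<forall>U. openin (base_top Z) U \<longrightarrow>
        h U \<in> carrier (mod_sec F U) \<rightarrow> carrier (mod_sec G U) \<and>
        (\<forall>i. h U ` mgrade (mod_sec F U) i \<subseteq> mgrade (mod_sec G U) i) \<and>
        (\<forall>s\<in>carrier (mod_sec F U). \<forall>t\<in>carrier (mod_sec F U).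
           h U (s \<oplus>\<^bsub>mod_sec F U\<^esub> t) = h U s \<oplus>\<^bsub>mod_sec G U\<^esub> h U t) \<and>
        (\<forall>f\<in>carrier (fun_ring Z U). \<forall>s\<in>carrier (mod_sec F U).
           h U (f \<odot>\<^bsub>mod_sec F U\<^esub> s) = f \<odot>\<^bsub>mod_sec G U\<^esub> h U s) \<and>
        (\<forall>v\<in>tangent \<Lambda> Z U. \<forall>s\<in>carrier (mod_sec F U). h U (nabla F U v s) = nabla G U v (h U s)) \<and>
        (\<forall>V s. openin (base_top Z) V \<and> V \<subseteq> U \<and> s \<in> carrier (mod_sec F U) \<longrightarrow>
           h V (mod_res F U V s) = mod_res G U V (h U s)))}"

section \<open>Categories and equivalences\<close>

text \<open>\<open>arr_comp C x y z g f\<close> is the composite of \<open>f : x \<rightarrow> y\<close> and \<open>g : y \<rightarrow> z\<close>.\<close>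

record ('o, 'f) category_data =
  obj :: "'o set"
  hom_set :: "'o \<Rightarrow> 'o \<Rightarrow> 'f set"
  ident :: "'o \<Rightarrow> 'f"
  arr_comp :: "'o \<Rightarrow> 'o \<Rightarrow> 'o \<Rightarrow> 'f \<Rightarrow> 'f \<Rightarrow> 'f"

locale category =
  fixes C :: "('o, 'f) category_data"
  assumes ident_in_hom: "\<And>x. x \<in> obj C \<Longrightarrow> ident C x \<in> hom_set C x x"
    and comp_in_hom: "\<And>x y z f g. x \<in> obj C \<Longrightarrow> y \<in> obj C \<Longrightarrow> z \<in> obj C \<Longrightarrow>
      f \<in> hom_set C x y \<Longrightarrow> g \<in> hom_set C y z \<Longrightarrow> arr_comp C x y z g f \<in> hom_set C x z"
    and comp_ident: "\<And>x y f. x \<in> obj C \<Longrightarrow> y \<in> obj C \<Longrightarrow> f \<in> hom_set C x y \<Longrightarrow>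
      arr_comp C x x y f (ident C x) = f"
    and ident_comp: "\<And>x y f. x \<in> obj C \<Longrightarrow> y \<in> obj C \<Longrightarrow> f \<in> hom_set C x y \<Longrightarrow>
      arr_comp C x y y (ident C y) f = f"
    and comp_assoc: "\<And>w x y z f g h. w \<in> obj C \<Longrightarrow> x \<in> obj C \<Longrightarrow> y \<in> obj C \<Longrightarrow> z \<in> obj C \<Longrightarrow>
      f \<in> hom_set C w x \<Longrightarrow> g \<in> hom_set C x y \<Longrightarrow> h \<in> hom_set C y z \<Longrightarrow>
      arr_comp C w y z h (arr_comp C w x y g f) = arr_comp C w x z (arr_comp C x y z h g) f"

record ('o, 'f, 'q, 'g) functor_data =
  on_obj :: "'o \<Rightarrow> 'q"
  on_hom :: "'o \<Rightarrow> 'o \<Rightarrow> 'f \<Rightarrow> 'g"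

locale category_functor = C: category C + D: category D
    for C :: "('o, 'f) category_data" and D :: "('q, 'g) category_data"
      and \<Phi> :: "('o, 'f, 'q, 'g) functor_data" +
  assumes on_obj_closed: "\<And>x. x \<in> obj C \<Longrightarrow> on_obj \<Phi> x \<in> obj D"
    and on_hom_closed: "\<And>x y f. x \<in> obj C \<Longrightarrow> y \<in> obj C \<Longrightarrow> f \<in> hom_set C x y \<Longrightarrow>
      on_hom \<Phi> x y f \<in> hom_set D (on_obj \<Phi> x) (on_obj \<Phi> y)"
    and on_ident: "\<And>x. x \<in> obj C \<Longrightarrow> on_hom \<Phi> x x (ident C x) = ident D (on_obj \<Phi> x)"
    and on_comp: "\<And>x y z f g. x \<in> obj C \<Longrightarrow> y \<in> obj C \<Longrightarrow> z \<in> obj C \<Longrightarrow>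
      f \<in> hom_set C x y \<Longrightarrow> g \<in> hom_set C y z \<Longrightarrow>
      on_hom \<Phi> x z (arr_comp C x y z g f) =
      arr_comp D (on_obj \<Phi> x) (on_obj \<Phi> y) (on_obj \<Phi> z) (on_hom \<Phi> y z g) (on_hom \<Phi> x y f)"

definition identity_functor :: "('o, 'f, 'o, 'f) functor_data" where
  "identity_functor = \<lparr>on_obj = (\<lambda>x. x), on_hom = (\<lambda>_ _ f. f)\<rparr>"

definition functor_comp ::
    "('q, 'g, 'r, 'h) functor_data \<Rightarrow> ('o, 'f, 'q, 'g) functor_data \<Rightarrow> ('o, 'f, 'r, 'h) functor_data" where
  "functor_comp \<Psi> \<Phi> =
     \<lparr>on_obj = (\<lambda>x. on_obj \<Psi> (on_obj \<Phi> x)),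
      on_hom = (\<lambda>x y f. on_hom \<Psi> (on_obj \<Phi> x) (on_obj \<Phi> y) (on_hom \<Phi> x y f))\<rparr>"

definition isos :: "('o, 'f) category_data \<Rightarrow> 'o \<Rightarrow> 'o \<Rightarrow> 'f set" where
  "isos C x y = {f \<in> hom_set C x y. \<exists>g\<in>hom_set C y x.
     arr_comp C x y x g f = ident C x \<and> arr_comp C y x y f g = ident C y}"

definition naturally_isomorphic ::
    "('o, 'f) category_data \<Rightarrow> ('q, 'g) category_data \<Rightarrow>
     ('o, 'f, 'q, 'g) functor_data \<Rightarrow> ('o, 'f, 'q, 'g) functor_data \<Rightarrow> bool" where
  "naturally_isomorphic C D \<Phi> \<Psi> \<longleftrightarrow>
     (\<exists>\<eta>. (\<forall>x\<in>obj C. \<eta> x \<in> isos D (on_obj \<Phi> x) (on_obj \<Psi> x)) \<and>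
          (\<forall>x\<in>obj C. \<forall>y\<in>obj C. \<forall>f\<in>hom_set C x y.
             arr_comp D (on_obj \<Phi> x) (on_obj \<Phi> y) (on_obj \<Psi> y) (\<eta> y) (on_hom \<Phi> x y f) =
             arr_comp D (on_obj \<Phi> x) (on_obj \<Psi> x) (on_obj \<Psi> y) (on_hom \<Psi> x y f) (\<eta> x)))"

locale inverse_equivalences =
    \<Phi>: category_functor C D \<Phi> + \<Psi>: category_functor D C \<Psi>
    for C :: "('o, 'f) category_data" and D :: "('q, 'g) category_data"
      and \<Phi> :: "('o, 'f, 'q, 'g) functor_data" and \<Psi> :: "('q, 'g, 'o, 'f) functor_data" +
  assumes unit_iso: "naturally_isomorphic C C identity_functor (functor_comp \<Psi> \<Phi>)"
    and counit_iso: "naturally_isomorphic D D (functor_comp \<Phi> \<Psi>) identity_functor"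

definition D_mod ::
    "'l complex_superalgebra \<Rightarrow> ('p, 'l, 'a) superspace \<Rightarrow>
     (('p, 'a, 'm) dmodule, ('p, 'm) dmod_map) category_data" where
  "D_mod \<Lambda> Z =
     \<lparr>obj = {F. D_module \<Lambda> Z F},
      hom_set = dmod_hom \<Lambda> Z,
      ident = (\<lambda>F. dmap_mk Z F (\<lambda>U s. s)),
      arr_comp = (\<lambda>F G H k h. dmap_mk Z F (\<lambda>U s. k U (h U s)))\<rparr>"

section \<open>The functor of vertical flat sections\<close>

definition vertical_tangent ::
    "'l complex_superalgebra \<Rightarrow> ('p, 'l, 'a) superspace \<Rightarrow> ('p, 'l, 'b) superspace \<Rightarrow>
     ('p set \<Rightarrow> 'b \<Rightarrow> 'a) \<Rightarrow> 'p set \<Rightarrow> ('p, 'a) vfield set" where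
  "vertical_tangent \<Lambda> Z W \<sigma> U = {v \<in> tangent \<Lambda> Z U.
     \<forall>V. openin (base_top Z) V \<and> V \<subseteq> U \<longrightarrow>
       (\<forall>b\<in>carrier (fun_ring W V). v V (\<sigma> V b) = \<zero>\<^bsub>fun_ring Z V\<^esub>)}"

definition lifts ::
    "'l complex_superalgebra \<Rightarrow> ('p, 'l, 'a) superspace \<Rightarrow> ('p, 'l, 'b) superspace \<Rightarrow>
     ('p set \<Rightarrow> 'b \<Rightarrow> 'a) \<Rightarrow> 'p set \<Rightarrow> ('p, 'b) vfield \<Rightarrow> ('p, 'a) vfield set" where
  "lifts \<Lambda> Z W \<sigma> U w = {v \<in> tangent \<Lambda> Z U.
     \<forall>V. openin (base_top Z) V \<and> V \<subseteq> U \<longrightarrow>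
       (\<forall>b\<in>carrier (fun_ring W V). v V (\<sigma> V b) = \<sigma> V (w V b))}"

definition vertical_ann ::
    "'l complex_superalgebra \<Rightarrow> ('p, 'l, 'a) superspace \<Rightarrow> ('p, 'l, 'b) superspace \<Rightarrow>
     ('p set \<Rightarrow> 'b \<Rightarrow> 'a) \<Rightarrow> ('p, 'a, 'm) dmodule \<Rightarrow> 'p set \<Rightarrow> 'm set" where
  "vertical_ann \<Lambda> Z W \<sigma> F U = {s \<in> carrier (mod_sec F U).
     \<forall>V. openin (base_top Z) V \<and> V \<subseteq> U \<longrightarrow>
       (\<forall>v\<in>vertical_tangent \<Lambda> Z W \<sigma> V. nabla F V v (mod_res F U V s) = \<zero>\<^bsub>mod_sec F V\<^esub>)}"

definition direct_image_obj ::
    "'l complex_superalgebra \<Rightarrow> ('p, 'l, 'a) superspace \<Rightarrow> ('p, 'l, 'b) superspace \<Rightarrow>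
     ('p set \<Rightarrow> 'b \<Rightarrow> 'a) \<Rightarrow> ('p, 'a, 'm) dmodule \<Rightarrow> ('p, 'b, 'm) dmodule" where
  "direct_image_obj \<Lambda> Z W \<sigma> F =
     \<lparr>mod_sec = (\<lambda>U.
        \<lparr>carrier = vertical_ann \<Lambda> Z W \<sigma> F U,
         mult = undefined, one = undefined,
         zero = \<zero>\<^bsub>mod_sec F U\<^esub>, add = add (mod_sec F U),
         smult = (\<lambda>b s. \<sigma> U b \<odot>\<^bsub>mod_sec F U\<^esub> s),
         mgrade = (\<lambda>i. mgrade (mod_sec F U) i \<inter> vertical_ann \<Lambda> Z W \<sigma> F U)\<rparr>),
      mod_res = mod_res F,
      nabla = (\<lambda>U w s. THE t. t \<in> carrier (mod_sec F U) \<and>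
        (\<forall>V. openin (base_top Z) V \<and> V \<subseteq> U \<longrightarrow>
           (\<forall>v\<in>lifts \<Lambda> Z W \<sigma> V w. mod_res F U V t = nabla F V v (mod_res F U V s))))\<rparr>"

definition direct_image ::
    "'l complex_superalgebra \<Rightarrow> ('p, 'l, 'a) superspace \<Rightarrow> ('p, 'l, 'b) superspace \<Rightarrow>
     ('p set \<Rightarrow> 'b \<Rightarrow> 'a) \<Rightarrow>
     (('p, 'a, 'm) dmodule, ('p, 'm) dmod_map, ('p, 'b, 'm) dmodule, ('p, 'm) dmod_map) functor_data" where
  "direct_image \<Lambda> Z W \<sigma> =
     \<lparr>on_obj = direct_image_obj \<Lambda> Z W \<sigma>,
      on_hom = (\<lambda>F G h. dmap_mk W (direct_image_obj \<Lambda> Z W \<sigma> F) h)\<rparr>"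

section \<open>The inverse image functor\<close>

subsection \<open>Tensor products and their sheafification\<close>

text \<open>A list $(a_1, s_1), \dots, (a_k, s_k)$ stands for the tensor $\sum a_i \otimes s_i$ in
  \<open>A \<otimes>\<^sub>B M\<close>, where \<open>\<phi> : B \<rightarrow> A\<close>; \<open>tensor_eq\<close> is equality of such tensors.\<close>

inductive tensor_eq ::
    "('a, 'x) ring_scheme \<Rightarrow> ('b, 'y) ring_scheme \<Rightarrow> ('b \<Rightarrow> 'a) \<Rightarrow> ('b, 'm, 'z) module_scheme \<Rightarrow>
     ('a \<times> 'm) list \<Rightarrow> ('a \<times> 'm) list \<Rightarrow> bool"
  for A :: "('a, 'x) ring_scheme" and B :: "('b, 'y) ring_scheme" and \<phi> :: "'b \<Rightarrow> 'a"
    and M :: "('b, 'm, 'z) module_scheme" where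
    refl: "l \<in> lists (carrier A \<times> carrier M) \<Longrightarrow> tensor_eq A B \<phi> M l l"
  | sym: "tensor_eq A B \<phi> M l l' \<Longrightarrow> tensor_eq A B \<phi> M l' l"
  | trans: "tensor_eq A B \<phi> M l l' \<Longrightarrow> tensor_eq A B \<phi> M l' l'' \<Longrightarrow> tensor_eq A B \<phi> M l l''"
  | append: "tensor_eq A B \<phi> M k k' \<Longrightarrow> tensor_eq A B \<phi> M l l' \<Longrightarrow> tensor_eq A B \<phi> M (k @ l) (k' @ l')"
  | commute: "k \<in> lists (carrier A \<times> carrier M) \<Longrightarrow> l \<in> lists (carrier A \<times> carrier M) \<Longrightarrow>
      tensor_eq A B \<phi> M (k @ l) (l @ k)"
  | zero: "s \<in> carrier M \<Longrightarrow> tensor_eq A B \<phi> M [(\<zero>\<^bsub>A\<^esub>, s)] []"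
  | add_left: "a \<in> carrier A \<Longrightarrow> a' \<in> carrier A \<Longrightarrow> s \<in> carrier M \<Longrightarrow>
      tensor_eq A B \<phi> M [(a \<oplus>\<^bsub>A\<^esub> a', s)] [(a, s), (a', s)]"
  | add_right: "a \<in> carrier A \<Longrightarrow> s \<in> carrier M \<Longrightarrow> s' \<in> carrier M \<Longrightarrow>
      tensor_eq A B \<phi> M [(a, s \<oplus>\<^bsub>M\<^esub> s')] [(a, s), (a, s')]"
  | balanced: "a \<in> carrier A \<Longrightarrow> b \<in> carrier B \<Longrightarrow> s \<in> carrier M \<Longrightarrow>
      tensor_eq A B \<phi> M [(a \<otimes>\<^bsub>A\<^esub> \<phi> b, s)] [(a, b \<odot>\<^bsub>M\<^esub> s)]"

definition tensors ::
    "('p, 'l, 'a) superspace \<Rightarrow> ('p, 'b, 'm) dmodule \<Rightarrow> 'p set \<Rightarrow> ('a \<times> 'm) list set" where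
  "tensors Z G V = lists (carrier (fun_ring Z V) \<times> carrier (mod_sec G V))"

definition tensor_res ::
    "('p, 'l, 'a) superspace \<Rightarrow> ('p, 'b, 'm) dmodule \<Rightarrow> 'p set \<Rightarrow> 'p set \<Rightarrow>
     ('a \<times> 'm) list \<Rightarrow> ('a \<times> 'm) list" where
  "tensor_res Z G V N l = map (\<lambda>(a, s). (fun_res Z V N a, mod_res G V N s)) l"

text \<open>The germ at \<open>p\<close> of the tensor \<open>l\<close> over \<open>V\<close>.\<close>

type_synonym ('p, 'a, 'm) tensor_germ = "('p set \<times> ('a \<times> 'm) list) set"

definition tensor_germ ::
    "('p, 'l, 'a) superspace \<Rightarrow> ('p, 'l, 'b) superspace \<Rightarrow> ('p set \<Rightarrow> 'b \<Rightarrow> 'a) \<Rightarrow>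
     ('p, 'b, 'm) dmodule \<Rightarrow> 'p \<Rightarrow> 'p set \<Rightarrow> ('a \<times> 'm) list \<Rightarrow> ('p, 'a, 'm) tensor_germ" where
  "tensor_germ Z W \<sigma> G p V l =
     {(V', l'). openin (base_top Z) V' \<and> p \<in> V' \<and> l' \<in> tensors Z G V' \<and>
        (\<exists>N. openin (base_top Z) N \<and> p \<in> N \<and> N \<subseteq> V \<inter> V' \<and>
           tensor_eq (fun_ring Z N) (fun_ring W N) (\<sigma> N) (mod_sec G N)
             (tensor_res Z G V N l) (tensor_res Z G V' N l'))}"

text \<open>\<open>represents \<dots> U s p V l\<close>: near \<open>p\<close>, on \<open>V \<subseteq> U\<close>, the section \<open>s\<close> over \<open>U\<close> is the tensor \<open>l\<close>.\<close>

definition represents ::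
    "('p, 'l, 'a) superspace \<Rightarrow> ('p, 'l, 'b) superspace \<Rightarrow> ('p set \<Rightarrow> 'b \<Rightarrow> 'a) \<Rightarrow>
     ('p, 'b, 'm) dmodule \<Rightarrow> 'p set \<Rightarrow> ('p \<Rightarrow> ('p, 'a, 'm) tensor_germ) \<Rightarrow>
     'p \<Rightarrow> 'p set \<Rightarrow> ('a \<times> 'm) list \<Rightarrow> bool" where
  "represents Z W \<sigma> G U s p V l \<longleftrightarrow>
     openin (base_top Z) V \<and> p \<in> V \<and> V \<subseteq> U \<and> l \<in> tensors Z G V \<and>
     (\<forall>q\<in>V. s q = tensor_germ Z W \<sigma> G q V l)"

definition tensor_sections ::
    "('p, 'l, 'a) superspace \<Rightarrow> ('p, 'l, 'b) superspace \<Rightarrow> ('p set \<Rightarrow> 'b \<Rightarrow> 'a) \<Rightarrow>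
     ('p, 'b, 'm) dmodule \<Rightarrow> 'p set \<Rightarrow> ('p \<Rightarrow> ('p, 'a, 'm) tensor_germ) set" where
  "tensor_sections Z W \<sigma> G U =
     {s \<in> extensional U. \<forall>p\<in>U. \<exists>V l. represents Z W \<sigma> G U s p V l}"

subsection \<open>The pulled-back connection\<close>

text \<open>The list \<open>ws\<close> of pairs $(h_k, w_k)$ represents the image $\sum h_k \otimes w_k$ of the vector
  field \<open>v\<close> under \<open>\<T>\<^sub>Z \<rightarrow> \<sigma>\<^sup>*\<T>\<^sub>W\<close>.\<close>

definition tangent_image ::
    "'l complex_superalgebra \<Rightarrow> ('p, 'l, 'a) superspace \<Rightarrow> ('p, 'l, 'b) superspace \<Rightarrow>
     ('p set \<Rightarrow> 'b \<Rightarrow> 'a) \<Rightarrow> 'p set \<Rightarrow> ('p, 'a) vfield \<Rightarrow> ('a \<times> ('p, 'b) vfield) list \<Rightarrow> bool" where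
  "tangent_image \<Lambda> Z W \<sigma> U v ws \<longleftrightarrow>
     ws \<in> lists (carrier (fun_ring Z U) \<times> tangent \<Lambda> W U) \<and>
     (\<forall>V. openin (base_top Z) V \<and> V \<subseteq> U \<longrightarrow>
        (\<forall>b\<in>carrier (fun_ring W V). v V (\<sigma> V b) =
           foldr (\<lambda>(h, w) y. (fun_res Z U V h \<otimes>\<^bsub>fun_ring Z V\<^esub> \<sigma> V (w V b)) \<oplus>\<^bsub>fun_ring Z V\<^esub> y)
             ws \<zero>\<^bsub>fun_ring Z V\<^esub>))"

text \<open>For \<open>v = v0 + v1\<close> with \<open>v0\<close> even and \<open>v1\<close> odd, and $\sum h \otimes w$ over \<open>ws0\<close>, \<open>ws1\<close> their images,
  $\nabla_v(a \otimes s) = v(a) \otimes s + \sum_{ws0} a h \otimes \nabla_w s + \sum_{ws1} \bar a h \otimes \nabla_w s$,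
  where $\bar a = (-1)^{|a|} a$.\<close>

definition tensor_nabla ::
    "('p, 'l, 'a) superspace \<Rightarrow> ('p, 'b, 'm) dmodule \<Rightarrow> 'p set \<Rightarrow> ('p, 'a) vfield \<Rightarrow>
     ('a \<times> ('p, 'b) vfield) list \<Rightarrow> ('a \<times> ('p, 'b) vfield) list \<Rightarrow> ('a \<times> 'm) list \<Rightarrow> ('a \<times> 'm) list" where
  "tensor_nabla Z G V v ws0 ws1 l = concat (map (\<lambda>(a, s).
     (v V a, s) #
     map (\<lambda>(h, w). (a \<otimes>\<^bsub>fun_ring Z V\<^esub> h, nabla G V w s)) ws0 @
     map (\<lambda>(h, w). (parity_inv (fun_ring Z V) a \<otimes>\<^bsub>fun_ring Z V\<^esub> h, nabla G V w s)) ws1) l)"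

definition inverse_image_raw ::
    "'l complex_superalgebra \<Rightarrow> ('p, 'l, 'a) superspace \<Rightarrow> ('p, 'l, 'b) superspace \<Rightarrow>
     ('p set \<Rightarrow> 'b \<Rightarrow> 'a) \<Rightarrow> ('p, 'b, 'm) dmodule \<Rightarrow> ('p, 'a, 'p \<Rightarrow> ('p, 'a, 'm) tensor_germ) dmodule" where
  "inverse_image_raw \<Lambda> Z W \<sigma> G =
     \<lparr>mod_sec = (\<lambda>U.
        \<lparr>carrier = tensor_sections Z W \<sigma> G U,
         mult = undefined, one = undefined,
         zero = (\<lambda>p\<in>U. tensor_germ Z W \<sigma> G p U []),
         add = (\<lambda>s t. \<lambda>p\<in>U. THE x. \<exists>V k l. represents Z W \<sigma> G U s p V k \<and>
            represents Z W \<sigma> G U t p V l \<and> x = tensor_germ Z W \<sigma> G p V (k @ l)),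
         smult = (\<lambda>f s. \<lambda>p\<in>U. THE x. \<exists>V l. represents Z W \<sigma> G U s p V l \<and>
            x = tensor_germ Z W \<sigma> G p V (map (\<lambda>(a, t). (fun_res Z U V f \<otimes>\<^bsub>fun_ring Z V\<^esub> a, t)) l)),
         mgrade = (\<lambda>i. {s \<in> tensor_sections Z W \<sigma> G U. \<forall>p\<in>U. \<exists>V l. represents Z W \<sigma> G U s p V l \<and>
            (\<forall>(a, t)\<in>set l. \<exists>j. a \<in> grade (fun_ring Z V) j \<and> t \<in> mgrade (mod_sec G V) (i \<noteq> j))})\<rparr>),
      mod_res = (\<lambda>U V s. restrict s V),
      nabla = (\<lambda>U v s. \<lambda>p\<in>U. THE x. \<exists>V l v0 v1 ws0 ws1. represents Z W \<sigma> G U s p V l \<and>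
         v0 \<in> derivations \<Lambda> Z V False \<and> v1 \<in> derivations \<Lambda> Z V True \<and>
         vf_res Z V v = vf_add Z V v0 v1 \<and>
         tangent_image \<Lambda> Z W \<sigma> V v0 ws0 \<and> tangent_image \<Lambda> Z W \<sigma> V v1 ws1 \<and>
         x = tensor_germ Z W \<sigma> G p V (tensor_nabla Z G V v ws0 ws1 l))\<rparr>"

definition inverse_image_raw_hom ::
    "('p, 'l, 'a) superspace \<Rightarrow> ('p, 'l, 'b) superspace \<Rightarrow> ('p set \<Rightarrow> 'b \<Rightarrow> 'a) \<Rightarrow>
     ('p, 'b, 'm) dmodule \<Rightarrow> ('p, 'b, 'm) dmodule \<Rightarrow> ('p, 'm) dmod_map \<Rightarrow>
     ('p, 'p \<Rightarrow> ('p, 'a, 'm) tensor_germ) dmod_map" where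
  "inverse_image_raw_hom Z W \<sigma> G H h =
     (\<lambda>U s. \<lambda>p\<in>U. THE x. \<exists>V l. represents Z W \<sigma> G U s p V l \<and>
        x = tensor_germ Z W \<sigma> H p V (map (\<lambda>(a, t). (a, h V t)) l))"

subsection \<open>Universes\<close>

text \<open>The sections of the sheaf just constructed live in another type than those of \<open>G\<close>. To have
  functors between categories of D-modules with sections in one fixed type, the sections are
  taken in a type that is closed, up to injections, under this construction; every type \<open>'j\<close>
  injects into some such type, so there is no bound on the size of D-modules.\<close>

type_synonym ('p, 'a, 'j) universe = "('p + 'a + 'j) list set"

definition section_code :: "('p, 'l, 'a) superspace \<Rightarrow> ('p, 'a, 'm) dmodule \<Rightarrow> 'm \<Rightarrow> 'n" where
  "section_code Z F = (SOME e. \<forall>U. openin (base_top Z) U \<longrightarrow> inj_on e (carrier (mod_sec F U)))"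

text \<open>Transport of structure along an injection \<open>e\<close>.\<close>

definition transport :: "('m \<Rightarrow> 'n) \<Rightarrow> ('p, 'a, 'm) dmodule \<Rightarrow> ('p, 'a, 'n) dmodule" where
  "transport e F =
     (let d = (\<lambda>U. inv_into (carrier (mod_sec F U)) e) in
     \<lparr>mod_sec = (\<lambda>U.
        \<lparr>carrier = e ` carrier (mod_sec F U),
         mult = undefined, one = undefined,
         zero = e \<zero>\<^bsub>mod_sec F U\<^esub>,
         add = (\<lambda>s t. e (d U s \<oplus>\<^bsub>mod_sec F U\<^esub> d U t)),
         smult = (\<lambda>f s. e (f \<odot>\<^bsub>mod_sec F U\<^esub> d U s)),
         mgrade = (\<lambda>i. e ` mgrade (mod_sec F U) i)\<rparr>),
      mod_res = (\<lambda>U V s. e (mod_res F U V (d U s))),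
      nabla = (\<lambda>U v s. e (nabla F U v (d U s)))\<rparr>)"

definition inverse_image_obj ::
    "'l complex_superalgebra \<Rightarrow> ('p, 'l, 'a) superspace \<Rightarrow> ('p, 'l, 'b) superspace \<Rightarrow>
     ('p set \<Rightarrow> 'b \<Rightarrow> 'a) \<Rightarrow>
     ('p, 'b, ('p, 'a, 'j) universe) dmodule \<Rightarrow> ('p, 'a, ('p, 'a, 'j) universe) dmodule" where
  "inverse_image_obj \<Lambda> Z W \<sigma> G =
     transport (section_code Z (inverse_image_raw \<Lambda> Z W \<sigma> G)) (inverse_image_raw \<Lambda> Z W \<sigma> G)"

definition inverse_image ::
    "'l complex_superalgebra \<Rightarrow> ('p, 'l, 'a) superspace \<Rightarrow> ('p, 'l, 'b) superspace \<Rightarrow>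
     ('p set \<Rightarrow> 'b \<Rightarrow> 'a) \<Rightarrow>
     (('p, 'b, ('p, 'a, 'j) universe) dmodule, ('p, ('p, 'a, 'j) universe) dmod_map,
      ('p, 'a, ('p, 'a, 'j) universe) dmodule, ('p, ('p, 'a, 'j) universe) dmod_map) functor_data" where
  "inverse_image \<Lambda> Z W \<sigma> =
     \<lparr>on_obj = inverse_image_obj \<Lambda> Z W \<sigma>,
      on_hom = (\<lambda>G H h. dmap_mk Z (inverse_image_obj \<Lambda> Z W \<sigma> G) (\<lambda>U x.
        section_code Z (inverse_image_raw \<Lambda> Z W \<sigma> H)
          (inverse_image_raw_hom Z W \<sigma> G H h U
            (inv_into (carrier (mod_sec (inverse_image_raw \<Lambda> Z W \<sigma> G) U))
              (section_code Z (inverse_image_raw \<Lambda> Z W \<sigma> G)) x))))\<rparr>"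

end

theory Submission
  imports Defs
begin

text \<open>Why the functors are inverse to each other. Locally \<open>\<O>\<^sub>Z = \<O>\<^sub>W[\<theta>\<^sub>1, \<dots>, \<theta>\<^sub>n]\<close> is free over \<open>\<O>\<^sub>W\<close>
  on the monomials in odd coordinates, and a derivation of \<open>\<O>\<^sub>W\<close> into \<open>\<O>\<^sub>Z\<close> extends to \<open>\<O>\<^sub>Z\<close> with arbitrary
  values on the $\theta_k$ (\<open>der_on_chart\<close>). Hence there are odd partial derivatives $\partial_k$, and vector fields
  on \<open>W\<close> lift locally. In a module with connection a section is a unique sum $\sum_I \theta_I x_I$ with all
  $x_I$ killed by the $\partial_k$, by Taylor's formula in one odd variable after the other:
  $s - \theta_k \partial_k s$ is killed by $\partial_k$, since $\partial_k^2 = 0$ by flatness (\<open>ann_span\<close>, \<open>ann_free\<close>).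
  The vertical fields are generated by the $\partial_k$, so a module on \<open>Z\<close> is locally free over its
  vertically flat sections. Two lifts of a field on \<open>W\<close> differ by a vertical one, and the local actions
  on flat sections glue to the connection of \<open>\<sigma>\<^sub>+ F\<close>.

  The pullback of \<open>G\<close> consists of sections of a sheafified tensor product, given locally by lists of
  pairs $(a, g)$. Its connection is determined by $\nabla_v(1 \otimes g) = \sum h \otimes \nabla_w g$, where
  $v(\sigma b) = \sum h\, \sigma(w b)$. This does not depend on the choice of the $h$ and $w$, because on a chart tensors are compared by
  their coefficients with respect to the monomials. The curvature is linear over functions, and every derivation is generated
  over functions by those that lift a field on \<open>W\<close>; so flatness reduces to that of \<open>G\<close>
  (\<open>flat_on_all\<close>).

  The unit $g \mapsto 1 \otimes g$ and the counit $a \otimes x \mapsto a x$ are then bijective: a sum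
  $\sum_I \theta_I \otimes g_I$ is vertically flat only if the $g_I$ with \<open>I\<close> nonempty vanish, and the counit is on a chart
  the expansion of a section into monomials with flat coefficients (\<open>unit_bij\<close>, \<open>eps_bij\<close>). Sections
  of the pullback are finally encoded in the universe type by an injection, along which the structure is transported.

  Signs are avoided throughout by the operator $x_0 + x_1 \mapsto x_0 \pm x_1$ on all sections.\<close>

text \<open>Notation: \<open>C\<close> is the carrier, \<open>op[R]\<close> an operation of \<open>R\<close>, \<open>Der\<close> the homogeneous derivations; \<open>Oz\<close>, \<open>Ow\<close>
  are the structure sheaves of \<open>Z\<close>, \<open>W\<close>, with carriers \<open>cO\<close>, \<open>cW\<close>, and \<open>sg\<close> is $\sigma^\#$; \<open>Fs\<close>, \<open>Gs\<close>, \<open>Ts\<close> are the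
  sections of \<open>F\<close>, of \<open>G\<close> and of the pullback of \<open>G\<close>; \<open>mr\<close>, \<open>fr\<close> restrict sections and functions.\<close>

abbreviation (input) C where "C == carrier"
abbreviation (input) Der where "Der == derivations"
abbreviation (input) rst where "rst == restrict"
abbreviation (input) Sec where "Sec == mod_sec"
abbreviation (input) mr where "mr == mod_res"
abbreviation (input) fr where "fr == fun_res"
abbreviation (input) op_in where "op_in X == openin (base_top X)"
abbreviation (input) add_in ("(_ +[_] _)" [65,0,66] 65) where "x +[R] y == x \<oplus>\<^bsub>R\<^esub> y"
abbreviation (input) minus_in ("(_ -[_] _)" [65,0,66] 65) where "x -[R] y == x \<ominus>\<^bsub>R\<^esub> y"
abbreviation (input) neg_in ("(-[_] _)" [0,81] 80) where "-[R] x == \<ominus>\<^bsub>R\<^esub> x"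
abbreviation (input) mult_in ("(_ *[_] _)" [70,0,71] 70) where "x *[R] y == x \<otimes>\<^bsub>R\<^esub> y"
abbreviation (input) smult_in ("(_ .*[_] _)" [70,0,71] 70) where "a .*[M] x == a \<odot>\<^bsub>M\<^esub> x"
abbreviation (input) zero_in ("0[_]") where "0[R] == \<zero>\<^bsub>R\<^esub>"
abbreviation (input) one_in ("1[_]") where "1[R] == \<one>\<^bsub>R\<^esub>"

locale sring = supercommutative_ring R for R (structure)

abbreviation (input) iff_in (infixr "<->" 25) where "A <-> B == A = B"

abbreviation (input) mg where "mg == mgrade"
abbreviation (input) vf_br where "vf_br == vf_bracket"

lemmas le = order_refl

lemmas (in abelian_group) ag = abelian_group_axioms

section \<open>Additive maps and finite sums\<close>

definition addmap :: "('a, 'x) ring_scheme => ('b, 'y) ring_scheme => ('a => 'b) => bool" where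
"addmap M N h <-> h:C M \<rightarrow> C N & (ALL x:C M. ALL y:C M. h (x+[M] y) = h x+[N] h y)"

lemma addmapI:
assumes "!!x. x:C M ==> h x:C N"
 and "!!x y. x:C M ==> y:C M ==> h (x+[M] y) = h x+[N] h y"
shows "addmap M N h"
using assms by(auto simp: addmap_def)

lemma addmap_cl: "addmap M N h ==> x:C M ==> h x:C N" by(auto simp: addmap_def)

lemma addmap_add: "addmap M N h ==> x:C M ==> y:C M ==> h (x+[M] y) = h x+[N] h y" by(auto simp: addmap_def)

lemma addmap_comp: "addmap M N h ==> addmap N P k ==> addmap M P (%x. k (h x))" by(auto simp: addmap_def Pi_iff)

lemma addmap_id: "addmap M M (%x. x)" by(auto simp: addmap_def)

lemma (in abelian_group) neg_zero [simp]: "\<ominus> \<zero> = \<zero>" by(rule minus_equality) auto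

lemmas (in abelian_group) ag_simprules [algebra abelian_group "zero G" "add G" "a_inv G" "a_minus G"] = a_closed zero_closed a_inv_closed minus_closed
a_assoc l_zero l_neg a_comm minus_eq r_zero r_neg r_neg2 r_neg1 minus_add minus_minus
a_lcomm neg_zero

lemma (in abelian_group) add_self_cancel: "x:C G ==> x \<oplus> x = x ==> x = \<zero>" by(metis add.r_cancel_one)

lemma (in abelian_group) minus_zero_imp_eq: "x:C G ==> y:C G ==> x \<ominus> y = \<zero> ==> x = y"
by(metis a_minus_def add.inv_closed minus_equality minus_minus)

lemma (in abelian_group) minus_self [simp]: "x:C G ==> x \<ominus> x = \<zero>" by(simp add: a_minus_def r_neg)

lemma (in abelian_group) ksz_cl [simp, intro]: "x:C G ==> koszul G i j x:C G" by(simp add: koszul_def)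

lemma (in abelian_group) ksz_zero [simp]: "koszul G i j \<zero> = \<zero>" by(simp add: koszul_def)

lemma (in abelian_group) ksz_add: "x:C G ==> y:C G ==> koszul G i j (x \<oplus> y) = koszul G i j x \<oplus> koszul G i j y"
by(auto simp: koszul_def minus_add a_comm)

lemma ksz_sym: "koszul M i j x = koszul M j i x" by(auto simp: koszul_def)

lemma ksz_False [simp]: "koszul M False j x = x" "koszul M i False x = x" by(auto simp: koszul_def)

lemma addmap_zero:
assumes "abelian_group M" "abelian_group N" "addmap M N h"
shows "h 0[M] = 0[N]"
proof -
interpret M: abelian_group M by fact
interpret N: abelian_group N by fact
have "h 0[M]+[N] h 0[M] = h 0[M]" using addmap_add[OF assms(3), of "0[M]" "0[M]"] by simp
thus ?thesis using addmap_cl[OF assms(3)] by(intro N.add_self_cancel) auto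
qed

lemma addmap_neg:
assumes "abelian_group M" "abelian_group N" "addmap M N h" "x:C M"
shows "h (-[M] x) = -[N] h x"
proof -
interpret M: abelian_group M by fact
interpret N: abelian_group N by fact
have "h (-[M] x)+[N] h x = 0[N]" using addmap_add[OF assms(3), of "-[M] x" x] assms addmap_zero[OF assms(1-3)] by(simp add: M.l_neg)
thus ?thesis using assms addmap_cl[OF assms(3)] by(metis M.a_inv_closed N.minus_equality)
qed

lemma addmap_minus:
assumes "abelian_group M" "abelian_group N" "addmap M N h" "x:C M" "y:C M"
shows "h (x -[M] y) = h x -[N] h y"
using assms addmap_add[OF assms(3)] addmap_neg[OF assms(1-3)]
by(simp add: a_minus_def abelian_group.a_inv_closed)

lemma addmap_ksz:
assumes "abelian_group M" "abelian_group N" "addmap M N h" "x:C M"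
shows "h (koszul M i j x) = koszul N i j (h x)"
using addmap_neg[OF assms] by(simp add: koszul_def)

definition lsum :: "('b, 'x) ring_scheme => ('i => 'b) => 'i list => 'b" where "lsum M f xs = foldr (%x y. f x+[M] y) xs 0[M]"

lemma lsum_simps [simp]: "lsum M f [] = 0[M]" "lsum M f (x # xs) = f x+[M] lsum M f xs" by(simp_all add: lsum_def)

lemma lsum_cong [cong]: "xs = ys ==> (!!x. x:set ys ==> f x = g x) ==> lsum M f xs = lsum M g ys"
proof(induction xs arbitrary: ys)
case Nil
thus ?case by auto
next
case (Cons a xs)
have "lsum M f xs = lsum M g xs" by(rule Cons.IH) (use Cons.prems in auto)
thus ?case using Cons.prems by auto
qed

lemma lsum_map [simp]: "lsum M f (map g xs) = lsum M (%x. f (g x)) xs" by(induction xs) auto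

context abelian_group
begin

lemma lsum_cl [intro]: "(!!x. x:set xs ==> f x:C G) ==> lsum G f xs:C G" by(induction xs) auto

lemma lsum_subgroup:
assumes "additive_subgroup H G" shows "(!!x. x:set xs ==> f x:H) ==> lsum G f xs:H"
proof -
interpret additive_subgroup H G by fact
show "(!!x. x:set xs ==> f x:H) ==> lsum G f xs:H" by(induction xs) auto
qed

lemma lsum_append: "(!!x. x:set xs \<union> set ys ==> f x:C G) ==> lsum G f (xs @ ys) = lsum G f xs \<oplus> lsum G f ys"
by(induction xs) (auto simp: lsum_cl a_assoc)

lemma lsum_add: "(!!x. x:set xs ==> f x:C G) ==> (!!x. x:set xs ==> g x:C G) ==> lsum G (%x. f x \<oplus> g x) xs = lsum G f xs \<oplus> lsum G g xs"
by(induction xs) (auto simp: lsum_cl a_ac)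

lemma lsum_zero: "(!!x. x:set xs ==> f x = \<zero>) ==> lsum G f xs = \<zero>" by(induction xs) auto

lemma lsum_swap: "(!!x y. x:set xs ==> y:set ys ==> f x y:C G) ==> lsum G (%x. lsum G (f x) ys) xs = lsum G (%y. lsum G (%x. f x y) xs) ys"
proof(induction xs)
case (Cons x xs)
hence "lsum G (%y. f x y \<oplus> lsum G (%x. f x y) xs) ys = lsum G (f x) ys \<oplus> lsum G (%y. lsum G (%x. f x y) xs) ys" by(intro lsum_add) auto
with Cons show ?case by simp
qed (simp add: lsum_zero)

lemma lsum_neg: "(!!x. x:set xs ==> f x:C G) ==> lsum G (%x. \<ominus> f x) xs = \<ominus> lsum G f xs"
by(induction xs) (auto simp: lsum_cl minus_add a_comm)

lemma lsum_minus: "(!!x. x:set xs ==> f x:C G) ==> (!!x. x:set xs ==> g x:C G) ==>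
 lsum G (%x. f x \<ominus> g x) xs = lsum G f xs \<ominus> lsum G g xs"
by(simp add: minus_eq lsum_add lsum_neg)

lemma lsum_single:
assumes "distinct xs" "y:set xs" "f y:C G"
 and "!!x. x:set xs ==> x ~= y ==> f x = \<zero>"
shows "lsum G f xs = f y"
using assms
proof(induction xs)
case (Cons x xs)
show ?case
proof(cases "x = y")
 case True
 with Cons.prems have "lsum G f xs = \<zero>" by(intro lsum_zero) auto
 with True Cons.prems show ?thesis by simp
next
 case False
 with Cons show ?thesis by auto
qed
qed simp

lemma lsum_finsum:
assumes "distinct xs" "!!x. x:set xs ==> f x:C G"
shows "lsum G f xs = finsum G f (set xs)"
using assms by(induction xs) (auto simp: finsum_insert)

end

lemma addmap_lsum:
assumes "abelian_group M" "abelian_group N" "addmap M N h"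
 and "!!x. x:set xs ==> f x:C M"
shows "h (lsum M f xs) = lsum N (%x. h (f x)) xs"
using assms(4)
proof(induction xs)
case Nil
thus ?case using addmap_zero[OF assms(1-3)] by simp
next
case (Cons x xs)
thus ?case using addmap_add[OF assms(3)] abelian_group.lsum_cl[OF assms(1), of xs f] by simp
qed

section \<open>Graded groups, rings and modules\<close>

definition hpart :: "('b, 'x) ring_scheme => (bool => 'b set) => bool => 'b => 'b" where
"hpart M gr i x = (let e = THE e. e:gr False & x -[M] e:gr True in if i then x -[M] e else e)"

text \<open>The sign change $x_0 + x_1 \mapsto x_0 + (-1)^i x_1$. It turns Koszul signs, which make
  sense for homogeneous elements only, into additive operators: a derivation of parity $i$
  satisfies $v(fg) = v(f) g + \mathrm{flip}_i(f)\, v(g)$ for all $f$ and $g$.\<close>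

definition flip :: "('b, 'x) ring_scheme => (bool => 'b set) => bool => 'b => 'b" where
"flip M gr i x = (if i then hpart M gr False x -[M] hpart M gr True x else x)"

locale gr_ag = abelian_group M for M :: "('b, 'x) ring_scheme" (structure) +
fixes gr :: "bool => 'b set"
assumes grading: "graded_group M gr"
begin

lemma gr_subgroup: "additive_subgroup (gr i) M" using grading by(simp add: graded_group_def)

lemma gr_car: "x:gr i ==> x:C M" using additive_subgroup.a_subset[OF gr_subgroup] by blast

lemma gr_add: "x:gr i ==> y:gr i ==> x \<oplus> y:gr i" by(rule additive_subgroup.a_closed[OF gr_subgroup])

lemma gr_zero [simp]: "\<zero>:gr i" by(rule additive_subgroup.zero_closed[OF gr_subgroup])

lemma gr_neg: "x:gr i ==> \<ominus> x:gr i" by(rule additive_subgroup.a_inv_closed[OF gr_subgroup])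

lemma gr_minus: "x:gr i ==> y:gr i ==> x \<ominus> y:gr i" by(simp add: minus_eq gr_add gr_neg)

lemma gr_ksz: "x:gr i ==> koszul M j k x:gr i" by(simp add: koszul_def gr_neg)

lemma gr_lsum: "(!!x. x:set xs ==> f x:gr i) ==> lsum M f xs:gr i" by(rule lsum_subgroup[OF gr_subgroup])

lemma hpart_sum:
assumes "x0:gr False" "x1:gr True"
shows "hpart M gr i (x0 \<oplus> x1) = (if i then x1 else x0)"
proof -
note c = assms[THEN gr_car]
have eq: "(x0 \<oplus> x1) \<ominus> x0 = x1" using c by algebra
have "EX! e. e:gr False & (x0 \<oplus> x1) \<ominus> e:gr True" using grading c by(auto simp: graded_group_def)
moreover have "x0:gr False & (x0 \<oplus> x1) \<ominus> x0:gr True" using assms eq by simp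
ultimately have "(THE e. e:gr False & (x0 \<oplus> x1) \<ominus> e:gr True) = x0" by(simp add: the1_equality)
thus ?thesis by(simp add: hpart_def eq)
qed

lemma decomposeE:
assumes "x:C M"
obtains x0 x1 where "x0:gr False" "x1:gr True" "x = x0 \<oplus> x1"
proof -
obtain e where e: "e:gr False" "x \<ominus> e:gr True" using grading assms by(auto simp: graded_group_def)
moreover have "x = e \<oplus> (x \<ominus> e)" using assms gr_car[OF e(1)] by algebra
ultimately show ?thesis using that by blast
qed

lemma hpart_in: "x:C M ==> hpart M gr i x:gr i" by(erule decomposeE) (auto simp: hpart_sum)

lemma hpart_cl [simp, intro]: "x:C M ==> hpart M gr i x:C M" using hpart_in gr_car by blast

lemma hpart_decompose: "x:C M ==> hpart M gr False x \<oplus> hpart M gr True x = x" by(erule decomposeE) (auto simp: hpart_sum)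

lemma hpart_homog: "x:gr j ==> hpart M gr i x = (if i = j then x else \<zero>)"
using hpart_sum[of x \<zero> i] hpart_sum[of \<zero> x i] gr_car[of x j] by(cases j) auto

lemma hpart_add:
assumes "x:C M" "y:C M"
shows "hpart M gr i (x \<oplus> y) = hpart M gr i x \<oplus> hpart M gr i y"
proof -
obtain x0 x1 y0 y1 where d: "x0:gr False" "x1:gr True" "x = x0 \<oplus> x1" "y0:gr False" "y1:gr True" "y = y0 \<oplus> y1"
 using assms by(meson decomposeE)
hence c: "x0:C M" "x1:C M" "y0:C M" "y1:C M" by(auto intro: gr_car)
have "x \<oplus> y = (x0 \<oplus> y0) \<oplus> (x1 \<oplus> y1)" using c d by(simp add: a_ac)
thus ?thesis using d by(simp add: hpart_sum gr_add)
qed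

lemma add_hpart: "addmap M M (hpart M gr i)" by(auto intro: addmapI simp: hpart_add)

lemma gr_disjoint: "x:gr False ==> x:gr True ==> x = \<zero>" using hpart_homog[of x False False] hpart_homog[of x True False] by simp

lemma gr_sum_zero:
assumes "x0:gr False" "x1:gr True" "x0 \<oplus> x1 = \<zero>"
shows "x0 = \<zero>" "x1 = \<zero>"
using assms hpart_sum[OF assms(1,2), of False] hpart_sum[OF assms(1,2), of True]
 hpart_homog[OF gr_zero, of False] hpart_homog[OF gr_zero, of True] by auto

lemma gr_sum_zero':
assumes "x0:gr j" "x1:gr (~ j)" "x0 \<oplus> x1 = \<zero>"
shows "x0 = \<zero>" "x1 = \<zero>"
using assms gr_sum_zero[of x0 x1] gr_sum_zero[of x1 x0] gr_car[OF assms(1)] gr_car[OF assms(2)]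
by(cases j; simp add: a_comm)+

lemma addmap_ext:
assumes "addmap M N f" "addmap M N g" "!!j x. x:gr j ==> f x = g x" "x:C M"
shows "f x = g x"
using assms(4) by(rule decomposeE) (use assms(3) in \<open>simp add: addmap_add[OF assms(1)] addmap_add[OF assms(2)] gr_car\<close>)

lemma flip_False [simp]: "flip M gr False x = x" by(simp add: flip_def)

lemma flip_cl [simp, intro]: "x:C M ==> flip M gr i x:C M" by(simp add: flip_def)

lemma flip_add:
assumes "x:C M" "y:C M"
shows "flip M gr i (x \<oplus> y) = flip M gr i x \<oplus> flip M gr i y"
proof -
have c: "hpart M gr False x:C M" "hpart M gr True x:C M" "hpart M gr False y:C M" "hpart M gr True y:C M" using assms by auto
have "(hpart M gr False x \<oplus> hpart M gr False y) \<ominus> (hpart M gr True x \<oplus> hpart M gr True y) =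
 (hpart M gr False x \<ominus> hpart M gr True x) \<oplus> (hpart M gr False y \<ominus> hpart M gr True y)"
 using c by algebra
thus ?thesis using assms by(simp add: flip_def hpart_add)
qed

lemma add_flip: "addmap M M (flip M gr i)" by(auto intro: addmapI simp: flip_add)

lemma flip_homog: "x:gr j ==> flip M gr i x = koszul M i j x" using gr_car[of x j] by(auto simp: flip_def koszul_def hpart_homog minus_eq)

lemma flip_gr: "x:gr j ==> flip M gr i x:gr j" by(simp add: flip_homog gr_ksz)

lemmas flip_zero [simp] = addmap_zero[OF ag ag add_flip]
lemmas flip_neg = addmap_neg[OF ag ag add_flip]
lemma flip_flip: "x:C M ==> flip M gr i (flip M gr j x) = flip M gr (i ~= j) x"
proof(rule addmap_ext[where N = M and x = x])
show "addmap M M (%x. flip M gr i (flip M gr j x))" by(rule addmap_comp[OF add_flip add_flip])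
show "flip M gr i (flip M gr j x) = flip M gr (i ~= j) x" if "x:gr k" for k x using that gr_car[OF that] flip_homog[OF gr_neg[OF that]]
 by(auto simp: flip_homog koszul_def)
qed (rule add_flip)

end

lemma flip_natural:
assumes "gr_ag M gr" "gr_ag N gr'" "addmap M N h"
 and "!!i. h ` gr i <= gr' i" "x:C M"
shows "h (flip M gr i x) = flip N gr' i (h x)"
proof -
interpret M: gr_ag M gr by fact
interpret N: gr_ag N gr' by fact
show ?thesis
proof(rule M.addmap_ext[where x = x])
 show "addmap M N (%x. h (flip M gr i x))" by(rule addmap_comp[OF M.add_flip assms(3)])
 show "addmap M N (%x. flip N gr' i (h x))" by(rule addmap_comp[OF assms(3) N.add_flip])
 show "h (flip M gr i x) = flip N gr' i (h x)" if "x:gr j" for j x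
 proof -
  have "h x:gr' j" using assms(4) that by blast
  thus ?thesis using that by(simp add: M.flip_homog N.flip_homog M.gr_car addmap_ksz[OF M.ag N.ag assms(3)])
 qed
qed fact
qed

lemma hpart_natural:
assumes "gr_ag M gr" "gr_ag N gr'" "addmap M N h"
 and "!!i. h ` gr i <= gr' i" "x:C M"
shows "h (hpart M gr i x) = hpart N gr' i (h x)"
proof -
interpret M: gr_ag M gr by fact
interpret N: gr_ag N gr' by fact
obtain x0 x1 where d: "x0:gr False" "x1:gr True" "x = x0+[M] x1" using assms(5) by(rule M.decomposeE)
moreover have "h x0:gr' False" "h x1:gr' True" using d assms(4) by blast+
ultimately show ?thesis by(simp add: addmap_add[OF assms(3)] M.hpart_sum N.hpart_sum M.gr_car)
qed

sublocale supercommutative_ring < gr_ag R "grade R" by unfold_locales (rule graded)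

abbreviation rflip :: "('a, 'x) superring_scheme => bool => 'a => 'a" where "rflip R == flip R (grade R)"

abbreviation mflip :: "('a, 'm, 'y) supermodule_scheme => bool => 'm => 'm" where "mflip M == flip M (mg M)"

context supercommutative_ring
begin

lemma add_mult_left: "a:C R ==> addmap R R (%x. a \<otimes> x)" by(rule addmapI) (auto simp: r_distr)

lemma add_mult_right: "a:C R ==> addmap R R (%x. x \<otimes> a)" by(rule addmapI) (auto simp: l_distr)

lemma ksz_mult: "a:C R ==> b:C R ==> koszul R i j a \<otimes> b = koszul R i j (a \<otimes> b)"
"a:C R ==> b:C R ==> a \<otimes> koszul R i j b = koszul R i j (a \<otimes> b)"
by(auto simp: koszul_def l_minus r_minus)

lemma flip_one [simp]: "rflip R i \<one> = \<one>" using flip_homog[OF one_even, of i] by simp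

lemma flip_mult:
assumes "a:C R" "b:C R"
shows "rflip R i (a \<otimes> b) = rflip R i a \<otimes> rflip R i b"
proof(rule addmap_ext[where x = a])
show "addmap R R (%a. rflip R i (a \<otimes> b))" by(rule addmap_comp[OF add_mult_right[OF assms(2)] add_flip])
show "addmap R R (%a. rflip R i a \<otimes> rflip R i b)" by(rule addmap_comp[OF add_flip add_mult_right]) (use assms in auto)
fix j a assume a: "a:grade R j"
show "rflip R i (a \<otimes> b) = rflip R i a \<otimes> rflip R i b"
proof(rule addmap_ext[where x = b])
 show "addmap R R (%b. rflip R i (a \<otimes> b))" by(rule addmap_comp[OF add_mult_left[OF gr_car[OF a]] add_flip])
 show "addmap R R (%b. rflip R i a \<otimes> rflip R i b)" by(rule addmap_comp[OF add_flip add_mult_left]) (use gr_car[OF a] in auto)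
 fix k b assume b: "b:grade R k"
 show "rflip R i (a \<otimes> b) = rflip R i a \<otimes> rflip R i b" using a b grade_mult[OF a b] gr_car[OF a] gr_car[OF b]
  by(auto simp: flip_homog koszul_def l_minus r_minus)
qed fact
qed fact

lemma homog_commute:
assumes "b:grade R j" "a:C R"
shows "b \<otimes> a = rflip R j a \<otimes> b"
proof(rule addmap_ext[where x = a])
note b = gr_car[OF assms(1)]
show "addmap R R (%a. b \<otimes> a)" by(rule add_mult_left[OF b])
show "addmap R R (%a. rflip R j a \<otimes> b)" by(rule addmap_comp[OF add_flip add_mult_right[OF b]])
fix k a assume a: "a:grade R k"
show "b \<otimes> a = rflip R j a \<otimes> b" using supercommutative[OF assms(1) a] gr_car[OF a] b by(simp add: flip_homog[OF a] ksz_mult)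
qed fact

lemma homog_commute':
assumes "b:grade R j" "a:C R"
shows "a \<otimes> b = b \<otimes> rflip R j a"
using homog_commute[OF assms(1), of "rflip R j a"] assms by(simp add: flip_flip)

lemma parity_inv_flip: "a:C R ==> parity_inv R a = rflip R True a"
proof -
assume a: "a:C R"
obtain a0 a1 where d: "a0:grade R False" "a1:grade R True" "a = a0 \<oplus> a1" using a by(rule decomposeE)
hence e: "rflip R True a = a0 \<ominus> a1" by(simp add: flip_def hpart_sum)
show ?thesis unfolding parity_inv_def
proof(rule the_equality)
 show "EX a0:grade R False. EX a1:grade R True. a = a0 \<oplus> a1 & rflip R True a = a0 \<ominus> a1" using d e by blast
 show "b = rflip R True a" if "EX a0:grade R False. EX a1:grade R True. a = a0 \<oplus> a1 & b = a0 \<ominus> a1" for b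
  using that by(auto simp: flip_def hpart_sum)
qed
qed

end

context left_supermodule
begin

sublocale M: gr_ag M "mg M" by unfold_locales (rule mgraded)

lemma add_smult_right: "a:C R ==> addmap M M (%s. a \<odot> s)" by(rule addmapI) (auto simp: smult_r_distr smult_closed)

lemma add_smult_left: "s:C M ==> addmap R M (%a. a \<odot> s)" by(rule addmapI) (auto simp: smult_l_distr smult_closed)

lemma smult_zero [simp]: "a:C R ==> a \<odot> \<zero> = \<zero>" "s:C M ==> 0[R] \<odot> s = \<zero>" using addmap_zero[OF M.ag M.ag add_smult_right]
 addmap_zero[OF R.ag M.ag add_smult_left] by auto

lemma smult_neg: "a:C R ==> s:C M ==> a \<odot> (\<ominus> s) = \<ominus> (a \<odot> s)"
"a:C R ==> s:C M ==> (-[R] a) \<odot> s = \<ominus> (a \<odot> s)"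
using addmap_neg[OF M.ag M.ag add_smult_right] addmap_neg[OF R.ag M.ag add_smult_left] by auto

lemma smult_ksz: "a:C R ==> s:C M ==> a \<odot> koszul M i j s = koszul M i j (a \<odot> s)"
"a:C R ==> s:C M ==> koszul R i j a \<odot> s = koszul M i j (a \<odot> s)"
by(auto simp: koszul_def smult_neg)

lemma smult_lsum: "a:C R ==> (!!x. x:set xs ==> f x:C M) ==> a \<odot> lsum M f xs = lsum M (%x. a \<odot> f x) xs"
by(rule addmap_lsum[OF M.ag M.ag add_smult_right])

lemma half_torsion_free:
assumes "h:C R" "h+[R] h = 1[R]" "s:C M" "s \<oplus> s = \<zero>"
shows "s = \<zero>"
proof -
have "(h+[R] h) \<odot> s = h \<odot> (s \<oplus> s)" using assms(1,3) by(simp only: smult_l_distr smult_r_distr)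
thus ?thesis using assms smult_one[OF assms(3)] by(simp del: smult_one)
qed

end

lemma (in gr_ag) gr_iff_flip:
assumes torsion_free: "!!a. a:C M ==> a \<oplus> a = \<zero> ==> a = \<zero>"
 and a: "a:C M"
shows "a:gr j <-> flip M gr True a = koszul M j True a"
proof
assume "a:gr j"
thus "flip M gr True a = koszul M j True a" by(simp add: flip_homog koszul_def)
next
assume eq: "flip M gr True a = koszul M j True a"
obtain a0 a1 where d: "a0:gr False" "a1:gr True" "a = a0 \<oplus> a1" using a by(rule decomposeE)
hence c: "a0:C M" "a1:C M" by(auto intro: gr_car)
have fl: "flip M gr True a = a0 \<ominus> a1" using d by(simp add: flip_def hpart_sum)
show "a:gr j"
proof(cases j)
 case True
 hence "a0 \<ominus> a1 = \<ominus> (a0 \<oplus> a1)" using eq fl d by(simp add: koszul_def)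
 hence 0: "(a0 \<ominus> a1) \<oplus> (a0 \<oplus> a1) = \<zero>" using c by(metis a_closed l_neg)
 have "a0 \<oplus> a0 = (a0 \<ominus> a1) \<oplus> (a0 \<oplus> a1)" using c by algebra
 hence "a0 = \<zero>" unfolding 0 by(rule torsion_free[OF c(1)])
 thus ?thesis using d c True by simp
next
 case False
 hence "a0 \<ominus> a1 = a0 \<oplus> a1" using eq fl d by simp
 hence 0: "(a0 \<oplus> a1) \<ominus> (a0 \<ominus> a1) = \<zero>" using c by(metis a_closed minus_self)
 have "a1 \<oplus> a1 = (a0 \<oplus> a1) \<ominus> (a0 \<ominus> a1)" using c by algebra
 hence "a1 = \<zero>" unfolding 0 by(rule torsion_free[OF c(2)])
 thus ?thesis using d c False by simp
qed
qed

section \<open>Rings generated by odd elements over a subring\<close>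

locale superalgebra = supercommutative_ring R for R :: "('a, 'x) superring_scheme" (structure) +
assumes half: "EX h:C R. h \<oplus> h = \<one>"
begin

lemma torsion_free: "a:C R ==> a \<oplus> a = \<zero> ==> a = \<zero>"
proof -
assume a: "a:C R" "a \<oplus> a = \<zero>"
obtain h where h: "h:C R" "h \<oplus> h = \<one>" using half by blast
have "(h \<oplus> h) \<otimes> a = h \<otimes> (a \<oplus> a)" using h(1) a(1) by(simp only: l_distr r_distr)
thus ?thesis using h a by simp
qed

lemma odd_square: "a:grade R True ==> a \<otimes> a = \<zero>"
proof -
assume a: "a:grade R True"
hence c: "a \<otimes> a:C R" using gr_car by simp
have "a \<otimes> a = \<ominus> (a \<otimes> a)" using supercommutative[OF a a] by(simp add: koszul_def)
hence "a \<otimes> a \<oplus> a \<otimes> a = \<zero>" using c r_neg by metis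
thus ?thesis using c torsion_free by blast
qed

lemma grade_iff_flip: "a:C R ==> a:grade R j <-> rflip R True a = koszul R j True a" by(rule gr_iff_flip) (rule torsion_free)

end

definition super_subring :: "('a, 'x) superring_scheme => 'a set => bool" where
"super_subring R B <-> subring B R & (ALL b:B. rflip R True b:B)"

text \<open>The derivations of parity \<open>i\<close> from a subring \<open>B\<close> to \<open>R\<close>; the last condition says that the
  parity of \<open>D\<close> is \<open>i\<close>.\<close>

definition superder :: "('a, 'x) superring_scheme => 'a set => bool => ('a => 'a) => bool" where
"superder R B i D <-> D:B \<rightarrow> C R & (ALL f:B. ALL g:B. D (f+[R] g) = D f+[R] D g) &
  (ALL f:B. ALL g:B. D (f*[R] g) = D f*[R] g+[R] rflip R i f*[R] D g) &
  (ALL f:B. D (rflip R True f) = koszul R i True (rflip R True (D f)))"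

definition adjoin :: "('a, 'x) ring_scheme => 'a set => 'a => 'a set" where "adjoin R B th = {b+[R] c*[R] th | b c. b:B & c:B}"

lemma super_subringD:
assumes "super_subring R B"
shows "b:B ==> b:C R" "1[R]:B" "b:B ==> -[R] b:B" "b:B ==> c:B ==> b+[R] c:B" "b:B ==> c:B ==> b*[R] c:B" "b:B ==> rflip R True b:B"
using assms subringE[of B R] by(auto simp: super_subring_def)

context superalgebra
begin

lemma super_subring_zero: "super_subring R B ==> \<zero>:B" using subringE(2)[of B R] by(auto simp: super_subring_def)

lemma super_subring_flip: "super_subring R B ==> b:B ==> rflip R i b:B" using super_subringD(6) by(cases i) auto

lemma odd_move:
assumes "th:grade R True" "c:C R"
shows "th \<otimes> c = rflip R True c \<otimes> th"
using homog_commute[OF assms] .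

text \<open>Since $\theta c = \mathrm{flip}(c)\,\theta$ and $\theta^2 = 0$, multiplication in
  $B + B\theta$ is as in an exterior algebra over $B$.\<close>

lemma adjoin_mult:
assumes "th:grade R True" "b:C R" "c:C R" "b':C R" "c':C R"
shows "(b \<oplus> c \<otimes> th) \<otimes> (b' \<oplus> c' \<otimes> th) = b \<otimes> b' \<oplus> (b \<otimes> c' \<oplus> c \<otimes> rflip R True b') \<otimes> th"
proof -
note t = gr_car[OF assms(1)]
have 1: "c \<otimes> th \<otimes> b' = c \<otimes> rflip R True b' \<otimes> th" using odd_move[OF assms(1,4)] assms t by(simp add: m_assoc)
have 2: "c \<otimes> th \<otimes> (c' \<otimes> th) = \<zero>"
proof -
 have "c \<otimes> th \<otimes> (c' \<otimes> th) = c \<otimes> (th \<otimes> c') \<otimes> th" using assms t by(simp add: m_assoc)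
 also have "... = c \<otimes> rflip R True c' \<otimes> (th \<otimes> th)" using assms t odd_move[OF assms(1,5)] by(simp add: m_assoc)
 finally show ?thesis using odd_square[OF assms(1)] assms by simp
qed
have "(b \<oplus> c \<otimes> th) \<otimes> (b' \<oplus> c' \<otimes> th) =
 b \<otimes> b' \<oplus> (b \<otimes> c' \<otimes> th \<oplus> c \<otimes> th \<otimes> b') \<oplus> c \<otimes> th \<otimes> (c' \<otimes> th)"
 using assms t by(simp add: l_distr r_distr m_assoc a_ac)
thus ?thesis using 1 2 assms t by(simp add: l_distr r_distr m_assoc)
qed

lemma adjoin_subset:
assumes "super_subring R B" "b:B" "th:C R" shows "b:adjoin R B th"
proof -
have "b = b \<oplus> \<zero> \<otimes> th" using super_subringD(1)[OF assms(1,2)] assms(3) by simp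
thus ?thesis using super_subring_zero[OF assms(1)] assms(2) unfolding adjoin_def by blast
qed

lemma adjoin_generator:
assumes "super_subring R B" "th:C R" shows "th:adjoin R B th"
proof -
have "th = \<zero> \<oplus> \<one> \<otimes> th" using assms(2) by simp
thus ?thesis using super_subring_zero[OF assms(1)] super_subringD(2)[OF assms(1)] unfolding adjoin_def by blast
qed

lemma flip_adjoin:
assumes "th:grade R True" "b:C R" "c:C R"
shows "rflip R True (b \<oplus> c \<otimes> th) = rflip R True b \<oplus> (\<ominus> rflip R True c) \<otimes> th"
using assms gr_car[OF assms(1)]
by(simp add: flip_add flip_mult flip_homog[OF assms(1)] koszul_def l_minus r_minus)

lemma super_subring_adjoin:
assumes B: "super_subring R B" and th: "th:grade R True"
shows "super_subring R (adjoin R B th)"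
proof -
note D = super_subringD[OF B] and t = gr_car[OF th]
have "subring (adjoin R B th) R"
proof(rule subringI)
 show "adjoin R B th <= C R" using D(1) t by(auto simp: adjoin_def)
 show "\<one>:adjoin R B th" by(rule adjoin_subset[OF B D(2) t])
 fix x assume "x:adjoin R B th"
 then obtain b c where x: "b:B" "c:B" "x = b \<oplus> c \<otimes> th" by(auto simp: adjoin_def)
 have "\<ominus> x = \<ominus> b \<oplus> (\<ominus> c) \<otimes> th" using x D(1) t by(simp add: minus_add a_comm l_minus)
 thus "\<ominus> x:adjoin R B th" using x D(3) by(auto simp: adjoin_def)
 fix y assume "y:adjoin R B th"
 then obtain b' c' where y: "b':B" "c':B" "y = b' \<oplus> c' \<otimes> th" by(auto simp: adjoin_def)
 have "x \<oplus> y = (b \<oplus> b') \<oplus> (c \<oplus> c') \<otimes> th" using x y D(1) t by(simp add: l_distr a_ac)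
 thus "x \<oplus> y:adjoin R B th" using x y D(4) by(auto simp: adjoin_def)
 have "x \<otimes> y = b \<otimes> b' \<oplus> (b \<otimes> c' \<oplus> c \<otimes> rflip R True b') \<otimes> th"
  using adjoin_mult[OF th] x y D(1) by simp
 moreover have "b \<otimes> b':B" "b \<otimes> c' \<oplus> c \<otimes> rflip R True b':B" using x y D(4-6) by simp_all
 ultimately show "x \<otimes> y:adjoin R B th" unfolding adjoin_def by blast
qed
moreover have "rflip R True x:adjoin R B th" if ad: "x:adjoin R B th" for x
proof -
 obtain b c where x: "b:B" "c:B" "x = b \<oplus> c \<otimes> th" using ad by(auto simp: adjoin_def)
 thus ?thesis using flip_adjoin[OF th] D(1,3,6) unfolding adjoin_def by blast
qed
ultimately show ?thesis by(simp add: super_subring_def)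
qed

text \<open>The only candidate is $b + c\theta \mapsto D b + (D c)\theta + \mathrm{flip}_i(c)\, t$. It is a derivation
  because $t$ commutes past coefficients as $\theta$ does, up to the sign of \<open>i\<close>, so that
  $t\theta + (-1)^i \theta t = 0$ is compatible with $\theta^2 = 0$.\<close>

lemma extend_der:
assumes B: "super_subring R B" and th: "th:grade R True"
 and free: "!!b c. b:B ==> c:B ==> b \<oplus> c \<otimes> th = \<zero> ==> b = \<zero> & c = \<zero>"
 and D: "superder R B i D" and t: "t:grade R (i ~= True)"
shows "EX D'. superder R (adjoin R B th) i D' & (ALL b:B. D' b = D b) & D' th = t"
proof -
note S = super_subringD[OF B] and tc = gr_car[OF t] and thc = gr_car[OF th]
note Z = super_subring_zero[OF B] and Fl = super_subring_flip[OF B]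
have Dc: "D b:C R" if "b:B" for b using D that by(auto simp: superder_def)
have Da: "D (b \<oplus> c) = D b \<oplus> D c" if "b:B" "c:B" for b c using D that by(auto simp: superder_def)
have Dm: "D (b \<otimes> c) = D b \<otimes> c \<oplus> rflip R i b \<otimes> D c" if "b:B" "c:B" for b c using D that by(auto simp: superder_def)
have Df: "D (rflip R True b) = koszul R i True (rflip R True (D b))" if "b:B" for b using D that by(auto simp: superder_def)
have D0: "D \<zero> = \<zero>" using Da[OF Z Z] Dc[OF Z] by(intro add_self_cancel) auto
have Dn: "D (\<ominus> b) = \<ominus> D b" if "b:B" for b using Da[OF S(3)[OF that] that] D0 S(1)[OF that] Dc[OF that] Dc[OF S(3)[OF that]]
 by(metis minus_equality l_neg)
have uniq: "b = b' & c = c'" if "b:B" "c:B" "b':B" "c':B" "b \<oplus> c \<otimes> th = b' \<oplus> c' \<otimes> th" for b c b' c'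
proof -
 note cc = S(1)[OF that(1)] S(1)[OF that(2)] S(1)[OF that(3)] S(1)[OF that(4)]
 have "(b \<ominus> b') \<oplus> (c \<ominus> c') \<otimes> th = (b \<oplus> c \<otimes> th) \<ominus> (b' \<oplus> c' \<otimes> th)"
  using cc thc by algebra
 hence "(b \<ominus> b') \<oplus> (c \<ominus> c') \<otimes> th = \<zero>" using that(5) cc thc by simp
 hence "b \<ominus> b' = \<zero>" "c \<ominus> c' = \<zero>" using free[of "b \<ominus> b'" "c \<ominus> c'"] S(3,4) that by(auto simp: minus_eq)
 thus ?thesis using minus_zero_imp_eq cc by blast
qed
define D' where "D' x = (THE y. EX b:B. EX c:B. x = b \<oplus> c \<otimes> th &
 y = D b \<oplus> D c \<otimes> th \<oplus> rflip R i c \<otimes> t)" for x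
have D': "D' (b \<oplus> c \<otimes> th) = D b \<oplus> D c \<otimes> th \<oplus> rflip R i c \<otimes> t" if "b:B" "c:B" for b c
 unfolding D'_def using that uniq by(intro the_equality) (blast, metis)
have tmove: "t \<otimes> c = rflip R (i ~= True) c \<otimes> t" if "c:C R" for c using homog_commute[OF t that] .
have "superder R (adjoin R B th) i D'" unfolding superder_def
proof(intro conjI ballI funcsetI)
 fix x assume "x:adjoin R B th"
 then obtain b c where x: "b:B" "c:B" "x = b \<oplus> c \<otimes> th" by(auto simp: adjoin_def)
 note xc = S(1)[OF x(1)] S(1)[OF x(2)] Dc[OF x(1)] Dc[OF x(2)]
 show "D' x:C R" using x(3) D'[OF x(1,2)] xc thc tc by simp
 have tf: "rflip R True t = koszul R (i ~= True) True t" using t by(simp add: flip_homog koszul_def)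
 have fx: "rflip R True x = rflip R True b \<oplus> (\<ominus> rflip R True c) \<otimes> th" using flip_adjoin[OF th] xc x by simp
 have "D' (rflip R True x) = D (rflip R True b) \<oplus> \<ominus> D (rflip R True c) \<otimes> th \<oplus> \<ominus> (rflip R i (rflip R True c)) \<otimes> t"
  unfolding fx using D' S(3,6) x xc by(simp add: Dn flip_neg)
 also have "... = koszul R i True (rflip R True (D' x))" using x xc thc tc tf D'[OF x(1,2)] Df
  by(cases i) (simp_all add: koszul_def flip_add flip_mult flip_homog[OF th] flip_flip l_minus r_minus minus_add a_ac)
 finally show "D' (rflip R True x) = koszul R i True (rflip R True (D' x))" .
 fix y assume "y:adjoin R B th"
 then obtain b' c' where y: "b':B" "c':B" "y = b' \<oplus> c' \<otimes> th" by(auto simp: adjoin_def)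
 note yc = S(1)[OF y(1)] S(1)[OF y(2)] Dc[OF y(1)] Dc[OF y(2)]
 let ?f = "rflip R i c" and ?f' = "rflip R i c'" and ?g = "rflip R i b" and ?b' = "rflip R True b'"
 let ?k = "koszul R i True (rflip R True (D b'))" and ?A = "D b \<otimes> b' \<oplus> ?g \<otimes> D b'"
 have "x \<oplus> y = (b \<oplus> b') \<oplus> (c \<oplus> c') \<otimes> th" using x y xc yc thc by(simp add: l_distr a_ac)
 hence "D' (x \<oplus> y) = D (b \<oplus> b') \<oplus> D (c \<oplus> c') \<otimes> th \<oplus> rflip R i (c \<oplus> c') \<otimes> t"
  using D' S(4) x y by simp
 thus "D' (x \<oplus> y) = D' x \<oplus> D' y" using D' x y xc yc thc tc Da by(simp add: l_distr flip_add a_ac)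
 have fb': "?b':B" using y S(6) by simp
 have xy: "x \<otimes> y = b \<otimes> b' \<oplus> (b \<otimes> c' \<oplus> c \<otimes> ?b') \<otimes> th" using adjoin_mult[OF th] x y xc yc by simp
 have "D' (x \<otimes> y) = D (b \<otimes> b') \<oplus> D (b \<otimes> c' \<oplus> c \<otimes> ?b') \<otimes> th
   \<oplus> rflip R i (b \<otimes> c' \<oplus> c \<otimes> ?b') \<otimes> t"
  unfolding xy using D' S(4-6) x y by simp
 also have "... = (?A) \<oplus> ((D b \<otimes> c' \<oplus> ?g \<otimes> D c') \<oplus> (D c \<otimes> ?b' \<oplus> ?f \<otimes> ?k)) \<otimes> th
   \<oplus> (?g \<otimes> ?f' \<oplus> ?f \<otimes> rflip R i (?b')) \<otimes> t"
  using S(4-6) x y fb' xc yc Df by(simp add: Da Dm flip_add flip_mult)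
 finally have 1: "D' (x \<otimes> y) = ..." .
 have a1: "D c \<otimes> th \<otimes> b' = D c \<otimes> ?b' \<otimes> th" using odd_move[OF th] xc yc thc by(simp add: m_assoc)
 have a2: "p \<otimes> th \<otimes> (q \<otimes> th) = \<zero>" if "p:C R" "q:C R" for p q
  using adjoin_mult[OF th zero_closed _ zero_closed, of p q] that thc by simp
 have a3: "?f \<otimes> t \<otimes> b' = ?f \<otimes> rflip R i (?b') \<otimes> t" using tmove[of b'] xc yc tc by(simp add: m_assoc flip_flip)
 have a4: "?f \<otimes> rflip R i th \<otimes> D b' = ?f \<otimes> ?k \<otimes> th" using odd_move[OF th, of "D b'"] xc yc thc
  by(simp add: flip_homog[OF th] ksz_mult m_assoc)
 have a5: "?f \<otimes> rflip R i th \<otimes> (D c' \<otimes> th) = \<zero>"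
  using a2[of "?f" "D c'"] xc yc thc by(simp add: flip_homog[OF th] ksz_mult)
 have tt: "t \<otimes> th = \<ominus> koszul R i True (th \<otimes> t)" using odd_move[OF th, of t] tc thc tf
  by(cases i) (simp_all add: koszul_def l_minus minus_minus)
 have a6: "t \<otimes> (c' \<otimes> th) = \<ominus> (rflip R i th \<otimes> (?f' \<otimes> t))"
 proof -
  have "t \<otimes> (c' \<otimes> th) = rflip R (i ~= True) c' \<otimes> (t \<otimes> th)"
   using tmove[of c'] yc tc thc by(simp add: m_assoc[symmetric])
  also have "... = \<ominus> koszul R i True (rflip R (i ~= True) c' \<otimes> (th \<otimes> t))"
   unfolding tt using yc tc thc by(simp add: r_minus ksz_mult)
  also have "rflip R (i ~= True) c' \<otimes> (th \<otimes> t) = th \<otimes> ?f' \<otimes> t"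
   using odd_move[OF th, of "?f'"] yc tc thc by(simp add: m_assoc flip_flip)
  finally show ?thesis using yc tc thc by(simp add: flip_homog[OF th] ksz_mult m_assoc)
 qed
 have a7: "?f \<otimes> t \<otimes> (c' \<otimes> th) \<oplus> ?f \<otimes> rflip R i th \<otimes> (?f' \<otimes> t) = \<zero>"
  using a6 xc yc tc thc by(simp add: m_assoc r_minus l_neg)
 have "D' x \<otimes> y \<oplus> rflip R i x \<otimes> D' y =
  (D b \<oplus> D c \<otimes> th \<oplus> ?f \<otimes> t) \<otimes> (b' \<oplus> c' \<otimes> th)
  \<oplus> (?g \<oplus> ?f \<otimes> rflip R i th) \<otimes> (D b' \<oplus> D c' \<otimes> th \<oplus> ?f' \<otimes> t)"
  using D' x y xc yc thc by(simp add: flip_add flip_mult)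
 also have "... = (?A) \<oplus> ((D b \<otimes> (c' \<otimes> th) \<oplus> ?g \<otimes> (D c' \<otimes> th)) \<oplus>
    (D c \<otimes> th \<otimes> b' \<oplus> ?f \<otimes> rflip R i th \<otimes> D b'))
   \<oplus> (?g \<otimes> (?f' \<otimes> t) \<oplus> ?f \<otimes> t \<otimes> b')
   \<oplus> (D c \<otimes> th \<otimes> (c' \<otimes> th) \<oplus> ?f \<otimes> rflip R i th \<otimes> (D c' \<otimes> th))
   \<oplus> (?f \<otimes> t \<otimes> (c' \<otimes> th) \<oplus> ?f \<otimes> rflip R i th \<otimes> (?f' \<otimes> t))"
  using xc yc tc thc by(simp add: l_distr r_distr a_ac)
 also have "... = (?A) \<oplus> ((D b \<otimes> (c' \<otimes> th) \<oplus> ?g \<otimes> (D c' \<otimes> th)) \<oplus>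
    (D c \<otimes> ?b' \<otimes> th \<oplus> ?f \<otimes> ?k \<otimes> th))
   \<oplus> (?g \<otimes> (?f' \<otimes> t) \<oplus> ?f \<otimes> rflip R i (?b') \<otimes> t)"
  unfolding a1 a3 a4 a5 a7 using a2 xc yc tc thc by simp
 also have "... = D' (x \<otimes> y)" unfolding 1 using xc yc tc thc by(simp add: l_distr m_assoc)
 finally show "D' (x \<otimes> y) = D' x \<otimes> y \<oplus> rflip R i x \<otimes> D' y" by simp
qed
moreover have "D' b = D b" if "b:B" for b using D'[OF that Z] that S(1) Dc D0 tc thc by simp
moreover have "D' th = t"
proof -
 have "D \<one> \<oplus> D \<one> = D \<one>" using Dm[OF S(2) S(2)] Dc[OF S(2)] by simp
 hence "D \<one> = \<zero>" using Dc[OF S(2)] add_self_cancel by blast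
 thus ?thesis using D'[OF Z S(2)] D0 tc thc by simp
qed
ultimately show ?thesis by blast
qed

end

section \<open>Monomials in odd elements\<close>

fun mons :: "nat => nat set list" where "mons 0 = [{}]"
| "mons (Suc k) = mons k @ map (insert k) (mons k)"

lemma set_mons: "set (mons n) = Pow {..<n}" by(induction n) (auto simp: lessThan_Suc Pow_insert)

lemma mons_subset: "I:set (mons n) ==> I <= {..<n}" by(simp add: set_mons)

lemma distinct_mons: "distinct (mons n)"
proof(induction n)
case (Suc n)
have "inj_on (insert n) (set (mons n))" by(rule inj_onI) (metis Diff_insert_absorb insert_ident lessThan_iff less_irrefl mons_subset subsetD)
thus ?case using Suc by(auto simp: distinct_map dest: mons_subset)
qed simp

lemma empty_in_mons [simp]: "{}:set (mons n)" by(simp add: set_mons)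

lemma odd_monomial_empty [simp]: "odd_monomial R ths {} = 1[R]" by(simp add: odd_monomial_def)

context superalgebra
begin

lemma odd_monomial_insert:
assumes "I <= {..<k}" "k < length ths" "set ths <= C R"
shows "odd_monomial R ths (insert k I) = odd_monomial R ths I \<otimes> ths ! k"
proof -
have fin: "finite I" using assms(1) finite_subset by blast
have s: "sorted_list_of_set (insert k I) = sorted_list_of_set I @ [k]"
proof(rule sorted_distinct_set_unique)
 show "sorted (sorted_list_of_set I @ [k])" using assms(1) fin by(auto simp: sorted_append less_imp_le)
 show "distinct (sorted_list_of_set I @ [k])" using assms(1) fin by auto
 show "set (sorted_list_of_set (insert k I)) = set (sorted_list_of_set I @ [k])" using fin by(simp del: sorted_list_of_set_insert_remove)
qed auto
have c: "foldr (%i y. ths ! i \<otimes> y) xs x:C R &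
  foldr (%i y. ths ! i \<otimes> y) xs (x \<otimes> z) = foldr (%i y. ths ! i \<otimes> y) xs x \<otimes> z"
 if "set xs <= {..<k}" "x:C R" "z:C R" for xs x z
 using that(1)
proof(induction xs)
 case Nil
 thus ?case using that by simp
next
 case (Cons j xs)
 hence "ths ! j:C R" using assms nth_mem[of j ths] by auto
 with Cons that show ?case by(simp add: m_assoc)
qed
have "ths ! k:C R" using assms by(meson nth_mem subsetD less_trans)
thus ?thesis using c[of "sorted_list_of_set I" \<one> "ths ! k"] assms(1) fin by(simp add: odd_monomial_def s)
qed

lemma odd_monomial_grade:
assumes "set ths <= grade R True" "n <= length ths"
shows "I:set (mons n) ==> odd_monomial R ths I:grade R (odd (card I))"
using assms(2)
proof(induction n arbitrary: I)
case 0
thus ?case by(simp add: one_even)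
next
case (Suc n)
show ?case
proof(cases "I:set (mons n)")
 case True
 with Suc show ?thesis by simp
next
 case False
 then obtain J where J: "J:set (mons n)" "I = insert n J" using Suc.prems by auto
 have "finite J" "n ~: J" using mons_subset[OF J(1)] finite_subset by auto
 hence "odd (card I) = (odd (card J) ~= True)" using J(2) by simp
 moreover have "ths ! n:grade R True" using assms(1) Suc.prems nth_mem[of n ths] by auto
 moreover have "odd_monomial R ths I = odd_monomial R ths J \<otimes> ths ! n"
  unfolding J(2) by(rule odd_monomial_insert[OF mons_subset[OF J(1)]]) (use Suc.prems assms(1) gr_car in auto)
 moreover have "odd_monomial R ths J:grade R (odd (card J))" using Suc.IH[OF J(1)] Suc.prems by simp
 ultimately show ?thesis by(simp only: grade_mult)
qed
qed

end

section \<open>Odd extensions\<close>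

text \<open>The algebra of a chart: \<open>S\<close> and \<open>R\<close> are the functions on the base and on the total space,
  \<open>ph\<close> is the comorphism and \<open>ths\<close> are the odd fiber coordinates.\<close>

locale odd_extension = superalgebra R + S: supercommutative_ring S
 for R :: "('a, 'x) superring_scheme" (structure) and S :: "('b, 'y) superring_scheme" +
fixes ph :: "'b => 'a" and ths :: "'a list"
assumes hom: "ph:superring_hom S R" and inj: "inj_on ph (C S)"
 and odd_ths: "set ths <= grade R True"
 and basis: "basis_over R (ph ` C S) (Pow {..<length ths}) (odd_monomial R ths)"
begin

abbreviation n :: nat where "n == length ths"
abbreviation mon :: "nat set => 'a" where "mon == odd_monomial R ths"
abbreviation B :: "'a set" where "B == ph ` C S"

lemma ring_hom: "ph:ring_hom S R" using hom by(simp add: superring_hom_def)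

lemma ph_cl [simp]: "b:C S ==> ph b:C R" using ring_hom_closed[OF ring_hom] .

lemma B_cl: "b:B ==> b:C R" by auto

lemma ph_add: "b:C S ==> c:C S ==> ph (b+[S] c) = ph b \<oplus> ph c" using ring_hom_add[OF ring_hom] .

lemma ph_mult: "b:C S ==> c:C S ==> ph (b*[S] c) = ph b \<otimes> ph c" using ring_hom_mult[OF ring_hom] .

lemma ph_one: "ph 1[S] = \<one>" using ring_hom_one[OF ring_hom] .

lemma ph_grade: "b:grade S i ==> ph b:grade R i" using hom by(auto simp: superring_hom_def)

lemma add_ph: "addmap S R ph" by(rule addmapI) (auto simp: ph_add)

lemma ph_zero: "ph 0[S] = \<zero>" by(rule addmap_zero[OF S.ag ag add_ph])

lemma ph_neg: "b:C S ==> ph (-[S] b) = \<ominus> ph b" by(rule addmap_neg[OF S.ag ag add_ph])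

lemma ph_flip: "b:C S ==> ph (rflip S i b) = rflip R i (ph b)" by(rule flip_natural[OF S.gr_ag_axioms gr_ag_axioms add_ph]) (use ph_grade in auto)

lemma B_subring: "super_subring R B" unfolding super_subring_def
proof
show "subring B R"
proof(rule subringI)
 show "B<=C R" by auto
 show "\<one>:B" using ph_one by(metis S.one_closed image_eqI)
 show "\<ominus> b:B" if "b:B" for b using that ph_neg by(metis (no_types, lifting) S.a_inv_closed image_iff)
 show "b \<otimes> c:B" if "b:B" "c:B" for b c using that ph_mult by(metis (no_types, lifting) S.m_closed image_iff)
 show "b \<oplus> c:B" if "b:B" "c:B" for b c using that ph_add by(metis (no_types, lifting) S.a_closed image_iff)
qed
show "ALL b:B. rflip R True b:B" using ph_flip S.flip_cl by(metis (no_types, lifting) image_iff)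
qed

lemma ths_grade: "k < n ==> ths ! k:grade R True" using odd_ths nth_mem by blast

lemma ths_car: "k < n ==> ths ! k:C R" by(rule gr_car[OF ths_grade])

lemma mon_grade: "I:set (mons n) ==> mon I:grade R (odd (card I))" using odd_monomial_grade[OF odd_ths] by blast

lemma mon_cl [simp]: "I:set (mons n) ==> mon I:C R" using mon_grade gr_car by blast

lemma mons_mono: "k <= n ==> I:set (mons k) ==> I:set (mons n)" by(auto simp: set_mons)

lemma mon_insert: "k < n ==> I:set (mons k) ==> mon (insert k I) = mon I \<otimes> ths ! k"
using odd_monomial_insert[of I k ths] odd_ths gr_car mons_subset[of I k] by blast

lemma left_sum_finsum:
assumes "!!I. I:set (mons n) ==> c I:C R"
shows "lsum R (%I. c I \<otimes> mon I) (mons n) = (\<Oplus>I\<in>Pow {..<n}. c I \<otimes> mon I)"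
using lsum_finsum[OF distinct_mons, of n "%I. c I \<otimes> mon I"] assms by(simp add: set_mons)

lemma left_span:
assumes "a:C R"
obtains c where "!!I. I:set (mons n) ==> c I:B" "a = lsum R (%I. c I \<otimes> mon I) (mons n)"
proof -
obtain c where c: "c:Pow {..<n} \<rightarrow>\<^sub>E B" "a = (\<Oplus>I\<in>Pow {..<n}. c I \<otimes> mon I)"
 using basis assms unfolding basis_over_def by(elim conjE) (drule (1) bspec, blast)
hence "c I:B" if "I:set (mons n)" for I using that by(auto simp: set_mons)
moreover from this have "c I:C R" if "I:set (mons n)" for I using B_cl that by simp
ultimately show ?thesis using c(2) left_sum_finsum[of c] that by metis
qed

lemma left_free:
assumes "!!I. I:set (mons n) ==> c I:B" "lsum R (%I. c I \<otimes> mon I) (mons n) = \<zero>"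
shows "I:set (mons n) ==> c I = \<zero>"
proof -
assume I: "I:set (mons n)"
let ?P = "%c. c:Pow {..<n} \<rightarrow>\<^sub>E B & \<zero> = (\<Oplus>I\<in>Pow {..<n}. c I \<otimes> mon I)"
have "ALL s:C R. EX! c. c:Pow {..<n} \<rightarrow>\<^sub>E B & s = (\<Oplus>I\<in>Pow {..<n}. c I \<otimes> mon I)"
 using basis by(simp add: basis_over_def)
hence ex: "EX! c. ?P c" by(rule bspec[OF _ zero_closed])
have sum: "?P (rst d (Pow {..<n}))" if "!!I. I:set (mons n) ==> d I:B" "lsum R (%I. d I \<otimes> mon I) (mons n) = \<zero>" for d
proof -
 have dc: "d I:C R" if "I:set (mons n)" for I using `!!I. I:set (mons n) ==> d I:B`[OF that] B_cl by blast
 have "(\<Oplus>I\<in>Pow {..<n}. rst d (Pow {..<n}) I \<otimes> mon I) = (\<Oplus>I\<in>Pow {..<n}. d I \<otimes> mon I)"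
  by(rule finsum_cong') (use dc in \<open>auto simp: set_mons[symmetric]\<close>)
 also have "... = lsum R (%I. d I \<otimes> mon I) (mons n)" using left_sum_finsum[of d] dc by simp
 finally show ?thesis using that by(auto simp: set_mons)
qed
have "?P (rst c (Pow {..<n}))" by(rule sum) (use assms in auto)
moreover have "?P (rst (%I. \<zero>) (Pow {..<n}))" by(rule sum) (use super_subring_zero[OF B_subring] in \<open>auto intro!: lsum_zero\<close>)
ultimately have "rst c (Pow {..<n}) = rst (%I. \<zero>) (Pow {..<n})" using ex by blast
thus "c I = \<zero>" using I by(metis restrict_apply' set_mons)
qed

lemma lsum_mons_extend:
assumes "k <= m" "!!I. I:set (mons k) ==> f I:C R" "!!I. I:set (mons m) ==> I ~: set (mons k) ==> f I = \<zero>"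
shows "lsum R f (mons m) = lsum R f (mons k)"
using assms(1,3)
proof(induction m rule: dec_induct)
case (step m)
have fc: "f I:C R" if "I:set (mons (Suc m))" for I using assms(2) step.prems that by(metis zero_closed)
have "lsum R f (map (insert m) (mons m)) = \<zero>" unfolding lsum_map
proof(rule lsum_zero)
 fix I assume "I:set (mons m)"
 hence "insert m I:set (mons (Suc m))" "insert m I ~: set (mons k)" using step.hyps by(auto dest: mons_subset)
 thus "f (insert m I) = \<zero>" using step.prems by blast
qed
moreover have "lsum R f (mons m) = lsum R f (mons k)" using step by auto
moreover have "lsum R f (mons (Suc m)) = lsum R f (mons m) \<oplus> lsum R f (map (insert m) (mons m))"
 unfolding mons.simps by(rule lsum_append) (use fc in auto)
moreover have "lsum R f (mons k):C R" using assms(2) by(rule lsum_cl)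
ultimately show ?case by simp
qed auto

lemma left_free_initial:
assumes "k <= n" "!!I. I:set (mons k) ==> c I:B" "lsum R (%I. c I \<otimes> mon I) (mons k) = \<zero>"
shows "I:set (mons k) ==> c I = \<zero>"
proof -
define d where "d I = (if I:set (mons k) then c I else \<zero>)" for I
have dB: "d I:B" for I using assms(2) super_subring_zero[OF B_subring] by(simp add: d_def)
have dc: "d I:C R" for I using dB[of I] by auto
have "lsum R (%I. d I \<otimes> mon I) (mons n) = lsum R (%I. d I \<otimes> mon I) (mons k)"
proof(rule lsum_mons_extend[OF assms(1)])
 show "d I \<otimes> mon I:C R" if "I:set (mons k)" for I by(rule m_closed[OF dc mon_cl[OF mons_mono[OF assms(1) that]]])
 show "d I \<otimes> mon I = \<zero>" if "I:set (mons n)" "I ~: set (mons k)" for I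
 proof -
  have "d I = \<zero>" unfolding d_def using that(2) by(rule if_not_P)
  thus ?thesis using l_null[OF mon_cl[OF that(1)]] by(simp only:)
 qed
qed
also have "... = lsum R (%I. c I \<otimes> mon I) (mons k)" by(rule lsum_cong) (auto simp: d_def)
also note assms(3)
finally have "I:set (mons n) ==> d I = \<zero>" for I by(rule left_free[OF dB])
thus "I:set (mons k) ==> c I = \<zero>" using mons_mono[OF assms(1), of I] unfolding d_def by metis
qed

fun tower :: "nat => 'a set" where "tower 0 = B"
| "tower (Suc k) = adjoin R (tower k) (ths ! k)"

lemma tower_subring: "k <= n ==> super_subring R (tower k)" by(induction k) (auto intro!: super_subring_adjoin B_subring ths_grade)

lemma lsum_mons_Suc:
assumes "k < n" "!!I. I:set (mons (Suc k)) ==> c I:C R"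
shows "lsum R (%I. c I \<otimes> mon I) (mons (Suc k)) =
 lsum R (%I. c I \<otimes> mon I) (mons k) \<oplus> lsum R (%I. c (insert k I) \<otimes> mon I) (mons k) \<otimes> ths ! k"
proof -
note tk = ths_car[OF assms(1)]
have monk: "mon I:C R" if "I:set (mons (Suc k))" for I using mons_mono[of "Suc k" I] assms that by simp
have "lsum R (%I. c I \<otimes> mon I) (mons (Suc k)) =
  lsum R (%I. c I \<otimes> mon I) (mons k) \<oplus> lsum R (%I. c I \<otimes> mon I) (map (insert k) (mons k))"
 unfolding mons.simps by(rule lsum_append) (use assms monk in auto)
also have "lsum R (%I. c I \<otimes> mon I) (map (insert k) (mons k)) = lsum R (%I. c (insert k I) \<otimes> mon I \<otimes> ths ! k) (mons k)"
 unfolding lsum_map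
 by(rule lsum_cong) (use assms monk tk in \<open>auto simp: mon_insert[OF assms(1)] m_assoc\<close>)
also have "... = lsum R (%I. c (insert k I) \<otimes> mon I) (mons k) \<otimes> ths ! k"
 by(rule addmap_lsum[OF ag ag add_mult_right[OF tk], symmetric]) (use assms monk in auto)
finally show ?thesis .
qed

lemma tower_sum:
assumes "k < n" "ALL I:set (mons k). \<beta> I:B" "ALL I:set (mons k). \<gamma> I:B"
obtains \<alpha> where "ALL I:set (mons (Suc k)). \<alpha> I:B" "ALL I:set (mons k). \<alpha> I = \<beta> I & \<alpha> (insert k I) = \<gamma> I"
 "lsum R (%I. \<alpha> I \<otimes> mon I) (mons (Suc k)) =
  lsum R (%I. \<beta> I \<otimes> mon I) (mons k) \<oplus> lsum R (%I. \<gamma> I \<otimes> mon I) (mons k) \<otimes> ths ! k"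
proof
define \<alpha> where "\<alpha> J = (if k:J then \<gamma> (J - {k}) else \<beta> J)" for J
have knot: "k ~: I" if "I:set (mons k)" for I using mons_subset[OF that] by auto
show B: "ALL I:set (mons (Suc k)). \<alpha> I:B" using assms knot by(auto simp: \<alpha>_def)
show eq: "ALL I:set (mons k). \<alpha> I = \<beta> I & \<alpha> (insert k I) = \<gamma> I" using knot by(auto simp: \<alpha>_def)
have "\<alpha> I:C R" if "I:set (mons (Suc k))" for I using B that B_cl by blast
from lsum_mons_Suc[OF assms(1) this] eq
show "lsum R (%I. \<alpha> I \<otimes> mon I) (mons (Suc k)) =
  lsum R (%I. \<beta> I \<otimes> mon I) (mons k) \<oplus> lsum R (%I. \<gamma> I \<otimes> mon I) (mons k) \<otimes> ths ! k"
 by(simp cong: lsum_cong del: mons.simps)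
qed

lemma tower_coefficients: "k <= n ==> x:tower k ==> EX c. (ALL I:set (mons k). c I:B) & x = lsum R (%I. c I \<otimes> mon I) (mons k)"
proof(induction k arbitrary: x)
case 0
thus ?case by(intro exI[of _ "%_. x"]) auto
next
case (Suc k)
then obtain b c where x: "b:tower k" "c:tower k" "x = b \<oplus> c \<otimes> ths ! k" by(auto simp: adjoin_def)
obtain \<beta> \<gamma> where \<beta>: "ALL I:set (mons k). \<beta> I:B" "b = lsum R (%I. \<beta> I \<otimes> mon I) (mons k)"
 and \<gamma>: "ALL I:set (mons k). \<gamma> I:B" "c = lsum R (%I. \<gamma> I \<otimes> mon I) (mons k)"
 using Suc.IH[OF _ x(1)] Suc.IH[OF _ x(2)] Suc.prems by auto
have "k < n" using Suc.prems by simp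
from tower_sum[OF this \<beta>(1) \<gamma>(1)] show ?case using \<beta>(2) \<gamma>(2) x(3) by metis
qed

lemma tower_subset: "k <= m ==> m <= n ==> tower k <= tower m"
proof(induction m rule: dec_induct)
case (step m)
thus ?case using adjoin_subset[OF tower_subring[of m]] ths_car[of m] by auto
qed auto

lemma mon_tower: "k <= n ==> I:set (mons k) ==> mon I:tower k"
proof(induction k arbitrary: I)
case 0
thus ?case using super_subringD(2)[OF B_subring] by simp
next
case (Suc k)
have k: "k < n" using Suc.prems by simp
note T = super_subringD[OF tower_subring[OF Suc.prems(1)]]
have sub: "tower k <= tower (Suc k)" using tower_subset[of k "Suc k"] Suc.prems by simp
have th: "ths ! k:tower (Suc k)" using adjoin_generator[OF tower_subring[of k] ths_car[OF k]] k by simp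
show ?case
proof(cases "I:set (mons k)")
 case True
 thus ?thesis using Suc sub by auto
next
 case False
 then obtain J where J: "J:set (mons k)" "I = insert k J" using Suc.prems by auto
 hence "mon J:tower (Suc k)" using Suc.IH[OF _ J(1)] sub k by auto
 thus ?thesis using T(5) th J(2) mon_insert[OF k J(1)] by simp
qed
qed

lemma tower_top: "tower n = C R"
proof
note T = super_subringD[OF tower_subring[of n, OF le]]
show "tower n <= C R" using T(1) by blast
show "C R <= tower n"
proof
 fix a assume "a:C R"
 then obtain c where c: "!!I. I:set (mons n) ==> c I:B" "a = lsum R (%I. c I \<otimes> mon I) (mons n)" by(rule left_span) blast
 have "additive_subgroup (tower n) R" using tower_subring[of n] by(simp add: super_subring_def subring_def additive_subgroup_def)
 thus "a:tower n" unfolding c(2)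
 proof(rule lsum_subgroup)
  fix I assume I: "I:set (mons n)"
  show "c I \<otimes> mon I:tower n" using T(5) mon_tower[OF le I] c(1)[OF I] tower_subset[of 0 n] by auto
 qed
qed
qed

lemma tower_free:
assumes "k < n" "b:tower k" "c:tower k" "b \<oplus> c \<otimes> ths ! k = \<zero>"
shows "b = \<zero> & c = \<zero>"
proof -
have k: "k <= n" "Suc k <= n" using assms by auto
obtain \<beta> where \<beta>: "ALL I:set (mons k). \<beta> I:B" "b = lsum R (%I. \<beta> I \<otimes> mon I) (mons k)"
 using tower_coefficients[OF k(1) assms(2)] by blast
obtain \<gamma> where \<gamma>: "ALL I:set (mons k). \<gamma> I:B" "c = lsum R (%I. \<gamma> I \<otimes> mon I) (mons k)"
 using tower_coefficients[OF k(1) assms(3)] by blast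
obtain \<alpha> where \<alpha>: "ALL I:set (mons (Suc k)). \<alpha> I:B"
 "ALL I:set (mons k). \<alpha> I = \<beta> I & \<alpha> (insert k I) = \<gamma> I"
 "lsum R (%I. \<alpha> I \<otimes> mon I) (mons (Suc k)) = \<zero>"
 using tower_sum[OF assms(1) \<beta>(1) \<gamma>(1)] assms(4) \<beta>(2) \<gamma>(2) by metis
have 0: "\<alpha> I = \<zero>" if "I:set (mons (Suc k))" for I using left_free_initial[OF k(2) _ \<alpha>(3)] \<alpha>(1) that by blast
have "\<beta> I = \<zero> & \<gamma> I = \<zero>" if "I:set (mons k)" for I using 0[of I] 0[of "insert k I"] that \<alpha>(2) by auto
moreover have "mon I:C R" if "I:set (mons k)" for I using mons_mono[of k I] k that by simp
ultimately show ?thesis unfolding \<beta>(2) \<gamma>(2) by(auto intro!: lsum_zero)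
qed

text \<open>\<open>R\<close> is generated by the functions on the base and the odd coordinates.\<close>

lemma generated_induct:
assumes "!!b. b:C S ==> P (ph b)" "!!k. k < n ==> P (ths ! k)"
 and "!!x y. x:C R ==> y:C R ==> P x ==> P y ==> P (x \<oplus> y)"
 and "!!x y. x:C R ==> y:C R ==> P x ==> P y ==> P (x \<otimes> y)"
 and "a:C R"
shows "P a"
proof -
have "ALL x:tower k. P x" if "k <= n" for k using that
proof(induction k)
 case 0
 thus ?case using assms(1) by auto
next
 case (Suc k)
 hence k: "k < n" "k <= n" by auto
 note T = super_subringD(1)[OF tower_subring[OF k(2)]]
 show ?case
 proof
  fix x assume "x:tower (Suc k)"
  then obtain b c where "b:tower k" "c:tower k" "x = b \<oplus> c \<otimes> ths ! k" by(auto simp: adjoin_def)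
  thus "P x" using Suc.IH k T ths_car[OF k(1)] assms(2)[OF k(1)] assms(3,4) by simp
 qed
qed
thus ?thesis using tower_top assms(5) by blast
qed

text \<open>A derivation on the base extends to \<open>R\<close>, with arbitrary values on the odd coordinates: adjoin
  the coordinates one at a time.\<close>

lemma extend_to_ring:
assumes w: "addmap S R w"
 and w_mult: "!!b c. b:C S ==> c:C S ==> w (b*[S] c) = w b \<otimes> ph c \<oplus> rflip R i (ph b) \<otimes> w c"
 and w_flip: "!!b. b:C S ==> w (rflip S True b) = koszul R i True (rflip R True (w b))"
 and t: "!!k. k < n ==> t k:grade R (i ~= True)"
shows "EX D. superder R (C R) i D & (ALL b:C S. D (ph b) = w b) & (ALL k<n. D (ths ! k) = t k)"
proof -
have "EX D. superder R (tower k) i D & (ALL b:C S. D (ph b) = w b) & (ALL j<k. D (ths ! j) = t j)" if "k <= n" for k using that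
proof(induction k)
 case 0
 define D where "D a = w (inv_into (C S) ph a)" for a
 have D: "D (ph b) = w b" if "b:C S" for b using inj that by(simp add: D_def)
 have "superder R B i D" unfolding superder_def
 proof(intro conjI ballI funcsetI)
  fix f assume "f:B"
  then obtain b where b: "b:C S" "f = ph b" by blast
  show "D f:C R" using b D addmap_cl[OF w] by simp
  show "D (rflip R True f) = koszul R i True (rflip R True (D f))" using b D[of "rflip S True b"] w_flip by(simp add: ph_flip D)
  fix g assume "g:B"
  then obtain c where c: "c:C S" "g = ph c" by blast
  show "D (f \<oplus> g) = D f \<oplus> D g" using b c D[of "b+[S] c"] addmap_add[OF w] by(simp add: ph_add D)
  show "D (f \<otimes> g) = D f \<otimes> g \<oplus> rflip R i f \<otimes> D g" using b c D[of "b*[S] c"] w_mult by(simp add: ph_mult D)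
 qed
 thus ?case using D by auto
next
 case (Suc k)
 hence k: "k < n" "k <= n" by auto
 obtain D where D: "superder R (tower k) i D" "ALL b:C S. D (ph b) = w b" "ALL j<k. D (ths ! j) = t j" using Suc.IH k by blast
 have "EX D'. superder R (adjoin R (tower k) (ths ! k)) i D' & (ALL b:tower k. D' b = D b) & D' (ths ! k) = t k"
  by(rule extend_der[OF tower_subring[OF k(2)] ths_grade[OF k(1)] tower_free[OF k(1)] D(1) t[OF k(1)]])
 then obtain D' where D': "superder R (tower (Suc k)) i D'" "ALL b:tower k. D' b = D b" "D' (ths ! k) = t k" unfolding tower.simps by blast
 have "ph b:tower k" if "b:C S" for b using tower_subset[of 0 k] k that by auto
 moreover have "ths ! j:tower k" if "j < k" for j
  using adjoin_generator[OF tower_subring[of j] ths_car[of j]] tower_subset[of "Suc j" k] k that by auto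
 ultimately have "ALL b:C S. D' (ph b) = w b" "ALL j<Suc k. D' (ths ! j) = t j" using D D' less_Suc_eq by auto
 thus ?case using D'(1) by blast
qed
from this[of n] show ?thesis by(simp add: tower_top)
qed

text \<open>Coefficients with respect to the monomials, as a basis of the right \<open>S\<close>-module \<open>R\<close>.\<close>

lemma mon_commute: "I:set (mons n) ==> b:C S ==> ph b \<otimes> mon I = mon I \<otimes> ph (rflip S (odd (card I)) b)"
using homog_commute'[OF mon_grade, of I "ph b"] by(simp add: ph_flip)

lemma mon_commute': "I:set (mons n) ==> b:C S ==> mon I \<otimes> ph b = ph (rflip S (odd (card I)) b) \<otimes> mon I"
using homog_commute[OF mon_grade, of I "ph b"] by(simp add: ph_flip)

lemma right_span:
assumes "a:C R"
shows "EX r. (ALL I. r I:C S) & a = lsum R (%I. mon I \<otimes> ph (r I)) (mons n)"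
proof -
obtain c where c: "!!I. I:set (mons n) ==> c I:B" "a = lsum R (%I. c I \<otimes> mon I) (mons n)" using left_span[OF assms] by blast
define b where "b I = (if I:set (mons n) then inv_into (C S) ph (c I) else 0[S])" for I
have b: "b I:C S" for I using c(1) by(auto simp: b_def intro: inv_into_into)
have bc: "ph (b I) = c I" if "I:set (mons n)" for I using c(1)[OF that] that by(simp add: b_def f_inv_into_f)
have "a = lsum R (%I. mon I \<otimes> ph (rflip S (odd (card I)) (b I))) (mons n)"
 unfolding c(2) by(rule lsum_cong) (use b bc in \<open>auto simp: mon_commute[symmetric]\<close>)
thus ?thesis using b by(intro exI[of _ "%I. rflip S (odd (card I)) (b I)"]) auto
qed

lemma right_free:
assumes "!!I. I:set (mons n) ==> r I:C S" "lsum R (%I. mon I \<otimes> ph (r I)) (mons n) = \<zero>"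
 and "I:set (mons n)"
shows "r I = 0[S]"
proof -
define c where "c I = ph (rflip S (odd (card I)) (r I))" for I
have "lsum R (%I. c I \<otimes> mon I) (mons n) = lsum R (%I. mon I \<otimes> ph (r I)) (mons n)"
 by(rule lsum_cong) (use assms(1) in \<open>auto simp: c_def mon_commute'\<close>)
hence "c I = \<zero>" using left_free[of c I] assms by(simp add: c_def)
hence "rflip S (odd (card I)) (r I) = 0[S]" using inj assms(1)[OF assms(3)] ph_zero unfolding c_def inj_on_def by(metis S.flip_cl S.zero_closed)
hence "rflip S (odd (card I)) (rflip S (odd (card I)) (r I)) = 0[S]" by simp
thus ?thesis using assms(1)[OF assms(3)] by(simp add: S.flip_flip)
qed

definition rc :: "'a => nat set => 'b" where "rc a = (SOME r. (ALL I. r I:C S) & a = lsum R (%I. mon I \<otimes> ph (r I)) (mons n))"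

lemma rc_cl: "a:C R ==> rc a I:C S"
and rc_expand: "a:C R ==> a = lsum R (%I. mon I \<otimes> ph (rc a I)) (mons n)"
using someI_ex[OF right_span, of a] unfolding rc_def by blast+

lemma rc_unique:
assumes "!!I. I:set (mons n) ==> r I:C S" "a = lsum R (%I. mon I \<otimes> ph (r I)) (mons n)"
 and I: "I:set (mons n)"
shows "rc a I = r I"
proof -
have a: "a:C R" unfolding assms(2) using assms(1) by(auto intro!: lsum_cl)
have "lsum R (%I. mon I \<otimes> ph (rc a I -[S] r I)) (mons n) =
 lsum R (%I. mon I \<otimes> ph (rc a I) \<ominus> mon I \<otimes> ph (r I)) (mons n)"
proof(rule lsum_cong)
 fix I assume I: "I:set (mons n)"
 show "mon I \<otimes> ph (rc a I -[S] r I) = mon I \<otimes> ph (rc a I) \<ominus> mon I \<otimes> ph (r I)"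
  using assms(1)[OF I] rc_cl[OF a, of I] mon_cl[OF I]
  by(simp add: minus_eq S.minus_eq ph_add ph_neg r_distr r_minus)
qed simp
also have "... = lsum R (%I. mon I \<otimes> ph (rc a I)) (mons n) \<ominus> lsum R (%I. mon I \<otimes> ph (r I)) (mons n)"
 by(rule lsum_minus) (use assms(1) rc_cl[OF a] in auto)
also have "... = \<zero>" using rc_expand[OF a] assms(2) a by(metis minus_self)
finally have "rc a I -[S] r I = 0[S]" by(intro right_free[of "%I. rc a I -[S] r I"]) (simp_all add: assms(1) rc_cl[OF a] I)
thus ?thesis using S.minus_zero_imp_eq rc_cl[OF a] assms(1)[OF I] by blast
qed

lemma rc_add:
assumes "a:C R" "b:C R" "I:set (mons n)"
shows "rc (a \<oplus> b) I = rc a I+[S] rc b I"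
proof(rule rc_unique[OF _ _ assms(3)])
have "lsum R (%I. mon I \<otimes> ph (rc a I+[S] rc b I)) (mons n) =
 lsum R (%I. mon I \<otimes> ph (rc a I) \<oplus> mon I \<otimes> ph (rc b I)) (mons n)"
 by(rule lsum_cong) (use assms rc_cl in \<open>auto simp: ph_add r_distr\<close>)
also have "... = a \<oplus> b" using lsum_add[of "mons n" "%I. mon I \<otimes> ph (rc a I)" "%I. mon I \<otimes> ph (rc b I)"] assms rc_cl
  rc_expand[OF assms(1)] rc_expand[OF assms(2)] by simp
finally show "a \<oplus> b = lsum R (%I. mon I \<otimes> ph (rc a I+[S] rc b I)) (mons n)" by simp
qed (use assms rc_cl in auto)

lemma rc_mult_right:
assumes "a:C R" "b:C S" "I:set (mons n)"
shows "rc (a \<otimes> ph b) I = rc a I*[S] b"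
proof(rule rc_unique[OF _ _ assms(3)])
have "a \<otimes> ph b = lsum R (%I. mon I \<otimes> ph (rc a I)) (mons n) \<otimes> ph b" using rc_expand[OF assms(1)] by simp
also have "... = lsum R (%I. mon I \<otimes> ph (rc a I) \<otimes> ph b) (mons n)" by(rule addmap_lsum[OF ag ag add_mult_right])
  (use assms rc_cl in auto)
also have "... = lsum R (%I. mon I \<otimes> ph (rc a I*[S] b)) (mons n)"
 by(rule lsum_cong) (use assms rc_cl in \<open>auto simp: ph_mult m_assoc\<close>)
finally show "a \<otimes> ph b = lsum R (%I. mon I \<otimes> ph (rc a I*[S] b)) (mons n)" .
qed (use assms rc_cl in auto)

lemma rc_mult_left:
assumes "a:C R" "b:C S" "I:set (mons n)"
shows "rc (ph b \<otimes> a) I = rflip S (odd (card I)) b*[S] rc a I"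
proof(rule rc_unique[OF _ _ assms(3)])
have "ph b \<otimes> a = ph b \<otimes> lsum R (%I. mon I \<otimes> ph (rc a I)) (mons n)" using rc_expand[OF assms(1)] by simp
also have "... = lsum R (%I. ph b \<otimes> (mon I \<otimes> ph (rc a I))) (mons n)" by(rule addmap_lsum[OF ag ag add_mult_left])
  (use assms rc_cl in auto)
also have "... = lsum R (%I. mon I \<otimes> ph (rflip S (odd (card I)) b*[S] rc a I)) (mons n)"
 by(rule lsum_cong) (use assms rc_cl in \<open>auto simp: ph_mult m_assoc[symmetric] mon_commute\<close>)
finally show "ph b \<otimes> a = lsum R (%I. mon I \<otimes> ph (rflip S (odd (card I)) b*[S] rc a I)) (mons n)" .
qed (use assms rc_cl in auto)

lemma rc_one: "rc \<one> {} = 1[S]"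
proof -
define r where "r I = (if I = {} then 1[S] else 0[S])" for I :: "nat set"
have "rc \<one> {} = r {}"
proof(rule rc_unique)
 have "lsum R (%I. mon I \<otimes> ph (r I)) (mons n) = mon {} \<otimes> ph (r {})"
  by(rule lsum_single[OF distinct_mons empty_in_mons]) (auto simp: r_def ph_zero ph_one)
 thus "\<one> = lsum R (%I. mon I \<otimes> ph (r I)) (mons n)" by(simp add: r_def ph_one)
qed (auto simp: r_def)
thus ?thesis by(simp add: r_def)
qed

lemma rc_zero: "I:set (mons n) ==> rc \<zero> I = 0[S]" by(rule rc_unique) (auto intro!: lsum_zero[symmetric] simp: ph_zero)

lemma rc_grade:
assumes "a:grade R j" "I:set (mons n)"
shows "rc a I:grade S (j ~= odd (card I))"
proof -
have a: "a:C R" using assms(1) gr_car by blast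
have "rc a I = hpart S (grade S) (j ~= odd (card I)) (rc a I)"
proof(rule rc_unique[OF _ _ assms(2)])
 have "a = hpart R (grade R) j (lsum R (%I. mon I \<otimes> ph (rc a I)) (mons n))" using rc_expand[OF a] hpart_homog[OF assms(1)] by simp
 also have "... = lsum R (%I. hpart R (grade R) j (mon I \<otimes> ph (rc a I))) (mons n)" by(rule addmap_lsum[OF ag ag add_hpart])
   (use a rc_cl in auto)
 also have "... = lsum R (%I. mon I \<otimes> ph (hpart S (grade S) (j ~= odd (card I)) (rc a I))) (mons n)"
 proof(rule lsum_cong)
  fix I assume I: "I:set (mons n)"
  obtain r0 r1 where r: "r0:grade S False" "r1:grade S True" "rc a I = r0+[S] r1" using rc_cl[OF a] by(rule S.decomposeE)
  hence rc: "r0:C S" "r1:C S" by(auto intro: S.gr_car)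
  have g: "mon I \<otimes> ph r0:grade R (odd (card I))" "mon I \<otimes> ph r1:grade R (~ odd (card I))"
   using grade_mult[OF mon_grade[OF I] ph_grade[OF r(1)]] grade_mult[OF mon_grade[OF I] ph_grade[OF r(2)]]
   by simp_all
  have "mon I \<otimes> ph (rc a I) = mon I \<otimes> ph r0 \<oplus> mon I \<otimes> ph r1" using r rc mon_cl[OF I] by(simp add: ph_add r_distr)
  thus "hpart R (grade R) j (mon I \<otimes> ph (rc a I)) = mon I \<otimes> ph (hpart S (grade S) (j ~= odd (card I)) (rc a I))"
   using g r rc mon_cl[OF I]
   by(cases j; cases "odd (card I)") (simp_all add: hpart_add hpart_homog S.hpart_sum)
 qed simp
 finally show "a = lsum R (%I. mon I \<otimes> ph (hpart S (grade S) (j ~= odd (card I)) (rc a I))) (mons n)" .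
qed (use a rc_cl in auto)
thus ?thesis using S.hpart_in rc_cl[OF a] by metis
qed

end

section \<open>Vector fields\<close>

lemma parity_map_flip:
assumes "gr_ag M gr" "gr_ag N gr'" "addmap M N h"
 and "!!j. h ` gr j <= gr' (i ~= j)" "x:C M"
shows "h (flip M gr k x) = koszul N i k (flip N gr' k (h x))"
proof -
interpret M: gr_ag M gr by fact
interpret N: gr_ag N gr' by fact
show ?thesis
proof(rule M.addmap_ext[where x = x and N = N])
 show "addmap M N (%x. h (flip M gr k x))" by(rule addmap_comp[OF M.add_flip assms(3)])
 have "addmap N N (koszul N i k)" by(rule addmapI) (auto simp: N.ksz_add)
 thus "addmap M N (%x. koszul N i k (flip N gr' k (h x)))" using addmap_comp[OF assms(3) addmap_comp[OF N.add_flip]] by blast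
 fix j x assume x: "x:gr j"
 hence h: "h x:gr' (i ~= j)" using assms(4) by blast
 show "h (flip M gr k x) = koszul N i k (flip N gr' k (h x))" using addmap_neg[OF M.ag N.ag assms(3) M.gr_car[OF x]] N.gr_car[OF h]
  by(simp add: M.flip_homog[OF x] N.flip_homog[OF h]) (auto simp: koszul_def)
qed fact
qed

locale lambda_superspace = superringed_space L Z
for L :: "'l complex_superalgebra" and Z :: "('p, 'l, 'a) superspace" +
assumes base_ring: "nilpotent_extension L"
begin

abbreviation opn :: "'p set => bool" where "opn == op_in Z"
abbreviation Oz :: "'p set => 'a superring" where "Oz == fun_ring Z"
abbreviation fl where "fl U == rflip (Oz U)"
abbreviation cO where "cO U == C (Oz U)"

lemma fun_sring: "opn U ==> sring (Oz U)" by(rule sring.intro) (rule fun_supercomm)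

lemma O_superalgebra: "opn U ==> superalgebra (Oz U)"
proof -
assume U: "opn U"
interpret L: nilpotent_extension L by(rule base_ring)
interpret sring "Oz U" by(rule fun_sring[OF U])
have s: "scalar Z U:ring_hom L (Oz U)" using scalar_hom[OF U] by(simp add: superring_hom_def)
let ?k = "%z. scalar Z U (of_cplx L z)"
have c: "of_cplx L z:C L" for z using ring_hom_closed[OF L.of_cplx_hom, of z] by(simp add: complex_ring_def)
have "?k (1/2)+[Oz U] ?k (1/2) = scalar Z U (of_cplx L (1/2)+[L] of_cplx L (1/2))" using ring_hom_add[OF s c c] by simp
also have "of_cplx L (1/2)+[L] of_cplx L (1/2) = 1[L]" using ring_hom_add[OF L.of_cplx_hom, of "1/2" "1/2"] ring_hom_one[OF L.of_cplx_hom]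
 by(simp add: complex_ring_def)
also have "scalar Z U 1[L] = 1[Oz U]" by(rule ring_hom_one[OF s])
finally show ?thesis using ring_hom_closed[OF s c, of "1/2"] by unfold_locales blast
qed

context
fixes U V assumes UV: "opn U" "opn V" "V<=U"
begin

lemma res_ring_hom: "fr Z U V:ring_hom (Oz U) (Oz V)" using fun_res_hom[OF UV] by(simp add: superring_hom_def)

lemma res_closed [simp]: "f:cO U ==> fr Z U V f:cO V" by(rule ring_hom_closed[OF res_ring_hom])

lemma res_add: "f:cO U ==> g:cO U ==> fr Z U V (f+[Oz U] g) = fr Z U V f+[Oz V] fr Z U V g" by(rule ring_hom_add[OF res_ring_hom])

lemma res_mult: "f:cO U ==> g:cO U ==> fr Z U V (f*[Oz U] g) = fr Z U V f*[Oz V] fr Z U V g" by(rule ring_hom_mult[OF res_ring_hom])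

lemma res_one: "fr Z U V 1[Oz U] = 1[Oz V]" by(rule ring_hom_one[OF res_ring_hom])

lemma res_grade: "f:grade (Oz U) i ==> fr Z U V f:grade (Oz V) i" using fun_res_hom[OF UV] by(auto simp: superring_hom_def)

lemma additive_res: "addmap (Oz U) (Oz V) (fr Z U V)" by(rule addmapI) (auto simp: res_add)

lemma O_ag: "abelian_group (Oz U)" "abelian_group (Oz V)" "gr_ag (Oz U) (grade (Oz U))" "gr_ag (Oz V) (grade (Oz V))"
proof -
interpret sring "Oz U" by(rule fun_sring[OF UV(1)])
interpret V: sring "Oz V" by(rule fun_sring[OF UV(2)])
show "abelian_group (Oz U)" "abelian_group (Oz V)" "gr_ag (Oz U) (grade (Oz U))" "gr_ag (Oz V) (grade (Oz V))" by unfold_locales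
qed

lemma res_zero: "fr Z U V 0[Oz U] = 0[Oz V]" by(rule addmap_zero[OF O_ag(1,2) additive_res])

lemma res_neg: "f:cO U ==> fr Z U V (-[Oz U] f) = -[Oz V] fr Z U V f" by(rule addmap_neg[OF O_ag(1,2) additive_res])

lemma res_minus: "f:cO U ==> g:cO U ==> fr Z U V (f -[Oz U] g) = fr Z U V f -[Oz V] fr Z U V g" by(rule addmap_minus[OF O_ag(1,2) additive_res])

lemma res_ksz: "f:cO U ==> fr Z U V (koszul (Oz U) i j f) = koszul (Oz V) i j (fr Z U V f)" by(rule addmap_ksz[OF O_ag(1,2) additive_res])

lemma res_flip: "f:cO U ==> fr Z U V (fl U i f) = fl V i (fr Z U V f)" by(rule flip_natural[OF O_ag(3,4) additive_res]) (use res_grade in auto)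

end

lemma res_id: "opn U ==> f:cO U ==> fr Z U U f = f" using set_sheaf.res_id[OF fun_sheaf] .

lemma res_trans: "opn U ==> opn V ==> opn N ==> N<=V ==> V<=U ==> f:cO U ==> fr Z V N (fr Z U V f) = fr Z U N f"
using set_sheaf.res_trans[OF fun_sheaf] .

text \<open>The conditions on derivations, with the sign change operator in place of Koszul signs.\<close>

lemma ders_iff: "v:Der L Z U i <-> v = vf_mk Z U v & (ALL V. opn V & V<=U -->
  addmap (Oz V) (Oz V) (v V) & (ALL j. v V ` grade (Oz V) j <= grade (Oz V) (i ~= j)) &
  (ALL f:cO V. ALL g:cO V. v V (f*[Oz V] g) = v V f*[Oz V] g+[Oz V] fl V i f*[Oz V] v V g) &
  (ALL x:C L. v V (scalar Z V x) = 0[Oz V]) &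
  (ALL N f. opn N & N<=V & f:cO V --> fr Z V N (v V f) = v N (fr Z V N f)))"
proof -
let ?K = "%V. ALL j. ALL f:grade (Oz V) j. ALL g:cO V. v V (f*[Oz V] g) = v V f*[Oz V] g+[Oz V] koszul (Oz V) i j (f*[Oz V] v V g)"
let ?R = "%V. ALL f:cO V. ALL g:cO V. v V (f*[Oz V] g) = v V f*[Oz V] g+[Oz V] fl V i f*[Oz V] v V g"
have reorder: "(A & C ==> D = D') ==> (A & B & C & D & E & F) = ((A & C) & B & D' & E & F)"
 for A B C D D' E F by blast
have Leibniz: "?K V <-> ?R V" if V: "opn V" and add: "addmap (Oz V) (Oz V) (v V)" for V
proof -
 interpret sring "Oz V" by(rule fun_sring[OF V])
 note vc = addmap_cl[OF add]
 show ?thesis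
 proof(intro iffI allI ballI)
  fix f g assume L: "?K V"
   and fg: "f:cO V" "g:cO V"
  show "v V (f*[Oz V] g) = v V f*[Oz V] g+[Oz V] fl V i f*[Oz V] v V g"
  proof(rule addmap_ext[where x = f and N = "Oz V"])
   show "addmap (Oz V) (Oz V) (%f. v V (f*[Oz V] g))" by(rule addmap_comp[OF add_mult_right[OF fg(2)] add])
   show "addmap (Oz V) (Oz V) (%f. v V f*[Oz V] g+[Oz V] fl V i f*[Oz V] v V g)"
    using fg vc by(intro addmapI) (simp_all add: addmap_add[OF add] l_distr flip_add a_ac)
   show "v V (f*[Oz V] g) = v V f*[Oz V] g+[Oz V] fl V i f*[Oz V] v V g" if "f:grade (Oz V) j" for j f
    using L that fg gr_car[OF that] vc by(simp add: flip_homog ksz_mult)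
  qed fact
 next
  fix j f g assume L: "?R V"
   and fg: "f:grade (Oz V) j" "g:cO V"
  show "v V (f*[Oz V] g) = v V f*[Oz V] g+[Oz V] koszul (Oz V) i j (f*[Oz V] v V g)"
   using L fg gr_car[OF fg(1)] vc by(simp add: flip_homog ksz_mult)
 qed
qed
show ?thesis unfolding derivations_def mem_Collect_eq addmap_def
proof(rule arg_cong2[of _ _ _ _ "(&)"], rule HOL.refl, rule arg_cong[of _ _ All], rule ext, rule imp_cong[OF HOL.refl], rule reorder)
 fix V assume "opn V & V<=U" "v V:cO V \<rightarrow> cO V & (ALL x:cO V. ALL y:cO V. v V (x+[Oz V] y) = v V x+[Oz V] v V y)"
 thus "?K V =
 ?R V" by(intro Leibniz) (blast, unfold addmap_def)
qed
qed

lemma vf_mk_app: "opn V ==> V<=U ==> f:cO V ==> vf_mk Z U h V f = h V f" by(simp add: vf_mk_def)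

lemma vf_mk_cong: "(!!V f. opn V ==> V<=U ==> f:cO V ==> h V f = k V f) ==> vf_mk Z U h = vf_mk Z U k" by(auto simp: vf_mk_def fun_eq_iff)

lemma vf_mk_idem: "vf_mk Z U (vf_mk Z U h) = vf_mk Z U h" by(auto simp: vf_mk_def fun_eq_iff)

lemma dersI:
assumes "!!V. opn V ==> V<=U ==> addmap (Oz V) (Oz V) (h V)"
 and "!!V j f. opn V ==> V<=U ==> f:grade (Oz V) j ==> h V f:grade (Oz V) (i ~= j)"
 and "!!V f g. opn V ==> V<=U ==> f:cO V ==> g:cO V ==> h V (f*[Oz V] g) = h V f*[Oz V] g+[Oz V] fl V i f*[Oz V] h V g"
 and "!!V x. opn V ==> V<=U ==> x:C L ==> h V (scalar Z V x) = 0[Oz V]"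
 and "!!V N f. opn V ==> V<=U ==> opn N ==> N<=V ==> f:cO V ==> fr Z V N (h V f) = h N (fr Z V N f)"
shows "vf_mk Z U h:Der L Z U i"
proof -
have c: "f:cO V" if "opn V" "f:grade (Oz V) j" for V f j
proof -
 interpret sring "Oz V" by(rule fun_sring[OF that(1)])
 show ?thesis by(rule gr_car[OF that(2)])
qed
have s: "scalar Z V x:cO V" if "opn V" "x:C L" for V x
 using ring_hom_closed[of "scalar Z V" L "Oz V"] scalar_hom[OF that(1)] that(2) by(auto simp: superring_hom_def)
show ?thesis unfolding ders_iff vf_mk_idem
proof(intro conjI allI impI ballI HOL.refl; (elim conjE)?)
 fix V assume V: "opn V" "V<=U"
 interpret sring "Oz V" by(rule fun_sring[OF V(1)])
 show "addmap (Oz V) (Oz V) (vf_mk Z U h V)" using assms(1)[OF V] V by(auto simp: addmap_def vf_mk_app)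
 show "vf_mk Z U h V ` grade (Oz V) j <= grade (Oz V) (i ~= j)" for j using assms(2)[OF V] c[OF V(1)] V by(auto simp: vf_mk_app)
 show "vf_mk Z U h V (f*[Oz V] g) = vf_mk Z U h V f*[Oz V] g+[Oz V] fl V i f*[Oz V] vf_mk Z U h V g" if "f:cO V" "g:cO V" for f g
  using assms(3)[OF V that] V that by(simp add: vf_mk_app)
 show "vf_mk Z U h V (scalar Z V x) = 0[Oz V]" if "x:C L" for x using assms(4)[OF V that] V s[OF V(1) that] by(simp add: vf_mk_app)
 show "fr Z V N (vf_mk Z U h V f) = vf_mk Z U h N (fr Z V N f)" if "opn N" "N<=V" "f:cO V" for N f
  using assms(5)[OF V that] V that by(simp add: vf_mk_app)
qed
qed

context
fixes U i v assumes v: "v:Der L Z U i"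
begin

lemma der_mk: "v = vf_mk Z U v" using v by(simp add: ders_iff)

context
fixes V assumes V: "opn V" "V<=U"
begin

lemma der_additive: "addmap (Oz V) (Oz V) (v V)" using v V by(simp add: ders_iff)

lemma der_cl [simp]: "f:cO V ==> v V f:cO V" by(rule addmap_cl[OF der_additive])

lemma der_add: "f:cO V ==> g:cO V ==> v V (f+[Oz V] g) = v V f+[Oz V] v V g" by(rule addmap_add[OF der_additive])

lemma der_grade: "f:grade (Oz V) j ==> v V f:grade (Oz V) (i ~= j)"
proof -
have "v V ` grade (Oz V) j <= grade (Oz V) (i ~= j)" for j
 using v[unfolded ders_iff, THEN conjunct2, rule_format, OF conjI[OF V]] by(elim conjE allE)
thus "f:grade (Oz V) j ==> v V f:grade (Oz V) (i ~= j)" by blast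
qed

lemma der_mult: "f:cO V ==> g:cO V ==> v V (f*[Oz V] g) = v V f*[Oz V] g+[Oz V] fl V i f*[Oz V] v V g" using v V by(simp add: ders_iff)

lemma der_scalar: "x:C L ==> v V (scalar Z V x) = 0[Oz V]" using v V by(simp add: ders_iff)

lemma der_res: "opn N ==> N<=V ==> f:cO V ==> fr Z V N (v V f) = v N (fr Z V N f)" using v V by(simp add: ders_iff)

lemma der_flip: "f:cO V ==> v V (fl V k f) = koszul (Oz V) i k (fl V k (v V f))"
by(rule parity_map_flip[OF O_ag(3)[OF V(1) V(1) le] O_ag(3)[OF V(1) V(1) le] der_additive]) (use der_grade in auto)

lemma der_zero: "v V 0[Oz V] = 0[Oz V]" by(rule addmap_zero[OF O_ag(1)[OF V(1) V(1) le] O_ag(1)[OF V(1) V(1) le] der_additive])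

end

end

lemma zero_der: "vf_mk Z U (%V f. 0[Oz V]):Der L Z U i"
proof(rule dersI)
fix V assume "opn V" "V<=U"
then interpret supercommutative_ring "Oz V" using fun_supercomm by blast
show "addmap (Oz V) (Oz V) (%f. 0[Oz V])" by(rule addmapI) auto
show "0[Oz V]:grade (Oz V) (i ~= j)" for j by simp
show "0[Oz V] = 0[Oz V]*[Oz V] g+[Oz V] fl V i f*[Oz V] 0[Oz V]" if "f:cO V" "g:cO V" for f g using that by simp
qed (auto simp: res_zero)

lemma vf_add_der:
assumes "v:Der L Z U i" "w:Der L Z U i"
shows "vf_add Z U v w:Der L Z U i"
unfolding vf_add_def
proof(rule dersI)
fix V assume V: "opn V" "V<=U"
interpret sring "Oz V" by(rule fun_sring[OF V(1)])
note v = der_cl[OF assms(1) V] der_cl[OF assms(2) V]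
show "addmap (Oz V) (Oz V) (%f. v V f+[Oz V] w V f)" using v by(intro addmapI) (simp_all add: der_add[OF assms(1) V] der_add[OF assms(2) V] a_ac)
show "v V f+[Oz V] w V f:grade (Oz V) (i ~= j)" if "f:grade (Oz V) j" for f j
 using der_grade[OF assms(1) V that] der_grade[OF assms(2) V that] by(rule gr_add)
show "v V (f*[Oz V] g)+[Oz V] w V (f*[Oz V] g) = (v V f+[Oz V] w V f)*[Oz V] g+[Oz V] fl V i f*[Oz V] (v V g+[Oz V] w V g)"
 if "f:cO V" "g:cO V" for f g
 using that v by(simp add: der_mult[OF assms(1) V] der_mult[OF assms(2) V] l_distr r_distr a_ac)
show "v V (scalar Z V x)+[Oz V] w V (scalar Z V x) = 0[Oz V]" if "x:C L" for x
 using that by(simp add: der_scalar[OF assms(1) V] der_scalar[OF assms(2) V])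
show "fr Z V N (v V f+[Oz V] w V f) = v N (fr Z V N f)+[Oz N] w N (fr Z V N f)" if "opn N" "N<=V" "f:cO V" for N f
 using that V v by(simp add: res_add der_res[OF assms(1) V] der_res[OF assms(2) V])
qed

lemma vf_smult_der:
assumes U: "opn U" and h: "h:grade (Oz U) j" and v: "v:Der L Z U i"
shows "vf_smult Z U h v:Der L Z U (j ~= i)"
unfolding vf_smult_def
proof(rule dersI)
interpret U: sring "Oz U" by(rule fun_sring[OF U])
note hc = U.gr_car[OF h]
fix V assume V: "opn V" "V<=U"
interpret sring "Oz V" by(rule fun_sring[OF V(1)])
note vc = der_cl[OF v V] and hV = res_closed[OF U V hc] and hg = res_grade[OF U V h]
show "addmap (Oz V) (Oz V) (%f. fr Z U V h*[Oz V] v V f)" by(rule addmap_comp[OF der_additive[OF v V] add_mult_left[OF hV]])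
show "fr Z U V h*[Oz V] v V f:grade (Oz V) ((j ~= i) ~= k)" if "f:grade (Oz V) k" for f k
 using grade_mult[OF hg der_grade[OF v V that]] by(cases i; cases j; cases k) simp_all
show "fr Z U V h*[Oz V] v V (f*[Oz V] g) = fr Z U V h*[Oz V] v V f*[Oz V] g+[Oz V] fl V (j ~= i) f*[Oz V] (fr Z U V h*[Oz V] v V g)"
 if fg: "f:cO V" "g:cO V" for f g
proof -
 have "fr Z U V h*[Oz V] (fl V i f*[Oz V] v V g) = fl V (j ~= i) f*[Oz V] (fr Z U V h*[Oz V] v V g)"
  using homog_commute[OF hg, of "fl V i f"] fg vc hV
  by(simp add: m_assoc[symmetric] flip_flip)
 thus ?thesis using fg vc hV by(simp add: der_mult[OF v V] r_distr m_assoc)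
qed
show "fr Z U V h*[Oz V] v V (scalar Z V x) = 0[Oz V]" if "x:C L" for x using that hV by(simp add: der_scalar[OF v V])
show "fr Z V N (fr Z U V h*[Oz V] v V f) = fr Z U N h*[Oz N] v N (fr Z V N f)" if "opn N" "N<=V" "f:cO V" for N f
 using that V U hV vc hc by(simp add: res_mult der_res[OF v V] res_trans)
qed

lemma vf_br_der:
assumes v: "v:Der L Z U i" and w: "w:Der L Z U j"
shows "vf_br Z U i j v w:Der L Z U (i ~= j)"
unfolding vf_bracket_def
proof(rule dersI)
fix V assume V: "opn V" "V<=U"
interpret sring "Oz V" by(rule fun_sring[OF V(1)])
note vc = der_cl[OF v V] and wc = der_cl[OF w V]
note D = der_mult[OF v V] der_mult[OF w V] der_add[OF v V] der_add[OF w V] der_flip[OF v V] der_flip[OF w V]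
show "addmap (Oz V) (Oz V) (%f. v V (w V f) -[Oz V] koszul (Oz V) i j (w V (v V f)))"
 using vc wc by(intro addmapI) (simp_all add: D ksz_add minus_eq minus_add a_ac)
show "v V (w V f) -[Oz V] koszul (Oz V) i j (w V (v V f)):grade (Oz V) ((i ~= j) ~= k)" if "f:grade (Oz V) k" for f k
 using der_grade[OF v V der_grade[OF w V that]] der_grade[OF w V der_grade[OF v V that]]
 by(intro gr_minus gr_ksz) (cases i; cases j; cases k; simp)+
show "v V (w V (f*[Oz V] g)) -[Oz V] koszul (Oz V) i j (w V (v V (f*[Oz V] g))) =
  (v V (w V f) -[Oz V] koszul (Oz V) i j (w V (v V f)))*[Oz V] g +[Oz V]
  fl V (i ~= j) f*[Oz V] (v V (w V g) -[Oz V] koszul (Oz V) i j (w V (v V g)))"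
 if fg: "f:cO V" "g:cO V" for f g
proof -
 define p q r s where "p = v V (w V f)*[Oz V] g" "q = fl V i (w V f)*[Oz V] v V g"
  "r = fl V j (v V f)*[Oz V] w V g" "s = fl V (i ~= j) f*[Oz V] v V (w V g)"
 define p' s' where "p' = w V (v V f)*[Oz V] g" "s' = fl V (i ~= j) f*[Oz V] w V (v V g)"
 have ff: "fl V j (fl V i f) = fl V (i ~= j) f" "fl V i (fl V j f) = fl V (i ~= j) f" using fg by(auto simp: flip_flip intro: arg_cong2)
 have c: "p:cO V" "q:cO V" "r:cO V" "s:cO V" "p':cO V" "s':cO V" using fg vc wc by(simp_all add: p_q_r_s_def p'_s'_def)
 have 1: "v V (w V (f*[Oz V] g)) = (p+[Oz V] q)+[Oz V] (koszul (Oz V) i j r+[Oz V] s)" using fg vc wc by(simp add: D p_q_r_s_def ff ksz_mult)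
 have 2: "w V (v V (f*[Oz V] g)) = (p'+[Oz V] r)+[Oz V] (koszul (Oz V) i j q+[Oz V] s')"
  using fg vc wc by(simp add: D p_q_r_s_def p'_s'_def ff ksz_mult ksz_sym[of "Oz V" j i])
 have "(v V (w V f) -[Oz V] koszul (Oz V) i j (w V (v V f)))*[Oz V] g +[Oz V]
  fl V (i ~= j) f*[Oz V] (v V (w V g) -[Oz V] koszul (Oz V) i j (w V (v V g))) =
  (p -[Oz V] koszul (Oz V) i j p')+[Oz V] (s -[Oz V] koszul (Oz V) i j s')"
  using fg vc wc
  by(simp add: minus_eq l_distr r_distr l_minus r_minus ksz_mult p_q_r_s_def p'_s'_def)
 moreover have "(p+[Oz V] q)+[Oz V] (koszul (Oz V) i j r+[Oz V] s) -[Oz V]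
  koszul (Oz V) i j ((p'+[Oz V] r)+[Oz V] (koszul (Oz V) i j q+[Oz V] s')) =
  (p -[Oz V] koszul (Oz V) i j p')+[Oz V] (s -[Oz V] koszul (Oz V) i j s')"
 proof(cases "i & j")
  case True
  thus ?thesis using c by(simp add: koszul_def) algebra
 next
  case False
  hence k: "koszul (Oz V) i j x = x" for x by(auto simp: koszul_def)
  show ?thesis unfolding k using c by algebra
 qed
 ultimately show ?thesis unfolding 1 2 by simp
qed
show "v V (w V (scalar Z V x)) -[Oz V] koszul (Oz V) i j (w V (v V (scalar Z V x))) = 0[Oz V]" if "x:C L" for x
 using that by(simp add: der_scalar[OF v V] der_scalar[OF w V] der_zero[OF v V] der_zero[OF w V])
show "fr Z V N (v V (w V f) -[Oz V] koszul (Oz V) i j (w V (v V f))) = v N (w N (fr Z V N f)) -[Oz N] koszul (Oz N) i j (w N (v N (fr Z V N f)))"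
 if "opn N" "N<=V" "f:cO V" for N f
 using that V vc wc by(simp add: res_minus res_ksz der_res[OF v V] der_res[OF w V])
qed

lemma vf_res_der:
assumes "v:Der L Z U i" "V<=U"
shows "vf_res Z V v:Der L Z V i"
unfolding vf_res_def
proof(rule dersI)
fix N assume N: "opn N" "N<=V"
hence NU: "N<=U" using assms(2) by blast
note d = der_additive[OF assms(1) N(1) NU] der_grade[OF assms(1) N(1) NU] der_mult[OF assms(1) N(1) NU]
 der_scalar[OF assms(1) N(1) NU] der_res[OF assms(1) N(1) NU]
show "addmap (Oz N) (Oz N) (v N)" by(rule d)
show "v N f:grade (Oz N) (i ~= j)" if "f:grade (Oz N) j" for f j using that by(rule d)
show "v N (f*[Oz N] g) = v N f*[Oz N] g+[Oz N] fl N i f*[Oz N] v N g" if "f:cO N" "g:cO N" for f g using that by(rule d)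
show "v N (scalar Z N x) = 0[Oz N]" if "x:C L" for x using that by(rule d)
show "fr Z N M (v N f) = v M (fr Z N M f)" if "opn M" "M<=N" "f:cO N" for M f using that by(rule d)
qed

lemma vf_res_app: "opn N ==> N<=V ==> f:cO N ==> vf_res Z V v N f = v N f" by(simp add: vf_res_def vf_mk_app)

lemma vf_add_app: "opn N ==> N<=V ==> f:cO N ==> vf_add Z V v w N f = v N f+[Oz N] w N f" by(simp add: vf_add_def vf_mk_app)

lemma vf_smult_app: "opn N ==> N<=V ==> f:cO N ==> vf_smult Z V h v N f = fr Z V N h*[Oz N] v N f" by(simp add: vf_smult_def vf_mk_app)

lemma vf_br_app: "opn N ==> N<=V ==> f:cO N ==> vf_br Z V i j v w N f = v N (w N f) -[Oz N] koszul (Oz N) i j (w N (v N f))"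
by(simp add: vf_bracket_def vf_mk_app)

text \<open>A vector field on \<open>U\<close> takes a fixed default value off the open subsets of \<open>U\<close>; so vector fields
  are equal if their values on functions are.\<close>

definition vf_on :: "'p set => ('p, 'a) vfield => bool" where "vf_on U v <-> v = vf_mk Z U v"

lemma vf_eqI:
assumes "vf_on U v" "vf_on U w" "!!V f. opn V ==> V<=U ==> f:cO V ==> v V f = w V f"
shows "v = w"
using vf_mk_cong[of U v w] assms by(simp add: vf_on_def)

lemma vf_on_simps [simp]: "vf_on U (vf_mk Z U h)" "vf_on U (vf_res Z U v)" "vf_on U (vf_add Z U v w)"
"vf_on U (vf_smult Z U f v)" "vf_on U (vf_br Z U i j v w)"
by(simp_all add: vf_on_def vf_mk_idem vf_res_def vf_add_def vf_smult_def vf_bracket_def)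

lemma vf_on_der: "v:Der L Z U i ==> vf_on U v" unfolding vf_on_def by(rule der_mk)

lemma tanE:
assumes "v:tangent L Z U"
obtains v0 v1 where "v0:Der L Z U False" "v1:Der L Z U True" "v = vf_add Z U v0 v1"
using assms by(auto simp: tangent_def)

lemma vf_on_tan: "v:tangent L Z U ==> vf_on U v" by(auto simp: tangent_def)

lemma der_tan:
assumes "v:Der L Z U i" shows "v:tangent L Z U"
proof -
let ?z = "vf_mk Z U (%V f. 0[Oz V])"
have "vf_add Z U v ?z = v & vf_add Z U ?z v = v"
proof(intro conjI; rule vf_eqI)
 fix V f assume V: "opn V" "V<=U" "f:cO V"
 interpret sring "Oz V" by(rule fun_sring[OF V(1)])
 show "vf_add Z U v ?z V f = v V f" "vf_add Z U ?z v V f = v V f" using V der_cl[OF assms V(1,2)] by(simp_all add: vf_add_app vf_mk_app)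
qed (use assms vf_on_der in auto)
thus ?thesis using assms zero_der unfolding tangent_def by(cases i) force+
qed

lemma vf_add_assoc_comm:
assumes "v0:Der L Z U i" "v1:Der L Z U j" "w0:Der L Z U i" "w1:Der L Z U j"
shows "vf_add Z U (vf_add Z U v0 v1) (vf_add Z U w0 w1) = vf_add Z U (vf_add Z U v0 w0) (vf_add Z U v1 w1)"
proof(rule vf_eqI)
fix V f assume V: "opn V" "V<=U" "f:cO V"
interpret sring "Oz V" by(rule fun_sring[OF V(1)])
show "vf_add Z U (vf_add Z U v0 v1) (vf_add Z U w0 w1) V f = vf_add Z U (vf_add Z U v0 w0) (vf_add Z U v1 w1) V f"
 using V der_cl[OF assms(1) V(1,2)] der_cl[OF assms(2) V(1,2)] der_cl[OF assms(3) V(1,2)] der_cl[OF assms(4) V(1,2)]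
 by(simp add: vf_add_app a_ac)
qed auto

lemma vf_add_tan:
assumes "v:tangent L Z U" "w:tangent L Z U" shows "vf_add Z U v w:tangent L Z U"
proof -
obtain v0 v1 w0 w1 where d: "v0:Der L Z U False" "v1:Der L Z U True" "v = vf_add Z U v0 v1"
 "w0:Der L Z U False" "w1:Der L Z U True" "w = vf_add Z U w0 w1"
 using assms by(meson tanE)
thus ?thesis using vf_add_assoc_comm[OF d(1,2,4,5)] vf_add_der[OF d(1,4)] vf_add_der[OF d(2,5)] unfolding tangent_def by blast
qed

context
fixes U v assumes v: "v:tangent L Z U"
begin

lemma tan_res: "opn V ==> V<=U ==> vf_res Z V v:tangent L Z V"
proof -
assume V: "opn V" "V<=U"
obtain v0 v1 where d: "v0:Der L Z U False" "v1:Der L Z U True" "v = vf_add Z U v0 v1" using v by(rule tanE)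
have "vf_res Z V v = vf_add Z V (vf_res Z V v0) (vf_res Z V v1)"
proof(rule vf_eqI)
 fix N f assume "opn N" "N<=V" "f:cO N"
 thus "vf_res Z V v N f = vf_add Z V (vf_res Z V v0) (vf_res Z V v1) N f" using V d(3) by(simp add: vf_res_app vf_add_app)
qed auto
thus ?thesis using vf_res_der[OF d(1) V(2)] vf_res_der[OF d(2) V(2)] unfolding tangent_def by blast
qed

context
fixes V assumes V: "opn V" "V<=U"
begin

lemma tan_add: "addmap (Oz V) (Oz V) (v V)"
proof -
interpret sring "Oz V" by(rule fun_sring[OF V(1)])
obtain v0 v1 where d: "v0:Der L Z U False" "v1:Der L Z U True" "v = vf_add Z U v0 v1" using v by(rule tanE)
show ?thesis using V der_cl[OF d(1) V] der_cl[OF d(2) V] unfolding d(3)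
 by(intro addmapI) (simp_all add: vf_add_app der_add[OF d(1) V] der_add[OF d(2) V] a_ac)
qed

lemma tan_cl [simp]: "f:cO V ==> v V f:cO V" by(rule addmap_cl[OF tan_add])

lemma tan_commute_res: "opn N ==> N<=V ==> f:cO V ==> fr Z V N (v V f) = v N (fr Z V N f)"
proof -
assume N: "opn N" "N<=V" "f:cO V"
obtain v0 v1 where d: "v0:Der L Z U False" "v1:Der L Z U True" "v = vf_add Z U v0 v1" using v by(rule tanE)
show ?thesis using N V der_cl[OF d(1) V] der_cl[OF d(2) V] unfolding d(3) by(simp add: vf_add_app res_add der_res[OF d(1) V] der_res[OF d(2) V])
qed

end

lemma vf_res_id: "vf_res Z U v = v" using vf_on_tan[OF v] by(simp add: vf_on_def vf_res_def)

lemma vf_res_res: "V<=N ==> vf_res Z V (vf_res Z N v) = vf_res Z V v" unfolding vf_res_def by(rule vf_mk_cong) (auto simp: vf_mk_app)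

end

lemma der_parts_unique:
assumes "v0:Der L Z U False" "v1:Der L Z U True" "w0:Der L Z U False" "w1:Der L Z U True" "vf_add Z U v0 v1 = vf_add Z U w0 w1"
shows "v0 = w0" "v1 = w1"
proof -
have *: "v0 V f = w0 V f & v1 V f = w1 V f" if V: "opn V" "V<=U" and f: "f:cO V" for V f
proof -
 interpret sring "Oz V" by(rule fun_sring[OF V(1)])
 note A = der_additive[OF assms(1) V] der_additive[OF assms(2) V] der_additive[OF assms(3) V] der_additive[OF assms(4) V]
 have "v0 V f = w0 V f & v1 V f = w1 V f" if f: "f:grade (Oz V) j" for j f
 proof -
  note fc = gr_car[OF f]
  note g = der_grade[OF assms(1) V f] der_grade[OF assms(2) V f] der_grade[OF assms(3) V f] der_grade[OF assms(4) V f]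
  note c = g[THEN gr_car]
  have "v0 V f+[Oz V] v1 V f = w0 V f+[Oz V] w1 V f" using assms(5) vf_add_app[OF V fc, of v0 v1] vf_add_app[OF V fc, of w0 w1] by simp
  hence "(v0 V f -[Oz V] w0 V f)+[Oz V] (v1 V f -[Oz V] w1 V f) = 0[Oz V]"
  proof -
   have "(v0 V f -[Oz V] w0 V f)+[Oz V] (v1 V f -[Oz V] w1 V f) = (v0 V f+[Oz V] v1 V f) -[Oz V] (w0 V f+[Oz V] w1 V f)" using c by algebra
   also assume "v0 V f+[Oz V] v1 V f = w0 V f+[Oz V] w1 V f"
   finally show ?thesis using c by simp
  qed
  hence "v0 V f -[Oz V] w0 V f = 0[Oz V]" "v1 V f -[Oz V] w1 V f = 0[Oz V]"
   using gr_sum_zero'[of "v0 V f -[Oz V] w0 V f" j "v1 V f -[Oz V] w1 V f"] g gr_minus by auto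
  thus ?thesis using minus_zero_imp_eq c by blast
 qed
 thus ?thesis using addmap_ext[OF A(1,3) _ f] addmap_ext[OF A(2,4) _ f] by blast
qed
show "v0 = w0" "v1 = w1" using * vf_on_der assms by(auto intro!: vf_eqI[of U])
qed

lemma vf_smult_add_left:
assumes "opn U" "f:cO U" "g:cO U" "v:tangent L Z U"
shows "vf_smult Z U (f+[Oz U] g) v = vf_add Z U (vf_smult Z U f v) (vf_smult Z U g v)"
proof(rule vf_eqI)
fix V h assume V: "opn V" "V<=U" "h:cO V"
interpret sring "Oz V" by(rule fun_sring[OF V(1)])
show "vf_smult Z U (f+[Oz U] g) v V h = vf_add Z U (vf_smult Z U f v) (vf_smult Z U g v) V h"
 using V assms tan_cl[OF assms(4) V(1,2)] by(simp add: vf_smult_app vf_add_app res_add l_distr)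
qed auto

lemma vf_smult_add_right:
assumes "opn U" "f:cO U" "v:tangent L Z U" "w:tangent L Z U"
shows "vf_smult Z U f (vf_add Z U v w) = vf_add Z U (vf_smult Z U f v) (vf_smult Z U f w)"
proof(rule vf_eqI)
fix V h assume V: "opn V" "V<=U" "h:cO V"
interpret sring "Oz V" by(rule fun_sring[OF V(1)])
show "vf_smult Z U f (vf_add Z U v w) V h = vf_add Z U (vf_smult Z U f v) (vf_smult Z U f w) V h"
 using V assms tan_cl[OF assms(3) V(1,2)] tan_cl[OF assms(4) V(1,2)]
 by(simp add: vf_smult_app vf_add_app r_distr)
qed auto

lemma vf_smult_tan:
assumes U: "opn U" and f: "f:cO U" and v: "v:tangent L Z U"
shows "vf_smult Z U f v:tangent L Z U"
proof -
interpret sring "Oz U" by(rule fun_sring[OF U])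
obtain v0 v1 where d: "v0:Der L Z U False" "v1:Der L Z U True" "v = vf_add Z U v0 v1" using v by(rule tanE)
obtain f0 f1 where e: "f0:grade (Oz U) False" "f1:grade (Oz U) True" "f = f0+[Oz U] f1" using f by(rule decomposeE)
have t: "vf_smult Z U g v:tangent L Z U" if g: "g:grade (Oz U) j" for g j
 unfolding d(3) vf_smult_add_right[OF U gr_car[OF g] der_tan[OF d(1)] der_tan[OF d(2)]]
 by(intro vf_add_tan der_tan[OF vf_smult_der[OF U g d(1)]] der_tan[OF vf_smult_der[OF U g d(2)]])
show ?thesis unfolding e(3) vf_smult_add_left[OF U gr_car[OF e(1)] gr_car[OF e(2)] v] by(intro vf_add_tan t[OF e(1)] t[OF e(2)])
qed

end

section \<open>Charts of an odd submersion\<close>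

lemma odd_monomial_hom:
assumes "ring R" "h:ring_hom R S" "set ths <= C R" "I <= {..<length ths}"
shows "odd_monomial S (map h ths) I = h (odd_monomial R ths I)"
proof -
interpret R: ring R by fact
have "foldr (%i y. ths ! i*[R] y) xs 1[R]:C R & foldr (%i y. map h ths ! i*[S] y) xs 1[S] = h (foldr (%i y. ths ! i*[R] y) xs 1[R])"
 if "set xs <= {..<length ths}" for xs
 using that
proof(induction xs)
 case Nil
 thus ?case using ring_hom_one[OF assms(2)] by simp
next
 case (Cons i xs)
 hence "ths ! i:C R" using assms(3) nth_mem[of i ths] by auto
 with Cons show ?case using ring_hom_mult[OF assms(2)] by simp
qed
moreover have "finite I" using assms(4) finite_subset by blast
ultimately show ?thesis using assms(4) by(simp add: odd_monomial_def)
qed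

locale odd_submersion = purely_odd_submersion L Z W sg + Z: lambda_superspace L Z + W: lambda_superspace L W
for L :: "'l complex_superalgebra" and Z :: "('p, 'l, 'a) superspace" and W :: "('p, 'l, 'b) superspace"
 and sg :: "'p set => 'b => 'a"
begin
abbreviation Lif where "Lif == lifts L Z W sg"
abbreviation Tim where "Tim == tangent_image L Z W sg"
abbreviation Vtan where "Vtan == vertical_tangent L Z W sg"
abbreviation DZ where "DZ == Der L Z"
abbreviation DW where "DW == Der L W"
abbreviation TZ where "TZ == tangent L Z"
abbreviation TW where "TW == tangent L W"


abbreviation opn :: "'p set => bool" where "opn == op_in Z"
abbreviation Oz :: "'p set => 'a superring" where "Oz == fun_ring Z"
abbreviation fl where "fl U == rflip (Oz U)"
abbreviation cO where "cO U == C (Oz U)"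
abbreviation Ow :: "'p set => 'b superring" where "Ow == fun_ring W"
abbreviation cW where "cW U == C (Ow U)"

lemma top_W [simp]: "base_top W = base_top Z" by(rule same_space[symmetric])

context
fixes U assumes U: "opn U"
begin

lemma sg_hom: "sg U:superring_hom (Ow U) (Oz U)" using comorphism_hom U by simp

lemma sg_ring_hom: "sg U:ring_hom (Ow U) (Oz U)" using sg_hom by(simp add: superring_hom_def)

lemma sg_cl [simp]: "b:cW U ==> sg U b:cO U" by(rule ring_hom_closed[OF sg_ring_hom])

lemma sg_add: "b:cW U ==> c:cW U ==> sg U (b+[Ow U] c) = sg U b+[Oz U] sg U c" by(rule ring_hom_add[OF sg_ring_hom])

lemma sg_mult: "b:cW U ==> c:cW U ==> sg U (b*[Ow U] c) = sg U b*[Oz U] sg U c" by(rule ring_hom_mult[OF sg_ring_hom])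

lemma sg_one: "sg U 1[Ow U] = 1[Oz U]" by(rule ring_hom_one[OF sg_ring_hom])

lemma sg_grade: "b:grade (Ow U) i ==> sg U b:grade (Oz U) i" using sg_hom by(auto simp: superring_hom_def)

lemma add_sg: "addmap (Ow U) (Oz U) (sg U)" by(rule addmapI) (simp_all add: sg_add)

lemma superalgebras: "superalgebra (Oz U)" "superalgebra (Ow U)" using Z.O_superalgebra W.O_superalgebra U by simp_all

lemma supercomm: "supercommutative_ring (Oz U)" "supercommutative_ring (Ow U)" using Z.fun_supercomm W.fun_supercomm U by simp_all

lemmas sc = sring.intro[OF supercomm(1)] and scW = sring.intro[OF supercomm(2)]

lemma graded_groups: "gr_ag (Oz U) (grade (Oz U))" "gr_ag (Ow U) (grade (Ow U))" using Z.O_ag(3)[OF U U] W.O_ag(3)[of U U] U by simp_all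

lemma groups: "abelian_group (Oz U)" "abelian_group (Ow U)" using Z.O_ag(1)[OF U U] W.O_ag(1)[of U U] U by simp_all

lemma sg_zero: "sg U 0[Ow U] = 0[Oz U]" by(rule addmap_zero[OF groups(2,1) add_sg])

lemma sg_ksz: "b:cW U ==> sg U (koszul (Ow U) i j b) = koszul (Oz U) i j (sg U b)" by(rule addmap_ksz[OF groups(2,1) add_sg])

lemma sg_minus: "b:cW U ==> c:cW U ==> sg U (b -[Ow U] c) = sg U b -[Oz U] sg U c" by(rule addmap_minus[OF groups(2,1) add_sg])

lemma sg_flip: "b:cW U ==> sg U (rflip (Ow U) i b) = fl U i (sg U b)" by(rule flip_natural[OF graded_groups(2,1) add_sg]) (use sg_grade in auto)

lemma sg_res: "opn V ==> V<=U ==> b:cW U ==> fr Z U V (sg U b) = sg V (fr W U V b)" using comorphism_res U by simp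

end

definition chart :: "'p set => 'a list => bool" where "chart V ths <-> opn V & set ths <= cO V &
  (ALL N. opn N & N<=V --> odd_extension (Oz N) (Ow N) (sg N) (map (fr Z V N) ths))"

lemma c_opn: "chart V ths ==> opn V" by(simp add: chart_def)

lemma chart_ext: "chart V ths ==> opn N ==> N<=V ==> odd_extension (Oz N) (Ow N) (sg N) (map (fr Z V N) ths)" by(simp add: chart_def)

lemma map_res_id: "opn V ==> set ths <= cO V ==> map (fr Z V V) ths = ths" by(induction ths) (auto simp: Z.res_id)

lemma chart_self: "chart V ths ==> odd_extension (Oz V) (Ow V) (sg V) ths" using chart_ext[of V ths V] map_res_id[of V ths] by(simp add: chart_def)

lemma map_res_trans: "opn U ==> opn V ==> opn N ==> N<=V ==> V<=U ==> set ths <= cO U ==>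
 map (fr Z V N) (map (fr Z U V) ths) = map (fr Z U N) ths"
by(induction ths) (auto simp: Z.res_trans)

lemma chart_res: "chart V ths ==> opn N ==> N<=V ==> chart N (map (fr Z V N) ths)" unfolding chart_def
by(intro conjI allI impI) (auto simp: map_res_trans simp del: map_map)

lemma chart_exists:
assumes "opn U" "p:U"
obtains V ths where "chart V ths" "p:V" "V<=U"
proof -
obtain n where n: "ALL p:topspace (base_top W). EX U ths. op_in W U & p:U & length ths = n & set ths <= grade (fun_ring Z U) True &
  (ALL V. op_in W V & V<=U --> inj_on (sg V) (C (fun_ring W V)) & basis_over (fun_ring Z V) (sg V ` C (fun_ring W V)) (Pow {..<n})
     (odd_monomial (fun_ring Z V) (map (fr Z U V) ths)))"
 using odd_fiber_coordinates by blast
have "p:topspace (base_top W)" using assms openin_subset by fastforce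
then obtain U' ths where ths: "opn U'" "p:U'" "length ths = n" "set ths <= grade (Oz U') True"
 and b: "!!V. opn V ==> V<=U' ==> inj_on (sg V) (cW V) & basis_over (Oz V) (sg V ` cW V) (Pow {..<n}) (odd_monomial (Oz V) (map (fr Z U' V) ths))"
 using bspec[OF n] by(metis top_W)
interpret U': gr_ag "Oz U'" "grade (Oz U')" by(rule graded_groups[OF ths(1)])
have tc: "set ths <= C (Oz U')" using ths(4) U'.gr_car by blast
have "chart U' ths" unfolding chart_def
proof(intro conjI allI impI ths(1) tc)
 fix N assume "opn N & N<=U'"
 hence N: "opn N" "N<=U'" by auto
 interpret N: superalgebra "Oz N" by(rule superalgebras[OF N(1)])
 interpret NB: superalgebra "Ow N" by(rule superalgebras[OF N(1)])
 show "odd_extension (Oz N) (Ow N) (sg N) (map (fr Z U' N) ths)"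
 proof unfold_locales
  show "sg N:superring_hom (Ow N) (Oz N)" by(rule sg_hom[OF N(1)])
  show "inj_on (sg N) (cW N)" using b[OF N] by blast
  show "set (map (fr Z U' N) ths) <= grade (Oz N) True" using ths(4) Z.res_grade[OF ths(1) N] by auto
  show "basis_over (Oz N) (sg N ` cW N) (Pow {..<length (map (fr Z U' N) ths)}) (odd_monomial (Oz N) (map (fr Z U' N) ths))"
   using b[OF N] ths(3) by simp
 qed
qed
hence "chart (U Int U') (map (fr Z U' (U Int U')) ths)" using chart_res assms ths(1) by(metis inf_le2 openin_Int)
thus ?thesis using that assms ths by blast
qed

abbreviation mon :: "'p set => 'a list => nat set => 'a" where "mon V == odd_monomial (Oz V)"

lemma mon_res:
assumes "chart V ths" "opn N" "N<=V" "I:set (mons (length ths))"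
shows "mon N (map (fr Z V N) ths) I = fr Z V N (mon V ths I)"
proof -
interpret V: sring "Oz V" by(rule sc[OF c_opn[OF assms(1)]])
show ?thesis by(rule odd_monomial_hom[OF V.ring_axioms Z.res_ring_hom[OF c_opn[OF assms(1)] assms(2,3)]])
  (use assms in \<open>auto simp: chart_def set_mons\<close>)
qed

abbreviation coef :: "'p set => 'a list => 'a => nat set => 'b" where "coef V ths == odd_extension.rc (Oz V) (Ow V) (sg V) ths"

lemma coef_res:
assumes V: "chart V ths" and N: "opn N" "N<=V" and a: "a:cO V" and I: "I:set (mons (length ths))"
shows "coef N (map (fr Z V N) ths) (fr Z V N a) I = fr W V N (coef V ths a I)"
proof -
note oV = c_opn[OF V]
interpret N: odd_extension "Oz N" "Ow N" "sg N" "map (fr Z V N) ths" by(rule chart_ext[OF V N])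
interpret V: odd_extension "Oz V" "Ow V" "sg V" ths by(rule chart_self[OF V])
show ?thesis
proof(rule N.rc_unique)
 show "fr W V N (coef V ths a I):cW N" for I using W.res_closed[of V N] V.rc_cl[OF a] oV N by simp
 have "fr Z V N a = fr Z V N (lsum (Oz V) (%I. mon V ths I*[Oz V] sg V (coef V ths a I)) (mons (length ths)))" using V.rc_expand[OF a] by simp
 also have "... = lsum (Oz N) (%I. fr Z V N (mon V ths I*[Oz V] sg V (coef V ths a I))) (mons (length ths))"
  by(rule addmap_lsum[OF groups(1)[OF oV] groups(1)[OF N(1)] Z.additive_res[OF oV N]]) (use V.rc_cl[OF a] in auto)
 also have "... = lsum (Oz N) (%I. mon N (map (fr Z V N) ths) I*[Oz N] sg N (fr W V N (coef V ths a I))) (mons (length ths))" by(rule lsum_cong)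
   (use V.rc_cl[OF a] in \<open>auto simp: Z.res_mult[OF oV N] mon_res[OF V N] sg_res[OF oV N]\<close>)
 finally show "fr Z V N a = lsum (Oz N) (%I. mon N (map (fr Z V N) ths) I*[Oz N] sg N (fr W V N (coef V ths a I)))
    (mons (length (map (fr Z V N) ths)))" by simp
qed (use I in simp)
qed

section \<open>Vector fields on a chart\<close>

lemma vf_eq_on_chart:
assumes V: "chart V ths" and v: "v:DZ V i" "w:DZ V i"
 and base: "!!N b. opn N ==> N<=V ==> b:cW N ==> v N (sg N b) = w N (sg N b)"
 and odd: "!!k. k < length ths ==> v V (ths ! k) = w V (ths ! k)"
shows "v = w"
proof(rule Z.vf_eqI[OF Z.vf_on_der[OF v(1)] Z.vf_on_der[OF v(2)]])
fix N f assume N: "opn N" "N<=V" and f: "f:cO N"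
interpret N: odd_extension "Oz N" "Ow N" "sg N" "map (fr Z V N) ths" by(rule chart_ext[OF V N])
note oV = c_opn[OF V]
show "v N f = w N f"
proof(rule N.generated_induct[OF _ _ _ _ f])
 show "v N (sg N b) = w N (sg N b)" if "b:cW N" for b by(rule base[OF N that])
 show "v N (map (fr Z V N) ths ! k) = w N (map (fr Z V N) ths ! k)" if "k < length (map (fr Z V N) ths)" for k
 proof -
  have k: "k < length ths" "ths ! k:cO V" using that V nth_mem[of k ths] by(auto simp: chart_def)
  show ?thesis using Z.der_res[OF v(1) oV le N k(2)] Z.der_res[OF v(2) oV le N k(2)] odd[OF k(1)] k(1) by simp
 qed
 show "v N (x+[Oz N] y) = w N (x+[Oz N] y)" "v N (x*[Oz N] y) = w N (x*[Oz N] y)" if "x:cO N" "y:cO N" "v N x = w N x" "v N y = w N y" for x y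
  using that by(simp_all add: Z.der_add[OF v(1) N] Z.der_add[OF v(2) N] Z.der_mult[OF v(1) N] Z.der_mult[OF v(2) N])
qed
qed

text \<open>The extensions over the open subsets of the chart commute with restriction, as both sides are
  determined by their values on generators; so they form a vector field.\<close>

lemma der_on_chart:
assumes V: "chart V ths"
 and w: "!!N. opn N ==> N<=V ==> addmap (Ow N) (Oz N) (w N)"
 and w_grade: "!!N j b. opn N ==> N<=V ==> b:grade (Ow N) j ==> w N b:grade (Oz N) (i ~= j)"
 and w_mult: "!!N b c. opn N ==> N<=V ==> b:cW N ==> c:cW N ==> w N (b*[Ow N] c) = w N b*[Oz N] sg N c+[Oz N] fl N i (sg N b)*[Oz N] w N c"
 and w_scalar: "!!N x. opn N ==> N<=V ==> x:C L ==> w N (scalar W N x) = 0[Oz N]"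
 and w_res: "!!N M b. opn N ==> N<=V ==> opn M ==> M<=N ==> b:cW N ==> fr Z N M (w N b) = w M (fr W N M b)"
 and t: "!!k. k < length ths ==> t k:grade (Oz V) (i ~= True)"
shows "EX D:DZ V i. (ALL N b. opn N & N<=V & b:cW N --> D N (sg N b) = w N b) & (ALL k<length ths. D V (ths ! k) = t k)"
proof -
note oV = c_opn[OF V]
have tc: "set ths <= cO V" using V by(simp add: chart_def)
have "EX D. superder (Oz N) (cO N) i D & (ALL b:cW N. D (sg N b) = w N b) &
 (ALL k<length ths. D (fr Z V N (ths ! k)) = fr Z V N (t k))" if N: "opn N" "N<=V" for N
proof -
 interpret N: odd_extension "Oz N" "Ow N" "sg N" "map (fr Z V N) ths" by(rule chart_ext[OF V N])
 have "EX D. superder (Oz N) (cO N) i D & (ALL b:cW N. D (sg N b) = w N b) &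
  (ALL k<length (map (fr Z V N) ths). D (map (fr Z V N) ths ! k) = fr Z V N (t k))"
 proof(rule N.extend_to_ring[OF w[OF N] w_mult[OF N]])
  show "w N (rflip (Ow N) True b) = koszul (Oz N) i True (fl N True (w N b))" if "b:cW N" for b
   by(rule parity_map_flip[OF graded_groups(2,1)[OF N(1) ] _ _ that]) (use w[OF N] w_grade[OF N] N(1) in blast)+
  show "fr Z V N (t k):grade (Oz N) (i ~= True)" if "k < length (map (fr Z V N) ths)" for k using Z.res_grade[OF oV N t] that by simp
 qed
 thus ?thesis by simp
qed
then obtain D where D: "!!N. opn N ==> N<=V ==> superder (Oz N) (cO N) i (D N)" "!!N b. opn N ==> N<=V ==> b:cW N ==> D N (sg N b) = w N b"
 "!!N k. opn N ==> N<=V ==> k < length ths ==> D N (fr Z V N (ths ! k)) = fr Z V N (t k)"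
 by metis
have Dc: "D N f:cO N" if "opn N" "N<=V" "f:cO N" for N f using D(1)[OF that(1,2)] that(3) by(auto simp: superder_def)
have Dadd: "addmap (Oz N) (Oz N) (D N)" if "opn N" "N<=V" for N using D(1)[OF that] by(auto simp: superder_def addmap_def)
have Dmult: "D N (f*[Oz N] g) = D N f*[Oz N] g+[Oz N] fl N i f*[Oz N] D N g" if "opn N" "N<=V" "f:cO N" "g:cO N" for N f g
 using D(1)[OF that(1,2)] that(3,4) by(auto simp: superder_def)
have "vf_mk Z V D:DZ V i"
proof(rule Z.dersI)
 fix N assume N: "opn N" "N<=V"
 interpret N: odd_extension "Oz N" "Ow N" "sg N" "map (fr Z V N) ths" by(rule chart_ext[OF V N])
 show "addmap (Oz N) (Oz N) (D N)" by(rule Dadd[OF N])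
 show "D N f:grade (Oz N) (i ~= j)" if f: "f:grade (Oz N) j" for f j
 proof -
  note fc = N.gr_car[OF f]
  have "fl N True (D N f) = koszul (Oz N) i True (D N (fl N True f))" using D(1)[OF N] fc Dc[OF N fc] N.minus_minus
   by(auto simp: superder_def koszul_def)
  also have "... = koszul (Oz N) (i ~= j) True (D N f)"
   using f fc Dc[OF N fc] N.minus_minus addmap_ksz[OF groups(1)[OF N(1)] groups(1)[OF N(1)] Dadd[OF N] fc, of True j]
   by(cases i; cases j) (simp_all add: N.flip_homog koszul_def)
  finally show ?thesis using N.grade_iff_flip[OF Dc[OF N fc]] by blast
 qed
 show "D N (f*[Oz N] g) = D N f*[Oz N] g+[Oz N] fl N i f*[Oz N] D N g" if "f:cO N" "g:cO N" for f g by(rule Dmult[OF N that])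
 show "D N (scalar Z N x) = 0[Oz N]" if x: "x:C L" for x
 proof -
  have "scalar W N x:cW N" using W.scalar_hom[of N] N(1) x ring_hom_closed[of "scalar W N" L "Ow N" x] by(simp add: superring_hom_def)
  thus ?thesis using D(2)[OF N, of "scalar W N x"] w_scalar[OF N x] comorphism_scalar[of N x] x N(1) by simp
 qed
 fix M f assume M: "opn M" "M<=N" and f: "f:cO N"
 hence MV: "M<=V" using N by blast
 interpret M: sring "Oz M" by(rule sc[OF M(1)])
 show "fr Z N M (D N f) = D M (fr Z N M f)"
 proof(rule N.generated_induct[OF _ _ _ _ f])
  show "fr Z N M (D N (sg N b)) = D M (fr Z N M (sg N b))" if "b:cW N" for b
   using D(2)[OF N that] D(2)[OF M(1) MV, of "fr W N M b"] w_res[OF N M that] sg_res[OF N(1) M that] W.res_closed[of N M b] N(1) M that by simp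
  show "fr Z N M (D N (map (fr Z V N) ths ! k)) = D M (fr Z N M (map (fr Z V N) ths ! k))" if "k < length (map (fr Z V N) ths)" for k
  proof -
   have k: "k < length ths" "ths ! k:cO V" using that tc nth_mem[of k ths] by auto
   have "t k:cO V" using t[OF k(1)] gr_ag.gr_car[OF graded_groups(1)[OF oV]] by blast
   thus ?thesis using k D(3)[OF N k(1)] D(3)[OF M(1) MV k(1)] Z.res_trans[OF oV N(1) M(1) M(2) N(2)] by simp
  qed
  show "fr Z N M (D N (x+[Oz N] y)) = D M (fr Z N M (x+[Oz N] y))" "fr Z N M (D N (x*[Oz N] y)) = D M (fr Z N M (x*[Oz N] y))"
   if "x:cO N" "y:cO N" "fr Z N M (D N x) = D M (fr Z N M x)" "fr Z N M (D N y) = D M (fr Z N M y)" for x y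
   using that Dc[OF N that(1)] Dc[OF N that(2)]
   by(simp_all add: Z.res_add[OF N(1) M] Z.res_mult[OF N(1) M] Z.res_flip[OF N(1) M]
     addmap_add[OF Dadd[OF N]] addmap_add[OF Dadd[OF M(1) MV]] Dmult[OF N] Dmult[OF M(1) MV]
     Z.res_closed[OF N(1) M])
 qed
qed
moreover have "vf_mk Z V D N (sg N b) = w N b" if "opn N" "N<=V" "b:cW N" for N b using that D(2) by(simp add: Z.vf_mk_app)
moreover have "vf_mk Z V D V (ths ! k) = t k" if k: "k < length ths" for k
proof -
 have k': "ths ! k:cO V" "t k:cO V" using k tc nth_mem[of k ths] t[OF k] gr_ag.gr_car[OF graded_groups(1)[OF oV]] by auto
 thus ?thesis using D(3)[OF oV le k] oV by(simp add: Z.vf_mk_app Z.res_id)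
qed
ultimately show ?thesis by blast
qed

text \<open>The odd partial derivatives of a chart.\<close>

lemma partials_exist:
assumes V: "chart V ths"
shows "EX d. ALL k<length ths. d k:DZ V True & (ALL N b. opn N & N<=V & b:cW N --> d k N (sg N b) = 0[Oz N]) &
 (ALL j<length ths. d k V (ths ! j) = (if j = k then 1[Oz V] else 0[Oz V]))"
proof -
have "EX D:DZ V True. (ALL N b. opn N & N<=V & b:cW N --> D N (sg N b) = 0[Oz N]) &
 (ALL j<length ths. D V (ths ! j) = (if j = k then 1[Oz V] else 0[Oz V]))" for k
proof(rule der_on_chart[OF V])
 fix N assume N: "opn N" "N<=V"
 interpret N: sring "Oz N" by(rule sc[OF N(1)])
 show "addmap (Ow N) (Oz N) (%b. 0[Oz N])" by(rule addmapI) auto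
 show "0[Oz N]:grade (Oz N) j" for j by simp
 show "0[Oz N] = 0[Oz N]*[Oz N] sg N c+[Oz N] fl N True (sg N b)*[Oz N] 0[Oz N]" if "b:cW N" "c:cW N" for b c using that N by simp
 show "fr Z N M 0[Oz N] = 0[Oz M]" if "opn M" "M<=N" for M by(rule Z.res_zero[OF N(1) that])
next
 interpret V: sring "Oz V" by(rule sc[OF c_opn[OF V]])
 show "(if j = k then 1[Oz V] else 0[Oz V]):grade (Oz V) (True ~= True)" for j using V.one_even by simp
qed auto
thus ?thesis by metis
qed

lemma lift_exists:
assumes V: "chart V ths" and w: "w:DW V i"
shows "EX v:DZ V i. ALL N b. opn N & N<=V & b:cW N --> v N (sg N b) = sg N (w N b)"
proof -
have "EX D:DZ V i. (ALL N b. opn N & N<=V & b:cW N --> D N (sg N b) = sg N (w N b)) & (ALL k<length ths. D V (ths ! k) = 0[Oz V])"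
proof(rule der_on_chart[OF V])
 fix N assume N: "opn N" "N<=V"
 hence N': "op_in W N" by simp
 interpret N: sring "Oz N" by(rule sc[OF N(1)])
 interpret NB: sring "Ow N" by(rule scW[OF N(1)])
 note c = W.der_cl[OF w N' N(2)]
 show "addmap (Ow N) (Oz N) (%b. sg N (w N b))" by(rule addmap_comp[OF W.der_additive[OF w N' N(2)] add_sg[OF N(1)]])
 show "sg N (w N b):grade (Oz N) (i ~= j)" if "b:grade (Ow N) j" for b j by(rule sg_grade[OF N(1) W.der_grade[OF w N' N(2) that]])
 show "sg N (w N (b*[Ow N] c)) = sg N (w N b)*[Oz N] sg N c+[Oz N] fl N i (sg N b)*[Oz N] sg N (w N c)" if "b:cW N" "c:cW N" for b c
  using that c by(simp add: W.der_mult[OF w N' N(2)] sg_add[OF N(1)] sg_mult[OF N(1)] sg_flip[OF N(1)])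
 show "sg N (w N (scalar W N x)) = 0[Oz N]" if "x:C L" for x using that by(simp add: W.der_scalar[OF w N' N(2)] sg_zero[OF N(1)])
 show "fr Z N M (sg N (w N b)) = sg M (w M (fr W N M b))" if "opn M" "M<=N" "b:cW N" for M b
  using that c W.der_res[OF w N' N(2), of M b] by(simp add: sg_res[OF N(1)])
next
 interpret V: sring "Oz V" by(rule sc[OF c_opn[OF V]])
 show "0[Oz V]:grade (Oz V) (i ~= True)" by simp
qed
thus ?thesis by blast
qed

end

section \<open>Gluing\<close>

context set_sheaf
begin

lemma local_eq:
assumes U: "openin X U" and st: "s:S U" "t:S U"
 and loc: "!!p. p:U ==> EX V. openin X V & p:V & V<=U & r U V s = r U V t"
shows "s = t"
proof -
define Vt where "Vt = {V. openin X V & V<=U & r U V s = r U V t}"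
have un: "\<Union>Vt = U" using loc by(auto simp: Vt_def)
have "EX! x. x:S (\<Union>Vt) & (ALL V:Vt. r (\<Union>Vt) V x = r U V s)"
proof(rule glue)
 fix V N assume VN: "V:Vt" "N:Vt"
 hence o: "openin X V" "openin X N" "V<=U" "N<=U" by(auto simp: Vt_def)
 show "r V (V Int N) (r U V s) = r N (V Int N) (r U N s)" using res_trans[OF U o(1) openin_Int[OF o(1,2)] Int_lower1 o(3) st(1)]
   res_trans[OF U o(2) openin_Int[OF o(1,2)] Int_lower2 o(4) st(1)] by simp
qed (use U st res_closed in \<open>auto simp: Vt_def\<close>)
thus ?thesis unfolding un using st by(auto simp: Vt_def)
qed

text \<open>Uniqueness makes local solutions of \<open>P\<close> agree on overlaps, so they glue.\<close>

lemma glue_local: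
assumes U: "openin X U"
 and cover: "!!p. p:U ==> EX V s. openin X V & p:V & V<=U & s:S V & P V s"
 and stable: "!!V N s. openin X V ==> openin X N ==> N<=V ==> V<=U ==> s:S V ==> P V s ==> P N (r V N s)"
 and unique: "!!V s t. openin X V ==> V<=U ==> s:S V ==> t:S V ==> P V s ==> P V t ==> s = t"
obtains s where "s:S U" "!!V t. openin X V ==> V<=U ==> t:S V ==> P V t ==> r U V s = t"
proof -
define Vt where "Vt = {V. openin X V & V<=U & (EX s:S V. P V s)}"
define f where "f V = (SOME s. s:S V & P V s)" for V
have f: "f V:S V & P V (f V)" if "V:Vt" for V using that someI_ex[of "%s. s:S V & P V s"] by(auto simp: Vt_def f_def)
have un: "\<Union>Vt = U"
proof
 show "\<Union>Vt <= U" by(auto simp: Vt_def)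
 show "U <= \<Union>Vt"
 proof
  fix p assume "p:U"
  from cover[OF this] obtain V s where "openin X V & p:V & V<=U & s:S V & P V s" by(elim exE)
  thus "p:\<Union>Vt" by(auto simp: Vt_def)
 qed
qed
have "EX! x. x:S (\<Union>Vt) & (ALL V:Vt. r (\<Union>Vt) V x = f V)"
proof(rule glue)
 fix V N assume VN: "V:Vt" "N:Vt"
 hence o: "openin X V" "openin X N" "openin X (V Int N)" "V<=U" "N<=U" by(auto simp: Vt_def)
 show "r V (V Int N) (f V) = r N (V Int N) (f N)"
 proof(rule unique[OF o(3)])
  show "V Int N<=U" using o by blast
  show "r V (V Int N) (f V):S (V Int N)" "r N (V Int N) (f N):S (V Int N)" using o f[OF VN(1)] f[OF VN(2)] res_closed by auto
  show "P (V Int N) (r V (V Int N) (f V))" "P (V Int N) (r N (V Int N) (f N))"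
   using stable[OF o(1,3)] stable[OF o(2,3)] o f[OF VN(1)] f[OF VN(2)] by auto
 qed
qed (use f in \<open>auto simp: Vt_def\<close>)
then obtain x where x: "x:S U" "ALL V:Vt. r U V x = f V" unfolding un by blast
show ?thesis
proof(rule that[OF x(1)])
 fix V t assume t: "openin X V" "V<=U" "t:S V" "P V t"
 hence "V:Vt" by(auto simp: Vt_def)
 thus "r U V x = t" using x(2) f unique[OF t(1,2) _ t(3) _ t(4)] by auto
qed
qed

end

section \<open>Modules with connection\<close>

context lambda_superspace
begin

definition vf_zero :: "'p set => ('p, 'a) vfield" where "vf_zero U = vf_mk Z U (%V f. 0[Oz V])"

lemma vf_zero_der: "vf_zero U:Der L Z U i" unfolding vf_zero_def by(rule zero_der)

lemma vf_zero_app: "opn V ==> V<=U ==> f:cO V ==> vf_zero U V f = 0[Oz V]" by(simp add: vf_zero_def vf_mk_app)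

lemma vf_on_zero [simp]: "vf_on U (vf_zero U)" by(simp add: vf_zero_def)

definition vf_sum :: "'p set => ('i => 'a) => ('i => ('p, 'a) vfield) => 'i list => ('p, 'a) vfield" where
"vf_sum U g e ks = foldr (%k u. vf_add Z U (vf_smult Z U (g k) (e k)) u) ks (vf_zero U)"

lemma vf_sum_simps [simp]: "vf_sum U g e [] = vf_zero U" "vf_sum U g e (k # ks) = vf_add Z U (vf_smult Z U (g k) (e k)) (vf_sum U g e ks)"
by(simp_all add: vf_sum_def)

lemma vf_on_sum [simp]: "vf_on U (vf_sum U g e ks)" by(cases ks) auto

lemma vf_sum_tan: "opn U ==> (!!k. k:set ks ==> g k:cO U & e k:tangent L Z U) ==> vf_sum U g e ks:tangent L Z U"
by(induction ks) (auto intro!: vf_add_tan vf_smult_tan der_tan[OF vf_zero_der])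

lemma vf_sum_der:
assumes "opn U"
shows "(!!k. k:set ks ==> EX q. g k:grade (Oz U) q & e k:Der L Z U (i ~= q)) ==> vf_sum U g e ks:Der L Z U i"
proof(induction ks)
case Nil
thus ?case by(simp add: vf_zero_der)
next
case (Cons k ks)
obtain q where q: "g k:grade (Oz U) q" "e k:Der L Z U (i ~= q)" using Cons.prems[of k] by auto
have "vf_smult Z U (g k) (e k):Der L Z U i" using vf_smult_der[OF assms q] by(cases i; cases q) simp_all
thus ?case using Cons by(auto intro: vf_add_der)
qed

lemma vf_sum_app:
assumes "opn V" "V<=U" "f:cO V"
shows "vf_sum U g e ks V f = lsum (Oz V) (%k. fr Z U V (g k)*[Oz V] e k V f) ks"
by(induction ks) (use assms in \<open>simp_all add: vf_zero_app vf_add_app vf_smult_app\<close>)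

end

locale dmod = lambda_superspace L Z + D_module L Z F
for L :: "'l complex_superalgebra" and Z :: "('p, 'l, 'a) superspace" and F :: "('p, 'a, 'm) dmodule"
begin

abbreviation Fs :: "'p set => ('a, 'm) supermodule" where "Fs == Sec F"
abbreviation cF where "cF U == C (Fs U)"

lemma M_ag: "opn U ==> abelian_group (Fs U)" using mod_sections left_supermodule.axioms by blast

lemma M_graded: "opn U ==> gr_ag (Fs U) (mg (Fs U))" by(simp add: M_ag gr_ag.intro gr_ag_axioms.intro left_supermodule.mgraded[OF mod_sections])

lemma mres_cl [simp]: "opn U ==> opn V ==> V<=U ==> s:cF U ==> mr F U V s:cF V" using set_sheaf.res_closed[OF mod_sheaf] .

lemma mres_id: "opn U ==> s:cF U ==> mr F U U s = s" using set_sheaf.res_id[OF mod_sheaf] .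

lemma mres_trans: "opn U ==> opn V ==> opn N ==> N<=V ==> V<=U ==> s:cF U ==> mr F V N (mr F U V s) = mr F U N s"
using set_sheaf.res_trans[OF mod_sheaf] .

lemma add_mres: "opn U ==> opn V ==> V<=U ==> addmap (Fs U) (Fs V) (mr F U V)" by(rule addmapI) (simp_all add: mod_res_add)

lemma mres_zero: "opn U ==> opn V ==> V<=U ==> mr F U V 0[Fs U] = 0[Fs V]" by(rule addmap_zero[OF M_ag M_ag add_mres])

lemma mres_minus: "opn U ==> opn V ==> V<=U ==> s:cF U ==> t:cF U ==> mr F U V (s -[Fs U] t) = mr F U V s -[Fs V] mr F U V t"
by(rule addmap_minus[OF M_ag M_ag add_mres])

lemma mres_hpart: "opn U ==> opn V ==> V<=U ==> s:cF U ==> mr F U V (hpart (Fs U) (mg (Fs U)) i s) = hpart (Fs V) (mg (Fs V)) i (mr F U V s)"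
by(rule hpart_natural[OF M_graded M_graded add_mres mod_res_grade])

lemma mres_lsum: "opn U ==> opn V ==> V<=U ==> (!!x. x:set xs ==> f x:cF U) ==> mr F U V (lsum (Fs U) f xs) = lsum (Fs V) (%x. mr F U V (f x)) xs"
by(rule addmap_lsum[OF M_ag M_ag add_mres])

lemma mlocal_eq:
assumes "opn U" "s:cF U" "t:cF U" "!!p. p:U ==> EX V. opn V & p:V & V<=U & mr F U V s = mr F U V t"
shows "s = t"
using set_sheaf.local_eq[OF mod_sheaf] assms by blast

lemma mlocal_grade:
assumes "opn U" "s:cF U" "!!p. p:U ==> EX V. opn V & p:V & V<=U & mr F U V s:mg (Fs V) i"
shows "s:mg (Fs U) i"
proof -
interpret U: gr_ag "Fs U" "mg (Fs U)" by(rule M_graded[OF assms(1)])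
have "hpart (Fs U) (mg (Fs U)) i s = s"
proof(rule mlocal_eq[OF assms(1)])
 fix p assume "p:U"
 then obtain V where V: "opn V" "p:V" "V<=U" "mr F U V s:mg (Fs V) i" using assms(3) by blast
 interpret V: gr_ag "Fs V" "mg (Fs V)" by(rule M_graded[OF V(1)])
 show "EX V. opn V & p:V & V<=U & mr F U V (hpart (Fs U) (mg (Fs U)) i s) = mr F U V s"
  using V assms by(intro exI[of _ V]) (simp add: mres_hpart V.hpart_homog)
qed (use assms in auto)
thus ?thesis using U.hpart_in[OF assms(2)] by metis
qed

context
fixes U v assumes U: "opn U" and v: "v:tangent L Z U"
begin

lemma add_nabla: "addmap (Fs U) (Fs U) (nabla F U v)" by(rule addmapI) (simp_all add: nabla_closed[OF U v] nabla_add[OF U v])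

lemma nabla_zero: "nabla F U v 0[Fs U] = 0[Fs U]" by(rule addmap_zero[OF M_ag[OF U] M_ag[OF U] add_nabla])

lemma nabla_minus: "s:cF U ==> t:cF U ==> nabla F U v (s -[Fs U] t) = nabla F U v s -[Fs U] nabla F U v t"
by(rule addmap_minus[OF M_ag[OF U] M_ag[OF U] add_nabla])

lemma nabla_neg: "s:cF U ==> nabla F U v (-[Fs U] s) = -[Fs U] nabla F U v s" by(rule addmap_neg[OF M_ag[OF U] M_ag[OF U] add_nabla])

end

lemma nabla_vf_zero: "opn U ==> s:cF U ==> nabla F U (vf_zero U) s = 0[Fs U]"
proof -
assume U: "opn U" and s: "s:cF U"
interpret M: abelian_group "Fs U" by(rule M_ag[OF U])
note z = der_tan[OF vf_zero_der[of U False]]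
have "vf_add Z U (vf_zero U) (vf_zero U) = vf_zero U"
proof(rule vf_eqI)
 fix V f assume V: "opn V" "V<=U" "f:cO V"
 interpret sring "Oz V" by(rule fun_sring[OF V(1)])
 show "vf_add Z U (vf_zero U) (vf_zero U) V f = vf_zero U V f" using V by(simp add: vf_add_app vf_zero_app)
qed auto
hence "nabla F U (vf_zero U) s+[Fs U] nabla F U (vf_zero U) s = nabla F U (vf_zero U) s" using nabla_vf_add[OF U z z s] by simp
thus ?thesis using nabla_closed[OF U z s] by(intro M.add_self_cancel) auto
qed

lemma nabla_vf_sum:
assumes U: "opn U" and s: "s:cF U"
shows "(!!k. k:set ks ==> g k:cO U & e k:tangent L Z U) ==> nabla F U (vf_sum U g e ks) s = lsum (Fs U) (%k. g k.*[Fs U] nabla F U (e k) s) ks"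
proof(induction ks)
case Nil
thus ?case using nabla_vf_zero[OF U s] by simp
next
case (Cons k ks)
thus ?case using nabla_vf_add[OF U vf_smult_tan[OF U, of "g k" "e k"] vf_sum_tan[OF U, of ks g e] s]
  nabla_vf_smult[OF U _ _ s, of "g k" "e k"] by simp
qed

lemma nabla_Leib_flip:
assumes U: "opn U" and v: "v:Der L Z U i" and f: "f:cO U" and s: "s:cF U"
shows "nabla F U v (f.*[Fs U] s) = v U f.*[Fs U] s+[Fs U] fl U i f.*[Fs U] nabla F U v s"
proof -
interpret left_supermodule "Oz U" "Fs U" by(rule mod_sections[OF U])
note vt = der_tan[OF v]
note n = nabla_closed[OF U vt s]
show ?thesis
proof(rule R.addmap_ext[where x = f and N = "Fs U"])
 show "addmap (Oz U) (Fs U) (%f. nabla F U v (f.*[Fs U] s))" by(rule addmap_comp[OF add_smult_left[OF s] add_nabla[OF U vt]])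
 show "addmap (Oz U) (Fs U) (%f. v U f.*[Fs U] s+[Fs U] fl U i f.*[Fs U] nabla F U v s)" using s n U der_cl[OF v U le] der_add[OF v U le]
  by(intro addmapI) (simp_all add: smult_closed smult_l_distr R.flip_add M.a_ac)
 show "nabla F U v (f.*[Fs U] s) = v U f.*[Fs U] s+[Fs U] fl U i f.*[Fs U] nabla F U v s" if "f:grade (Oz U) j" for j f
  using nabla_Leibniz[OF U v that s] that n
  by(simp add: R.flip_homog smult_ksz R.gr_car)
qed fact
qed

lemma nabla_hpart_zero:
assumes U: "opn U" and v: "v:Der L Z U i" and s: "s:cF U" and 0: "nabla F U v s = 0[Fs U]"
shows "nabla F U v (hpart (Fs U) (mg (Fs U)) j s) = 0[Fs U]"
proof -
interpret M: gr_ag "Fs U" "mg (Fs U)" by(rule M_graded[OF U])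
let ?h = "%j. hpart (Fs U) (mg (Fs U)) j s"
note vt = der_tan[OF v]
have g: "nabla F U v (?h j):mg (Fs U) (i ~= j)" for j using nabla_grade[OF U v, of j] M.hpart_in[OF s] by blast
have "nabla F U v (?h False)+[Fs U] nabla F U v (?h True) = 0[Fs U]"
 using nabla_add[OF U vt, of "?h False" "?h True"] M.hpart_decompose[OF s] s 0 by simp
thus ?thesis using M.gr_sum_zero'[of "nabla F U v (?h False)" i "nabla F U v (?h True)"] g[of False] g[of True] by(cases j) auto
qed

end

context odd_submersion
begin

section \<open>Lifts and images of vector fields\<close>

lemma liftsD:
assumes "v:Lif U w"
shows "v:TZ U" "opn V ==> V<=U ==> b:cW V ==> v V (sg V b) = sg V (w V b)"
using assms by(auto simp: lifts_def)

lemma vertical_iff_lifts: "v:Vtan U <-> v:Lif U (W.vf_zero U)"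
unfolding vertical_tangent_def lifts_def by(auto simp: W.vf_zero_app sg_zero)

lemma lift_parts:
assumes v: "vf_add Z U v0 v1:Lif U (vf_add W U w0 w1)"
 and d: "v0:DZ U False" "v1:DZ U True" "w0:DW U False" "w1:DW U True"
shows "v0:Lif U w0" "v1:Lif U w1"
proof -
have *: "v0 V (sg V b) = sg V (w0 V b) & v1 V (sg V b) = sg V (w1 V b)" if V: "opn V" "V<=U" and b: "b:cW V" for V b
proof -
 interpret V: sring "Oz V" by(rule sc[OF V(1)])
 interpret B: sring "Ow V" by(rule scW[OF V(1)])
 have VW: "op_in W V" using V by simp
 note A = addmap_comp[OF add_sg[OF V(1)] Z.der_additive[OF d(1) V]] addmap_comp[OF add_sg[OF V(1)] Z.der_additive[OF d(2) V]]
  addmap_comp[OF W.der_additive[OF d(3) VW V(2)] add_sg[OF V(1)]]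
  addmap_comp[OF W.der_additive[OF d(4) VW V(2)] add_sg[OF V(1)]]
 have "v0 V (sg V b) = sg V (w0 V b) & v1 V (sg V b) = sg V (w1 V b)" if b: "b:grade (Ow V) j" for j b
 proof -
  note bc = B.gr_car[OF b] and sb = sg_grade[OF V(1) b]
  note g = Z.der_grade[OF d(1) V sb] Z.der_grade[OF d(2) V sb]
   sg_grade[OF V(1) W.der_grade[OF d(3) VW V(2) b]] sg_grade[OF V(1) W.der_grade[OF d(4) VW V(2) b]]
  note c = g[THEN V.gr_car]
  have eq: "v0 V (sg V b)+[Oz V] v1 V (sg V b) = sg V (w0 V b)+[Oz V] sg V (w1 V b)"
   using liftsD(2)[OF v V bc] V VW bc W.der_cl[OF d(3) VW V(2) bc] W.der_cl[OF d(4) VW V(2) bc]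
   by(simp add: Z.vf_add_app W.vf_add_app sg_add)
  have "(v0 V (sg V b) -[Oz V] sg V (w0 V b))+[Oz V] (v1 V (sg V b) -[Oz V] sg V (w1 V b)) =
    (v0 V (sg V b)+[Oz V] v1 V (sg V b)) -[Oz V] (sg V (w0 V b)+[Oz V] sg V (w1 V b))"
   using c by algebra
  also have "... = 0[Oz V]" unfolding eq using c by simp
  finally have "v0 V (sg V b) -[Oz V] sg V (w0 V b) = 0[Oz V]" "v1 V (sg V b) -[Oz V] sg V (w1 V b) = 0[Oz V]"
   using V.gr_sum_zero'[of "v0 V (sg V b) -[Oz V] sg V (w0 V b)" j "v1 V (sg V b) -[Oz V] sg V (w1 V b)"] g V.gr_minus
   by auto
  thus ?thesis using V.minus_zero_imp_eq c by blast
 qed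
 thus ?thesis using B.addmap_ext[OF A(1,3) _ b] B.addmap_ext[OF A(2,4) _ b] by blast
qed
thus "v0:Lif U w0" "v1:Lif U w1" using Z.der_tan d unfolding lifts_def by auto
qed

lemma vertical_parts:
assumes "vf_add Z U v0 v1:Vtan U" "v0:DZ U False" "v1:DZ U True"
shows "v0:Vtan U" "v1:Vtan U"
proof -
have z: "vf_add W U (W.vf_zero U) (W.vf_zero U) = W.vf_zero U"
proof(rule W.vf_eqI)
 fix V f assume V: "op_in W V" "V<=U" "f:cW V"
 interpret supercommutative_ring "Ow V" by(rule W.fun_supercomm[OF V(1)])
 show "vf_add W U (W.vf_zero U) (W.vf_zero U) V f = W.vf_zero U V f" using V by(simp add: W.vf_add_app W.vf_zero_app)
qed auto
show "v0:Vtan U" "v1:Vtan U" using lift_parts[of U v0 v1 "W.vf_zero U" "W.vf_zero U"] assms W.vf_zero_der unfolding vertical_iff_lifts z by blast+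
qed

lemma lifts_res:
assumes "v:Lif U w" "opn V" "V<=U"
shows "vf_res Z V v:Lif V w"
unfolding lifts_def
using Z.tan_res[OF liftsD(1)[OF assms(1)] assms(2,3)] liftsD(2)[OF assms(1)] assms(2,3)
by(auto simp: Z.vf_res_app)

lemma vertical_res:
assumes "v:Vtan U" "opn V" "V<=U"
shows "vf_res Z V v:Vtan V"
using assms Z.tan_res unfolding vertical_tangent_def
by(auto simp: Z.vf_res_app)

lemma tan_lift_exists:
assumes V: "chart V ths" and w: "w:TW U" and VU: "V<=U"
shows "Lif V w ~= {}"
proof -
note oV = c_opn[OF V]
obtain w0 w1 where d: "w0:DW U False" "w1:DW U True" "w = vf_add W U w0 w1" using w by(rule W.tanE)
obtain v0 where v0: "v0:DZ V False" "!!N b. opn N ==> N<=V ==> b:cW N ==> v0 N (sg N b) = sg N (vf_res W V w0 N b)"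
 using lift_exists[OF V W.vf_res_der[OF d(1) VU]] by blast
obtain v1 where v1: "v1:DZ V True" "!!N b. opn N ==> N<=V ==> b:cW N ==> v1 N (sg N b) = sg N (vf_res W V w1 N b)"
 using lift_exists[OF V W.vf_res_der[OF d(2) VU]] by blast
have "vf_add Z V v0 v1:Lif V w" unfolding lifts_def
proof(intro CollectI conjI allI impI ballI)
 show "vf_add Z V v0 v1:TZ V" using v0(1) v1(1) unfolding tangent_def by blast
 fix N b assume "opn N & N<=V" and b: "b:cW N"
 hence N: "opn N" "N<=V" "N<=U" "op_in W N" using VU by auto
 show "vf_add Z V v0 v1 N (sg N b) = sg N (w N b)"
  using N b v0(2)[OF N(1,2) b] v1(2)[OF N(1,2) b] W.der_cl[OF d(1) N(4,3) b] W.der_cl[OF d(2) N(4,3) b]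
  unfolding d(3) by(simp add: Z.vf_add_app W.vf_add_app W.vf_res_app sg_add)
qed
thus ?thesis by blast
qed

lemma tan_image_iff: "Tim U v ws <-> (ALL (h, w):set ws. h:cO U & w:TW U) & (ALL V b. opn V & V<=U & b:cW V -->
  v V (sg V b) = lsum (Oz V) (%(h, w). fr Z U V h*[Oz V] sg V (w V b)) ws)"
proof -
have "foldr (%(h, w) y. (fr Z U V h*[Oz V] sg V (w V b))+[Oz V] y) ws 0[Oz V] = lsum (Oz V) (%(h, w). fr Z U V h*[Oz V] sg V (w V b)) ws" for V b
 by(induction ws) auto
thus ?thesis unfolding tangent_image_def by(auto simp: in_lists_conv_set)
qed

text \<open>Expanding $v(\sigma b)$ in the monomials, the coefficients are derivations of \<open>b\<close>.\<close>

lemma tan_image_exists: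
assumes V: "chart V ths" and v: "v:DZ V i"
shows "EX ws. Tim V v ws & (ALL (h, w):set ws. EX q. h:grade (Oz V) q & w:DW V (i ~= q))"
proof -
note oV = c_opn[OF V]
define c where "c I N b = coef N (map (fr Z V N) ths) (v N (sg N b)) I" for I N b
let ?n = "length ths"
have cd: "vf_mk W V (c I):DW V (i ~= odd (card I))" if I: "I:set (mons ?n)" for I
proof(rule W.dersI)
 fix N assume N: "op_in W N" "N<=V"
 hence N': "opn N" by simp
 interpret N: odd_extension "Oz N" "Ow N" "sg N" "map (fr Z V N) ths" by(rule chart_ext[OF V N' N(2)])
 have IN: "I:set (mons (length (map (fr Z V N) ths)))" using I by simp
 have vc: "v N (sg N b):cO N" if "b:cW N" for b using that Z.der_cl[OF v N' N(2)] N' by simp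
 show "addmap (Ow N) (Ow N) (c I N)" unfolding c_def using IN vc N' by(intro addmapI) (simp_all add: N.rc_cl sg_add Z.der_add[OF v N' N(2)] N.rc_add)
 show "c I N b:grade (Ow N) ((i ~= odd (card I)) ~= j)" if "b:grade (Ow N) j" for b j
  using N.rc_grade[OF Z.der_grade[OF v N' N(2) sg_grade[OF N' that]] IN]
  by(cases i; cases j; cases "odd (card I)") (simp_all add: c_def)
 show "c I N (b*[Ow N] b') = c I N b*[Ow N] b'+[Ow N] rflip (Ow N) (i ~= odd (card I)) b*[Ow N] c I N b'" if b: "b:cW N" "b':cW N" for b b'
 proof -
  have "v N (sg N (b*[Ow N] b')) = v N (sg N b)*[Oz N] sg N b'+[Oz N] sg N (rflip (Ow N) i b)*[Oz N] v N (sg N b')"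
   using b N' by(simp add: sg_mult Z.der_mult[OF v N' N(2)] sg_flip)
  moreover have "rflip (Ow N) (odd (card I)) (rflip (Ow N) i b) = rflip (Ow N) (i ~= odd (card I)) b"
   using b N.S.flip_flip[of b "odd (card I)" i] by(simp add: eq_commute)
  ultimately show ?thesis unfolding c_def using b vc[OF b(1)] vc[OF b(2)] N'
   by(simp only: N.rc_add N.rc_mult_left N.rc_mult_right IN N.m_closed sg_cl N.S.flip_cl)
 qed
 show "c I N (scalar W N x) = 0[Ow N]" if "x:C L" for x
  using that comorphism_scalar[OF N(1) that] N.rc_zero[OF IN] by(simp add: c_def Z.der_scalar[OF v N' N(2)])
 show "fr W N M (c I N b) = c I M (fr W N M b)" if M: "op_in W M" "M<=N" and b: "b:cW N" for M b
 proof -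
  have M': "opn M" using M by simp
  have "coef M (map (fr Z N M) (map (fr Z V N) ths)) (fr Z N M (v N (sg N b))) I = fr W N M (c I N b)"
   unfolding c_def by(rule coef_res[OF chart_res[OF V N' N(2)] M' M(2) vc[OF b] IN])
  moreover have "map (fr Z N M) (map (fr Z V N) ths) = map (fr Z V M) ths"
   by(rule map_res_trans[OF oV N' M' M(2) N(2)]) (use V in \<open>simp add: chart_def\<close>)
  moreover have "fr Z N M (v N (sg N b)) = v M (sg M (fr W N M b))" using Z.der_res[OF v N' N(2) M' M(2)] b N' M' M(2) by(simp add: sg_res)
  ultimately show ?thesis by(simp only: c_def)
 qed
qed
define ws where "ws = map (%I. (mon V ths I, vf_mk W V (c I))) (mons ?n)"
interpret V: odd_extension "Oz V" "Ow V" "sg V" ths by(rule chart_self[OF V])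
have "Tim V v ws" unfolding tan_image_iff
proof(intro conjI allI impI)
 show "ALL (h, w):set ws. h:cO V & w:TW V" using W.der_tan[OF cd] by(auto simp: ws_def)
 fix N b assume "opn N & N<=V & b:cW N"
 hence N: "opn N" "N<=V" and b: "b:cW N" by auto
 interpret N: odd_extension "Oz N" "Ow N" "sg N" "map (fr Z V N) ths" by(rule chart_ext[OF V N])
 have "v N (sg N b):cO N" using b Z.der_cl[OF v N] N by simp
 hence "v N (sg N b) = lsum (Oz N) (%I. mon N (map (fr Z V N) ths) I*[Oz N] sg N (c I N b)) (mons ?n)"
  using N.rc_expand[of "v N (sg N b)"] by(simp add: c_def)
 also have "... = lsum (Oz N) (%(h, w). fr Z V N h*[Oz N] sg N (w N b)) ws" unfolding ws_def lsum_map
  by(rule lsum_cong) (use N b in \<open>auto simp: mon_res[OF V N] W.vf_mk_app\<close>)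
 finally show "v N (sg N b) = ..." .
qed
moreover have "ALL (h, w):set ws. EX q. h:grade (Oz V) q & w:DW V (i ~= q)"
proof
 fix x assume "x:set ws"
 then obtain I where I: "I:set (mons ?n)" "x = (mon V ths I, vf_mk W V (c I))" by(auto simp: ws_def)
 show "case x of (h, w) => EX q. h:grade (Oz V) q & w:DW V (i ~= q)"
  unfolding I(2) prod.case using V.mon_grade[OF I(1)] cd[OF I(1)] by(intro exI conjI)
qed
ultimately show ?thesis by blast
qed

end

section \<open>Vertically flat sections\<close>

locale odd_dmod = odd_submersion L Z W sg + F: dmod L Z F
for L :: "'l complex_superalgebra" and Z :: "('p, 'l, 'a) superspace" and W :: "('p, 'l, 'b) superspace"
 and sg :: "'p set => 'b => 'a" and F :: "('p, 'a, 'm) dmodule"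
begin

abbreviation Fs :: "'p set => ('a, 'm) supermodule" where "Fs == Sec F"
abbreviation cF where "cF U == C (Fs U)"
abbreviation ann :: "'p set => 'm set" where "ann == vertical_ann L Z W sg F"

lemma M_smod: "opn U ==> left_supermodule (Oz U) (Fs U)" by(rule F.mod_sections)

lemma M_torsion_free:
assumes U: "opn U" and s: "s:cF U" "s+[Fs U] s = 0[Fs U]" shows "s = 0[Fs U]"
proof -
interpret superalgebra "Oz U" by(rule superalgebras[OF U])
interpret left_supermodule "Oz U" "Fs U" by(rule M_smod[OF U])
show ?thesis using half half_torsion_free[OF _ _ s] by blast
qed

lemma annD:
assumes "s:ann U"
shows "s:cF U" "opn V ==> V<=U ==> v:Vtan V ==> nabla F V v (mr F U V s) = 0[Fs V]"
using assms by(auto simp: vertical_ann_def)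

lemma verticalD:
assumes "v:Vtan U"
shows "v:TZ U" "opn V ==> V<=U ==> b:cW V ==> v V (sg V b) = 0[Oz V]"
using assms by(auto simp: vertical_tangent_def)

text \<open>It suffices to test homogeneous vertical fields.\<close>

lemma annI:
assumes U: "opn U" and s: "s:cF U"
 and hom: "!!V i v. opn V ==> V<=U ==> v:DZ V i ==> v:Vtan V ==> nabla F V v (mr F U V s) = 0[Fs V]"
shows "s:ann U"
unfolding vertical_ann_def
proof(intro CollectI conjI allI impI ballI s)
fix V v assume "opn V & V<=U" and v: "v:Vtan V"
hence V: "opn V" "V<=U" by auto
interpret V: abelian_group "Fs V" by(rule F.M_ag[OF V(1)])
obtain v0 v1 where d: "v0:DZ V False" "v1:DZ V True" "v = vf_add Z V v0 v1" using verticalD(1)[OF v] by(rule Z.tanE)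
thus "nabla F V v (mr F U V s) = 0[Fs V]" using hom[OF V d(1)] hom[OF V d(2)] vertical_parts[of V v0 v1] v U V s
  F.nabla_vf_add[OF V(1) Z.der_tan[OF d(1)] Z.der_tan[OF d(2)]] by simp
qed

lemma ann_subgroup: "opn U ==> additive_subgroup (ann U) (Fs U)"
proof -
assume U: "opn U"
interpret U: abelian_group "Fs U" by(rule F.M_ag[OF U])
have neg: "-[Fs U] s:ann U" if "s:ann U" for s
proof(rule annI[OF U])
 fix V i v assume V: "opn V" "V<=U" "v:DZ V i" "v:Vtan V"
 interpret V: abelian_group "Fs V" by(rule F.M_ag[OF V(1)])
 show "nabla F V v (mr F U V (-[Fs U] s)) = 0[Fs V]" using annD[OF that] V U addmap_neg[OF F.M_ag[OF U] F.M_ag[OF V(1)] F.add_mres[OF U V(1,2)]]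
   F.nabla_neg[OF V(1) verticalD(1)[OF V(4)]] by simp
qed (use annD[OF that] in simp)
have add: "s+[Fs U] t:ann U" if st: "s:ann U" "t:ann U" for s t
proof(rule annI[OF U])
 fix V i v assume V: "opn V" "V<=U" "v:DZ V i" "v:Vtan V"
 interpret V: abelian_group "Fs V" by(rule F.M_ag[OF V(1)])
 show "nabla F V v (mr F U V (s+[Fs U] t)) = 0[Fs V]" using annD[OF st(1)] annD[OF st(2)] V U
  by(simp add: F.mod_res_add F.nabla_add[OF V(1) verticalD(1)[OF V(4)]])
qed (use annD st in simp)
have zero: "0[Fs U]:ann U" by(rule annI[OF U]) (use U verticalD(1) in \<open>simp_all add: F.mres_zero F.nabla_zero\<close>)
have "subgroup (ann U) (add_monoid (Fs U))" by(rule U.add.subgroupI) (use annD(1) neg add zero in \<open>auto simp: a_inv_def[symmetric]\<close>)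
thus ?thesis by(rule additive_subgroup.intro)
qed

context
fixes U assumes U: "opn U"
begin

lemma ann_add: "s:ann U ==> t:ann U ==> s+[Fs U] t:ann U" by(rule additive_subgroup.a_closed[OF ann_subgroup[OF U]])

lemma ann_zero: "0[Fs U]:ann U" by(rule additive_subgroup.zero_closed[OF ann_subgroup[OF U]])

lemma ann_neg: "s:ann U ==> -[Fs U] s:ann U" by(rule additive_subgroup.a_inv_closed[OF ann_subgroup[OF U]])

lemma ann_ksz: "s:ann U ==> koszul (Fs U) i j s:ann U" by(simp add: koszul_def ann_neg)

lemma ann_res: "s:ann U ==> opn V ==> V<=U ==> mr F U V s:ann V" by(rule annI) (use annD[of s U] U in \<open>auto simp: F.mres_trans\<close>)

lemma ann_smult:
assumes b: "b:cW U" and s: "s:ann U"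
shows "sg U b.*[Fs U] s:ann U"
proof(rule annI[OF U])
interpret U: left_supermodule "Oz U" "Fs U" by(rule M_smod[OF U])
show "sg U b.*[Fs U] s:cF U" using b U annD(1)[OF s] by(simp add: U.smult_closed)
fix V i v assume V: "opn V" "V<=U" and v: "v:DZ V i" "v:Vtan V"
interpret V: left_supermodule "Oz V" "Fs V" by(rule M_smod[OF V(1)])
have b': "fr W U V b:cW V" using W.res_closed[of U V b] U V b by simp
have s': "mr F U V s:cF V" using annD(1)[OF s] U V by simp
show "nabla F V v (mr F U V (sg U b.*[Fs U] s)) = 0[Fs V]" using b' s' U V b annD(1)[OF s] annD(2)[OF s V v(2)] verticalD(2)[OF v(2) V(1) le b']
 by(simp add: F.mod_res_smult sg_res F.nabla_Leib_flip[OF V(1) v(1)])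
qed

lemma ann_hpart:
assumes s: "s:ann U"
shows "hpart (Fs U) (mg (Fs U)) j s:ann U"
proof(rule annI[OF U])
interpret U: gr_ag "Fs U" "mg (Fs U)" by(rule F.M_graded[OF U])
show "hpart (Fs U) (mg (Fs U)) j s:cF U" using annD(1)[OF s] by simp
fix V i v assume V: "opn V" "V<=U" and v: "v:DZ V i" "v:Vtan V"
show "nabla F V v (mr F U V (hpart (Fs U) (mg (Fs U)) j s)) = 0[Fs V]"
 using F.nabla_hpart_zero[OF V(1) v(1) _ annD(2)[OF s V v(2)]] U V annD(1)[OF s] by(simp add: F.mres_hpart)
qed

lemma ann_local:
assumes s: "s:cF U"
 and loc: "!!p. p:U ==> EX V. opn V & p:V & V<=U & mr F U V s:ann V"
shows "s:ann U"
proof(rule annI[OF U s])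
fix V i v assume V: "opn V" "V<=U" and v: "v:Vtan V"
note vt = verticalD(1)[OF v]
interpret V: abelian_group "Fs V" by(rule F.M_ag[OF V(1)])
show "nabla F V v (mr F U V s) = 0[Fs V]"
proof(rule F.mlocal_eq[OF V(1)])
 show "nabla F V v (mr F U V s):cF V" using s U V F.nabla_closed[OF V(1) vt] by simp
 fix p assume p: "p:V"
 then obtain N where N: "opn N" "p:N" "N<=U" "mr F U N s:ann N" using loc V by blast
 let ?N = "N Int V"
 have oN: "opn ?N" "?N<=N" "?N<=V" using N V by auto
 have "mr F V ?N (nabla F V v (mr F U V s)) = nabla F ?N (vf_res Z ?N v) (mr F N ?N (mr F U N s))"
  using F.nabla_res[OF V(1) oN(1,3) vt] s U V N oN by(simp add: F.mres_trans)
 also have "... = 0[Fs ?N]" by(rule annD(2)[OF N(4) oN(1,2) vertical_res[OF v oN(1,3)]])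
 finally show "EX N. opn N & p:N & N<=V & mr F V N (nabla F V v (mr F U V s)) = mr F V N 0[Fs V]"
  using N p oN V by(intro exI[of _ ?N]) (simp add: F.mres_zero)
qed simp
qed

end

text \<open>The action of a vector field on vertically flat sections depends on its values on functions
  of the base only.\<close>

lemma nabla_ann_cong:
assumes U: "opn U" and v: "v:TZ U" "u:TZ U"
 and eq: "!!V b. opn V ==> V<=U ==> b:cW V ==> v V (sg V b) = u V (sg V b)"
 and s: "s:ann U"
shows "nabla F U v s = nabla F U u s"
proof -
interpret U: left_supermodule "Oz U" "Fs U" by(rule M_smod[OF U])
let ?m = "-[Oz U] 1[Oz U]"
let ?u = "vf_smult Z U ?m u"
have ut: "?u:TZ U" by(rule Z.vf_smult_tan[OF U _ v(2)]) simp
have "vf_add Z U v ?u:Vtan U" unfolding vertical_tangent_def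
proof(intro CollectI conjI allI impI ballI Z.vf_add_tan[OF v(1) ut])
 fix V b assume "opn V & V<=U" and b: "b:cW V"
 hence V: "opn V" "V<=U" by auto
 interpret V: sring "Oz V" by(rule sc[OF V(1)])
 have "fr Z U V ?m = -[Oz V] 1[Oz V]" using Z.res_neg[OF U V] Z.res_one[OF U V] by simp
 thus "vf_add Z U v ?u V (sg V b) = 0[Oz V]" using V b eq[OF V b] Z.tan_cl[OF v(2) V, of "sg V b"]
  by(simp add: Z.vf_add_app Z.vf_smult_app V.l_minus V.r_neg)
qed
hence "nabla F U (vf_add Z U v ?u) s = 0[Fs U]" using annD[OF s] U F.mres_id[OF U annD(1)[OF s]] by(metis le)
moreover have "nabla F U (vf_add Z U v ?u) s = nabla F U v s -[Fs U] nabla F U u s"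
 using F.nabla_vf_add[OF U v(1) ut annD(1)[OF s]] F.nabla_vf_smult[OF U _ v(2) annD(1)[OF s], of ?m]
  F.nabla_closed[OF U v(2) annD(1)[OF s]] by(simp add: U.smult_neg U.smult_one a_minus_def)
ultimately show ?thesis using U.M.minus_zero_imp_eq F.nabla_closed[OF U _ annD(1)[OF s]] v by metis
qed

text \<open>A chart and its odd partial derivatives, with the successive conditions $\partial_j s = 0$
  for $j \ge k$, which interpolate between vertically flat and arbitrary sections.\<close>

context
fixes V ths d
assumes V: "chart V ths"
 and d: "!!k. k < length ths ==> d k:DZ V True"
 and d_base: "!!k N b. k < length ths ==> opn N ==> N<=V ==> b:cW N ==> d k N (sg N b) = 0[Oz N]"
 and d_odd: "!!k j. k < length ths ==> j < length ths ==> d k V (ths ! j) = (if j = k then 1[Oz V] else 0[Oz V])"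
begin

interpretation V: odd_extension "Oz V" "Ow V" "sg V" ths by(rule chart_self[OF V])
interpretation M: left_supermodule "Oz V" "Fs V" by(rule M_smod[OF c_opn[OF V]])

text \<open>On the chart a vertical field \<open>v\<close> is $\sum_k v(\theta_k) \partial_k$, since both agree on generators.\<close>

lemma ann_of_partials:
assumes s: "s:cF V" and 0: "!!k. k < length ths ==> nabla F V (d k) s = 0[Fs V]"
shows "s:ann V"
proof(rule annI[OF c_opn[OF V] s])
note oV = c_opn[OF V]
fix N i v assume N: "opn N" "N<=V" and v: "v:DZ N i" and vert: "v:Vtan N"
interpret N: odd_extension "Oz N" "Ow N" "sg N" "map (fr Z V N) ths" by(rule chart_ext[OF V N])
interpret MN: left_supermodule "Oz N" "Fs N" by(rule M_smod[OF N(1)])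
let ?t = "map (fr Z V N) ths" and ?n = "length ths"
let ?e = "%k. vf_res Z N (d k)"
let ?g = "%k. v N (?t ! k)"
let ?u = "Z.vf_sum N ?g ?e [0..<?n]"
have s': "mr F V N s:cF N" using s oV N by simp
have tk: "?t ! k:cO N" "?t ! k = fr Z V N (ths ! k)" "ths ! k:cO V" if "k < ?n" for k using N.ths_car[of k] V.ths_car[of k] that by auto
have gk: "?g k:cO N" if "k < ?n" for k using tk[OF that] Z.der_cl[OF v N(1) le] by simp
have ek: "?e k:DZ N True" if "k < ?n" for k by(rule Z.vf_res_der[OF d[OF that] N(2)])
have u: "?u:DZ N i"
proof(rule Z.vf_sum_der[OF N(1)])
 fix k assume "k:set [0..<?n]"
 hence k: "k < ?n" by simp
 have "?g k:grade (Oz N) (i ~= True)" by(rule Z.der_grade[OF v N(1) le N.ths_grade]) (use k in simp)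
 thus "EX q. ?g k:grade (Oz N) q & ?e k:DZ N (i ~= q)" using ek[OF k] by(intro exI[of _ "i ~= True"]) simp
qed
have "v = ?u"
proof(rule vf_eq_on_chart[OF chart_res[OF V N] v u])
 fix M b assume M: "opn M" "M<=N" and b: "b:cW M"
 interpret OM: sring "Oz M" by(rule sc[OF M(1)])
 have "?u M (sg M b) = lsum (Oz M) (%k. fr Z N M (?g k)*[Oz M] ?e k M (sg M b)) [0..<?n]" by(rule Z.vf_sum_app[OF M]) (use M b in simp)
 also have "... = 0[Oz M]" by(rule OM.lsum_zero) (use M N b gk d_base in \<open>auto simp: Z.vf_res_app dest: subset_trans\<close>)
 finally show "v M (sg M b) = ?u M (sg M b)" using verticalD(2)[OF vert M b] by simp
next
 fix j assume "j < length ?t"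
 hence j: "j < ?n" by simp
 have ekj: "?e k N (?t ! j) = (if j = k then 1[Oz N] else 0[Oz N])" if "k < ?n" for k
  using Z.der_res[OF d[OF that] oV le N tk(3)[OF j]] d_odd[OF that j] tk[OF j] N Z.res_one[OF oV N] Z.res_zero[OF oV N]
  by(simp add: Z.vf_res_app split: if_splits)
 have "?u N (?t ! j) = lsum (Oz N) (%k. fr Z N N (?g k)*[Oz N] ?e k N (?t ! j)) [0..<?n]" by(rule Z.vf_sum_app[OF N(1) le tk(1)[OF j]])
 also have "... = fr Z N N (?g j)*[Oz N] ?e j N (?t ! j)" by(rule N.lsum_single) (use j gk ekj N in \<open>auto simp del: nth_map\<close>)
 also have "... = ?g j" using gk[OF j] ekj[OF j] N by(simp add: Z.res_id del: nth_map)
 finally show "v N (?t ! j) = ?u N (?t ! j)" by simp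
qed
hence "nabla F N v (mr F V N s) = lsum (Fs N) (%k. ?g k.*[Fs N] nabla F N (?e k) (mr F V N s)) [0..<?n]"
 using F.nabla_vf_sum[OF N(1) s', of "[0..<?n]" ?g ?e] gk Z.der_tan[OF ek] by simp
also have "... = 0[Fs N]"
proof(rule MN.M.lsum_zero)
 fix k assume "k:set [0..<?n]"
 hence k: "k < ?n" by simp
 have "nabla F N (?e k) (mr F V N s) = 0[Fs N]" using F.nabla_res[OF oV N Z.der_tan[OF d[OF k]] s] 0[OF k] F.mres_zero[OF oV N] by simp
 thus "?g k.*[Fs N] nabla F N (?e k) (mr F V N s) = 0[Fs N]" using MN.smult_zero(1)[OF gk[OF k]] by(simp only:)
qed
finally show "nabla F N v (mr F V N s) = 0[Fs N]" .
qed

lemma d_tan: "k < length ths ==> d k:TZ V" by(rule Z.der_tan[OF d])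

lemma nabla_d_cl: "k < length ths ==> s:cF V ==> nabla F V (d k) s:cF V" by(rule F.nabla_closed[OF c_opn[OF V] d_tan])

lemma d_anticommute:
assumes k: "k < length ths" and j: "j < length ths" and s: "s:cF V"
shows "nabla F V (d k) (nabla F V (d j) s) = -[Fs V] nabla F V (d j) (nabla F V (d k) s)"
proof -
note oV = c_opn[OF V]
have b: "vf_br Z V True True (d k) (d j):DZ V False" using Z.vf_br_der[OF d[OF k] d[OF j]] by simp
have "vf_br Z V True True (d k) (d j) = Z.vf_zero V"
proof(rule vf_eq_on_chart[OF V b Z.vf_zero_der])
 fix N b assume N: "opn N" "N<=V" "b:cW N"
 interpret ON: sring "Oz N" by(rule sc[OF N(1)])
 show "vf_br Z V True True (d k) (d j) N (sg N b) = Z.vf_zero V N (sg N b)"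
  using N k j by(simp add: Z.vf_br_app Z.vf_zero_app d_base Z.der_zero[OF d])
next
 fix m assume m: "m < length ths"
 note 1 = Z.der_zero[OF d oV le]
 have 2: "d l V 1[Oz V] = 0[Oz V]" if "l < length ths" for l using d_base[OF that oV le, of "1[Ow V]"] sg_one[OF oV] by simp
 show "vf_br Z V True True (d k) (d j) V (ths ! m) = Z.vf_zero V V (ths ! m)" using V.ths_car[OF m] oV k j m 1 2
  by(simp add: Z.vf_br_app Z.vf_zero_app d_odd)
qed
hence "0[Fs V] = nabla F V (d k) (nabla F V (d j) s) -[Fs V] -[Fs V] nabla F V (d j) (nabla F V (d k) s)"
 using F.nabla_flat[OF oV d[OF k] d[OF j] s] F.nabla_vf_zero[OF oV s] by(simp add: koszul_def)
thus ?thesis using nabla_d_cl k j s by(metis M.M.a_inv_closed M.M.minus_zero_imp_eq)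
qed

lemma d_square: "k < length ths ==> s:cF V ==> nabla F V (d k) (nabla F V (d k) s) = 0[Fs V]" by(rule M_torsion_free[OF c_opn[OF V]])
 (use d_anticommute[of k k s] nabla_d_cl M.M.r_neg in \<open>metis+\<close>)

lemma d_theta:
assumes "k < length ths" "j < length ths" "s:cF V"
shows "nabla F V (d k) (ths ! j.*[Fs V] s) = (if j = k then s else 0[Fs V]) -[Fs V] ths ! j.*[Fs V] nabla F V (d k) s"
using F.nabla_Leib_flip[OF c_opn[OF V] d[OF assms(1)] V.ths_car[OF assms(2)] assms(3)]
 V.flip_homog[OF V.ths_grade[OF assms(2)]] V.ths_car[OF assms(2)] nabla_d_cl[OF assms(1,3)] assms
by(simp add: d_odd koszul_def M.smult_neg M.smult_one a_minus_def)

definition flat_from :: "nat => 'm set" where "flat_from k = {s:cF V. ALL j. k <= j & j < length ths --> nabla F V (d j) s = 0[Fs V]}"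

lemma flat_from_0: "flat_from 0 = ann V"
proof
show "flat_from 0 <= ann V" using ann_of_partials by(auto simp: flat_from_def)
have "nabla F V (d k) s = 0[Fs V]" if s: "s:ann V" and k: "k < length ths" for s k
proof -
 have "d k:Vtan V" using d_base[OF k] d_tan[OF k] by(auto simp: vertical_tangent_def)
 thus ?thesis using annD(2)[OF s c_opn[OF V] le] F.mres_id[OF c_opn[OF V] annD(1)[OF s]] by simp
qed
thus "ann V <= flat_from 0" using annD(1) by(auto simp: flat_from_def)
qed

lemma flat_from_mono: "k <= m ==> flat_from k <= flat_from m" by(auto simp: flat_from_def)

lemma flat_from_add: "s:flat_from k ==> t:flat_from k ==> s+[Fs V] t:flat_from k" by(auto simp: flat_from_def F.nabla_add[OF c_opn[OF V] d_tan])

lemma flat_from_zero: "0[Fs V]:flat_from k" by(auto simp: flat_from_def F.nabla_zero[OF c_opn[OF V] d_tan])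

lemma flat_from_lsum: "(!!x. x:set xs ==> f x:flat_from k) ==> lsum (Fs V) f xs:flat_from k"
by(induction xs) (auto intro: flat_from_add flat_from_zero)

lemma flat_from_theta:
assumes "m < k" "m < length ths" "s:flat_from k" shows "ths ! m.*[Fs V] s:flat_from k"
using assms V.ths_car[OF assms(2)] M.smult_closed by(auto simp: flat_from_def d_theta a_minus_def)

lemma flat_from_mon: "k <= length ths ==> I:set (mons k) ==> s:flat_from k ==> mon V ths I.*[Fs V] s:flat_from k"
proof -
have "m <= k ==> k <= length ths ==> I:set (mons m) ==> s:flat_from k ==> mon V ths I.*[Fs V] s:flat_from k" for m I s
proof(induction m arbitrary: I s)
 case 0
 thus ?case by(auto simp: flat_from_def M.smult_one)
next
 case (Suc m)
 have m: "m < length ths" "m < k" using Suc.prems by auto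
 have sc: "s:cF V" using Suc.prems(4) by(simp add: flat_from_def)
 show ?case
 proof(cases "I:set (mons m)")
  case True
  thus ?thesis using Suc by simp
 next
  case False
  then obtain J where J: "J:set (mons m)" "I = insert m J" using Suc.prems by auto
  have "J:set (mons (length ths))" using V.mons_mono[of m J] J(1) m by simp
  hence "mon V ths I.*[Fs V] s = mon V ths J.*[Fs V] (ths ! m.*[Fs V] s)"
   using J V.mon_insert[OF m(1) J(1)] V.ths_car[OF m(1)] sc by(simp add: M.smult_assoc)
  thus ?thesis using Suc.IH[OF _ _ J(1)] flat_from_theta[OF m(2,1) Suc.prems(4)] Suc.prems by simp
 qed
qed
thus "k <= length ths ==> I:set (mons k) ==> s:flat_from k ==> mon V ths I.*[Fs V] s:flat_from k" by blast
qed

lemma theta_sum: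
assumes k: "k < length ths" and c: "!!I. I:set (mons k) ==> c I:cF V"
shows "ths ! k.*[Fs V] lsum (Fs V) (%I. mon V ths I.*[Fs V] c I) (mons k) =
 lsum (Fs V) (%I. mon V ths (insert k I).*[Fs V] koszul (Fs V) True (odd (card I)) (c I)) (mons k)"
proof -
have mk: "I:set (mons (length ths))" if "I:set (mons k)" for I using V.mons_mono[of k I] that k by simp
have "ths ! k.*[Fs V] lsum (Fs V) (%I. mon V ths I.*[Fs V] c I) (mons k) = lsum (Fs V) (%I. ths ! k.*[Fs V] (mon V ths I.*[Fs V] c I)) (mons k)"
 by(rule M.smult_lsum) (use V.ths_car[OF k] mk c in \<open>auto simp: M.smult_closed\<close>)
also have "... = lsum (Fs V) (%I. mon V ths (insert k I).*[Fs V] koszul (Fs V) True (odd (card I)) (c I)) (mons k)"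
proof(rule lsum_cong)
 fix I assume I: "I:set (mons k)"
 note Ic = V.mon_cl[OF mk[OF I]] and tk = V.ths_car[OF k]
 have "ths ! k*[Oz V] mon V ths I = koszul (Oz V) True (odd (card I)) (mon V ths (insert k I))"
  using V.odd_move[OF V.ths_grade[OF k] Ic] V.flip_homog[OF V.mon_grade[OF mk[OF I]]] V.mon_insert[OF k I] Ic tk
  by(simp add: V.ksz_mult)
 moreover have "mon V ths (insert k I):cO V" using V.mon_insert[OF k I] Ic tk by simp
 ultimately show "ths ! k.*[Fs V] (mon V ths I.*[Fs V] c I) = mon V ths (insert k I).*[Fs V] koszul (Fs V) True (odd (card I)) (c I)"
  using c[OF I] Ic tk by(simp add: M.smult_assoc[symmetric] M.smult_ksz)
qed simp
finally show ?thesis .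
qed

text \<open>Induction step: in $s = (s - \theta_k \partial_k s) + \theta_k \partial_k s$ both $s - \theta_k \partial_k s$
  and $\partial_k s$ are killed by $\partial_k$.\<close>

lemma flat_from_span: "k <= length ths ==> s:flat_from k ==>
 EX c. (ALL I:set (mons k). c I:ann V) & s = lsum (Fs V) (%I. mon V ths I.*[Fs V] c I) (mons k)"
proof(induction k arbitrary: s)
case 0
hence "s:ann V" "s:cF V" using flat_from_0 by(auto simp: flat_from_def)
thus ?case by(intro exI[of _ "%_. s"]) (simp add: M.smult_one)
next
case (Suc k)
have k: "k < length ths" using Suc.prems by simp
have s: "s:cF V" using Suc.prems by(simp add: flat_from_def)
note tk = V.ths_car[OF k]
define y where "y = nabla F V (d k) s"
have y: "y:cF V" using nabla_d_cl k s by(simp add: y_def)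
have ydk: "nabla F V (d k) y = 0[Fs V]" using d_square[OF k s] by(simp add: y_def)
have sj: "nabla F V (d j) s = 0[Fs V]" if "k < j" "j < length ths" for j using Suc.prems that by(auto simp: flat_from_def)
have yj: "nabla F V (d j) y = 0[Fs V]" if "k <= j" "j < length ths" for j
proof(cases "j = k")
 case False
 thus ?thesis using d_anticommute[OF that(2) k s] sj[of j] that F.nabla_zero[OF c_opn[OF V] d_tan[OF k]] by(simp add: y_def)
qed (use ydk in simp)
hence yG: "y:flat_from k" using y by(simp add: flat_from_def)
define x where "x = s -[Fs V] ths ! k.*[Fs V] y"
have x: "x:cF V" using s y tk by(simp add: x_def M.smult_closed)
have "nabla F V (d j) x = 0[Fs V]" if j: "k <= j" "j < length ths" for j
proof -
 have "nabla F V (d j) x = nabla F V (d j) s -[Fs V] nabla F V (d j) (ths ! k.*[Fs V] y)"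
  unfolding x_def by(rule F.nabla_minus[OF c_opn[OF V] d_tan[OF j(2)] s]) (use y tk in \<open>simp add: M.smult_closed\<close>)
 also have "... = 0[Fs V]" using d_theta[OF j(2) k y] yj[OF j] sj[of j] y tk j y_def by(cases "j = k") (simp_all add: M.M.minus_eq M.M.r_neg)
 finally show ?thesis .
qed
hence xG: "x:flat_from k" using x by(simp add: flat_from_def)
obtain a where a: "ALL I:set (mons k). a I:ann V" "x = lsum (Fs V) (%I. mon V ths I.*[Fs V] a I) (mons k)" using Suc.IH[OF _ xG] k by auto
obtain b where b: "ALL I:set (mons k). b I:ann V" "y = lsum (Fs V) (%I. mon V ths I.*[Fs V] b I) (mons k)" using Suc.IH[OF _ yG] k by auto
define c where "c J = (if k:J then koszul (Fs V) True (odd (card (J - {k}))) (b (J - {k})) else a J)" for J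
have knot: "k ~: I" if "I:set (mons k)" for I using mons_subset[OF that] by auto
have cA: "c I:ann V" if "I:set (mons (Suc k))" for I using that a(1) b(1) knot ann_ksz[OF c_opn[OF V]] by(auto simp: c_def)
have mc: "mon V ths I.*[Fs V] c I:cF V" if "I:set (mons (Suc k))" for I
 using cA[OF that] annD(1) V.mons_mono[of "Suc k" I] that Suc.prems(1) M.smult_closed V.mon_cl by blast
have "lsum (Fs V) (%I. mon V ths I.*[Fs V] c I) (mons (Suc k)) = lsum (Fs V) (%I. mon V ths I.*[Fs V] c I) (mons k) +[Fs V]
  lsum (Fs V) (%I. mon V ths (insert k I).*[Fs V] c (insert k I)) (mons k)"
 unfolding mons.simps using mc by(subst M.M.lsum_append) auto
also have "lsum (Fs V) (%I. mon V ths I.*[Fs V] c I) (mons k) = x" unfolding a(2) by(rule lsum_cong) (auto simp: c_def knot)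
also have "lsum (Fs V) (%I. mon V ths (insert k I).*[Fs V] c (insert k I)) (mons k) = ths ! k.*[Fs V] y" unfolding b(2) using annD(1) b(1)
 by(subst theta_sum[OF k]) (auto simp: c_def knot intro!: lsum_cong)
also have "x+[Fs V] ths ! k.*[Fs V] y = s" unfolding x_def using s M.smult_closed[OF tk y] by algebra
finally show ?case using cA by metis
qed

text \<open>Applying $\partial_k$ to a relation $a + \theta_k b = 0$ gives \<open>b = 0\<close>.\<close>

lemma flat_from_free: "k <= length ths ==> (!!I. I:set (mons k) ==> c I:ann V) ==>
 lsum (Fs V) (%I. mon V ths I.*[Fs V] c I) (mons k) = 0[Fs V] ==> I:set (mons k) ==> c I = 0[Fs V]"
proof(induction k arbitrary: c I)
case 0
thus ?case using annD(1)[OF "0.prems"(2), of "{}"] by(simp add: M.smult_one)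
next
case (Suc k)
have k: "k < length ths" using Suc.prems by simp
note tk = V.ths_car[OF k]
define b where "b I = koszul (Fs V) True (odd (card I)) (c (insert k I))" for I
have cA: "c I:ann V" "c (insert k I):ann V" "b I:ann V" if "I:set (mons k)" for I
 using Suc.prems(2)[of I] Suc.prems(2)[of "insert k I"] that ann_ksz[OF c_opn[OF V]] by(auto simp: b_def)
define x y where "x = lsum (Fs V) (%I. mon V ths I.*[Fs V] c I) (mons k)"
 and "y = lsum (Fs V) (%I. mon V ths I.*[Fs V] b I) (mons k)"
have G: "x:flat_from k" "y:flat_from k" unfolding x_def y_def using cA flat_from_0 flat_from_mono[of 0 k] k
 by(auto intro!: flat_from_lsum flat_from_mon)
hence xy: "x:cF V" "y:cF V" "nabla F V (d k) x = 0[Fs V]" "nabla F V (d k) y = 0[Fs V]" using k by(auto simp: flat_from_def)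
have mc: "mon V ths I.*[Fs V] c I:cF V" if "I:set (mons (Suc k))" for I
 using Suc.prems(2)[OF that] annD(1) V.mons_mono[of "Suc k" I] that Suc.prems(1) M.smult_closed V.mon_cl by blast
have "0[Fs V] = x+[Fs V] lsum (Fs V) (%I. mon V ths (insert k I).*[Fs V] c (insert k I)) (mons k)" using Suc.prems(3) mc unfolding mons.simps x_def
 by(subst (asm) M.M.lsum_append) auto
also have "lsum (Fs V) (%I. mon V ths (insert k I).*[Fs V] c (insert k I)) (mons k) = ths ! k.*[Fs V] y" unfolding y_def using annD(1) cA
 by(subst theta_sum[OF k]) (auto simp: b_def koszul_def M.M.minus_minus intro!: lsum_cong)
finally have 0: "x+[Fs V] ths ! k.*[Fs V] y = 0[Fs V]" by simp
have "nabla F V (d k) (x+[Fs V] ths ! k.*[Fs V] y) = y"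
 using F.nabla_add[OF c_opn[OF V] d_tan[OF k], of x "ths ! k.*[Fs V] y"] xy tk d_theta[OF k k xy(2)]
 by(simp add: M.smult_closed M.M.minus_eq)
hence y0: "y = 0[Fs V]" unfolding 0 using F.nabla_zero[OF c_opn[OF V] d_tan[OF k]] by simp
hence x0: "x = 0[Fs V]" using 0 tk xy by simp
have 1: "c J = 0[Fs V]" if "J:set (mons k)" for J by(rule Suc.IH[of c, OF _ cA(1) _ that]) (use k x0 x_def in simp_all)
have 2: "c (insert k J) = 0[Fs V]" if "J:set (mons k)" for J
proof -
 have "b J = 0[Fs V]" by(rule Suc.IH[of b, OF _ cA(3) _ that]) (use k y0 y_def in simp_all)
 hence "koszul (Fs V) True (odd (card J)) (b J) = 0[Fs V]" by simp
 thus ?thesis unfolding b_def using annD(1)[OF cA(2)[OF that]] M.M.minus_minus by(cases "odd (card J)") (simp_all add: koszul_def)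
qed
show ?case using Suc.prems(4) 1 2 by auto
qed

end

text \<open>On a chart, a module with connection is freely generated by its vertically flat sections.\<close>

lemma ann_span:
assumes V: "chart V ths" and s: "s:cF V"
shows "EX c. (ALL I:set (mons (length ths)). c I:ann V) & s = lsum (Fs V) (%I. mon V ths I.*[Fs V] c I) (mons (length ths))"
proof -
obtain d where d: "ALL k<length ths. d k:DZ V True & (ALL N b. opn N & N<=V & b:cW N --> d k N (sg N b) = 0[Oz N]) &
 (ALL j<length ths. d k V (ths ! j) = (if j = k then 1[Oz V] else 0[Oz V]))"
 using partials_exist[OF V] by blast
show ?thesis by(rule flat_from_span[OF V, of d]) (use d s in \<open>auto simp: flat_from_def[OF V, of d]\<close>)
qed

lemma ann_free:
assumes V: "chart V ths" and c: "!!I. I:set (mons (length ths)) ==> c I:ann V"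
 and 0: "lsum (Fs V) (%I. mon V ths I.*[Fs V] c I) (mons (length ths)) = 0[Fs V]"
 and I: "I:set (mons (length ths))"
shows "c I = 0[Fs V]"
proof -
obtain d where d: "ALL k<length ths. d k:DZ V True & (ALL N b. opn N & N<=V & b:cW N --> d k N (sg N b) = 0[Oz N]) &
 (ALL j<length ths. d k V (ths ! j) = (if j = k then 1[Oz V] else 0[Oz V]))"
 using partials_exist[OF V] by blast
show ?thesis by(rule flat_from_free[OF V, of d "length ths" c]) (use d c 0 I in auto)
qed

end

section \<open>The direct image of a module with connection\<close>

lemma add_subgroup_criterion:
assumes "abelian_group M" "H<=C M" "0[M]:H"
 and "!!x y. x:H ==> y:H ==> x+[M] y:H" "!!x. x:H ==> -[M] x:H"
shows "additive_subgroup H M"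
proof -
interpret abelian_group M by fact
have "subgroup H (add_monoid M)" by(rule add.subgroupI) (use assms in \<open>auto simp: a_inv_def[symmetric]\<close>)
thus ?thesis by(rule additive_subgroup.intro)
qed

lemma graded_abelian_subgroup:
assumes M: "gr_ag M gr" and A: "additive_subgroup A M"
 and hp: "!!i x. x:A ==> hpart M gr i x:A"
 and N: "C N = A" "0[N] = 0[M]" "add N = add M"
shows "gr_ag N (%i. gr i Int A)" and "!!x. x:A ==> -[N] x = -[M] x"
proof -
interpret M: gr_ag M gr by fact
interpret A: additive_subgroup A M by fact
have neg: "-[M] x:A" if "x:A" for x using A.a_inv_closed[OF that] .
have Ac: "x:C M" if "x:A" for x using A.a_subset that by blast
have ag: "abelian_group N"
proof(rule abelian_groupI)
 show "EX y:C N. y+[N] x = 0[N]" if "x:C N" for x by(rule bexI[of _ "-[M] x"]) (use N that neg Ac M.l_neg in auto)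
qed (use N Ac A.a_closed A.zero_closed M.a_ac in auto)
interpret N: abelian_group N by fact
show neg_eq: "-[N] x = -[M] x" if "x:A" for x by(rule N.minus_equality) (use that N neg Ac M.l_neg in auto)
have minus_eq: "x -[N] y = x -[M] y" if "x:A" "y:A" for x y using that N neg_eq by(simp add: a_minus_def)
have "graded_group N (%i. gr i Int A)" unfolding graded_group_def
proof(intro conjI allI ballI)
 show "additive_subgroup (gr i Int A) N" for i by(rule add_subgroup_criterion[OF ag]) (use N neg neg_eq M.gr_add M.gr_neg A.a_closed in auto)
 fix x assume "x:C N"
 hence x: "x:A" using N by simp
 show "EX! x0. x0:gr False Int A & x -[N] x0:gr True Int A"
 proof(intro ex1I conjI)
  have m: "x -[M] hpart M gr False x = hpart M gr True x" using M.hpart_decompose[OF Ac[OF x]] M.hpart_cl[OF Ac[OF x]] Ac[OF x]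
   by(metis M.a_comm M.minus_eq M.r_neg2 M.a_inv_closed M.a_lcomm M.r_neg1)
  show "hpart M gr False x:gr False Int A" using hp[OF x] M.hpart_in[OF Ac[OF x]] by blast
  show "x -[N] hpart M gr False x:gr True Int A" using minus_eq[OF x hp[OF x]] m hp[OF x] M.hpart_in[OF Ac[OF x]] by simp
  fix x0 assume x0: "x0:gr False Int A & x -[N] x0:gr True Int A"
  hence c: "x0:C M" using Ac by blast
  have eq: "x = x0+[M] (x -[M] x0)" using Ac[OF x] c by algebra
  have "x -[M] x0:gr True" using minus_eq[OF x, of x0] x0 by auto
  hence "hpart M gr False (x0+[M] (x -[M] x0)) = x0" using M.hpart_sum[of x0 "x -[M] x0" False] x0 by auto
  thus "x0 = hpart M gr False x" by(simp only: eq[symmetric])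
 qed
qed
thus "gr_ag N (%i. gr i Int A)" by(intro gr_ag.intro ag gr_ag_axioms.intro)
qed

context odd_dmod
begin

abbreviation dF :: "('p, 'b, 'm) dmodule" where "dF == direct_image_obj L Z W sg F"

lemma N_simps [simp]: "C (Sec dF U) = ann U" "zero (Sec dF U) = 0[Fs U]" "add (Sec dF U) = add (Fs U)"
"smult (Sec dF U) b s = sg U b.*[Fs U] s" "mg (Sec dF U) i = mg (Fs U) i Int ann U"
"mr dF = mr F"
by(simp_all add: direct_image_obj_def)

lemma N_graded: "opn U ==> gr_ag (Sec dF U) (mg (Sec dF U))"
and N_neg: "opn U ==> s:ann U ==> -[Sec dF U] s = -[Fs U] s"
proof -
assume U: "opn U"
note g = graded_abelian_subgroup[OF F.M_graded[OF U] ann_subgroup[OF U] ann_hpart[OF U], of "Sec dF U"]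
have "mg (Sec dF U) = (%i. mg (Fs U) i Int ann U)" by auto
thus "gr_ag (Sec dF U) (mg (Sec dF U))" using g(1) by simp
show "s:ann U ==> -[Sec dF U] s = -[Fs U] s" using g(2) by simp
qed

lemma N_ksz: "opn U ==> s:ann U ==> koszul (Sec dF U) i j s = koszul (Fs U) i j s" by(simp add: koszul_def N_neg)

lemma N_minus: "opn U ==> t:ann U ==> s -[Sec dF U] t = s -[Fs U] t" by(simp add: a_minus_def N_neg)

lemma cover_lift:
assumes "opn U" "p:U" "w:TW U"
obtains V ths v where "chart V ths" "opn V" "p:V" "V<=U" "v:Lif V w"
proof -
obtain V ths where V: "chart V ths" "p:V" "V<=U" using chart_exists[OF assms(1,2)] .
thus ?thesis using that tan_lift_exists[OF V(1) assms(3) V(3)] c_opn by blast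
qed

lemma cover_lift_homog:
assumes "opn U" "p:U" "w:DW U i"
obtains V ths v where "chart V ths" "opn V" "p:V" "V<=U" "v:DZ V i" "v:Lif V w"
proof -
obtain V ths where V: "chart V ths" "p:V" "V<=U" using chart_exists[OF assms(1,2)] .
obtain v where v: "v:DZ V i" "!!N b. opn N ==> N<=V ==> b:cW N ==> v N (sg N b) = sg N (vf_res W V w N b)"
 using lift_exists[OF V(1) W.vf_res_der[OF assms(3) V(3)]] by blast
have "v:Lif V w" using v Z.der_tan[OF v(1)] by(auto simp: lifts_def W.vf_res_app)
thus ?thesis using that V v c_opn by blast
qed

lemma nabla_lifts_cong:
assumes "opn V" "v:Lif V w" "v':Lif V w" "s:ann V"
shows "nabla F V v s = nabla F V v' s"
by(rule nabla_ann_cong[OF assms(1) liftsD(1)[OF assms(2)] liftsD(1)[OF assms(3)] _ assms(4)])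
 (use liftsD(2)[OF assms(2)] liftsD(2)[OF assms(3)] in simp)

definition along :: "'p set => ('p, 'b) vfield => 'm => 'm => bool" where "along U w s t <-> t:cF U & (ALL V. opn V & V<=U -->
  (ALL v:Lif V w. mr F U V t = nabla F V v (mr F U V s)))"

abbreviation lifted_at where "lifted_at p U w x s == EX V v. opn V & p:V & V<=U & v:Lif V w & mr F U V x = nabla F V v (mr F U V s)"

lemma along_local:
assumes U: "opn U" and s: "s:ann U" and t: "t:cF U"
 and loc: "!!p. p:U ==> lifted_at p U w t s"
shows "along U w s t"
unfolding along_def
proof(intro conjI allI impI ballI t)
fix V v assume "opn V & V<=U" and v: "v:Lif V w"
hence V: "opn V" "V<=U" by auto
note sc = annD(1)[OF s]
show "mr F U V t = nabla F V v (mr F U V s)"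
proof(rule F.mlocal_eq[OF V(1)])
 show "mr F U V t:cF V" "nabla F V v (mr F U V s):cF V" using U V t sc F.nabla_closed[OF V(1) liftsD(1)[OF v]] by simp_all
 fix p assume p: "p:V"
 then obtain N u where N: "opn N" "p:N" "N<=U" "u:Lif N w" "mr F U N t = nabla F N u (mr F U N s)" using loc V(2) by blast
 let ?N = "N Int V"
 have o: "opn ?N" "?N<=N" "?N<=V" "?N<=U" using N V by auto
 have "mr F U ?N t = mr F N ?N (mr F U N t)" using F.mres_trans[OF U N(1) o(1,2) N(3) t] by simp
 also have "... = nabla F ?N (vf_res Z ?N u) (mr F U ?N s)"
  unfolding N(5) using F.nabla_res[OF N(1) o(1,2) liftsD(1)[OF N(4)]] U N o sc by(simp add: F.mres_trans)
 also have "... = nabla F ?N (vf_res Z ?N v) (mr F U ?N s)"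
  by(rule nabla_lifts_cong[OF o(1) lifts_res[OF N(4) o(1,2)] lifts_res[OF v o(1,3)] ann_res[OF U s o(1,4)]])
 also have "... = mr F V ?N (nabla F V v (mr F U V s))" using F.nabla_res[OF V(1) o(1,3) liftsD(1)[OF v]] U V o sc by(simp add: F.mres_trans)
 finally show "EX N. opn N & p:N & N<=V & mr F V N (mr F U V t) = mr F V N (nabla F V v (mr F U V s))"
  using o p N U V t by(intro exI[of _ ?N]) (simp add: F.mres_trans)
qed
qed

lemma along_unique:
assumes U: "opn U" and w: "w:TW U" and t: "along U w s t" "along U w s t'"
shows "t = t'"
proof(rule F.mlocal_eq[OF U])
show "t:cF U" "t':cF U" using t by(auto simp: along_def)
fix p assume "p:U"
then obtain V ths v where "opn V" "p:V" "V<=U" "v:Lif V w" using cover_lift[OF U _ w] by metis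
thus "EX V. opn V & p:V & V<=U & mr F U V t = mr F U V t'" using t unfolding along_def by metis
qed

lemma along_res:
assumes "opn U" "opn V" "V<=U" "s:cF U" "along U w s t"
shows "along V w (mr F U V s) (mr F U V t)"
using assms unfolding along_def by(auto simp: F.mres_trans)

text \<open>Local lifts of \<open>w\<close> give local values of $\nabla_w s$; they agree, so they can be glued.\<close>

lemma along_exists:
assumes U: "opn U" and w: "w:TW U" and s: "s:ann U"
shows "EX t. along U w s t"
proof -
note sc = annD(1)[OF s]
have "EX t:cF U. ALL V t'. opn V --> V<=U --> t':cF V --> along V w (mr F U V s) t' --> mr F U V t = t'"
proof(rule set_sheaf.glue_local[OF F.mod_sheaf U, of "%V. along V w (mr F U V s)"])
 fix p assume "p:U"
 then obtain V ths v where V: "opn V" "p:V" "V<=U" "v:Lif V w" using cover_lift[OF U _ w] by metis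
 let ?t = "nabla F V v (mr F U V s)"
 have tc: "?t:cF V" using F.nabla_closed[OF V(1) liftsD(1)[OF V(4)]] U V sc by simp
 have "along V w (mr F U V s) ?t" by(rule along_local[OF V(1) ann_res[OF U s V(1,3)] tc])
   (use V U sc tc in \<open>auto intro!: exI[of _ V] exI[of _ v] simp: F.mres_id\<close>)
 thus "EX V t. opn V & p:V & V<=U & t:cF V & along V w (mr F U V s) t" using V tc by blast
next
 fix V N t assume "opn V" "opn N" "N<=V" "V<=U" "t:cF V" "along V w (mr F U V s) t"
 thus "along N w (mr F U N s) (mr F V N t)" using along_res[of V N "mr F U V s" w t] U sc by(simp add: F.mres_trans)
next
 fix V t t' assume V: "opn V" "V<=U" "along V w (mr F U V s) t" "along V w (mr F U V s) t'"
 have wV: "vf_res W V w:TW V" using W.tan_res[OF w] V by simp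
 have "Lif N w = Lif N (vf_res W V w)" if "N<=V" for N using that unfolding lifts_def by(auto simp: W.vf_res_app dest: subset_trans)
 hence "along V w = along V (vf_res W V w)" by(auto simp: along_def fun_eq_iff)
 thus "t = t'" using along_unique[OF V(1) wV] V by simp
qed blast
then obtain t where t: "t:cF U" "!!V t'. opn V ==> V<=U ==> t':cF V ==> along V w (mr F U V s) t' ==> mr F U V t = t'" by blast
have "along U w s t"
proof(rule along_local[OF U s t(1)])
 fix p assume "p:U"
 then obtain V ths v where V: "opn V" "p:V" "V<=U" "v:Lif V w" using cover_lift[OF U _ w] by metis
 let ?t = "nabla F V v (mr F U V s)"
 have tc: "?t:cF V" using F.nabla_closed[OF V(1) liftsD(1)[OF V(4)]] U V sc by simp
 have "along V w (mr F U V s) ?t" by(rule along_local[OF V(1) ann_res[OF U s V(1,3)] tc])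
   (use V U sc tc in \<open>auto intro!: exI[of _ V] exI[of _ v] simp: F.mres_id\<close>)
 thus "lifted_at p U w t s" using t(2)[OF V(1,3) tc] V by blast
qed
thus ?thesis by blast
qed

lemma nabla_N_along:
assumes "opn U" "w:TW U" "s:ann U"
shows "along U w s (nabla dF U w s)"
proof -
have "nabla dF U w s = (THE t. along U w s t)" by(simp add: direct_image_obj_def along_def)
thus ?thesis using theI'[of "along U w s"] along_exists[OF assms] along_unique[OF assms(1,2)] by metis
qed

lemma nabla_N_cl: "opn U ==> w:TW U ==> s:ann U ==> nabla dF U w s:cF U" using nabla_N_along by(auto simp: along_def)

lemma nabla_N_lift:
assumes "opn U" "w:TW U" "s:ann U" "opn V" "V<=U" "v:Lif V w"
shows "mr F U V (nabla dF U w s) = nabla F V v (mr F U V s)"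
using nabla_N_along[OF assms(1-3)] assms(4-6) by(auto simp: along_def)

lemma nabla_N_eqI:
assumes "opn U" "w:TW U" "s:ann U" "t:cF U" "!!p. p:U ==> lifted_at p U w t s"
shows "nabla dF U w s = t"
using along_unique[OF assms(1,2) nabla_N_along[OF assms(1-3)] along_local[OF assms(1,3-5)]] by blast

lemma br_vertical:
assumes u: "u:DZ V i" "u:Vtan V"
 and v: "v:DZ V j" "v:Lif V w" and w: "w:TW U" "V<=U"
shows "vf_br Z V i j u v:Vtan V"
unfolding vertical_tangent_def
proof(intro CollectI conjI allI impI ballI)
show "vf_br Z V i j u v:TZ V" by(rule Z.der_tan[OF Z.vf_br_der[OF u(1) v(1)]])
fix N b assume "opn N & N<=V" and b: "b:cW N"
hence N: "opn N" "N<=V" "N<=U" using w(2) by auto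
interpret N: sring "Oz N" by(rule sc[OF N(1)])
have wb: "w N b:cW N" using W.tan_cl[OF w(1)] N b by simp
show "vf_br Z V i j u v N (sg N b) = 0[Oz N]" using N b wb verticalD(2)[OF u(2) N(1,2) b] verticalD(2)[OF u(2) N(1,2) wb] liftsD(2)[OF v(2) N(1,2) b]
 by(simp add: Z.vf_br_app Z.der_zero[OF v(1) N(1,2)])
qed

text \<open>For vertical \<open>u\<close> flatness expresses $\nabla_u \nabla_v s$ by $\nabla_v \nabla_u s = 0$ and $\nabla_{[u,v]} s$, and
  $[u,v]$ is vertical if \<open>v\<close> lifts a field on the base.\<close>

lemma nabla_N_ann:
assumes U: "opn U" and w: "w:TW U" and s: "s:ann U"
shows "nabla dF U w s:ann U"
proof(rule ann_local[OF U nabla_N_cl[OF assms]])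
have hom: "nabla F V v s':ann V" if V: "opn V" "V<=U" and v: "v:DZ V j" "v:Lif V w'" and w': "w':TW U" and s': "s':ann V"
 for V v j w' s'
proof(rule annI[OF V(1)])
 note vt = liftsD(1)[OF v(2)]
 show "nabla F V v s':cF V" by(rule F.nabla_closed[OF V(1) vt annD(1)[OF s']])
 fix N i u assume N: "opn N" "N<=V" and u: "u:DZ N i" "u:Vtan N"
 interpret N: abelian_group "Fs N" by(rule F.M_ag[OF N(1)])
 let ?v = "vf_res Z N v"
 have sN: "mr F V N s':cF N" using annD(1)[OF s'] V N by simp
 have v': "?v:DZ N j" by(rule Z.vf_res_der[OF v(1) N(2)])
 have vert: "vf_br Z N i j u ?v:Vtan N" by(rule br_vertical[OF u v' lifts_res[OF v(2) N] w']) (use N V in blast)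
 have 0: "nabla F N u (mr F V N s') = 0[Fs N]" by(rule annD(2)[OF s' N u(2)])
 have c: "nabla F N u (nabla F N ?v (mr F V N s')):cF N" by(intro F.nabla_closed[OF N(1)] Z.der_tan[OF u(1)] Z.der_tan[OF v'] sN)
 have "0[Fs N] = nabla F N u (nabla F N ?v (mr F V N s'))"
  using F.nabla_flat[OF N(1) u(1) v' sN] annD(2)[OF s' N vert] 0 F.nabla_zero[OF N(1) Z.der_tan[OF v']] c
  by(simp add: N.minus_eq)
 thus "nabla F N u (mr F V N (nabla F V v s')) = 0[Fs N]" using F.nabla_res[OF V(1) N vt annD(1)[OF s']] by simp
qed
obtain w0 w1 where d: "w0:DW U False" "w1:DW U True" "w = vf_add W U w0 w1" using w by(rule W.tanE)
note wt = W.der_tan[OF d(1)] W.der_tan[OF d(2)]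
fix p assume p: "p:U"
obtain V ths v where V: "chart V ths" "opn V" "p:V" "V<=U" "v:Lif V w" using cover_lift[OF U p w] .
obtain v0 v1 where v: "v0:DZ V False" "v1:DZ V True" "v = vf_add Z V v0 v1" using liftsD(1)[OF V(5)] by(rule Z.tanE)
note vt = Z.der_tan[OF v(1)] Z.der_tan[OF v(2)]
have "vf_add Z V v0 v1:Lif V (vf_add W V (vf_res W V w0) (vf_res W V w1))" using V(2,4,5) unfolding v(3) d(3) lifts_def
 by(auto simp: W.vf_res_app W.vf_add_app dest: subset_trans)
from lift_parts[OF this v(1,2) W.vf_res_der[OF d(1) V(4)] W.vf_res_der[OF d(2) V(4)]]
have l: "v0:Lif V w0" "v1:Lif V w1" unfolding lifts_def by(auto simp: W.vf_res_app)
note sV = ann_res[OF U s V(2,4)]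
have "mr F U V (nabla dF U w s) = nabla F V v0 (mr F U V s)+[Fs V] nabla F V v1 (mr F U V s)"
 using nabla_N_lift[OF U w s V(2,4,5)] F.nabla_vf_add[OF V(2) vt annD(1)[OF sV]] v(3) by simp
also have "...:ann V" by(rule ann_add[OF V(2) hom[OF V(2,4) v(1) l(1) wt(1) sV] hom[OF V(2,4) v(2) l(2) wt(2) sV]])
finally show "EX V. opn V & p:V & V<=U & mr F U V (nabla dF U w s):ann V" using V by blast
qed

lemma N_smod:
assumes U: "opn U" shows "left_supermodule (Ow U) (Sec dF U)"
proof -
interpret O: left_supermodule "Oz U" "Fs U" by(rule M_smod[OF U])
interpret B: sring "Ow U" by(rule scW[OF U])
interpret N: gr_ag "Sec dF U" "mg (Sec dF U)" by(rule N_graded[OF U])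
show ?thesis
proof unfold_locales
 show "graded_group (Sec dF U) (mg (Sec dF U))" by(rule N.grading)
 fix a s assume "a:cW U" "s:C (Sec dF U)"
 thus "a.*[Sec dF U] s:C (Sec dF U)" by(simp add: ann_smult[OF U])
next
 fix i j a s assume as: "a:grade (Ow U) i" "s:mg (Sec dF U) j"
 thus "a.*[Sec dF U] s:mg (Sec dF U) (i ~= j)" using O.mgrade_smult[OF sg_grade[OF U as(1)], of s j] ann_smult[OF U B.gr_car[OF as(1)]] by simp
qed (use U annD(1) in \<open>simp_all add: sg_add sg_mult sg_one O.smult_l_distr O.smult_r_distr O.smult_assoc O.smult_one\<close>)
qed

lemma N_sheaf: "set_sheaf (base_top W) (%U. C (Sec dF U)) (mr dF)"
proof
fix Vt f
assume oV: "!!V. V:Vt ==> op_in W V" and f: "!!V. V:Vt ==> f V:C (Sec dF V)"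
 and c: "!!V N. V:Vt ==> N:Vt ==> mr dF V (V Int N) (f V) = mr dF N (V Int N) (f N)"
have ex1: "EX! s. s:C (Fs (\<Union>Vt)) & (ALL V:Vt. mr F (\<Union>Vt) V s = f V)"
 by(rule set_sheaf.glue[OF F.mod_sheaf]) (use oV f annD(1) c in auto)
then obtain s where s: "s:C (Fs (\<Union>Vt))" "ALL V:Vt. mr F (\<Union>Vt) V s = f V" by blast
have o: "opn (\<Union>Vt)" using oV by auto
have "s:ann (\<Union>Vt)"
proof(rule ann_local[OF o s(1)])
 fix p assume "p:\<Union>Vt"
 then obtain V where "V:Vt" "p:V" by blast
 thus "EX V. opn V & p:V & V <= \<Union>Vt & mr F (\<Union>Vt) V s:ann V" using s(2) f oV by(intro exI[of _ V]) auto
qed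
thus "EX! s. s:C (Sec dF (\<Union>Vt)) & (ALL V:Vt. mr dF (\<Union>Vt) V s = f V)"
proof(intro ex1I[of _ s] conjI)
 fix t assume t: "t:C (Sec dF (\<Union>Vt)) & (ALL V:Vt. mr dF (\<Union>Vt) V t = f V)"
 hence "t:C (Fs (\<Union>Vt)) & (ALL V:Vt. mr F (\<Union>Vt) V t = f V)" using annD(1)[of t] by simp
 thus "t = s" using ex1 s by blast
qed (use s in simp_all)
qed (auto simp: ann_res F.mres_id[OF _ annD(1)] F.mres_trans[OF _ _ _ _ _ annD(1)])

text \<open>The axioms are checked locally, where they are those of \<open>F\<close>: sums, multiples and brackets of lifts
  lift the sums, multiples and brackets.\<close>

lemma dir_im_mod: "D_module L W dF"
proof(rule D_module.intro)
show "set_sheaf (base_top W) (%U. C (Sec dF U)) (mr dF)" by(rule N_sheaf)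
fix U assume "op_in W U"
hence U: "opn U" by simp
show "left_supermodule (Ow U) (Sec dF U)" by(rule N_smod[OF U])
interpret M: left_supermodule "Oz U" "Fs U" by(rule M_smod[OF U])
interpret B: sring "Ow U" by(rule scW[OF U])
{ fix V assume "op_in W V" and VU: "V<=U"
 hence V: "opn V" by simp
 show "mr dF U V (s+[Sec dF U] t) = mr dF U V s+[Sec dF V] mr dF U V t" if "s:C (Sec dF U)" "t:C (Sec dF U)" for s t
  using that annD(1) U V VU by(simp add: F.mod_res_add)
 show "mr dF U V (f.*[Sec dF U] s) = fr W U V f.*[Sec dF V] mr dF U V s" if "f:cW U" "s:C (Sec dF U)" for f s
  using that annD(1) U V VU by(simp add: F.mod_res_smult sg_res)
 show "mr dF U V ` mg (Sec dF U) i <= mg (Sec dF V) i" for i using F.mod_res_grade[OF U V VU, of i] ann_res[OF U _ V VU] by auto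
 show "mr dF U V (nabla dF U w s) = nabla dF V (vf_res W V w) (mr dF U V s)" if w: "w:TW U" and s: "s:C (Sec dF U)" for w s
 proof -
  have s': "s:ann U" using s by simp
  have wV: "vf_res W V w:TW V" using W.tan_res[OF w] V VU by simp
  have "nabla dF V (vf_res W V w) (mr F U V s) = mr F U V (nabla dF U w s)"
  proof(rule nabla_N_eqI[OF V wV ann_res[OF U s' V VU]])
   show "mr F U V (nabla dF U w s):cF V" using nabla_N_cl[OF U w s'] U V VU by simp
   fix p assume "p:V"
   then obtain N ths v where N: "opn N" "p:N" "N<=V" "v:Lif N (vf_res W V w)" using cover_lift[OF V _ wV] by metis
   have v: "v:Lif N w" using N unfolding lifts_def by(auto simp: W.vf_res_app dest: subset_trans)
   have NU: "N<=U" using N VU by blast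
   show "lifted_at p V (vf_res W V w) (mr F U V (nabla dF U w s)) (mr F U V s)"
    using N nabla_N_lift[OF U w s' N(1) NU v] nabla_N_cl[OF U w s'] annD(1)[OF s'] U V VU
    by(intro exI[of _ N] exI[of _ v]) (simp add: F.mres_trans)
  qed
  thus ?thesis by simp
 qed }
{ fix w s assume w: "w:TW U" and s: "s:C (Sec dF U)"
 hence s': "s:ann U" by simp
 note sc = annD(1)[OF s']
 show "nabla dF U w s:C (Sec dF U)" using nabla_N_ann[OF U w s'] by simp
 show "nabla dF U w (s+[Sec dF U] t) = nabla dF U w s+[Sec dF U] nabla dF U w t" if "t:C (Sec dF U)" for t
 proof -
  have t': "t:ann U" using that by simp
  have "nabla dF U w (s+[Fs U] t) = nabla dF U w s+[Fs U] nabla dF U w t"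
  proof(rule nabla_N_eqI[OF U w ann_add[OF U s' t']])
   fix p assume "p:U"
   then obtain V ths v where V: "opn V" "p:V" "V<=U" "v:Lif V w" using cover_lift[OF U _ w] by metis
   thus "lifted_at p U w (nabla dF U w s+[Fs U] nabla dF U w t) (s+[Fs U] t)"
    using nabla_N_lift[OF U w s' V(1,3,4)] nabla_N_lift[OF U w t' V(1,3,4)] U sc annD(1)[OF t']
     nabla_N_cl[OF U w s'] nabla_N_cl[OF U w t'] liftsD(1)[OF V(4)]
    by(intro exI[of _ V] exI[of _ v]) (simp add: F.mod_res_add F.nabla_add)
  qed (use nabla_N_cl[OF U w] s' t' in simp)
  thus ?thesis by simp
 qed
 show "nabla dF U (vf_add W U w w') s = nabla dF U w s+[Sec dF U] nabla dF U w' s" if w': "w':TW U" for w'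
 proof -
  have "nabla dF U (vf_add W U w w') s = nabla dF U w s+[Fs U] nabla dF U w' s"
  proof(rule nabla_N_eqI[OF U W.vf_add_tan[OF w w'] s'])
   fix p assume p: "p:U"
   obtain V ths v where V: "chart V ths" "opn V" "p:V" "V<=U" "v:Lif V w" using cover_lift[OF U p w] .
   obtain v' where v': "v':Lif V w'" using tan_lift_exists[OF V(1) w' V(4)] by blast
   have "vf_add Z V v v':Lif V (vf_add W U w w')" unfolding lifts_def
   proof(intro CollectI conjI allI impI ballI Z.vf_add_tan[OF liftsD(1)[OF V(5)] liftsD(1)[OF v']])
    fix N b assume "opn N & N<=V" and b: "b:cW N"
    hence N: "opn N" "N<=V" "N<=U" "op_in W N" using V(4) by auto
    show "vf_add Z V v v' N (sg N b) = sg N (vf_add W U w w' N b)" using N b W.tan_cl[OF w N(4,3) b] W.tan_cl[OF w' N(4,3) b]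
     by(simp add: Z.vf_add_app W.vf_add_app liftsD(2)[OF V(5)] liftsD(2)[OF v'] sg_add)
   qed
   thus "lifted_at p U (vf_add W U w w') (nabla dF U w s+[Fs U] nabla dF U w' s) s"
    using V nabla_N_lift[OF U w s' V(2,4,5)] nabla_N_lift[OF U w' s' V(2,4) v'] U sc
     nabla_N_cl[OF U w s'] nabla_N_cl[OF U w' s'] liftsD(1)[OF V(5)] liftsD(1)[OF v']
    by(intro exI[of _ V] exI[of _ "vf_add Z V v v'"]) (simp add: F.mod_res_add F.nabla_vf_add)
  qed (use nabla_N_cl[OF U] w w' s' in simp)
  thus ?thesis by simp
 qed
 show "nabla dF U (vf_smult W U f w) s = f.*[Sec dF U] nabla dF U w s" if f: "f:cW U" for f
 proof -
  have U': "op_in W U" using U by simp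
  have "nabla dF U (vf_smult W U f w) s = sg U f.*[Fs U] nabla dF U w s"
  proof(rule nabla_N_eqI[OF U W.vf_smult_tan[OF U' f w] s'])
   fix p assume p: "p:U"
   obtain V ths v where V: "chart V ths" "opn V" "p:V" "V<=U" "v:Lif V w" using cover_lift[OF U p w] .
   have fV: "fr W U V f:cW V" using W.res_closed[of U V f] U V f by simp
   have "vf_smult Z V (sg V (fr W U V f)) v:Lif V (vf_smult W U f w)" unfolding lifts_def
   proof(intro CollectI conjI allI impI ballI Z.vf_smult_tan[OF V(2) _ liftsD(1)[OF V(5)]])
    fix N b assume "opn N & N<=V" and b: "b:cW N"
    hence N: "opn N" "N<=V" "N<=U" "op_in W N" using V(4) by auto
    have "fr Z V N (sg V (fr W U V f)) = sg N (fr W U N f)" using sg_res[OF V(2) N(1,2) fV] W.res_trans[of U V N f] U V N f by simp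
    thus "vf_smult Z V (sg V (fr W U V f)) v N (sg N b) = sg N (vf_smult W U f w N b)" using N b W.tan_cl[OF w N(4,3) b] W.res_closed[of U N f] U f
     by(simp add: Z.vf_smult_app W.vf_smult_app liftsD(2)[OF V(5)] sg_mult)
   qed (use fV V(2) in simp)
   thus "lifted_at p U (vf_smult W U f w) (sg U f.*[Fs U] nabla dF U w s) s"
    using V nabla_N_lift[OF U w s' V(2,4,5)] U sc f fV nabla_N_cl[OF U w s'] liftsD(1)[OF V(5)]
    by(intro exI[of _ V] exI[of _ "vf_smult Z V (sg V (fr W U V f)) v"]) (simp add: F.mod_res_smult F.nabla_vf_smult sg_res)
  qed (use nabla_N_cl[OF U w s'] U f in \<open>simp add: M.smult_closed\<close>)
  thus ?thesis by simp
 qed }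
{ fix i w assume w: "w:DW U i"
 note wt = W.der_tan[OF w]
 show "nabla dF U w ` mg (Sec dF U) j <= mg (Sec dF U) (i ~= j)" for j
 proof safe
  fix s assume "s:mg (Sec dF U) j"
  hence s: "s:mg (Fs U) j" "s:ann U" by auto
  have "nabla dF U w s:mg (Fs U) (i ~= j)"
  proof(rule F.mlocal_grade[OF U nabla_N_cl[OF U wt s(2)]])
   fix p assume p: "p:U"
   obtain V ths v where V: "opn V" "p:V" "V<=U" "v:DZ V i" "v:Lif V w" using cover_lift_homog[OF U p w] by metis
   have "mr F U V s:mg (Fs V) j" using F.mod_res_grade[OF U V(1,3)] s(1) by blast
   hence "mr F U V (nabla dF U w s):mg (Fs V) (i ~= j)" using F.nabla_grade[OF V(1,4), of j] nabla_N_lift[OF U wt s(2) V(1,3,5)] by auto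
   thus "EX V. opn V & p:V & V<=U & mr F U V (nabla dF U w s):mg (Fs V) (i ~= j)" using V by blast
  qed
  thus "nabla dF U w s:mg (Sec dF U) (i ~= j)" using nabla_N_ann[OF U wt s(2)] by simp
 qed
 show "nabla dF U w (f.*[Sec dF U] s) = w U f.*[Sec dF U] s+[Sec dF U] koszul (Sec dF U) i j (f.*[Sec dF U] nabla dF U w s)"
  if f: "f:grade (Ow U) j" and s: "s:C (Sec dF U)" for j f s
 proof -
  have s': "s:ann U" using s by simp
  note sc = annD(1)[OF s'] and fc = B.gr_car[OF f]
  have U': "op_in W U" using U by simp
  have wf: "w U f:cW U" by(rule W.der_cl[OF w U' le fc])
  have fs: "sg U f.*[Fs U] nabla dF U w s:ann U" by(rule ann_smult[OF U fc nabla_N_ann[OF U wt s']])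
  have "nabla dF U w (sg U f.*[Fs U] s) = sg U (w U f).*[Fs U] s+[Fs U] koszul (Fs U) i j (sg U f.*[Fs U] nabla dF U w s)"
  proof(rule nabla_N_eqI[OF U wt ann_smult[OF U fc s']])
   fix p assume p: "p:U"
   obtain V ths v where V: "opn V" "p:V" "V<=U" "v:DZ V i" "v:Lif V w" using cover_lift_homog[OF U p w] by metis
   have V': "op_in W V" using V by simp
   have fV: "fr W U V f:grade (Ow V) j" by(rule W.res_grade[OF U' V' V(3) f])
   have fVc: "fr W U V f:cW V" by(rule W.res_closed[OF U' V' V(3) fc])
   have "nabla F V v (mr F U V (sg U f.*[Fs U] s)) = nabla F V v (sg V (fr W U V f).*[Fs V] mr F U V s)"
    using U V sc fc by(simp add: F.mod_res_smult sg_res)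
   also have "... = v V (sg V (fr W U V f)).*[Fs V] mr F U V s+[Fs V] koszul (Fs V) i j (sg V (fr W U V f).*[Fs V] nabla F V v (mr F U V s))"
    by(rule F.nabla_Leibniz[OF V(1,4) sg_grade[OF V(1) fV]]) (use U V sc in simp)
   also have "v V (sg V (fr W U V f)) = fr Z U V (sg U (w U f))"
    using liftsD(2)[OF V(5,1) le fVc] W.der_res[OF w U' le V' V(3) fc] sg_res[OF U V(1,3) wf] by simp
   also have "nabla F V v (mr F U V s) = mr F U V (nabla dF U w s)" using nabla_N_lift[OF U wt s' V(1,3,5)] by simp
   finally have "mr F U V (sg U (w U f).*[Fs U] s+[Fs U] koszul (Fs U) i j (sg U f.*[Fs U] nabla dF U w s)) =
     nabla F V v (mr F U V (sg U f.*[Fs U] s))"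
    using U V sc wf fc annD(1)[OF fs] nabla_N_cl[OF U wt s']
    by(simp add: F.mod_res_add F.mod_res_smult sg_res M.smult_closed addmap_ksz[OF F.M_ag[OF U] F.M_ag[OF V(1)] F.add_mres[OF U V(1,3)]])
   thus "EX V v. opn V & p:V & V<=U & v:Lif V w & mr F U V (sg U (w U f).*[Fs U] s+[Fs U] koszul (Fs U) i j (sg U f.*[Fs U] nabla dF U w s)) =
     nabla F V v (mr F U V (sg U f.*[Fs U] s))" using V by blast
  qed (use U sc wf annD(1)[OF fs] in \<open>simp add: M.smult_closed\<close>)
  thus ?thesis using fs by(simp add: N_ksz[OF U])
 qed
 show "nabla dF U (vf_br W U i j w w') s = nabla dF U w (nabla dF U w' s) -[Sec dF U] koszul (Sec dF U) i j (nabla dF U w' (nabla dF U w s))"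
  if w': "w':DW U j" and s: "s:C (Sec dF U)" for j w' s
 proof -
  have s': "s:ann U" using s by simp
  note sc = annD(1)[OF s']
  note wt' = W.der_tan[OF w'] and bt = W.der_tan[OF W.vf_br_der[OF w w']]
  note a1 = nabla_N_ann[OF U wt' s'] and a2 = nabla_N_ann[OF U wt s']
  note b1 = nabla_N_ann[OF U wt a1] and b2 = nabla_N_ann[OF U wt' a2]
  have "nabla dF U (vf_br W U i j w w') s = nabla dF U w (nabla dF U w' s) -[Fs U] koszul (Fs U) i j (nabla dF U w' (nabla dF U w s))"
  proof(rule nabla_N_eqI[OF U bt s'])
   fix p assume p: "p:U"
   obtain V ths v where V: "chart V ths" "opn V" "p:V" "V<=U" "v:DZ V i" "v:Lif V w" using cover_lift_homog[OF U p w] .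
   obtain N ths' v' where N: "chart N ths'" "opn N" "p:N" "N<=V" "v':DZ N j" "v':Lif N (vf_res W V w')"
    using cover_lift_homog[OF V(2,3) W.vf_res_der[OF w' V(4)]] .
   have NU: "N<=U" using N V by blast
   let ?v = "vf_res Z N v"
   have v: "?v:DZ N i" "?v:Lif N w" using Z.vf_res_der[OF V(5) N(4)] lifts_res[OF V(6) N(2,4)] by auto
   have v': "v':Lif N w'" using N(4,6) unfolding lifts_def by(auto simp: W.vf_res_app dest: subset_trans)
   have sN: "mr F U N s:cF N" using sc U N(2) NU by simp
   have br: "vf_br Z N i j ?v v':Lif N (vf_br W U i j w w')" unfolding lifts_def
   proof(intro CollectI conjI allI impI ballI Z.der_tan[OF Z.vf_br_der[OF v(1) N(5)]])
    fix P b assume "opn P & P<=N" and b: "b:cW P"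
    hence P: "opn P" "P<=N" "P<=U" "op_in W P" using NU by auto
    interpret P: abelian_group "Ow P" by(rule groups(2)[OF P(1)])
    note wc = W.der_cl[OF w P(4,3)] W.der_cl[OF w' P(4,3)]
    show "vf_br Z N i j ?v v' P (sg P b) = sg P (vf_br W U i j w w' P b)"
     using P b wc by(simp add: Z.vf_br_app W.vf_br_app liftsD(2)[OF v(2)] liftsD(2)[OF v'] sg_minus sg_ksz)
   qed
   have "nabla F N (vf_br Z N i j ?v v') (mr F U N s) =
    nabla F N ?v (nabla F N v' (mr F U N s)) -[Fs N] koszul (Fs N) i j (nabla F N v' (nabla F N ?v (mr F U N s)))"
    by(rule F.nabla_flat[OF N(2) v(1) N(5) sN])
   also have "... = mr F U N (nabla dF U w (nabla dF U w' s) -[Fs U] koszul (Fs U) i j (nabla dF U w' (nabla dF U w s)))"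
    using U N(2) NU annD(1)[OF b1] annD(1)[OF b2] nabla_N_lift[OF U wt a1 N(2) NU v(2)] nabla_N_lift[OF U wt' a2 N(2) NU v']
     nabla_N_lift[OF U wt s' N(2) NU v(2)] nabla_N_lift[OF U wt' s' N(2) NU v']
    by(simp add: F.mres_minus addmap_ksz[OF F.M_ag[OF U] F.M_ag[OF N(2)] F.add_mres[OF U N(2) NU]])
   finally show "EX V v. opn V & p:V & V<=U & v:Lif V (vf_br W U i j w w') &
     mr F U V (nabla dF U w (nabla dF U w' s) -[Fs U] koszul (Fs U) i j (nabla dF U w' (nabla dF U w s))) =
     nabla F V v (mr F U V s)"
    using N(2,3) NU br by(intro exI[of _ N] exI[of _ "vf_br Z N i j ?v v'"]) simp
  qed (use U annD(1)[OF b1] annD(1)[OF b2] in simp)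
  thus ?thesis using b2 ann_ksz[OF U b2] by(simp add: N_ksz[OF U] N_minus[OF U])
 qed }
qed

end

section \<open>Morphisms\<close>

text \<open>Morphisms between modules whose sections may have different types.\<close>

definition dmor :: "'l complex_superalgebra => ('p, 'l, 'a) superspace =>
  ('p, 'a, 'm) dmodule => ('p, 'a, 'n) dmodule => ('p set => 'm => 'n) => bool" where
"dmor L Z F G h <-> (ALL U. op_in Z U --> h U:C (Sec F U) \<rightarrow> C (Sec G U) &
  (ALL i. h U ` mg (Sec F U) i <= mg (Sec G U) i) &
  (ALL s:C (Sec F U). ALL t:C (Sec F U). h U (s+[Sec F U] t) = h U s+[Sec G U] h U t) &
  (ALL f:C (fun_ring Z U). ALL s:C (Sec F U). h U (f.*[Sec F U] s) = f.*[Sec G U] h U s) &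
  (ALL v:tangent L Z U. ALL s:C (Sec F U). h U (nabla F U v s) = nabla G U v (h U s)) &
  (ALL V s. op_in Z V & V<=U & s:C (Sec F U) --> h V (mr F U V s) = mr G U V (h U s)))"

lemma dmod_hom_iff: "h:dmod_hom L Z F G <-> h = dmap_mk Z F h & dmor L Z F G h" by(simp add: dmod_hom_def dmor_def)

lemma dmorI:
assumes "!!U s. op_in Z U ==> s:C (Sec F U) ==> h U s:C (Sec G U)"
 and "!!U i s. op_in Z U ==> s:mg (Sec F U) i ==> h U s:mg (Sec G U) i"
 and "!!U s t. op_in Z U ==> s:C (Sec F U) ==> t:C (Sec F U) ==> h U (s+[Sec F U] t) = h U s+[Sec G U] h U t"
 and "!!U f s. op_in Z U ==> f:C (fun_ring Z U) ==> s:C (Sec F U) ==> h U (f.*[Sec F U] s) = f.*[Sec G U] h U s"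
 and "!!U v s. op_in Z U ==> v:tangent L Z U ==> s:C (Sec F U) ==> h U (nabla F U v s) = nabla G U v (h U s)"
 and "!!U V s. op_in Z U ==> op_in Z V ==> V<=U ==> s:C (Sec F U) ==> h V (mr F U V s) = mr G U V (h U s)"
shows "dmor L Z F G h"
unfolding dmor_def using assms by(intro allI impI conjI funcsetI ballI image_subsetI) auto

context
fixes L Z F G h U
assumes h: "dmor L Z F G h" and U: "op_in Z U"
begin

lemma mor_cl: "s:C (Sec F U) ==> h U s:C (Sec G U)" using h U by(auto simp: dmor_def)

lemma mor_grade: "s:mg (Sec F U) i ==> h U s:mg (Sec G U) i" using h[unfolded dmor_def, rule_format, OF U] by(elim conjE) blast

lemma mor_add: "s:C (Sec F U) ==> t:C (Sec F U) ==> h U (s+[Sec F U] t) = h U s+[Sec G U] h U t" using h U by(auto simp: dmor_def)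

lemma mor_smult: "f:C (fun_ring Z U) ==> s:C (Sec F U) ==> h U (f.*[Sec F U] s) = f.*[Sec G U] h U s" using h U by(auto simp: dmor_def)

lemma mor_nabla: "v:tangent L Z U ==> s:C (Sec F U) ==> h U (nabla F U v s) = nabla G U v (h U s)" using h U by(auto simp: dmor_def)

lemma mor_res: "op_in Z V ==> V<=U ==> s:C (Sec F U) ==> h V (mr F U V s) = mr G U V (h U s)" using h U by(auto simp: dmor_def)

lemma add_mor: "addmap (Sec F U) (Sec G U) (h U)" by(rule addmapI) (simp_all add: mor_cl mor_add)

end

lemma mor_id: "dmor L Z F F (%U s. s)" by(rule dmorI) auto

lemma mor_comp:
assumes "dmor L Z F G h" "dmor L Z G H k"
shows "dmor L Z F H (%U s. k U (h U s))"
by(rule dmorI) (simp_all add: mor_cl[OF assms(1)] mor_cl[OF assms(2)] mor_grade[OF assms(1)]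
  mor_grade[OF assms(2)] mor_add[OF assms(1)] mor_add[OF assms(2)] mor_smult[OF assms(1)]
  mor_smult[OF assms(2)] mor_nabla[OF assms(1)] mor_nabla[OF assms(2)] mor_res[OF assms(1)]
  mor_res[OF assms(2)])

lemma mor_cong:
assumes "D_module L Z F" "dmor L Z F G h"
 and eq: "!!U s. op_in Z U ==> s:C (Sec F U) ==> k U s = h U s"
shows "dmor L Z F G k"
proof -
interpret D_module L Z F by fact
note h = assms(2)
have r: "mr F U V s:C (Sec F V)" if "op_in Z U" "op_in Z V" "V<=U" "s:C (Sec F U)" for U V s using set_sheaf.res_closed[OF mod_sheaf that] .
show ?thesis
proof(rule dmorI)
 fix U assume U: "op_in Z U"
 interpret left_supermodule "fun_ring Z U" "Sec F U" by(rule mod_sections[OF U])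
 show "k U s:mg (Sec G U) i" if "s:mg (Sec F U) i" for i s using eq[OF U M.gr_car[OF that]] mor_grade[OF h U that] by simp
 show "k U (s+[Sec F U] t) = k U s+[Sec G U] k U t" if "s:C (Sec F U)" "t:C (Sec F U)" for s t using that U by(simp add: eq mor_add[OF h])
 show "k U (f.*[Sec F U] s) = f.*[Sec G U] k U s" if "f:C (fun_ring Z U)" "s:C (Sec F U)" for f s
  using that U by(simp add: eq smult_closed mor_smult[OF h])
qed (simp_all add: eq r nabla_closed mor_cl[OF h] mor_nabla[OF h] mor_res[OF h])
qed

lemma mor_dmap_mk: "D_module L Z F ==> dmor L Z F G h ==> dmor L Z F G (dmap_mk Z F h)" by(erule (1) mor_cong) (simp add: dmap_mk_def)

lemma mod_graded: "D_module L Z F ==> op_in Z U ==> gr_ag (Sec F U) (mg (Sec F U))"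
using D_module.mod_sections left_supermodule.axioms(2) left_supermodule.mgraded
by(metis gr_ag.intro gr_ag_axioms.intro)

lemma mor_inverse:
assumes F: "D_module L Z F" and G: "D_module L Z G" and h: "dmor L Z F G h"
 and bij: "!!U. op_in Z U ==> bij_betw (h U) (C (Sec F U)) (C (Sec G U))"
shows "dmor L Z G F (%U. inv_into (C (Sec F U)) (h U))"
proof -
interpret F: D_module L Z F by fact
interpret G: D_module L Z G by fact
let ?k = "%U. inv_into (C (Sec F U)) (h U)"
have k: "?k U t:C (Sec F U)" "h U (?k U t) = t" if "op_in Z U" "t:C (Sec G U)" for U t
 using bij_betw_imp_surj_on[OF bij[OF that(1)]] that(2) by(auto intro: inv_into_into f_inv_into_f)
have kI: "?k U t = s" if "op_in Z U" "s:C (Sec F U)" "h U s = t" for U s t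
 using inv_into_f_f[OF bij_betw_imp_inj_on[OF bij[OF that(1)]] that(2)] that(3) by simp
show ?thesis
proof(rule dmorI)
 fix U assume U: "op_in Z U"
 interpret FU: left_supermodule "fun_ring Z U" "Sec F U" by(rule F.mod_sections[OF U])
 interpret GU: left_supermodule "fun_ring Z U" "Sec G U" by(rule G.mod_sections[OF U])
 { fix t assume t: "t:C (Sec G U)"
  show "?k U t:C (Sec F U)" by(rule k(1)[OF U t])
  show "?k U (t+[Sec G U] t') = ?k U t+[Sec F U] ?k U t'" if "t':C (Sec G U)" for t'
   by(rule kI[OF U]) (use k[OF U t] k[OF U that] in \<open>simp_all add: mor_add[OF h U]\<close>)
  show "?k U (f.*[Sec G U] t) = f.*[Sec F U] ?k U t" if "f:C (fun_ring Z U)" for f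
   by(rule kI[OF U]) (use k[OF U t] that in \<open>simp_all add: mor_smult[OF h U] FU.smult_closed\<close>)
  show "?k U (nabla G U v t) = nabla F U v (?k U t)" if "v:tangent L Z U" for v
   by(rule kI[OF U]) (use k[OF U t] that in \<open>simp_all add: mor_nabla[OF h U] F.nabla_closed[OF U]\<close>)
  show "?k V (mr G U V t) = mr F U V (?k U t)" if V: "op_in Z V" "V<=U" for V
   by(rule kI[OF V(1)]) (use k[OF U t] set_sheaf.res_closed[OF F.mod_sheaf U V] in \<open>simp_all add: mor_res[OF h U V]\<close>) }
 fix i t assume t: "t:mg (Sec G U) i"
 note k' = k[OF U GU.M.gr_car[OF t]]
 have "h U (hpart (Sec F U) (mg (Sec F U)) i (?k U t)) = hpart (Sec G U) (mg (Sec G U)) i (h U (?k U t))"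
  by(rule hpart_natural[OF mod_graded[OF F U] mod_graded[OF G U] add_mor[OF h U] _ k'(1)]) (use mor_grade[OF h U] in blast)
 hence "h U (hpart (Sec F U) (mg (Sec F U)) i (?k U t)) = t" using k'(2) GU.M.hpart_homog[OF t] by simp
 hence "?k U t = hpart (Sec F U) (mg (Sec F U)) i (?k U t)" by(rule kI[OF U FU.M.hpart_cl[OF k'(1)]])
 thus "?k U t:mg (Sec F U) i" using FU.M.hpart_in[OF k'(1), of i] by simp
qed
qed

context odd_submersion
begin

lemma odd_dmodI: "D_module L Z F ==> odd_dmod L Z W sg F" by(intro odd_dmod.intro dmod.intro odd_submersion_axioms Z.lambda_superspace_axioms)

abbreviation dir :: "('p, 'a, 'm) dmodule => ('p, 'b, 'm) dmodule" where "dir == direct_image_obj L Z W sg"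

lemma dir_im_mor:
assumes F: "D_module L Z F" and G: "D_module L Z G" and h: "dmor L Z F G h"
shows "dmor L W (dir F) (dir G) h"
proof -
interpret F: odd_dmod L Z W sg F by(rule odd_dmodI[OF F])
interpret G: odd_dmod L Z W sg G by(rule odd_dmodI[OF G])
have h_ann: "h U s:G.ann U" if U: "opn U" and s: "s:F.ann U" for U s unfolding vertical_ann_def
proof(intro CollectI conjI allI impI ballI)
 show "h U s:C (Sec G U)" using mor_cl[OF h U F.annD(1)[OF s]] .
 fix V v assume "opn V & V<=U" and v: "v:Vtan V"
 hence V: "opn V" "V<=U" by auto
 have sV: "mr F U V s:C (Sec F V)" using F.F.mres_cl[OF U V F.annD(1)[OF s]] .
 have "nabla G V v (mr G U V (h U s)) = h V (nabla F V v (mr F U V s))"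
  using mor_res[OF h U V F.annD(1)[OF s]] mor_nabla[OF h V(1) F.verticalD(1)[OF v] sV] by simp
 also have "... = h V 0[Sec F V]" using F.annD(2)[OF s V v] by simp
 also have "... = 0[Sec G V]" by(rule addmap_zero[OF F.F.M_ag[OF V(1)] G.F.M_ag[OF V(1)] add_mor[OF h V(1)]])
 finally show "nabla G V v (mr G U V (h U s)) = 0[Sec G V]" .
qed
show ?thesis
proof(rule dmorI)
 fix U assume "op_in W U"
 hence U: "opn U" by simp
 { fix s assume "s:C (Sec (dir F) U)"
  hence s: "s:F.ann U" "s:C (Sec F U)" using F.annD(1) by auto
  show "h U s:C (Sec (dir G) U)" using h_ann[OF U s(1)] by simp
  show "h U (s+[Sec (dir F) U] t) = h U s+[Sec (dir G) U] h U t" if "t:C (Sec (dir F) U)" for t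
   using that s F.annD(1)[of t] by(simp add: mor_add[OF h U])
  show "h U (f.*[Sec (dir F) U] s) = f.*[Sec (dir G) U] h U s" if "f:cW U" for f using that s U by(simp add: mor_smult[OF h U])
  show "h V (mr (dir F) U V s) = mr (dir G) U V (h U s)" if "op_in W V" "V<=U" for V using that s U by(simp add: mor_res[OF h])
  show "h U (nabla (dir F) U w s) = nabla (dir G) U w (h U s)" if w: "w:TW U" for w
  proof(rule G.nabla_N_eqI[OF U w h_ann[OF U s(1)], symmetric])
   note n = F.nabla_N_cl[OF U w s(1)]
   show "h U (nabla (dir F) U w s):C (Sec G U)" by(rule mor_cl[OF h U n])
   fix p assume p: "p:U"
   obtain V ths v where V: "opn V" "p:V" "V<=U" "v:Lif V w" using F.cover_lift[OF U p w] by metis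
   have "mr G U V (h U (nabla (dir F) U w s)) = nabla G V v (mr G U V (h U s))"
    using mor_res[OF h U V(1,3) n] F.nabla_N_lift[OF U w s(1) V(1,3,4)] mor_res[OF h U V(1,3) s(2)]
     mor_nabla[OF h V(1) liftsD(1)[OF V(4)], of "mr F U V s"] F.F.mres_cl[OF U V(1,3) s(2)] by simp
   thus "EX V v. opn V & p:V & V<=U & v:Lif V w & mr G U V (h U (nabla (dir F) U w s)) = nabla G V v (mr G U V (h U s))" using V by blast
  qed }
 show "h U s:mg (Sec (dir G) U) i" if "s:mg (Sec (dir F) U) i" for i s using that mor_grade[OF h U] h_ann[OF U] by simp
qed
qed

end

context odd_dmod
begin

text \<open>On vertically flat sections, a vector field acts through its image on the base.\<close>

lemma nabla_ann_image:
assumes V: "chart V ths" and v: "v:DZ V i" and ws: "Tim V v ws" and x: "x:ann V"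
shows "nabla F V v x = lsum (Fs V) (%(h, w). h.*[Fs V] nabla dF V w x) ws"
proof -
note oV = c_opn[OF V] and xc = annD(1)[OF x]
have wsD: "h:cO V" "w:TW V" if "(h, w):set ws" for h w using ws that by(auto simp: tan_image_iff)
define e where "e w = (SOME u. u:Lif V w)" for w
have e: "e w:Lif V w" if "(h, w):set ws" for h w
 using tan_lift_exists[OF V wsD(2)[OF that] le] some_in_eq unfolding e_def by(metis all_not_in_conv someI)
let ?u = "Z.vf_sum V fst (%p. e (snd p)) ws"
have t: "fst p:cO V & e (snd p):TZ V" if "p:set ws" for p using wsD(1)[of "fst p" "snd p"] liftsD(1)[OF e, of "fst p" "snd p"] that by simp
have "nabla F V v x = nabla F V ?u x"
proof(rule nabla_ann_cong[OF oV Z.der_tan[OF v] Z.vf_sum_tan[OF oV t] _ x])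
 fix N b assume N: "opn N" "N<=V" and b: "b:cW N"
 have "?u N (sg N b) = lsum (Oz N) (%p. fr Z V N (fst p)*[Oz N] e (snd p) N (sg N b)) ws" by(rule Z.vf_sum_app[OF N]) (use N b in simp)
 also have "... = lsum (Oz N) (%(h, w). fr Z V N h*[Oz N] sg N (w N b)) ws" by(rule lsum_cong) (use liftsD(2)[OF e N b] in auto)
 also have "... = v N (sg N b)" using ws N b by(simp add: tan_image_iff)
 finally show "v N (sg N b) = ?u N (sg N b)" by simp
qed
also have "... = lsum (Fs V) (%p. fst p.*[Fs V] nabla F V (e (snd p)) x) ws" by(rule F.nabla_vf_sum[OF oV xc t])
also have "... = lsum (Fs V) (%(h, w). h.*[Fs V] nabla dF V w x) ws"
proof(rule lsum_cong)
 fix p assume p: "p:set ws"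
 obtain h w where hw: "p = (h, w)" by(cases p)
 have "nabla F V (e w) x = nabla dF V w x" using nabla_N_lift[OF oV wsD(2) x oV le e] p hw F.mres_id[OF oV xc]
   F.mres_id[OF oV nabla_N_cl[OF oV wsD(2) x]] by metis
 thus "fst p.*[Fs V] nabla F V (e (snd p)) x = (case p of (h, w) => h.*[Fs V] nabla dF V w x)" by(simp add: hw)
qed simp
finally show ?thesis .
qed

end

section \<open>Sections of the sheafified tensor product\<close>

locale inv_im_of = odd_submersion L Z W sg + G: dmod L W G
for L :: "'l complex_superalgebra" and Z :: "('p, 'l, 'a) superspace" and W :: "('p, 'l, 'b) superspace"
 and sg :: "'p set => 'b => 'a" and G :: "('p, 'b, 'm) dmodule"
begin

abbreviation Gs :: "'p set => ('b, 'm) supermodule" where "Gs == Sec G"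
abbreviation cG where "cG U == C (Gs U)"
abbreviation teq where "teq N == tensor_eq (Oz N) (Ow N) (sg N) (Gs N)"
abbreviation tens where "tens == tensors Z G"
abbreviation tres where "tres == tensor_res Z G"
abbreviation germ where "germ == tensor_germ Z W sg G"
abbreviation rep where "rep == represents Z W sg G"
abbreviation Ss where "Ss == tensor_sections Z W sg G"
abbreviation R where "R == inverse_image_raw L Z W sg G"
abbreviation Ts where "Ts == Sec R"
abbreviation cT where "cT U == C (Ts U)"

lemma G_smod: "opn U ==> left_supermodule (Ow U) (Gs U)" using G.mod_sections by simp

lemma tens_iff: "l:tens V <-> (ALL (a, s):set l. a:cO V & s:cG V)" by(auto simp: tensors_def in_lists_conv_set)

lemma tens_simps [simp]: "[]:tens V" "(a, s) # l:tens V <-> a:cO V & s:cG V & l:tens V"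
"k @ l:tens V <-> k:tens V & l:tens V"
by(auto simp: tens_iff)

lemma tens_lists: "l:tens V <-> l:lists (cO V \<times> cG V)" by(simp add: tensors_def)

lemma tres_simps [simp]: "tres V N [] = []" "tres V N ((a, s) # l) = (fr Z V N a, mr G V N s) # tres V N l"
"tres V N (k @ l) = tres V N k @ tres V N l"
by(simp_all add: tensor_res_def)

lemma set_tres: "set (tres V N l) = (%(a, s). (fr Z V N a, mr G V N s)) ` set l" by(simp add: tensor_res_def)

context
fixes V N assumes VN: "opn V" "opn N" "N<=V"
begin

lemma gres_cl [simp]: "s:cG V ==> mr G V N s:cG N" using G.mres_cl VN by simp

lemma tres_tens: "l:tens V ==> tres V N l:tens N" using VN by(auto simp: tens_iff set_tres)

end

lemma tres_id: "opn V ==> l:tens V ==> tres V V l = l" by(induction l) (auto simp: Z.res_id G.mres_id)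

lemma tres_trans: "opn U ==> opn V ==> opn N ==> N<=V ==> V<=U ==> l:tens U ==> tres V N (tres U V l) = tres U N l"
by(induction l) (auto simp: Z.res_trans G.mres_trans)

text \<open>The universal property of the tensor product.\<close>

lemma tensor_lift:
assumes V: "opn V" and T: "abelian_group T"
 and ph: "!!a s. a:cO V ==> s:cG V ==> ph a s:C T"
 and left: "!!a a' s. a:cO V ==> a':cO V ==> s:cG V ==> ph (a+[Oz V] a') s = ph a s+[T] ph a' s"
 and right: "!!a s s'. a:cO V ==> s:cG V ==> s':cG V ==> ph a (s+[Gs V] s') = ph a s+[T] ph a s'"
 and bal: "!!a b s. a:cO V ==> b:cW V ==> s:cG V ==> ph (a*[Oz V] sg V b) s = ph a (b.*[Gs V] s)"
 and eq: "teq V l l'"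
shows "l:tens V & l':tens V & lsum T (%(a, s). ph a s) l = lsum T (%(a, s). ph a s) l'"
proof -
interpret T: abelian_group T by(rule T)
interpret O: sring "Oz V" by(rule sc[OF V])
interpret G: left_supermodule "Ow V" "Gs V" by(rule G_smod[OF V])
have c: "(case p of (a, s) => ph a s):C T" if "l:tens V" "p:set l" for l p using that ph by(auto simp: tens_iff)
have app: "lsum T (%(a, s). ph a s) (k @ l) = lsum T (%(a, s). ph a s) k+[T] lsum T (%(a, s). ph a s) l" if "k:tens V" "l:tens V" for k l
 by(rule T.lsum_append) (use c that in auto)
have cl: "lsum T (%(a, s). ph a s) l:C T" if "l:tens V" for l by(rule T.lsum_cl) (use c that in auto)
show ?thesis using eq
proof(induction rule: tensor_eq.induct)
 case (zero s)
 have "ph 0[Oz V] s+[T] ph 0[Oz V] s = ph 0[Oz V] s" using left[of "0[Oz V]" "0[Oz V]" s] zero by simp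
 thus ?case using zero ph[of "0[Oz V]" s] T.add_self_cancel by simp
next
 case (commute k l)
 thus ?case using app cl T.a_comm by(simp add: tens_lists[symmetric])
next
 case (balanced a b s)
 thus ?case using bal[of a b s] ph V by(simp add: G.smult_closed)
qed (use app cl left right ph in \<open>simp_all add: tens_lists[symmetric]\<close>)
qed

lemma teq_tens:
assumes "opn V" "teq V l l'" shows "l:tens V" "l':tens V"
proof -
interpret O: sring "Oz V" by(rule sc[OF assms(1)])
have "l:tens V & l':tens V & lsum (Oz V) (%(a, s). 0[Oz V]) l = lsum (Oz V) (%(a, s). 0[Oz V]) l'"
 by(rule tensor_lift[OF assms(1) O.ag _ _ _ _ assms(2)]) auto
thus "l:tens V" "l':tens V" by auto
qed

lemma teq_map:
assumes V: "opn V" "opn N"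
 and f: "addmap (Oz V) (Oz N) f" and g: "addmap (Gs V) (Sec H N) g"
 and fg: "!!a b s. a:cO V ==> b:cW V ==> s:cG V ==> EX b':cW N. f (a*[Oz V] sg V b) = f a*[Oz N] sg N b' & g (b.*[Gs V] s) = b'.*[Sec H N] g s"
 and eq: "teq V l l'"
shows "tensor_eq (Oz N) (Ow N) (sg N) (Sec H N) (map (%(a, s). (f a, g s)) l) (map (%(a, s). (f a, g s)) l')"
proof -
interpret O: sring "Oz V" by(rule sc[OF V(1)])
interpret N: sring "Oz N" by(rule sc[OF V(2)])
have m: "map (%(a, s). (f a, g s)) l:lists (cO N \<times> C (Sec H N))" if "l:lists (cO V \<times> cG V)" for l
 using that addmap_cl[OF f] addmap_cl[OF g] by(auto simp: in_lists_conv_set)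
have f0: "f 0[Oz V] = 0[Oz N]" by(rule addmap_zero[OF O.ag N.ag f])
show ?thesis using eq
proof(induction rule: tensor_eq.induct)
 case (balanced a b s)
 from fg[OF this] obtain b' where b': "b':cW N" "f (a*[Oz V] sg V b) = f a*[Oz N] sg N b'" "g (b.*[Gs V] s) = b'.*[Sec H N] g s" by blast
 show ?case using tensor_eq.balanced[OF addmap_cl[OF f balanced(1)] b'(1) addmap_cl[OF g balanced(3)]] by(simp add: b')
qed (use m addmap_cl[OF f] addmap_cl[OF g] addmap_add[OF f] addmap_add[OF g] in \<open>auto simp: f0 intro: tensor_eq.intros\<close>)
qed

lemma teq_res:
assumes V: "opn V" "opn N" "N<=V" and eq: "teq V l l'"
shows "teq N (tres V N l) (tres V N l')"
unfolding tensor_res_def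
proof(rule teq_map[OF V(1,2) Z.additive_res[OF V] _ _ eq])
have V': "op_in W V" "op_in W N" using V by auto
show "addmap (Gs V) (Gs N) (mr G V N)" by(rule G.add_mres[OF V' V(3)])
fix a b s assume abs: "a:cO V" "b:cW V" "s:cG V"
show "EX b':cW N. fr Z V N (a*[Oz V] sg V b) = fr Z V N a*[Oz N] sg N b' & mr G V N (b.*[Gs V] s) = b'.*[Gs N] mr G V N s"
 using abs V G.mod_res_smult[OF V' V(3)] W.res_closed[OF V' V(3)]
 by(intro bexI[of _ "fr W V N b"]) (simp_all add: Z.res_mult sg_res)
qed

lemma teq_refl: "l:tens V ==> teq V l l" by(rule tensor_eq.refl) (simp add: tens_lists)

lemma germ_eq_iff:
assumes V: "opn V" "p:V" "l:tens V" and V': "opn V'" "p:V'" "l':tens V'"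
shows "germ p V l = germ p V' l' <-> (EX N. opn N & p:N & N<=V Int V' & teq N (tres V N l) (tres V' N l'))"
proof
have self: "(V', l'):germ p V' l'" using V' by(auto simp: tensor_germ_def tres_id intro!: exI[of _ V'] teq_refl)
assume "germ p V l = germ p V' l'"
hence "(V', l'):germ p V l" using self by simp
thus "EX N. opn N & p:N & N<=V Int V' & teq N (tres V N l) (tres V' N l')" by(auto simp: tensor_germ_def)
next
assume "EX N. opn N & p:N & N<=V Int V' & teq N (tres V N l) (tres V' N l')"
then obtain N where N: "opn N" "p:N" "N<=V Int V'" "teq N (tres V N l) (tres V' N l')" by blast
have "EX M. opn M & p:M & M<=B Int P & teq M (tres B M k') (tres P M m)"
 if A: "opn A" "p:A" "k:tens A" "N<=A" and B: "opn B" "p:B" "k':tens B" "N<=B"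
  and e: "teq N (tres B N k') (tres A N k)"
  and P: "opn P" "p:P" "m:tens P" and M: "EX M. opn M & p:M & M<=A Int P & teq M (tres A M k) (tres P M m)"
 for A k B k' P m
proof -
 obtain M where M: "opn M" "p:M" "M<=A Int P" "teq M (tres A M k) (tres P M m)" using M by blast
 let ?M = "M Int N"
 have o: "opn ?M" "?M<=N" "?M<=M" "?M<=A" "?M<=B" "?M<=P" using M N A B by auto
 have "teq ?M (tres B ?M k') (tres A ?M k)" using teq_res[OF N(1) o(1,2) e] A B N(1) o by(simp add: tres_trans)
 moreover have "teq ?M (tres A ?M k) (tres P ?M m)" using teq_res[OF M(1) o(1,3) M(4)] A P M(1,3) o by(simp add: tres_trans)
 ultimately show ?thesis using o M(2) N(2) by(intro exI[of _ ?M]) (auto intro: tensor_eq.trans)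
qed
note half = this
have NV: "N<=V" "N<=V'" using N(3) by auto
show "germ p V l = germ p V' l'"
proof(rule Set.set_eqI)
 fix y :: "'p set \<times> ('a \<times> 'm) list"
 obtain P m where y: "y = (P, m)" by(cases y)
 show "y:germ p V l <-> y:germ p V' l'" unfolding y tensor_germ_def mem_Collect_eq case_prod_conv
  using half[OF V NV(1) V' NV(2) tensor_eq.sym[OF N(4)], of P m] half[OF V' NV(2) V NV(1) N(4), of P m] by blast
qed
qed

lemma germ_res:
assumes "opn V" "opn N" "p:N" "N<=V" "l:tens V"
shows "germ p N (tres V N l) = germ p V l"
using assms
by(subst germ_eq_iff) (auto intro!: exI[of _ N] teq_refl simp: tres_tens tres_id)

lemma germ_teq: "opn V ==> p:V ==> teq V l l' ==> germ p V l = germ p V l'"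
using teq_tens[of V l l'] by(subst germ_eq_iff) (auto intro!: exI[of _ V] simp: tres_id)

definition sec :: "'p set => ('a \<times> 'm) list => 'p => ('p, 'a, 'm) tensor_germ" where "sec V l = (\<lambda>p\<in>V. germ p V l)"

lemma rep_iff: "rep U s p V l <-> opn V & p:V & V<=U & l:tens V & rst s V = sec V l"
unfolding represents_def sec_def by(auto simp: fun_eq_iff restrict_def)

lemma rep_germ: "rep U s p V l ==> s p = germ p V l" by(simp add: represents_def)

lemma S_iff: "s:Ss U <-> s:extensional U & (ALL p:U. EX V l. rep U s p V l)" by(auto simp: tensor_sections_def)

lemma sec_S: "opn V ==> l:tens V ==> sec V l:Ss V" by(auto simp: S_iff rep_iff sec_def intro!: exI[of _ V] exI[of _ l])

lemma sec_res: "opn V ==> opn N ==> N<=V ==> l:tens V ==> rst (sec V l) N = sec N (tres V N l)"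
by(auto simp: sec_def fun_eq_iff restrict_def germ_res)

lemma sec_teq: "opn V ==> teq V l l' ==> sec V l = sec V l'" using germ_teq by(auto simp: sec_def restrict_def fun_eq_iff)

lemma rep_res: "rep U s p V l ==> opn N ==> q:N ==> N<=V ==> rep U s q N (tres V N l)"
proof -
assume a: "rep U s p V l" "opn N" "q:N" "N<=V"
hence "rst (rst s V) N = sec N (tres V N l)" by(simp add: rep_iff sec_res)
moreover have "rst (rst s V) N = rst s N" using a(4) by(simp add: Int_absorb1)
ultimately show "rep U s q N (tres V N l)" using a by(auto simp: rep_iff tres_tens)
qed

lemma S_ext: "s:Ss U ==> rst s U = s" by(simp add: S_iff extensional_restrict)

lemma S_res: "opn U ==> s:Ss U ==> opn V ==> V<=U ==> rst s V:Ss V" unfolding S_iff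
proof(intro conjI ballI)
fix p assume a: "s:extensional U & (ALL p:U. EX V l. rep U s p V l)" "opn V" "V<=U" "p:V"
then obtain N l where "rep U s p N l" by blast
hence "rep U s p (N Int V) (tres N (N Int V) l)" using a by(intro rep_res) (auto simp: rep_iff)
hence "rep V (rst s V) p (N Int V) (tres N (N Int V) l)" using a(3) by(auto simp: rep_iff Int_absorb1 inf_commute)
thus "EX N l. rep V (rst s V) p N l" by blast
qed auto

lemma S_local:
assumes "opn U" "s:Ss U" "p:U"
obtains V l where "opn V" "p:V" "V<=U" "l:tens V" "rst s V = sec V l"
using assms unfolding S_iff rep_iff by blast

lemma S_eqI:
assumes "s:Ss U" "t:Ss U" "!!p. p:U ==> EX V. p:V & rst s V = rst t V"
shows "s = t"
proof(rule extensionalityI[of s U t])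
show "s:extensional U" "t:extensional U" using assms by(auto simp: S_iff)
fix p assume "p:U"
thus "s p = t p" using assms(3) by(metis restrict_apply')
qed

lemma S_sheaf: "set_sheaf (base_top Z) Ss (%U V s. rst s V)"
proof
fix Vt f
assume o: "!!V. V:Vt ==> opn V" and f: "!!V. V:Vt ==> f V:Ss V"
 and c: "!!V N. V:Vt ==> N:Vt ==> rst (f V) (V Int N) = rst (f N) (V Int N)"
define s where "s = (\<lambda>p\<in>\<Union>Vt. f (SOME V. V:Vt & p:V) p)"
have sV: "s p = f V p" if "V:Vt" "p:V" for V p
proof -
 let ?N = "SOME V. V:Vt & p:V"
 have N: "?N:Vt & p:?N" using someI[of "%V. V:Vt & p:V" V] that by blast
 have "f V p = f ?N p" using fun_cong[OF c[OF that(1), of ?N], of p] N that by simp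
 thus ?thesis using that by(auto simp: s_def)
qed
have rs: "rst s V = f V" if "V:Vt" for V using sV that f[OF that] by(auto simp: fun_eq_iff restrict_def S_iff extensional_def)
show "EX! s. s:Ss (\<Union>Vt) & (ALL V:Vt. rst s V = f V)"
proof(intro ex1I conjI ballI)
 show "s:Ss (\<Union>Vt)" unfolding S_iff
 proof(intro conjI ballI)
  show "s:extensional (\<Union>Vt)" by(auto simp: s_def)
  fix p assume "p:\<Union>Vt"
  then obtain V where V: "V:Vt" "p:V" by blast
  obtain N l where N: "opn N" "p:N" "N<=V" "l:tens N" "rst (f V) N = sec N l" using S_local[OF o[OF V(1)] f[OF V(1)] V(2)] .
  have "rst s N = rst (f V) N" using rs[OF V(1)] N(3) by(metis Int_absorb1 restrict_restrict)
  thus "EX N l. rep (\<Union>Vt) s p N l" using N V by(intro exI[of _ N] exI[of _ l]) (auto simp: rep_iff)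
 qed
 show "rst s V = f V" if "V:Vt" for V by(rule rs[OF that])
 fix t assume t: "t:Ss (\<Union>Vt) & (ALL V:Vt. rst t V = f V)"
 show "t = s"
 proof(rule extensionalityI[of t "\<Union>Vt" s])
  show "t:extensional (\<Union>Vt)" using t by(simp add: S_iff)
  show "s:extensional (\<Union>Vt)" by(auto simp: s_def)
  fix p assume "p:\<Union>Vt"
  then obtain V where V: "V:Vt" "p:V" by blast
  thus "t p = s p" using t rs[OF V(1)] by(metis restrict_apply')
 qed
qed
qed (auto simp: S_res S_ext Int_absorb1)

section \<open>Module structure\<close>

lemma R_simps: "cT U = Ss U" "0[Ts U] = sec U []" "mr R U V s = rst s V" by(simp_all add: inverse_image_raw_def sec_def)

text \<open>Operations defined on germs through representatives are computed by any representative.\<close>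

lemma THE_rep:
assumes r: "rep U s p V l"
 and \<Phi>: "!!V l. opn V ==> V<=U ==> l:tens V ==> \<Phi> V l:tensors Z H V"
 and \<Phi>_res: "!!V N l. opn V ==> V<=U ==> opn N ==> N<=V ==> l:tens V ==> tensor_res Z H V N (\<Phi> V l) = \<Phi> N (tres V N l)"
 and \<Phi>_teq: "!!N l l'. opn N ==> N<=U ==> teq N l l' ==> tensor_eq (Oz N) (Ow N) (sg N) (Sec H N) (\<Phi> N l) (\<Phi> N l')"
 and H: "D_module L W H"
shows "(THE x. EX V l. rep U s p V l & x = tensor_germ Z W sg H p V (\<Phi> V l)) = tensor_germ Z W sg H p V (\<Phi> V l)"
proof(rule the_equality)
show "EX V' l'. rep U s p V' l' & tensor_germ Z W sg H p V (\<Phi> V l) = tensor_germ Z W sg H p V' (\<Phi> V' l')" using r by blast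
fix x assume "EX V l. rep U s p V l & x = tensor_germ Z W sg H p V (\<Phi> V l)"
then obtain V' l' where r': "rep U s p V' l'" "x = tensor_germ Z W sg H p V' (\<Phi> V' l')" by blast
interpret H: inv_im_of L Z W sg H by(intro inv_im_of.intro dmod.intro H odd_submersion_axioms W.lambda_superspace_axioms)
have o: "opn V" "p:V" "V<=U" "l:tens V" "opn V'" "p:V'" "V' <= U" "l':tens V'" using r r'(1) by(auto simp: rep_iff)
have "germ p V l = germ p V' l'" using rep_germ[OF r] rep_germ[OF r'(1)] by simp
then obtain N where N: "opn N" "p:N" "N<=V Int V'" "teq N (tres V N l) (tres V' N l')" using germ_eq_iff[OF o(1,2,4-6,8)] by blast
have "tensor_germ Z W sg H p V (\<Phi> V l) = tensor_germ Z W sg H p V' (\<Phi> V' l')"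
proof(subst H.germ_eq_iff)
 have NU: "N<=U" "N<=V" "N<=V'" using N(3) o by auto
 thus "EX N. opn N & p:N & N<=V Int V' & H.teq N (H.tres V N (\<Phi> V l)) (H.tres V' N (\<Phi> V' l'))"
  using N o \<Phi>_teq[OF N(1) NU(1) N(4)] by(intro exI[of _ N]) (simp add: \<Phi>_res)
qed (use o \<Phi> in auto)
thus "x = tensor_germ Z W sg H p V (\<Phi> V l)" using r'(2) by simp
qed

lemma G_mod: "D_module L W G" by(rule G.D_module_axioms)

lemma add_rep:
assumes s: "rep U s p V k" and t: "rep U t p V l"
shows "rep U (s+[Ts U] t) p V (k @ l)"
proof -
have o: "opn V" "p:V" "V<=U" "k:tens V" "l:tens V" using s t by(auto simp: rep_iff)
have "(s+[Ts U] t) q = germ q V (k @ l)" if q: "q:V" for q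
proof -
 have sq: "rep U s q V k" "rep U t q V l" using s t q by(auto simp: rep_iff)
 have "(THE x. EX V k l. rep U s q V k & rep U t q V l & x = germ q V (k @ l)) = germ q V (k @ l)"
 proof(rule the_equality)
  show "EX V' k' l'. rep U s q V' k' & rep U t q V' l' & germ q V (k @ l) = germ q V' (k' @ l')" using sq by blast
  fix x assume "EX V k l. rep U s q V k & rep U t q V l & x = germ q V (k @ l)"
  then obtain V' k' l' where r: "rep U s q V' k'" "rep U t q V' l'" "x = germ q V' (k' @ l')" by blast
  have o': "opn V'" "q:V'" "k':tens V'" "l':tens V'" using r by(auto simp: rep_iff)
  have "germ q V k = germ q V' k'" "germ q V l = germ q V' l'"
   using rep_germ[OF r(1)] rep_germ[OF r(2)] rep_germ[OF sq(1)] rep_germ[OF sq(2)] by simp_all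
  then obtain N M where N: "opn N" "q:N" "N<=V Int V'" "teq N (tres V N k) (tres V' N k')"
   and M: "opn M" "q:M" "M<=V Int V'" "teq M (tres V M l) (tres V' M l')"
   using germ_eq_iff[OF o(1) q o(4) o'(1-3)] germ_eq_iff[OF o(1) q o(5) o'(1,2,4)] by blast
  let ?N = "N Int M"
  have oN: "opn ?N" "q:?N" "?N<=N" "?N<=M" "?N<=V" "?N<=V'" using N M by auto
  have "teq ?N (tres V ?N k) (tres V' ?N k')" "teq ?N (tres V ?N l) (tres V' ?N l')"
   using teq_res[OF N(1) oN(1,3) N(4)] teq_res[OF M(1) oN(1,4) M(4)] N(1,3) M(1,3) oN o o'
   by(simp_all add: tres_trans)
  hence "teq ?N (tres V ?N (k @ l)) (tres V' ?N (k' @ l'))" by(simp add: tensor_eq.append)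
  hence "germ q V (k @ l) = germ q V' (k' @ l')" using germ_eq_iff[OF o(1) q, of "k @ l" V' "k' @ l'"] o o' oN by auto
  thus "x = germ q V (k @ l)" using r(3) by simp
 qed
 thus ?thesis using q o(3) by(simp add: inverse_image_raw_def subset_iff)
qed
thus ?thesis using o by(auto simp: represents_def)
qed

lemma smult_rep:
assumes U: "opn U" and f: "f:cO U" and s: "rep U s p V l"
shows "rep U (f.*[Ts U] s) p V (map (%(a, t). (fr Z U V f*[Oz V] a, t)) l)"
proof -
have o: "opn V" "p:V" "V<=U" "l:tens V" using s by(auto simp: rep_iff)
let ?\<Phi> = "%V l. map (%(a, t). (fr Z U V f*[Oz V] a, t)) l"
have \<Phi>: "?\<Phi> V l:tens V" if "opn V" "V<=U" "l:tens V" for V l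
proof -
 interpret V: sring "Oz V" by(rule sc[OF that(1)])
 show ?thesis using that Z.res_closed[OF U that(1,2) f] by(auto simp: tens_iff)
qed
have "(f.*[Ts U] s) q = germ q V (?\<Phi> V l)" if q: "q:V" for q
proof -
 have "(THE x. EX V l. rep U s q V l & x = germ q V (?\<Phi> V l)) = germ q V (?\<Phi> V l)"
 proof(rule THE_rep[OF _ _ _ _ G_mod])
  show "rep U s q V l" using s q by(simp add: rep_iff)
  show "?\<Phi> V l:tens V" if "opn V" "V<=U" "l:tens V" for V l by(rule \<Phi>[OF that])
  show "tres V N (?\<Phi> V l) = ?\<Phi> N (tres V N l)" if "opn V" "V<=U" "opn N" "N<=V" "l:tens V" for V N l
   using that U f by(induction l) (auto simp: Z.res_mult Z.res_trans)
  show "teq N (?\<Phi> N l) (?\<Phi> N l')" if N: "opn N" "N<=U" and eq: "teq N l l'" for N l l'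
  proof(rule teq_map[OF N(1) N(1) _ _ _ eq])
   interpret N: sring "Oz N" by(rule sc[OF N(1)])
   note fN = Z.res_closed[OF U N f]
   show "addmap (Oz N) (Oz N) (%a. fr Z U N f*[Oz N] a)" by(rule N.add_mult_left[OF fN])
   show "addmap (Gs N) (Gs N) (%s. s)" by(rule addmap_id)
   show "EX b':cW N. fr Z U N f*[Oz N] (a*[Oz N] sg N b) = fr Z U N f*[Oz N] a*[Oz N] sg N b' & b.*[Gs N] s = b'.*[Gs N] s"
    if "a:cO N" "b:cW N" for a b s
    using that fN N by(intro bexI[of _ b]) (simp_all add: N.m_assoc)
  qed
 qed
 thus ?thesis using q o(3) by(simp add: inverse_image_raw_def subset_iff)
qed
thus ?thesis using o \<Phi> by(auto simp: represents_def)
qed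

lemma S_local2:
assumes "opn U" "s:Ss U" "t:Ss U" "p:U"
obtains V k l where "rep U s p V k" "rep U t p V l"
proof -
obtain V k where V: "rep U s p V k" using assms unfolding S_iff by blast
obtain V' l where V': "rep U t p V' l" using assms unfolding S_iff by blast
have "opn (V Int V')" "p:V Int V'" using V V' by(auto simp: rep_iff)
thus ?thesis using that rep_res[OF V, of "V Int V'" p] rep_res[OF V', of "V Int V'" p] by blast
qed

lemma S_local3:
assumes "opn U" "s:Ss U" "t:Ss U" "u:Ss U" "p:U"
obtains V k l m where "rep U s p V k" "rep U t p V l" "rep U u p V m"
proof -
obtain V k l where V: "rep U s p V k" "rep U t p V l" using S_local2[OF assms(1-3,5)] .
obtain V' m where V': "rep U u p V' m" using assms unfolding S_iff by blast
have "opn (V Int V')" "p:V Int V'" using V V' by(auto simp: rep_iff)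
thus ?thesis using that rep_res[OF V(1), of "V Int V'" p] rep_res[OF V(2), of "V Int V'" p] rep_res[OF V', of "V Int V'" p] by blast
qed

lemma rep_eqI:
assumes "s:Ss U" "t:Ss U" "!!p. p:U ==> EX V k l. rep U s p V k & rep U t p V l & teq V k l"
shows "s = t"
proof(rule S_eqI[OF assms(1,2)])
fix p assume "p:U"
then obtain V k l where "rep U s p V k" "rep U t p V l" "teq V k l" using assms(3) by blast
thus "EX V. p:V & rst s V = rst t V" using sec_teq by(auto simp: rep_iff)
qed

lemma add_cl: "opn U ==> s:Ss U ==> t:Ss U ==> s+[Ts U] t:Ss U"
proof -
assume a: "opn U" "s:Ss U" "t:Ss U"
have "s+[Ts U] t:extensional U" by(simp add: inverse_image_raw_def)
thus "s+[Ts U] t:Ss U" using S_local2[OF a] add_rep unfolding S_iff by metis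
qed

lemma smult_closed: "opn U ==> f:cO U ==> s:Ss U ==> f.*[Ts U] s:Ss U"
proof -
assume a: "opn U" "f:cO U" "s:Ss U"
have "f.*[Ts U] s:extensional U" by(simp add: inverse_image_raw_def)
thus "f.*[Ts U] s:Ss U" using a(3) smult_rep[OF a(1,2)] unfolding S_iff by metis
qed

lemma zero_rep: "opn U ==> p:U ==> opn V ==> p:V ==> V<=U ==> rep U (sec U []) p V []" by(simp add: rep_iff sec_res)

lemma teq_swap:
assumes "k:tens V" "l:tens V" "m:tens V" "n:tens V"
shows "teq V ((k @ l) @ (m @ n)) ((k @ m) @ (l @ n))"
proof -
have "teq V (l @ m) (m @ l)" using assms by(auto intro: tensor_eq.commute simp: tens_lists)
hence "teq V (k @ (l @ m) @ n) (k @ (m @ l) @ n)" using assms by(intro tensor_eq.append[OF teq_refl] tensor_eq.append[OF _ teq_refl])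
thus ?thesis by simp
qed

lemma R_group: "opn U ==> abelian_group (Ts U)"
proof(rule abelian_groupI, unfold R_simps)
assume U: "opn U"
show "sec U []:Ss U" using U by(simp add: sec_S)
fix x assume x: "x:Ss U"
show "sec U []+[Ts U] x = x"
proof(rule rep_eqI[OF add_cl[OF U _ x] x])
 fix p assume p: "p:U"
 obtain V l where V: "rep U x p V l" using x p unfolding S_iff by blast
 hence "rep U (sec U []) p V []" by(intro zero_rep[OF U p]) (auto simp: rep_iff)
 from add_rep[OF this V] have "rep U (sec U []+[Ts U] x) p V l" by simp
 moreover have "teq V l l" using V teq_refl by(simp add: rep_iff)
 ultimately show "EX V k l. rep U (sec U []+[Ts U] x) p V k & rep U x p V l & teq V k l" using V by blast
qed (use U in \<open>simp add: sec_S\<close>)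
interpret U: sring "Oz U" by(rule sc[OF U])
have m1: "-[Oz U] 1[Oz U]:cO U" by simp
show "EX y:Ss U. y+[Ts U] x = sec U []"
proof(rule bexI[OF _ smult_closed[OF U m1 x]], rule rep_eqI[OF add_cl[OF U smult_closed[OF U m1 x] x]])
 fix p assume p: "p:U"
 obtain V l where V: "rep U x p V l" using x p unfolding S_iff by blast
 hence o: "opn V" "p:V" "V<=U" "l:tens V" by(auto simp: rep_iff)
 interpret V: sring "Oz V" by(rule sc[OF o(1)])
 let ?n = "%(a, t). (-[Oz V] a, t)"
 have e: "map (%(a, t). (fr Z U V (-[Oz U] 1[Oz U])*[Oz V] a, t)) l = map ?n l"
  using o(4) Z.res_neg[OF U o(1,3) U.one_closed] Z.res_one[OF U o(1,3)] V.l_minus by(intro map_cong HOL.refl) (auto simp: tens_iff)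
 have r: "rep U (-[Oz U] 1[Oz U].*[Ts U] x) p V (map ?n l)" using smult_rep[OF U m1 V] unfolding e .
 have "teq V (map ?n l @ l) []" using o(4)
 proof(induction l)
  case (Cons q l)
  obtain a t where q: "q = (a, t)" by(cases q)
  have c: "a:cO V" "t:cG V" "l:tens V" using Cons.prems q by auto
  have n: "map ?n l:tens V" using c(3) by(auto simp: tens_iff)
  have "teq V (([(-[Oz V] a, t)] @ map ?n l) @ ([(a, t)] @ l)) (([(-[Oz V] a, t)] @ [(a, t)]) @ (map ?n l @ l))" by(rule teq_swap) (use c n in auto)
  moreover have "teq V [(-[Oz V] a, t), (a, t)] []" using tensor_eq.add_left[of "-[Oz V] a" "Oz V" a t "Gs V" "Ow V" "sg V"]
    tensor_eq.zero[of t "Gs V" "Oz V" "Ow V" "sg V"] c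
   by(auto simp: V.l_neg intro: tensor_eq.trans[OF tensor_eq.sym])
  hence "teq V (([(-[Oz V] a, t)] @ [(a, t)]) @ (map ?n l @ l)) ([] @ [])" using Cons.IH[OF c(3)] by(intro tensor_eq.append) auto
  ultimately show ?case using q by(auto intro: tensor_eq.trans)
 qed (simp add: teq_refl)
 thus "EX V k l. rep U (-[Oz U] 1[Oz U].*[Ts U] x+[Ts U] x) p V k & rep U (sec U []) p V l & teq V k l"
  using add_rep[OF r V] zero_rep[OF U p o(1,2,3)] by blast
qed (use U in \<open>simp add: sec_S\<close>)
fix y assume y: "y:Ss U"
show "x+[Ts U] y:Ss U" by(rule add_cl[OF U x y])
show "x+[Ts U] y = y+[Ts U] x"
proof(rule rep_eqI[OF add_cl[OF U x y] add_cl[OF U y x]])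
 fix p assume p: "p:U"
 obtain V k l where V: "rep U x p V k" "rep U y p V l" using S_local2[OF U x y p] .
 have "teq V (k @ l) (l @ k)" using V by(intro tensor_eq.commute) (auto simp: rep_iff tens_lists)
 thus "EX V k l. rep U (x+[Ts U] y) p V k & rep U (y+[Ts U] x) p V l & teq V k l" using add_rep[OF V] add_rep[OF V(2,1)] by blast
qed
fix z assume z: "z:Ss U"
show "x+[Ts U] y+[Ts U] z = x+[Ts U] (y+[Ts U] z)"
proof(rule rep_eqI[OF add_cl[OF U add_cl[OF U x y] z] add_cl[OF U x add_cl[OF U y z]]])
 fix p assume p: "p:U"
 obtain V k l m where V: "rep U x p V k" "rep U y p V l" "rep U z p V m" using S_local3[OF U x y z p] .
 have "teq V ((k @ l) @ m) (k @ (l @ m))" using V by(auto intro: teq_refl simp: rep_iff)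
 thus "EX V k l. rep U (x+[Ts U] y+[Ts U] z) p V k & rep U (x+[Ts U] (y+[Ts U] z)) p V l & teq V k l"
  using add_rep[OF add_rep[OF V(1,2)] V(3)] add_rep[OF V(1) add_rep[OF V(2,3)]] by blast
qed
qed

end

context inv_im_of
begin

lemma sec_rep: "opn V ==> l:tens V ==> p:V ==> rep V (sec V l) p V l" by(auto simp: rep_iff sec_def)

lemma rep_all_eqI:
assumes "opn V" "l:tens V" "s:Ss V" "!!p. p:V ==> rep V s p V l"
shows "s = sec V l"
proof(rule S_eqI[OF assms(3) sec_S[OF assms(1,2)]])
fix p assume p: "p:V"
hence "rst s V = rst (sec V l) V" using assms(4)[OF p] S_ext[OF sec_S[OF assms(1,2)]] by(simp add: rep_iff)
thus "EX N. p:N & rst s N = rst (sec V l) N" using p by blast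
qed

lemma sec_append: "opn V ==> k:tens V ==> l:tens V ==> sec V (k @ l) = sec V k+[Ts V] sec V l"
by(rule rep_all_eqI[symmetric]) (auto intro: add_cl sec_S add_rep sec_rep)

lemma sec_smult:
assumes V: "opn V" and f: "f:cO V" and l: "l:tens V"
shows "f.*[Ts V] sec V l = sec V (map (%(a, t). (f*[Oz V] a, t)) l)"
proof(rule rep_all_eqI[OF V])
interpret V: sring "Oz V" by(rule sc[OF V])
show "map (%(a, t). (f*[Oz V] a, t)) l:tens V" using f l by(auto simp: tens_iff)
show "f.*[Ts V] sec V l:Ss V" by(rule smult_closed[OF V f sec_S[OF V l]])
show "rep V (f.*[Ts V] sec V l) p V (map (%(a, t). (f*[Oz V] a, t)) l)" if "p:V" for p
 using smult_rep[OF V f sec_rep[OF V l that]] Z.res_id[OF V f] by simp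
qed

lemma add_res:
assumes U: "opn U" "opn V" "V<=U" and s: "s:Ss U" "t:Ss U"
shows "rst (s+[Ts U] t) V = rst s V+[Ts V] rst t V"
proof(rule rep_eqI)
show "rst (s+[Ts U] t) V:Ss V" "rst s V+[Ts V] rst t V:Ss V" using S_res add_cl U s by auto
fix p assume p: "p:V"
obtain N k l where N: "rep U s p N k" "rep U t p N l" using S_local2[OF U(1) s] p U(3) by blast
have o: "opn N" "p:N" using N by(auto simp: rep_iff)
let ?N = "N Int V"
have oN: "opn ?N" "p:?N" "?N<=N" using o U p by auto
note r = rep_res[OF N(1) oN] rep_res[OF N(2) oN]
have loc: "rep V (rst u V) p ?N m" if "rep U u p ?N m" for u m using that by(auto simp: rep_iff Int_absorb1 inf_commute inf_left_commute)
have "rep V (rst (s+[Ts U] t) V) p ?N (tres N ?N k @ tres N ?N l)" by(rule loc[OF add_rep[OF r]])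
moreover have "rep V (rst s V+[Ts V] rst t V) p ?N (tres N ?N k @ tres N ?N l)" by(rule add_rep[OF loc[OF r(1)] loc[OF r(2)]])
moreover have "teq ?N (tres N ?N k @ tres N ?N l) (tres N ?N k @ tres N ?N l)" using r by(intro teq_refl) (simp add: rep_iff)
ultimately show "EX N k l. rep V (rst (s+[Ts U] t) V) p N k & rep V (rst s V+[Ts V] rst t V) p N l & teq N k l" by blast
qed

lemma smult_res:
assumes U: "opn U" "opn V" "V<=U" and f: "f:cO U" and s: "s:Ss U"
shows "rst (f.*[Ts U] s) V = fr Z U V f.*[Ts V] rst s V"
proof(rule rep_eqI)
note fV = Z.res_closed[OF U f]
show "rst (f.*[Ts U] s) V:Ss V" "fr Z U V f.*[Ts V] rst s V:Ss V" using S_res smult_closed U s f fV by auto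
fix p assume p: "p:V"
then obtain N l where N: "rep U s p N l" using s U(3) unfolding S_iff by blast
have o: "opn N" "p:N" using N by(auto simp: rep_iff)
let ?N = "N Int V"
have oN: "opn ?N" "p:?N" "?N<=N" "?N<=V" using o U p by auto
note r = rep_res[OF N oN(1-3)]
have loc: "rep V (rst u V) p ?N m" if "rep U u p ?N m" for u m using that by(auto simp: rep_iff Int_absorb1 inf_commute inf_left_commute)
have "rep V (rst (f.*[Ts U] s) V) p ?N (map (%(a, t). (fr Z U ?N f*[Oz ?N] a, t)) (tres N ?N l))" by(rule loc[OF smult_rep[OF U(1) f r]])
moreover have "rep V (fr Z U V f.*[Ts V] rst s V) p ?N (map (%(a, t). (fr Z V ?N (fr Z U V f)*[Oz ?N] a, t)) (tres N ?N l))"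
 by(rule smult_rep[OF U(2) fV loc[OF r]])
moreover have "fr Z V ?N (fr Z U V f) = fr Z U ?N f" by(rule Z.res_trans[OF U(1,2) oN(1,4) U(3) f])
ultimately show "EX N k l. rep V (rst (f.*[Ts U] s) V) p N k & rep V (fr Z U V f.*[Ts V] rst s V) p N l & teq N k l"
 using teq_refl by(metis rep_iff)
qed

text \<open>On a small chart finitely many sections are given by tensors at once.\<close>

lemma S_eq_on_secs:
assumes U: "opn U" and "s:Ss U" "t:Ss U" and u: "!!x. x:set us ==> x:Ss U"
 and loc: "!!V. opn V ==> V<=U ==> EX ths. chart V ths ==> (!!x. x:set us ==> EX l:tens V. rst x V = sec V l) ==> rst s V = rst t V"
shows "s = t"
proof(rule S_eqI[OF assms(2,3)])
fix p assume p: "p:U"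
have "EX V. opn V & p:V & V<=U & (ALL x:set us. EX l:tens V. rst x V = sec V l)" using u
proof(induction us)
 case Nil
 thus ?case using U p by auto
next
 case (Cons x us)
 have "EX V. opn V & p:V & V<=U & (ALL x:set us. EX l:tens V. rst x V = sec V l)" by(rule Cons.IH) (rule Cons.prems, simp)
 then obtain V where V: "opn V" "p:V" "V<=U" "ALL x:set us. EX l:tens V. rst x V = sec V l" by blast
 obtain N l where N: "rep U x p N l" using Cons.prems[of x] p unfolding S_iff by auto
 let ?N = "N Int V"
 have oN: "opn ?N" "p:?N" "?N<=N" "?N<=V" using V N by(auto simp: rep_iff)
 have "EX l:tens ?N. rst y ?N = sec ?N l" if "y:set (x # us)" for y
 proof(cases "y = x")
  case True
  thus ?thesis using rep_res[OF N oN(1-3)] by(auto simp: rep_iff)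
 next
  case False
  then obtain m where m: "m:tens V" "rst y V = sec V m" using V(4) `y:set (x # us)` by auto
  have "rst y ?N = sec ?N (tres V ?N m)" using sec_res[OF V(1) oN(1,4) m(1)] m(2) oN(4) by(metis Int_absorb1 restrict_restrict)
  thus ?thesis using tres_tens[OF V(1) oN(1,4) m(1)] by blast
 qed
 thus ?case using oN V(3) by(intro exI[of _ ?N] conjI ballI) blast+
qed
then obtain V where V: "opn V" "p:V" "V<=U" "ALL x:set us. EX l:tens V. rst x V = sec V l" by blast
obtain N ths where N: "chart N ths" "p:N" "N<=V" using chart_exists[OF V(1,2)] .
have "rst s N = rst t N"
proof(rule loc)
 show "opn N" "EX ths. chart N ths" "N<=U" using N c_opn V by blast+
 fix x assume "x:set us"
 then obtain l where l: "l:tens V" "rst x V = sec V l" using V(4) by blast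
 hence "rst x N = sec N (tres V N l)" using sec_res[OF V(1) c_opn[OF N(1)] N(3) l(1)] N(3) by(metis Int_absorb1 restrict_restrict)
 thus "EX l:tens N. rst x N = sec N l" using tres_tens[OF V(1) c_opn[OF N(1)] N(3) l(1)] by blast
qed
thus "EX V. p:V & rst s V = rst t V" using N(2) by blast
qed

definition ten :: "'p set => 'a => 'm => 'p => ('p, 'a, 'm) tensor_germ" where "ten V a s = sec V [(a, s)]"

context
fixes V assumes V: "opn V"
begin

interpretation O: sring "Oz V" by(rule sc[OF V])
interpretation G: left_supermodule "Ow V" "Gs V" by(rule G_smod[OF V])
interpretation T: abelian_group "Ts V" by(rule R_group[OF V])

lemma ten_S [simp]: "a:cO V ==> s:cG V ==> ten V a s:Ss V" using V by(simp add: ten_def sec_S)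

lemma ten_cl: "a:cO V ==> s:cG V ==> ten V a s:cT V" by(simp add: R_simps)

lemma sec_Cons: "a:cO V ==> s:cG V ==> l:tens V ==> sec V ((a, s) # l) = ten V a s+[Ts V] sec V l"
using sec_append[OF V, of "[(a, s)]" l] by(simp add: ten_def)

lemma sec_lsum: "l:tens V ==> sec V l = lsum (Ts V) (%(a, s). ten V a s) l" by(induction l) (auto simp: sec_Cons R_simps)

lemma ten_add_left: "a:cO V ==> a':cO V ==> s:cG V ==> ten V (a+[Oz V] a') s = ten V a s+[Ts V] ten V a' s"
using sec_teq[OF V tensor_eq.add_left[of a "Oz V" a' s "Gs V"]] sec_Cons[of a s "[(a', s)]"] by(simp add: ten_def)

lemma ten_add_right: "a:cO V ==> s:cG V ==> s':cG V ==> ten V a (s+[Gs V] s') = ten V a s+[Ts V] ten V a s'"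
using sec_teq[OF V tensor_eq.add_right[of a "Oz V" s "Gs V" s']] sec_Cons[of a s "[(a, s')]"] by(simp add: ten_def)

lemma ten_balanced: "a:cO V ==> b:cW V ==> s:cG V ==> ten V (a*[Oz V] sg V b) s = ten V a (b.*[Gs V] s)"
unfolding ten_def by(rule sec_teq[OF V tensor_eq.balanced])

lemma smult_ten: "f:cO V ==> a:cO V ==> s:cG V ==> f.*[Ts V] ten V a s = ten V (f*[Oz V] a) s"
using sec_smult[OF V, of f "[(a, s)]"] by(simp add: ten_def)

text \<open>The module axioms hold for sections that are given by tensors, hence in general.\<close>

lemma sec_smult_axioms:
assumes f: "f:cO V" "f':cO V" and l: "l:tens V"
shows "(f+[Oz V] f').*[Ts V] sec V l = f.*[Ts V] sec V l+[Ts V] f'.*[Ts V] sec V l"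
 and "(f*[Oz V] f').*[Ts V] sec V l = f.*[Ts V] (f'.*[Ts V] sec V l)"
 and "1[Oz V].*[Ts V] sec V l = sec V l"
 and "l':tens V ==> f.*[Ts V] (sec V l+[Ts V] sec V l') = f.*[Ts V] sec V l+[Ts V] f.*[Ts V] sec V l'"
proof -
let ?m = "%f. map (%(a, t). (f*[Oz V] a, t))"
have mt: "?m f l:tens V" if "f:cO V" "l:tens V" for f l using that by(auto simp: tens_iff)
have "sec V (?m (f+[Oz V] f') l) = sec V (?m f l)+[Ts V] sec V (?m f' l)" using l
proof(induction l)
 case Nil
 thus ?case using T.l_zero[OF T.zero_closed] by(simp add: R_simps)
next
 case (Cons q l)
 obtain a t where q: "q = (a, t)" by(cases q)
 have c: "a:cO V" "t:cG V" "l:tens V" using Cons.prems q by auto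
 have c': "sec V (?m f l):cT V" "sec V (?m f' l):cT V" using mt c f V by(simp_all add: R_simps sec_S)
 show ?case using Cons.IH[OF c(3)] c f mt[OF _ c(3)] ten_cl c' by(simp add: q sec_Cons O.l_distr ten_add_left T.a_ac)
qed
thus "(f+[Oz V] f').*[Ts V] sec V l = f.*[Ts V] sec V l+[Ts V] f'.*[Ts V] sec V l" using f l V by(simp add: sec_smult)
have e: "?m (f*[Oz V] f') l = ?m f (?m f' l)" using f l by(auto simp: tens_iff O.m_assoc)
show "(f*[Oz V] f').*[Ts V] sec V l = f.*[Ts V] (f'.*[Ts V] sec V l)"
 unfolding sec_smult[OF V O.m_closed[OF f] l] sec_smult[OF V f(2) l] sec_smult[OF V f(1) mt[OF f(2) l]] e ..
have "?m 1[Oz V] l = l" using l by(induction l) auto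
thus "1[Oz V].*[Ts V] sec V l = sec V l" using l V by(simp add: sec_smult)
show "f.*[Ts V] (sec V l+[Ts V] sec V l') = f.*[Ts V] sec V l+[Ts V] f.*[Ts V] sec V l'" if "l':tens V"
 using f l that mt V by(simp add: sec_append[symmetric] sec_smult)
qed

end

lemma R_smult_axioms:
assumes U: "opn U" and f: "f:cO U" "f':cO U" and s: "s:Ss U" "s':Ss U"
shows "(f+[Oz U] f').*[Ts U] s = f.*[Ts U] s+[Ts U] f'.*[Ts U] s" (is ?A)
 and "(f*[Oz U] f').*[Ts U] s = f.*[Ts U] (f'.*[Ts U] s)" (is ?B)
 and "1[Oz U].*[Ts U] s = s" (is ?C)
 and "f.*[Ts U] (s+[Ts U] s') = f.*[Ts U] s+[Ts U] f.*[Ts U] s'" (is ?D)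
proof -
interpret U: sring "Oz U" by(rule sc[OF U])
note cl = add_cl[OF U] smult_closed[OF U]
note rs = add_res[OF U] smult_res[OF U] Z.res_add[OF U] Z.res_mult[OF U] Z.res_one[OF U] Z.res_closed[OF U]
show ?A
proof(rule S_eq_on_secs[OF U, of _ _ "[s]"])
 fix V assume V: "opn V" "V<=U" and l: "!!x. x:set [s] ==> EX l:tens V. rst x V = sec V l"
 obtain l where l: "l:tens V" "rst s V = sec V l" using l[of s] by auto
 show "rst ((f+[Oz U] f').*[Ts U] s) V = rst (f.*[Ts U] s+[Ts U] f'.*[Ts U] s) V"
  using sec_smult_axioms(1)[OF V(1) _ _ l(1)] V f s(1) l(2) by(simp add: rs cl)
qed (use f s cl in auto)
show ?B
proof(rule S_eq_on_secs[OF U, of _ _ "[s]"])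
 fix V assume V: "opn V" "V<=U" and l: "!!x. x:set [s] ==> EX l:tens V. rst x V = sec V l"
 obtain l where l: "l:tens V" "rst s V = sec V l" using l[of s] by auto
 show "rst ((f*[Oz U] f').*[Ts U] s) V = rst (f.*[Ts U] (f'.*[Ts U] s)) V"
  using sec_smult_axioms(2)[OF V(1) _ _ l(1)] V f s(1) l(2) by(simp add: rs cl)
qed (use f s cl in auto)
show ?C
proof(rule S_eq_on_secs[OF U, of _ _ "[s]"])
 fix V assume V: "opn V" "V<=U" and l: "!!x. x:set [s] ==> EX l:tens V. rst x V = sec V l"
 obtain l where l: "l:tens V" "rst s V = sec V l" using l[of s] by auto
 interpret V: sring "Oz V" by(rule sc[OF V(1)])
 show "rst (1[Oz U].*[Ts U] s) V = rst s V" using sec_smult_axioms(3)[OF V(1) V.one_closed V.one_closed l(1)] V s(1) l(2) by(simp add: rs cl)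
qed (use f s cl in auto)
show ?D
proof(rule S_eq_on_secs[OF U, of _ _ "[s, s']"])
 fix V assume V: "opn V" "V<=U" and l: "!!x. x:set [s, s'] ==> EX l:tens V. rst x V = sec V l"
 obtain l where l1: "l:tens V" "rst s V = sec V l" using l[of s] by auto
 obtain l' where l2: "l':tens V" "rst s' V = sec V l'" using l[of s'] by auto
 show "rst (f.*[Ts U] (s+[Ts U] s')) V = rst (f.*[Ts U] s+[Ts U] f.*[Ts U] s') V"
  using sec_smult_axioms(4)[OF V(1) _ _ l1(1) l2(1), of "fr Z U V f" "fr Z U V f"] V f s l1(2) l2(2) by(simp add: rs cl)
qed (use f s cl in auto)
qed

section \<open>Coefficients of tensors\<close>

definition tcoef :: "'p set => 'a list => ('a \<times> 'm) list => nat set => 'm" where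
"tcoef V ths l I = lsum (Gs V) (%(a, s). coef V ths a I.*[Gs V] s) l"

context
fixes V ths assumes V: "chart V ths"
begin

interpretation V: odd_extension "Oz V" "Ow V" "sg V" ths by(rule chart_self[OF V])
interpretation G: left_supermodule "Ow V" "Gs V" by(rule G_smod[OF c_opn[OF V]])
interpretation T: abelian_group "Ts V" by(rule R_group[OF c_opn[OF V]])

lemma tcoef_cl: "l:tens V ==> tcoef V ths l I:cG V" unfolding tcoef_def by(rule G.M.lsum_cl) (auto simp: tens_iff V.rc_cl intro!: G.smult_closed)

text \<open>Coefficients move across the tensor sign: $\theta_I\, \sigma(b) \otimes g = \theta_I \otimes b g$.\<close>

lemma sec_expand:
assumes l: "l:tens V"
shows "sec V l = lsum (Ts V) (%I. ten V (mon V ths I) (tcoef V ths l I)) (mons (length ths))"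
proof -
note oV = c_opn[OF V]
have tadd: "addmap (Oz V) (Ts V) (%a. ten V a s)" if "s:cG V" for s using that oV by(intro addmapI) (simp_all add: ten_cl ten_add_left)
have tadd': "addmap (Gs V) (Ts V) (ten V a)" if "a:cO V" for a using that oV by(intro addmapI) (simp_all add: ten_cl ten_add_right)
have c: "a:cO V" "s:cG V" if "(a, s):set l" for a s using l that by(auto simp: tens_iff)
have "sec V l = lsum (Ts V) (%p. lsum (Ts V) (%I. ten V (mon V ths I) (coef V ths (fst p) I.*[Gs V] snd p)) (mons (length ths))) l"
 unfolding sec_lsum[OF oV l]
proof(rule lsum_cong)
 fix p assume p: "p:set l"
 obtain a s where q: "p = (a, s)" by(cases p)
 note c = c[OF p[unfolded q]]
 have "ten V a s = ten V (lsum (Oz V) (%I. mon V ths I*[Oz V] sg V (coef V ths a I)) (mons (length ths))) s" using V.rc_expand[OF c(1)] by simp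
 also have "... = lsum (Ts V) (%I. ten V (mon V ths I*[Oz V] sg V (coef V ths a I)) s) (mons (length ths))"
  by(rule addmap_lsum[OF V.ag T.ag tadd[OF c(2)]]) (use c oV V.rc_cl in auto)
 also have "... = lsum (Ts V) (%I. ten V (mon V ths I) (coef V ths a I.*[Gs V] s)) (mons (length ths))"
  by(rule lsum_cong) (use c oV V.rc_cl ten_balanced in auto)
 finally show "(case p of (a, s) => ten V a s) = lsum (Ts V) (%I. ten V (mon V ths I) (coef V ths (fst p) I.*[Gs V] snd p)) (mons (length ths))"
  by(simp add: q)
qed simp
also have "... = lsum (Ts V) (%I. lsum (Ts V) (%p. ten V (mon V ths I) (coef V ths (fst p) I.*[Gs V] snd p)) l) (mons (length ths))"
 by(rule T.lsum_swap) (use c oV V.rc_cl in \<open>auto intro!: ten_cl G.smult_closed\<close>)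
also have "... = lsum (Ts V) (%I. ten V (mon V ths I) (tcoef V ths l I)) (mons (length ths))"
proof(rule lsum_cong)
 fix I assume I: "I:set (mons (length ths))"
 have "ten V (mon V ths I) (tcoef V ths l I) = lsum (Ts V) (%p. ten V (mon V ths I) (case p of (a, s) => coef V ths a I.*[Gs V] s)) l"
  unfolding tcoef_def
  by(rule addmap_lsum[OF G.M.ag T.ag tadd'[OF V.mon_cl[OF I]]]) (use c V.rc_cl in \<open>auto intro!: G.smult_closed\<close>)
 thus "lsum (Ts V) (%p. ten V (mon V ths I) (coef V ths (fst p) I.*[Gs V] snd p)) l = ten V (mon V ths I) (tcoef V ths l I)"
  by(simp add: case_prod_beta)
qed simp
finally show ?thesis .
qed

lemma tcoef_res:
assumes N: "opn N" "N<=V" and l: "l:tens V" and I: "I:set (mons (length ths))"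
shows "tcoef N (map (fr Z V N) ths) (tres V N l) I = mr G V N (tcoef V ths l I)"
proof -
note oV = c_opn[OF V]
have o': "op_in W V" "op_in W N" using oV N by auto
have "mr G V N (tcoef V ths l I) = lsum (Gs N) (%p. mr G V N (case p of (a, s) => coef V ths a I.*[Gs V] s)) l" unfolding tcoef_def
 by(rule G.mres_lsum[OF o' N(2)]) (use l V.rc_cl in \<open>auto simp: tens_iff intro!: G.smult_closed\<close>)
also have "... = lsum (Gs N) (%p. case p of (a, s) => coef N (map (fr Z V N) ths) (fr Z V N a) I.*[Gs N] mr G V N s) l"
proof(rule lsum_cong)
 fix p assume p: "p:set l"
 obtain a s where q: "p = (a, s)" by(cases p)
 have c: "a:cO V" "s:cG V" using l p q by(auto simp: tens_iff)
 show "mr G V N (case p of (a, s) => coef V ths a I.*[Gs V] s) =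
   (case p of (a, s) => coef N (map (fr Z V N) ths) (fr Z V N a) I.*[Gs N] mr G V N s)"
  using G.mod_res_smult[OF o' N(2) V.rc_cl[OF c(1)] c(2)] coef_res[OF V N c(1) I] by(simp add: q)
qed simp
also have "... = tcoef N (map (fr Z V N) ths) (tres V N l) I" unfolding tcoef_def tensor_res_def lsum_map by(rule lsum_cong) auto
finally show ?thesis by simp
qed

lemma sec_eq_iff:
assumes l: "l:tens V" "l':tens V"
shows "sec V l = sec V l' <-> (ALL I:set (mons (length ths)). tcoef V ths l I = tcoef V ths l' I)"
proof
note oV = c_opn[OF V]
assume eq: "sec V l = sec V l'"
show "ALL I:set (mons (length ths)). tcoef V ths l I = tcoef V ths l' I"
proof
 fix I assume I: "I:set (mons (length ths))"
 show "tcoef V ths l I = tcoef V ths l' I"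
 proof(rule G.mlocal_eq[OF _ tcoef_cl[OF l(1)] tcoef_cl[OF l(2)]])
  fix p assume p: "p:V"
  have "germ p V l = germ p V l'" using fun_cong[OF eq, of p] p by(simp add: sec_def)
  then obtain N where N: "opn N" "p:N" "N<=V" "teq N (tres V N l) (tres V N l')" using germ_eq_iff[OF oV p l(1) oV p l(2)] by blast
  interpret N: odd_extension "Oz N" "Ow N" "sg N" "map (fr Z V N) ths" by(rule chart_ext[OF V N(1,3)])
  interpret GN: left_supermodule "Ow N" "Gs N" by(rule G_smod[OF N(1)])
  have "tcoef N (map (fr Z V N) ths) (tres V N l) I = tcoef N (map (fr Z V N) ths) (tres V N l') I" unfolding tcoef_def
   using tensor_lift[OF N(1) GN.M.ag, of "%a s. N.rc a I.*[Gs N] s" "tres V N l" "tres V N l'"] N(4) I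
   by(simp add: N.rc_cl GN.smult_closed N.rc_add GN.smult_l_distr GN.smult_r_distr N.rc_mult_right GN.smult_assoc)
  thus "EX N. op_in W N & p:N & N<=V & mr G V N (tcoef V ths l I) = mr G V N (tcoef V ths l' I)"
   using tcoef_res[OF N(1,3) l(1) I] tcoef_res[OF N(1,3) l(2) I] N by(intro exI[of _ N]) simp
 qed (use oV in simp)
qed
next
assume "ALL I:set (mons (length ths)). tcoef V ths l I = tcoef V ths l' I"
thus "sec V l = sec V l'" unfolding sec_expand[OF l(1)] sec_expand[OF l(2)] by(intro lsum_cong) auto
qed

end

section \<open>Grading\<close>

definition hten :: "'p set => bool => ('a \<times> 'm) list => bool" where
"hten V i l <-> (ALL (a, t):set l. EX j. a:grade (Oz V) j & t:mg (Gs V) (i ~= j))"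

lemma R_grade: "s:mg (Ts U) i <-> s:Ss U & (ALL p:U. EX V l. rep U s p V l & hten V i l)"
by(simp add: inverse_image_raw_def hten_def)

lemma hten_res:
assumes "opn V" "opn N" "N<=V" "hten V i l" shows "hten N i (tres V N l)"
proof -
have "op_in W V" "op_in W N" using assms by auto
thus ?thesis using assms Z.res_grade[OF assms(1-3)] G.mod_res_grade[of V N] unfolding hten_def set_tres by fastforce
qed

lemma hten_tens: "opn V ==> hten V i l ==> l:tens V"
proof -
assume V: "opn V" and h: "hten V i l"
interpret O: sring "Oz V" by(rule sc[OF V])
interpret G: left_supermodule "Ow V" "Gs V" by(rule G_smod[OF V])
show "l:tens V" using h O.gr_car G.M.gr_car by(force simp: hten_def tens_iff)
qed

lemma sec_grade: "opn V ==> hten V i l ==> sec V l:mg (Ts V) i" unfolding R_grade using sec_rep hten_tens sec_S by blast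

lemma grade_rep_res:
assumes "rep U s p V l" "hten V i l" "opn N" "p:N" "N<=V"
shows "rep U s p N (tres V N l)" "hten N i (tres V N l)"
using rep_res[OF assms(1,3-5)] hten_res[OF _ assms(3,5,2)] assms(1) by(auto simp: rep_iff)

lemma R_grade_res: "opn U ==> opn V ==> V<=U ==> s:mg (Ts U) i ==> rst s V:mg (Ts V) i" unfolding R_grade
proof(intro conjI ballI)
assume U: "opn U" "opn V" "V<=U" and s: "s:Ss U & (ALL p:U. EX V l. rep U s p V l & hten V i l)"
show "rst s V:Ss V" using S_res U s by blast
fix p assume p: "p:V"
then obtain N l where N: "rep U s p N l" "hten N i l" using s U(3) by blast
have "opn (N Int V)" "p:N Int V" using N U p by(auto simp: rep_iff)
from grade_rep_res[OF N this] show "EX N l. rep V (rst s V) p N l & hten N i l"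
 by(intro exI conjI) (auto simp: rep_iff Int_absorb1 inf_commute inf_left_commute)
qed

lemma R_grade_local:
assumes U: "opn U" and s: "s:Ss U"
 and loc: "!!p. p:U ==> EX V. opn V & p:V & V<=U & rst s V:mg (Ts V) i"
shows "s:mg (Ts U) i"
unfolding R_grade
proof(intro conjI ballI s)
fix p assume "p:U"
then obtain V where V: "opn V" "p:V" "V<=U" "rst s V:mg (Ts V) i" using loc by blast
then obtain N l where N: "rep V (rst s V) p N l" "hten N i l" unfolding R_grade by blast
hence "rep U s p N l" using V(3) by(auto simp: rep_iff Int_absorb1)
thus "EX V l. rep U s p V l & hten V i l" using N(2) by blast
qed

lemma tcoef_grade:
assumes V: "chart V ths" and h: "hten V i l" and I: "I:set (mons (length ths))"
shows "tcoef V ths l I:mg (Gs V) (i ~= odd (card I))"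
proof -
interpret V: odd_extension "Oz V" "Ow V" "sg V" ths by(rule chart_self[OF V])
interpret G: left_supermodule "Ow V" "Gs V" by(rule G_smod[OF c_opn[OF V]])
show ?thesis unfolding tcoef_def
proof(rule G.M.gr_lsum)
 fix p assume p: "p:set l"
 obtain a t where q: "p = (a, t)" by(cases p)
 obtain j where j: "a:grade (Oz V) j" "t:mg (Gs V) (i ~= j)" using h p q by(auto simp: hten_def)
 have "coef V ths a I.*[Gs V] t:mg (Gs V) ((j ~= odd (card I)) ~= (i ~= j))" by(rule G.mgrade_smult[OF V.rc_grade[OF j(1) I] j(2)])
 thus "(case p of (a, s) => coef V ths a I.*[Gs V] s):mg (Gs V) (i ~= odd (card I))"
  unfolding q prod.case by(cases i; cases j; cases "odd (card I)") simp_all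
qed
qed

lemma R_grade_disjoint:
assumes U: "opn U" and s: "s:mg (Ts U) False" "s:mg (Ts U) True"
shows "s = sec U []"
proof(rule S_eqI)
show "s:Ss U" "sec U []:Ss U" using s U by(simp_all add: R_grade sec_S)
fix p assume p: "p:U"
obtain A k where A: "rep U s p A k" "hten A False k" using s p unfolding R_grade by blast
obtain B l where B: "rep U s p B l" "hten B True l" using s p unfolding R_grade by blast
have "opn (A Int B)" "p:A Int B" using A B by(auto simp: rep_iff)
then obtain N ths where N: "chart N ths" "p:N" "N<=A Int B" using chart_exists by metis
note oN = c_opn[OF N(1)]
have NN: "N<=A" "N<=B" using N(3) by auto
note k = grade_rep_res[OF A oN N(2) NN(1)] and l = grade_rep_res[OF B oN N(2) NN(2)]
interpret G: left_supermodule "Ow N" "Gs N" by(rule G_smod[OF oN])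
have t: "tres A N k:tens N" "tres B N l:tens N" using k l by(auto simp: rep_iff)
have eq: "sec N (tres A N k) = sec N (tres B N l)" using k(1) l(1) by(simp add: rep_iff)
have "tcoef N ths (tres A N k) I = tcoef N ths [] I" if I: "I:set (mons (length ths))" for I
proof -
 have "tcoef N ths (tres A N k) I = tcoef N ths (tres B N l) I" using eq sec_eq_iff[OF N(1) t] I by blast
 hence "tcoef N ths (tres A N k) I:mg (Gs N) (odd (card I))" "tcoef N ths (tres A N k) I:mg (Gs N) (~ odd (card I))"
  using tcoef_grade[OF N(1) k(2) I] tcoef_grade[OF N(1) l(2) I] by simp_all
 hence "tcoef N ths (tres A N k) I = 0[Gs N]" using G.M.gr_disjoint by(cases "odd (card I)") auto
 thus ?thesis by(simp add: tcoef_def)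
qed
hence "sec N (tres A N k) = sec N []" using sec_eq_iff[OF N(1) t(1), of "[]"] by simp
hence "rst s N = rst (sec U []) N" using k(1) sec_res[OF U oN, of "[]"] by(simp add: rep_iff)
thus "EX V. p:V & rst s V = rst (sec U []) V" using N(2) by blast
qed

lemma R_grade_subgroup: "opn U ==> additive_subgroup (mg (Ts U) i) (Ts U)"
proof(rule add_subgroup_criterion[OF R_group], unfold R_simps)
assume U: "opn U"
interpret O: sring "Oz U" by(rule sc[OF U])
interpret T: abelian_group "Ts U" by(rule R_group[OF U])
show "mg (Ts U) i <= Ss U" by(auto simp: R_grade)
show "sec U []:mg (Ts U) i" by(rule sec_grade[OF U]) (simp add: hten_def)
fix x assume x: "x:mg (Ts U) i"
show "x+[Ts U] y:mg (Ts U) i" if y: "y:mg (Ts U) i" for y unfolding R_grade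
proof(intro conjI ballI)
 show "x+[Ts U] y:Ss U" using add_cl[OF U] x y by(simp add: R_grade)
 fix p assume p: "p:U"
 obtain A k where A: "rep U x p A k" "hten A i k" using x p unfolding R_grade by blast
 obtain B l where B: "rep U y p B l" "hten B i l" using y p unfolding R_grade by blast
 have o: "opn (A Int B)" "p:A Int B" using A B by(auto simp: rep_iff)
 note k = grade_rep_res[OF A o] and l = grade_rep_res[OF B o]
 have "rep U (x+[Ts U] y) p (A Int B) (tres A (A Int B) k @ tres B (A Int B) l)" by(rule add_rep[OF k(1) l(1)]) auto
 moreover have "hten (A Int B) i (tres A (A Int B) k @ tres B (A Int B) l)" using k(2) l(2) by(auto simp: hten_def)
 ultimately show "EX V l. rep U (x+[Ts U] y) p V l & hten V i l" by blast
qed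
have xS: "x:Ss U" using x by(simp add: R_grade)
have neg: "-[Ts U] x = -[Oz U] 1[Oz U].*[Ts U] x"
proof(rule T.minus_equality)
 have "-[Oz U] 1[Oz U].*[Ts U] x+[Ts U] x = (-[Oz U] 1[Oz U]+[Oz U] 1[Oz U]).*[Ts U] x"
  using R_smult_axioms(1,3)[OF U _ _ xS xS, of "-[Oz U] 1[Oz U]" "1[Oz U]"] by simp
 also have "... = 0[Oz U].*[Ts U] x" by(simp add: O.l_neg)
 also have "... = 0[Ts U]" using R_smult_axioms(1)[OF U O.zero_closed O.zero_closed xS xS] smult_closed[OF U O.zero_closed xS]
  by(intro T.add_self_cancel) (simp_all add: R_simps)
 finally show "-[Oz U] 1[Oz U].*[Ts U] x+[Ts U] x = 0[Ts U]" .
qed (use xS smult_closed[OF U] in \<open>simp_all add: R_simps\<close>)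
show "-[Ts U] x:mg (Ts U) i" unfolding neg R_grade
proof(intro conjI ballI smult_closed[OF U _ xS])
 fix p assume p: "p:U"
 obtain A k where A: "rep U x p A k" "hten A i k" using x p unfolding R_grade by blast
 have oA: "opn A" "A<=U" using A by(auto simp: rep_iff)
 interpret A: sring "Oz A" by(rule sc[OF oA(1)])
 have "fr Z U A (-[Oz U] 1[Oz U]):grade (Oz A) False" using Z.res_grade[OF U oA O.gr_neg[OF O.one_even]] .
 hence "hten A i (map (%(a, t). (fr Z U A (-[Oz U] 1[Oz U])*[Oz A] a, t)) k)" using A(2) A.grade_mult[of _ False] unfolding hten_def by fastforce
 thus "EX V l. rep U (-[Oz U] 1[Oz U].*[Ts U] x) p V l & hten V i l" using smult_rep[OF U _ A(1), of "-[Oz U] 1[Oz U]"] by blast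
qed simp
qed

lemma tensor_parts:
assumes V: "opn V" and l: "l:tens V"
shows "EX l0 l1. hten V False l0 & hten V True l1 & sec V l = sec V l0+[Ts V] sec V l1"
using l
proof(induction l)
case Nil
interpret T: abelian_group "Ts V" by(rule R_group[OF V])
show ?case using T.l_zero[OF T.zero_closed] by(intro exI[of _ "[]"]) (simp add: hten_def R_simps)
next
case (Cons q l)
interpret O: sring "Oz V" by(rule sc[OF V])
interpret G: left_supermodule "Ow V" "Gs V" by(rule G_smod[OF V])
interpret T: abelian_group "Ts V" by(rule R_group[OF V])
obtain a t where q: "q = (a, t)" by(cases q)
have c: "a:cO V" "t:cG V" "l:tens V" using Cons.prems q by auto
obtain l0 l1 where L: "hten V False l0" "hten V True l1" "sec V l = sec V l0+[Ts V] sec V l1" using Cons.IH[OF c(3)] by blast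
obtain a0 a1 where a: "a0:grade (Oz V) False" "a1:grade (Oz V) True" "a = a0+[Oz V] a1" using c(1) by(rule O.decomposeE)
obtain t0 t1 where t: "t0:mg (Gs V) False" "t1:mg (Gs V) True" "t = t0+[Gs V] t1" using c(2) by(rule G.M.decomposeE)
note cc = a(1,2)[THEN O.gr_car] t(1,2)[THEN G.M.gr_car]
have lt: "l0:tens V" "l1:tens V" using L hten_tens[OF V] by blast+
have sc: "sec V l0:cT V" "sec V l1:cT V" using lt V by(simp_all add: R_simps sec_S)
have "hten V False ([(a0, t0), (a1, t1)] @ l0)" "hten V True ([(a0, t1), (a1, t0)] @ l1)" using L a t by(auto simp: hten_def)
moreover have "sec V (q # l) = sec V ([(a0, t0), (a1, t1)] @ l0)+[Ts V] sec V ([(a0, t1), (a1, t0)] @ l1)"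
 using L(3) c cc lt V sc ten_cl[OF V] a(3) t(3)
 by(simp add: q sec_Cons ten_add_left ten_add_right T.a_ac)
ultimately show ?case by blast
qed

lemma restrict_minus:
assumes U: "opn U" "opn V" "V<=U" and st: "s:Ss U" "t:Ss U"
shows "rst (s -[Ts U] t) V = rst s V -[Ts V] rst t V"
proof -
have "addmap (Ts U) (Ts V) (%s. rst s V)" by(rule addmapI) (simp_all add: R_simps S_res[OF U(1) _ U(2,3)] add_res[OF U])
from addmap_minus[OF R_group[OF U(1)] R_group[OF U(2)] this] show ?thesis using st by(simp add: R_simps)
qed

text \<open>The decomposition of a section into homogeneous parts is unique, so local decompositions glue.\<close>

lemma R_smod:
assumes U: "opn U" shows "left_supermodule (Oz U) (Ts U)"
proof -
interpret O: sring "Oz U" by(rule sc[OF U])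
interpret T: abelian_group "Ts U" by(rule R_group[OF U])
have "graded_group (Ts U) (mg (Ts U))" unfolding graded_group_def
proof(intro conjI allI ballI R_grade_subgroup[OF U])
 fix s assume "s:cT U"
 hence s: "s:Ss U" by(simp add: R_simps)
 let ?P = "%V x. x:mg (Ts V) False & rst s V -[Ts V] x:mg (Ts V) True"
 have uniq: "x = y" if V: "opn V" "V<=U" and xy: "?P V x" "?P V y" for V x y
 proof -
  interpret V: abelian_group "Ts V" by(rule R_group[OF V(1)])
  interpret A: additive_subgroup "mg (Ts V) False" "Ts V" by(rule R_grade_subgroup[OF V(1)])
  interpret B: additive_subgroup "mg (Ts V) True" "Ts V" by(rule R_grade_subgroup[OF V(1)])
  have sV: "rst s V:cT V" using S_res[OF U s V] by(simp add: R_simps)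
  have c: "x:cT V" "y:cT V" using xy A.a_subset by blast+
  have 0: "x -[Ts V] y:mg (Ts V) False" using xy A.a_closed A.a_inv_closed by(simp add: a_minus_def)
  have "x -[Ts V] y = (rst s V -[Ts V] y) -[Ts V] (rst s V -[Ts V] x)" using c sV by algebra
  moreover have "...:mg (Ts V) True" using xy B.a_closed B.a_inv_closed by(simp add: a_minus_def)
  ultimately have "x -[Ts V] y = 0[Ts V]" using R_grade_disjoint[OF V(1) 0] by(simp add: R_simps)
  thus "x = y" using V.minus_zero_imp_eq c by blast
 qed
 have loc: "EX V x. opn V & p:V & V<=U & x:Ss V & ?P V x" if pU: "p:U" for p
 proof -
  obtain V l where V: "opn V" "p:V" "V<=U" "l:tens V" "rst s V = sec V l" using S_local[OF U s pU] .
  interpret V: abelian_group "Ts V" by(rule R_group[OF V(1)])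
  obtain l0 l1 where L: "hten V False l0" "hten V True l1" "sec V l = sec V l0+[Ts V] sec V l1" using tensor_parts[OF V(1,4)] by blast
  have c: "sec V l0:cT V" "sec V l1:cT V" using hten_tens[OF V(1)] L V(1) by(simp_all add: R_simps sec_S)
  have "sec V l0+[Ts V] sec V l1 -[Ts V] sec V l0 = sec V l1" using c by algebra
  thus ?thesis using V L sec_grade[OF V(1)] c by(intro exI[of _ V] exI[of _ "sec V l0"]) (simp add: R_simps)
 qed
 have stable: "?P N (rst x N)" if "opn V" "opn N" "N<=V" "V<=U" "x:Ss V" "?P V x" for V N x
 proof -
  have "rst (rst s V -[Ts V] x) N = rst s N -[Ts N] rst x N"
   using restrict_minus[OF that(1-3) S_res[OF U s that(1,4)] that(5)] that(3) by(simp add: Int_absorb1)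
  thus ?thesis using R_grade_res[OF that(1-3), of x False] R_grade_res[OF that(1-3), of "rst s V -[Ts V] x" True] that(6) by simp
 qed
 obtain x where x: "x:Ss U" "!!V y. opn V ==> V<=U ==> y:Ss V ==> ?P V y ==> rst x V = y"
 proof(rule set_sheaf.glue_local[OF S_sheaf U, of ?P])
  show "EX V x. opn V & p:V & V<=U & x:Ss V & ?P V x" if "p:U" for p by(rule loc[OF that])
  show "?P N (rst x N)" if "opn V" "opn N" "N<=V" "V<=U" "x:Ss V" "?P V x" for V N x by(rule stable[OF that])
  show "x = y" if "opn V" "V<=U" "x:Ss V" "y:Ss V" "?P V x" "?P V y" for V x y by(rule uniq[OF that(1,2,5,6)])
 qed (blast intro: that)
 have xc: "x:cT U" "s:cT U" using x(1) s by(simp_all add: R_simps)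
 have mS: "s -[Ts U] x:Ss U" using T.minus_closed[OF xc(2,1)] by(simp add: R_simps)
 have xl: "EX V. opn V & p:V & V<=U & rst x V:mg (Ts V) False & rst (s -[Ts U] x) V:mg (Ts V) True" if pU: "p:U" for p
 proof -
  obtain V y where V: "opn V" "p:V" "V<=U" "y:Ss V" "?P V y" using loc[OF pU] by blast
  thus ?thesis using x(2)[OF V(1,3-5)] restrict_minus[OF U V(1,3) s x(1)] by(intro exI[of _ V]) simp
 qed
 have x0: "x:mg (Ts U) False" by(rule R_grade_local[OF U x(1)]) (use xl in blast)
 have x1: "s -[Ts U] x:mg (Ts U) True" by(rule R_grade_local[OF U mS]) (use xl in blast)
 show "EX! x0. x0:mg (Ts U) False & s -[Ts U] x0:mg (Ts U) True"
 proof(rule ex1I[of _ x])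
  fix y assume "y:mg (Ts U) False & s -[Ts U] y:mg (Ts U) True"
  thus "y = x" by(intro uniq[OF U le]) (use x0 x1 S_ext[OF s] in simp_all)
 qed (use x0 x1 in simp)
qed
moreover have "f.*[Ts U] s:mg (Ts U) (i ~= j)" if f: "f:grade (Oz U) i" and s: "s:mg (Ts U) j" for f s i j unfolding R_grade
proof(intro conjI ballI smult_closed[OF U O.gr_car[OF f]])
 show "s:Ss U" using s by(simp add: R_grade)
 fix p assume p: "p:U"
 obtain A k where A: "rep U s p A k" "hten A j k" using s p unfolding R_grade by blast
 have oA: "opn A" "A<=U" using A by(auto simp: rep_iff)
 interpret A: sring "Oz A" by(rule sc[OF oA(1)])
 have "hten A (i ~= j) (map (%(a, t). (fr Z U A f*[Oz A] a, t)) k)" unfolding hten_def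
 proof
  fix q assume "q:set (map (%(a, t). (fr Z U A f*[Oz A] a, t)) k)"
  then obtain a t where at: "(a, t):set k" "q = (fr Z U A f*[Oz A] a, t)" by auto
  obtain m where m: "a:grade (Oz A) m" "t:mg (Gs A) (j ~= m)" using A(2) at(1) by(auto simp: hten_def)
  have "fr Z U A f*[Oz A] a:grade (Oz A) (i ~= m)" by(rule A.grade_mult[OF Z.res_grade[OF U oA f] m(1)])
  moreover have "t:mg (Gs A) ((i ~= j) ~= (i ~= m))" using m(2) by(cases i; cases j; cases m) simp_all
  ultimately show "case q of (a, t) => EX ja. a:grade (Oz A) ja & t:mg (Gs A) ((i ~= j) ~= ja)" unfolding at(2) prod.case by blast
 qed
 thus "EX V l. rep U (f.*[Ts U] s) p V l & hten V (i ~= j) l" using smult_rep[OF U O.gr_car[OF f] A(1)] by blast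
qed
ultimately show ?thesis
 using smult_closed[OF U] R_smult_axioms(1,2,4)[OF U] R_smult_axioms(3)[OF U O.zero_closed O.zero_closed _ sec_S[OF U tens_simps(1)]]
 by(intro left_supermodule.intro left_supermodule_axioms.intro supercomm(1)[OF U] R_group[OF U]) (simp_all only: R_simps)
qed

end

context odd_submersion
begin

text \<open>On a chart the derivations are generated, under addition and multiplication by functions, by those
  that are related to derivations of the base: subtracting $\sum h_k\, \tilde w_k$ from a
  derivation with image $\sum h_k \otimes w_k$, where $\tilde w_k$ lifts $w_k$, leaves a vertical one, a
  lift of zero.\<close>

definition lifts_to :: "'p set => ('p, 'a) vfield => ('p, 'b) vfield => bool" where
"lifts_to V v w <-> (ALL N b. opn N & N<=V & b:cW N --> v N (sg N b) = sg N (w N b))"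

lemma chart_der_induct [consumes 2, case_names lift smult add]:
assumes V: "chart V ths" and v: "v:DZ V i"
 and lift: "!!k v w. v:DZ V k ==> w:DW V k ==> lifts_to V v w ==> P k v"
 and smult: "!!q f k v. f:grade (Oz V) q ==> v:DZ V k ==> P k v ==> P (q ~= k) (vf_smult Z V f v)"
 and add: "!!k v u. v:DZ V k ==> u:DZ V k ==> P k v ==> P k u ==> P k (vf_add Z V v u)"
shows "P i v"
proof -
note oV = c_opn[OF V]
obtain ws where ws: "Tim V v ws" "!!h w. (h, w):set ws ==> EX q. h:grade (Oz V) q & w:DW V (i ~= q)" using tan_image_exists[OF V v] by blast
interpret O: sring "Oz V" by(rule sc[OF oV])
show ?thesis using v ws
proof(induction ws arbitrary: v)
 case Nil
 have "lifts_to V v (W.vf_zero V)" using Nil.prems(2) by(auto simp: lifts_to_def tan_image_iff W.vf_zero_app sg_zero)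
 thus ?case by(rule lift[OF Nil.prems(1) W.vf_zero_der])
next
 case (Cons p ws)
 obtain h w where p: "p = (h, w)" by(cases p)
 obtain q where q: "h:grade (Oz V) q" "w:DW V (i ~= q)" using Cons.prems(3)[of h w] p by auto
 note hc = O.gr_car[OF q(1)]
 obtain x where x: "x:DZ V (i ~= q)" "lifts_to V x w" using lift_exists[OF V q(2)] unfolding lifts_to_def by blast
 let ?x = "%h. vf_smult Z V h x"
 have iq: "(q ~= (i ~= q)) = i" by(cases i; cases q) simp_all
 have xd: "?x h:DZ V i" "?x (-[Oz V] h):DZ V i" using Z.vf_smult_der[OF oV q(1) x(1)] Z.vf_smult_der[OF oV O.gr_neg[OF q(1)] x(1)] unfolding iq .
 let ?v = "vf_add Z V (?x (-[Oz V] h)) v"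
 note vd = Z.vf_add_der[OF xd(2) Cons.prems(1)]
 have "Tim V ?v ws" unfolding tan_image_iff
 proof(intro conjI allI impI)
  show "ALL (h, w):set ws. h:cO V & w:TW V" using Cons.prems(2) by(simp add: tan_image_iff)
  fix N b assume "opn N & N<=V & b:cW N"
  hence N: "opn N" "N<=V" "b:cW N" by auto
  interpret N: sring "Oz N" by(rule sc[OF N(1)])
  let ?s = "%ws. lsum (Oz N) (%(h, w). fr Z V N h*[Oz N] sg N (w N b)) ws"
  have "w N b:cW N" using W.der_cl[OF q(2) _ N(2,3)] N(1) by simp
  hence c: "fr Z V N h*[Oz N] sg N (w N b):cO N" using hc oV N by simp
  have s: "?s ws:cO N" using Cons.prems(2) W.tan_cl[of _ V N b] oV N by(intro N.lsum_cl) (auto simp: tan_image_iff)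
  have "v N (sg N b) = fr Z V N h*[Oz N] sg N (w N b)+[Oz N] ?s ws" using Cons.prems(2) N p by(simp add: tan_image_iff)
  moreover have "x N (sg N b) = sg N (w N b)" using x(2) N by(simp add: lifts_to_def)
  ultimately show "?v N (sg N b) = ?s ws" using N oV hc c s `w N b:cW N`
   by(simp add: Z.vf_add_app Z.vf_smult_app Z.res_neg[OF oV] N.l_minus N.r_neg1)
 qed
 hence Pv: "P i ?v" using Cons.prems(3) by(intro Cons.IH[OF vd]) auto
 have Px: "P i (?x h)" using smult[OF q(1) x(1) lift[OF x(1) q(2) x(2)]] unfolding iq .
 have "P i (vf_add Z V (?x h) ?v)" by(rule add[OF xd(1) vd Px Pv])
 moreover have "vf_add Z V (?x h) ?v = v"
 proof(rule Z.vf_eqI[OF _ Z.vf_on_der[OF Cons.prems(1)]])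
  fix N f assume N: "opn N" "N<=V" "f:cO N"
  interpret N: sring "Oz N" by(rule sc[OF N(1)])
  show "vf_add Z V (?x h) ?v N f = v N f" using N oV hc Z.der_cl[OF x(1) N] Z.der_cl[OF Cons.prems(1) N]
   by(simp add: Z.vf_add_app Z.vf_smult_app Z.res_neg[OF oV] N.l_minus N.r_neg2)
 qed simp
 ultimately show ?case by simp
qed
qed

lemma tan_image_res:
assumes "opn V" "opn N" "N<=V" "Tim V v ws"
shows "Tim N (vf_res Z N v) (map (%(h, w). (fr Z V N h, vf_res W N w)) ws)"
unfolding tan_image_iff
proof(intro conjI allI impI)
show "ALL (h, w):set (map (%(h, w). (fr Z V N h, vf_res W N w)) ws). h:cO N & w:TW N" using assms W.tan_res[of _ V N] by(auto simp: tan_image_iff)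
fix M b assume "opn M & M<=N & b:cW M"
hence M: "opn M" "M<=N" "b:cW M" by auto
hence "vf_res Z N v M (sg M b) = lsum (Oz M) (%(h, w). fr Z V M h*[Oz M] sg M (w M b)) ws" using assms by(auto simp: tan_image_iff Z.vf_res_app)
also have "... = lsum (Oz M) (%(h, w). fr Z N M h*[Oz M] sg M (w M b)) (map (%(h, w). (fr Z V N h, vf_res W N w)) ws)" unfolding lsum_map
 by(rule lsum_cong) (use M assms in \<open>auto simp: tan_image_iff W.vf_res_app Z.res_trans\<close>)
finally show "vf_res Z N v M (sg M b) = ..." .
qed

end

context inv_im_of
begin

section \<open>The action of vector fields on pulled-back sections\<close>

text \<open>The unit of the pullback: \<open>unit V g\<close> is $1 \otimes g$.\<close>

abbreviation unit :: "'p set => 'm => 'p => ('p, 'a, 'm) tensor_germ" where "unit V == ten V 1[Oz V]"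

definition Kl :: "'p set => ('a \<times> ('p, 'b) vfield) list => 'm => 'p => ('p, 'a, 'm) tensor_germ" where
"Kl V ws g = sec V (map (%(h, w). (h, nabla G V w g)) ws)"

text \<open>\<open>K V v g\<close> is $\nabla_v(1 \otimes g) = \sum h \otimes \nabla_w g$, for any image $\sum h \otimes w$ of \<open>v\<close>.\<close>

definition K :: "'p set => ('p, 'a) vfield => 'm => 'p => ('p, 'a, 'm) tensor_germ" where "K V v g = Kl V (SOME ws. Tim V v ws) g"

lemma ten_res: "opn V ==> opn N ==> N<=V ==> a:cO V ==> g:cG V ==> rst (ten V a g) N = ten N (fr Z V N a) (mr G V N g)"
by(simp add: ten_def sec_res)

context
fixes V ths assumes V: "chart V ths"
begin

lemma oV: "opn V" by(rule c_opn[OF V])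
lemma oV': "op_in W V" using oV by simp

interpretation V: odd_extension "Oz V" "Ow V" "sg V" ths by(rule chart_self[OF V])
interpretation G: left_supermodule "Ow V" "Gs V" by(rule G_smod[OF oV])
interpretation T: left_supermodule "Oz V" "Ts V" by(rule R_smod[OF oV])

lemma Kl_tens: "Tim V v ws ==> g:cG V ==> map (%(h, w). (h, nabla G V w g)) ws:tens V"
using G.nabla_closed[OF oV'] by(auto simp: tan_image_iff tens_iff)

text \<open>The \<open>I\<close>-th coefficient of $\sum h \otimes \nabla_w g$ is $\nabla_{w_I} g$, where $w_I(b)$ is the \<open>I\<close>-th coefficient
  of $v(\sigma b)$; this involves \<open>v\<close> only.\<close>

lemma Kl_unique:
assumes ws: "Tim V v ws" "Tim V v us" and g: "g:cG V"
shows "Kl V ws g = Kl V us g"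
unfolding Kl_def sec_eq_iff[OF V Kl_tens[OF ws(1) g] Kl_tens[OF ws(2) g]]
proof
fix I assume I: "I:set (mons (length ths))"
let ?s = "%ws. W.vf_sum V (%p. coef V ths (fst p) I) snd ws"
have t: "tcoef V ths (map (%(h, w). (h, nabla G V w g)) ws) I = nabla G V (?s ws) g" if "Tim V v ws" for ws using that V.rc_cl
 by(subst G.nabla_vf_sum[OF oV' g]) (auto simp: tan_image_iff tcoef_def case_prod_beta)
have a: "?s ws N b = coef N (map (fr Z V N) ths) (v N (sg N b)) I" if w: "Tim V v ws" and N: "op_in W N" "N<=V" and b: "b:cW N" for ws N b
proof -
 have N': "opn N" using N by simp
 interpret N: odd_extension "Oz N" "Ow N" "sg N" "map (fr Z V N) ths" by(rule chart_ext[OF V N' N(2)])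
 interpret B: sring "Ow N" by(rule scW[OF N'])
 have c: "fst p:cO V" "snd p N b:cW N" if "p:set ws" for p using w that W.tan_cl[OF _ N b, of "snd p"] by(auto simp: tan_image_iff)
 have ad: "addmap (Oz N) (Ow N) (%a. N.rc a I)" using I by(intro addmapI) (simp_all add: N.rc_cl N.rc_add)
 have "v N (sg N b) = lsum (Oz N) (%p. fr Z V N (fst p)*[Oz N] sg N (snd p N b)) ws" using w N' N b by(simp add: tan_image_iff case_prod_beta)
 hence "N.rc (v N (sg N b)) I = lsum (Ow N) (%p. N.rc (fr Z V N (fst p)*[Oz N] sg N (snd p N b)) I) ws"
  using addmap_lsum[OF groups[OF N'] ad, of ws "%p. fr Z V N (fst p)*[Oz N] sg N (snd p N b)"] c oV N' N by simp
 also have "... = lsum (Ow N) (%p. fr W V N (coef V ths (fst p) I)*[Ow N] snd p N b) ws"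
  by(rule lsum_cong) (use c oV N N' I in \<open>auto simp: N.rc_mult_right coef_res[OF V N' N(2)]\<close>)
 finally show ?thesis using W.vf_sum_app[OF N b] by simp
qed
have "?s ws = ?s us" by(rule W.vf_eqI[of V]) (simp_all add: a ws)
thus "tcoef V ths (map (%(h, w). (h, nabla G V w g)) ws) I = tcoef V ths (map (%(h, w). (h, nabla G V w g)) us) I" using t ws by simp
qed

context
fixes g assumes g: "g:cG V"
begin

lemma K_image: "Tim V v ws ==> K V v g = Kl V ws g" unfolding K_def by(rule Kl_unique[OF someI[of "Tim V v"] _ g])

lemma K_cl: "v:DZ V i ==> K V v g:cT V" using tan_image_exists[OF V, of v i] K_image Kl_tens[OF _ g] sec_S[OF oV] by(auto simp: Kl_def R_simps)

lemma K_lift: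
assumes v: "lifts_to V v w" and w: "w:DW V k" shows "K V v g = unit V (nabla G V w g)"
proof -
have "Tim V v [(1[Oz V], w)]" unfolding tan_image_iff
proof(intro conjI allI impI)
 show "ALL (h, w):set [(1[Oz V], w)]. h:cO V & w:TW V" using W.der_tan[OF w] by simp
 fix N b assume "opn N & N<=V & b:cW N"
 hence N: "opn N" "op_in W N" "N<=V" "b:cW N" by auto
 interpret N: sring "Oz N" by(rule sc[OF N(1)])
 show "v N (sg N b) = lsum (Oz N) (%(h, w). fr Z V N h*[Oz N] sg N (w N b)) [(1[Oz V], w)]"
  using v N W.der_cl[OF w N(2-4)] by(simp add: lifts_to_def Z.res_one[OF oV N(1,3)])
qed
from K_image[OF this] show ?thesis by(simp add: Kl_def ten_def)
qed

lemma K_vf_add: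
assumes "v:DZ V i" "u:DZ V j"
shows "K V (vf_add Z V v u) g = K V v g+[Ts V] K V u g"
proof -
obtain ws us where w: "Tim V v ws" "Tim V u us" using tan_image_exists[OF V] assms by blast
have "Tim V (vf_add Z V v u) (ws @ us)" unfolding tan_image_iff
proof(intro conjI allI impI)
 show "ALL (h, w):set (ws @ us). h:cO V & w:TW V" using w by(auto simp: tan_image_iff)
 fix N b assume "opn N & N<=V & b:cW N"
 hence N: "opn N" "op_in W N" "N<=V" "b:cW N" by auto
 interpret N: sring "Oz N" by(rule sc[OF N(1)])
 show "vf_add Z V v u N (sg N b) = lsum (Oz N) (%(h, w). fr Z V N h*[Oz N] sg N (w N b)) (ws @ us)" using w N W.tan_cl[OF _ N(2-4)] oV
  by(subst N.lsum_append) (auto simp: tan_image_iff Z.vf_add_app)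
qed
from K_image[OF this] show ?thesis using Kl_tens[OF w(1) g] Kl_tens[OF w(2) g] K_image[OF w(1)] K_image[OF w(2)] oV by(simp add: Kl_def sec_append)
qed

lemma K_vf_smult:
assumes f: "f:cO V" and v: "v:DZ V i"
shows "K V (vf_smult Z V f v) g = f.*[Ts V] K V v g"
proof -
obtain ws where w: "Tim V v ws" using tan_image_exists[OF V v] by blast
let ?ws = "map (%(h, w). (f*[Oz V] h, w)) ws"
have "Tim V (vf_smult Z V f v) ?ws" unfolding tan_image_iff
proof(intro conjI allI impI)
 show "ALL (h, w):set ?ws. h:cO V & w:TW V" using w f by(auto simp: tan_image_iff)
 fix N b assume "opn N & N<=V & b:cW N"
 hence N: "opn N" "op_in W N" "N<=V" "b:cW N" by auto
 interpret N: sring "Oz N" by(rule sc[OF N(1)])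
 note r = Z.res_closed[OF oV N(1,3)]
 have c: "fst p:cO V" "snd p N b:cW N" if "p:set ws" for p using w that W.tan_cl[OF _ N(2-4), of "snd p"] by(auto simp: tan_image_iff)
 have "vf_smult Z V f v N (sg N b) = fr Z V N f*[Oz N] lsum (Oz N) (%p. fr Z V N (fst p)*[Oz N] sg N (snd p N b)) ws"
  using w N by(simp add: tan_image_iff Z.vf_smult_app case_prod_beta)
 also have "... = lsum (Oz N) (%p. fr Z V N f*[Oz N] (fr Z V N (fst p)*[Oz N] sg N (snd p N b))) ws"
  by(rule addmap_lsum[OF N.ag N.ag N.add_mult_left[OF r[OF f]]]) (use c r N in auto)
 also have "... = lsum (Oz N) (%(h, w). fr Z V N h*[Oz N] sg N (w N b)) ?ws" unfolding lsum_map
  by(rule lsum_cong) (use c r f N in \<open>auto simp: case_prod_beta N.m_assoc Z.res_mult[OF oV N(1,3)]\<close>)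
 finally show "vf_smult Z V f v N (sg N b) = ..." .
qed
from K_image[OF this] show ?thesis using sec_smult[OF oV f Kl_tens[OF w g]] K_image[OF w] by(simp add: Kl_def case_prod_beta comp_def)
qed

end

lemma unit_cl: "g:cG V ==> unit V g:cT V" by(simp add: ten_cl[OF oV])

lemma ten_unit: "a:cO V ==> g:cG V ==> ten V a g = a.*[Ts V] unit V g" by(simp add: smult_ten[OF oV])

lemma unit_smult: "b:cW V ==> g:cG V ==> unit V (b.*[Gs V] g) = sg V b.*[Ts V] unit V g"
using ten_balanced[OF oV V.one_closed, of b g] oV by(simp add: ten_unit[symmetric])

lemma nabla_G_cl: "w:DW V k ==> g:cG V ==> nabla G V w g:cG V" by(rule G.nabla_closed[OF oV' W.der_tan])

lemma K_add:
assumes "v:DZ V i" shows "addmap (Gs V) (Ts V) (K V v)"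
using V assms
proof(induction rule: chart_der_induct)
case (lift k v w)
have "K V v (g+[Gs V] g') = K V v g+[Ts V] K V v g'" if "g:cG V" "g':cG V" for g g'
 using that nabla_G_cl[OF lift(2)] G.nabla_add[OF oV' W.der_tan[OF lift(2)] that]
 by(simp add: K_lift[OF _ lift(3,2)] ten_add_right[OF oV])
thus ?case using K_cl[OF _ lift(1)] by(intro addmapI)
next
case (smult q f k v)
note fc = V.gr_car[OF smult(1)]
have "addmap (Gs V) (Ts V) (%g. f.*[Ts V] K V v g)" by(rule addmap_comp[OF smult(3) T.add_smult_right[OF fc]])
thus ?case by(simp add: addmap_def K_vf_smult[OF _ fc smult(2)] Pi_iff)
next
case (add k v u)
note c = addmap_cl[OF add(3)] addmap_cl[OF add(4)]
show ?case using c by(intro addmapI) (simp_all add: K_vf_add[OF _ add(1,2)] addmap_add[OF add(3)] addmap_add[OF add(4)] T.M.a_ac)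
qed

lemma K_Leib:
assumes v: "v:DZ V i" and b: "b:cW V" and g: "g:cG V"
shows "K V v (b.*[Gs V] g) = v V (sg V b).*[Ts V] unit V g+[Ts V] fl V i (sg V b).*[Ts V] K V v g"
using V v
proof(induction rule: chart_der_induct)
case (lift k v w)
interpret B: sring "Ow V" by(rule scW[OF oV])
note wb = W.der_cl[OF lift(2) oV' le b]
show ?case using G.nabla_Leib_flip[OF oV' lift(2) b g] nabla_G_cl[OF lift(2) g] wb b g oV lift(3)
 by(simp add: K_lift[OF _ lift(3,2)] G.smult_closed ten_add_right unit_smult sg_flip lifts_to_def)
next
case (smult q f k v)
note fc = V.gr_car[OF smult(1)] and vb = Z.der_cl[OF smult(2) oV le sg_cl[OF oV b]]
have "f*[Oz V] fl V k (sg V b) = fl V (q ~= k) (sg V b)*[Oz V] f"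
 using V.homog_commute[OF smult(1), of "fl V k (sg V b)"] b oV by(simp add: V.flip_flip)
thus ?case using smult(3) fc vb b g oV K_cl[OF g smult(2)] unit_cl[OF g] Z.vf_smult_app[OF oV le sg_cl[OF oV b], of f v]
 by(simp add: K_vf_smult[OF _ fc smult(2)] G.smult_closed T.smult_r_distr T.smult_closed T.smult_assoc[symmetric] Z.res_id)
next
case (add k v u)
note vb = Z.der_cl[OF add(1) oV le sg_cl[OF oV b]] Z.der_cl[OF add(2) oV le sg_cl[OF oV b]]
show ?case using add(3,4) vb b g oV K_cl[OF g add(1)] K_cl[OF g add(2)] unit_cl[OF g] Z.vf_add_app[OF oV le sg_cl[OF oV b], of v u]
 by(simp add: K_vf_add[OF _ add(1,2)] G.smult_closed T.smult_r_distr T.smult_l_distr T.smult_closed T.M.a_ac)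
qed

lemma K_grade:
assumes v: "v:DZ V i" and g: "g:mg (Gs V) j"
shows "K V v g:mg (Ts V) (i ~= j)"
using V v
proof(induction rule: chart_der_induct)
case (lift k v w)
have "nabla G V w g:mg (Gs V) (k ~= j)" using G.nabla_grade[OF oV' lift(2)] g by blast
hence "hten V (k ~= j) [(1[Oz V], nabla G V w g)]" using V.one_even by(auto simp: hten_def)
thus ?case using sec_grade[OF oV] by(simp add: K_lift[OF G.M.gr_car[OF g] lift(3,2)] ten_def)
next
case (smult q f k v)
have e: "(q ~= (k ~= j)) = ((q ~= k) ~= j)" by(cases q; cases k; cases j) simp_all
show ?case using T.mgrade_smult[OF smult(1,3)] unfolding e by(simp only: K_vf_smult[OF G.M.gr_car[OF g] V.gr_car[OF smult(1)] smult(2)])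
next
case (add k v u)
show ?case using T.M.gr_add[OF add(3,4)] by(simp only: K_vf_add[OF G.M.gr_car[OF g] add(1,2)])
qed

end

end

context inv_im_of
begin

text \<open>The value of $\nabla_v$ on $a \otimes g$ that the Leibniz rule dictates, for \<open>v\<close> of parity \<open>i\<close>.\<close>

definition Lt :: "'p set => bool => ('p, 'a) vfield => 'a => 'm => 'p => ('p, 'a, 'm) tensor_germ" where
"Lt V i v a g = ten V (v V a) g+[Ts V] fl V i a.*[Ts V] K V v g"

abbreviation La :: "'p set => bool => ('p, 'a) vfield => ('a \<times> 'm) list => 'p => ('p, 'a, 'm) tensor_germ" where
"La V i v == lsum (Ts V) (%(a, g). Lt V i v a g)"

lemma S_localI:
assumes "s:extensional U" "!!p. p:U ==> EX V. p:V & V<=U & rst s V:Ss V"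
shows "s:Ss U"
unfolding S_iff
proof(intro conjI ballI assms(1))
fix p assume "p:U"
then obtain V where V: "p:V" "V<=U" "rst s V:Ss V" using assms(2) by blast
then obtain N l where "rep V (rst s V) p N l" unfolding S_iff by blast
hence "rep U s p N l" using V by(auto simp: rep_iff Int_absorb1)
thus "EX V l. rep U s p V l" by blast
qed

lemma chart_rep:
assumes U: "opn U" and s: "s:Ss U" and p: "p:U"
obtains V ths l where "chart V ths" "p:V" "V<=U" "l:tens V" "rst s V = sec V l"
proof -
obtain N k where N: "rep U s p N k" using s p unfolding S_iff by blast
hence "opn N" "p:N" by(auto simp: rep_iff)
then obtain V ths where V: "chart V ths" "p:V" "V<=N" using chart_exists[of N p] by blast
show thesis using rep_res[OF N c_opn[OF V(1)] V(2,3)] N V by(intro that[OF V(1,2)]) (auto simp: rep_iff)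
qed

lemma tensor_nabla_simps [simp]: "tensor_nabla Z G V v ws0 ws1 [] = []" "tensor_nabla Z G V v ws0 ws1 ((a, s) # l) = (v V a, s) #
  map (%(h, w). (a*[Oz V] h, nabla G V w s)) ws0 @
  map (%(h, w). (parity_inv (Oz V) a*[Oz V] h, nabla G V w s)) ws1 @ tensor_nabla Z G V v ws0 ws1 l"
by(simp_all add: tensor_nabla_def)

context
fixes V ths assumes V: "chart V ths"
begin

interpretation V: odd_extension "Oz V" "Ow V" "sg V" ths by(rule chart_self[OF V])
interpretation G: left_supermodule "Ow V" "Gs V" by(rule G_smod[OF oV[OF V]])
interpretation T: left_supermodule "Oz V" "Ts V" by(rule R_smod[OF oV[OF V]])

lemmas oV1 = oV[OF V] and oV2 = oV'[OF V]

lemma smult_K_image: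
assumes w: "Tim V v ws" and a: "a:cO V" and g: "g:cG V"
shows "map (%(h, w). (a*[Oz V] h, nabla G V w g)) ws:tens V"
 and "sec V (map (%(h, w). (a*[Oz V] h, nabla G V w g)) ws) = a.*[Ts V] K V v g"
proof -
have e: "map (%(h, w). (a*[Oz V] h, nabla G V w g)) ws = map (%(b, t). (a*[Oz V] b, t)) (map (%(h, w). (h, nabla G V w g)) ws)" by auto
show "map (%(h, w). (a*[Oz V] h, nabla G V w g)) ws:tens V" unfolding e using Kl_tens[OF V w g] a by(force simp: tens_iff)
show "sec V (map (%(h, w). (a*[Oz V] h, nabla G V w g)) ws) = a.*[Ts V] K V v g"
 unfolding e K_image[OF V g w] Kl_def by(rule sec_smult[OF oV1 a Kl_tens[OF V w g], symmetric])
qed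

lemma sec_tensor_nabla:
assumes v: "v0:DZ V False" "v1:DZ V True"
 and u: "!!a. a:cO V ==> u V a = v0 V a+[Oz V] v1 V a"
 and w: "Tim V v0 ws0" "Tim V v1 ws1" and l: "l:tens V"
shows "tensor_nabla Z G V u ws0 ws1 l:tens V & sec V (tensor_nabla Z G V u ws0 ws1 l) = La V False v0 l+[Ts V] La V True v1 l"
using l
proof(induction l)
case Nil
show ?case using T.M.l_zero[OF T.M.zero_closed] by(simp add: R_simps)
next
case (Cons p l)
obtain a g where p: "p = (a, g)" by(cases p)
have c: "a:cO V" "g:cG V" "l:tens V" using Cons.prems p by auto
note vc = Z.der_cl[OF v(1) oV1 le c(1)] Z.der_cl[OF v(2) oV1 le c(1)]
note f = V.parity_inv_flip[OF c(1)]
note k0 = smult_K_image[OF w(1) c(1,2)] and k1 = smult_K_image[OF w(2) V.flip_cl[OF c(1), of True] c(2)]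
have lt: "Lt V i v a g:cT V" if "a:cO V" "g:cG V" "v:DZ V i" for a g i v using that K_cl[OF V] Z.der_cl[OF that(3) oV1 le] unfolding Lt_def
 by(intro T.M.a_closed T.smult_closed ten_cl[OF oV1]) auto
have la: "La V i v l:cT V" if "v:DZ V i" for i v by(rule T.M.lsum_cl) (use c(3) lt that in \<open>auto simp: tens_iff\<close>)
note K = K_cl[OF V c(2) v(1)] K_cl[OF V c(2) v(2)]
show ?case using Cons.IH[OF c(3)] c k0 k1 vc u[OF c(1)] la[OF v(1)] la[OF v(2)] K ten_cl[OF oV1] oV1
 by(simp add: p f sec_Cons sec_append ten_add_left Lt_def T.M.a_ac T.smult_closed)
qed

lemma Lt_cl:
assumes "v:DZ V i" "a:cO V" "g:cG V" shows "Lt V i v a g:cT V"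
using assms K_cl[OF V assms(3,1)] Z.der_cl[OF assms(1) oV1 le] unfolding Lt_def
by(intro T.M.a_closed T.smult_closed ten_cl[OF oV1]) auto

lemma La_teq:
assumes v: "v:DZ V i" and eq: "teq V l l'" shows "La V i v l = La V i v l'"
proof -
note d = Z.der_add[OF v oV1 le] Z.der_mult[OF v oV1 le] and dc = Z.der_cl[OF v oV1 le]
have K: "K V v g:cT V" if "g:cG V" for g using K_cl[OF V that v] .
have "l:tens V & l':tens V & La V i v l = La V i v l'"
proof(rule tensor_lift[OF oV1 T.M.ag _ _ _ _ eq])
 show "Lt V i v a g:cT V" if "a:cO V" "g:cG V" for a g using Lt_cl[OF v that] .
 show "Lt V i v (a+[Oz V] a') g = Lt V i v a g+[Ts V] Lt V i v a' g" if "a:cO V" "a':cO V" "g:cG V" for a a' g using that dc K ten_cl[OF oV1]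
  by(simp add: Lt_def d V.flip_add ten_add_left[OF oV1] T.smult_l_distr T.smult_closed T.M.a_ac)
 show "Lt V i v a (g+[Gs V] g') = Lt V i v a g+[Ts V] Lt V i v a g'" if "a:cO V" "g:cG V" "g':cG V" for a g g'
  using that dc K ten_cl[OF oV1] addmap_add[OF K_add[OF V v]]
  by(simp add: Lt_def ten_add_right[OF oV1] T.smult_r_distr T.smult_closed T.M.a_ac)
 show "Lt V i v (a*[Oz V] sg V b) g = Lt V i v a (b.*[Gs V] g)" if "a:cO V" "b:cW V" "g:cG V" for a b g
  using that dc K ten_cl[OF oV1] sg_cl[OF oV1 that(2)]
  by(simp add: Lt_def d K_Leib[OF V v that(2,3)] V.flip_mult ten_balanced[OF oV1, symmetric] smult_ten[OF oV1] ten_add_left[OF oV1] unit_cl[OF V] G.smult_closed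
    T.smult_l_distr T.smult_r_distr T.smult_closed T.smult_assoc T.M.a_ac)
qed
thus ?thesis by blast
qed

end

lemma tres_tensor_nabla:
assumes V: "opn V" "opn N" "N<=V" and w: "Tim V v0 ws0" "Tim V v1 ws1"
 and u: "!!a. a:cO V ==> fr Z V N (u V a) = u N (fr Z V N a)" and l: "l:tens V"
shows "tres V N (tensor_nabla Z G V u ws0 ws1 l) = tensor_nabla Z G N u
 (map (%(h, w). (fr Z V N h, vf_res W N w)) ws0) (map (%(h, w). (fr Z V N h, vf_res W N w)) ws1) (tres V N l)"
using l
proof(induction l)
case (Cons p l)
interpret O: sring "Oz V" by(rule sc[OF V(1)])
interpret N: sring "Oz N" by(rule sc[OF V(2)])
obtain a g where p: "p = (a, g)" by(cases p)
have c: "a:cO V" "g:cG V" "l:tens V" using Cons.prems p by auto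
have f: "fr Z V N (parity_inv (Oz V) a) = parity_inv (Oz N) (fr Z V N a)" "parity_inv (Oz V) a:cO V"
 using c V by(simp_all add: O.parity_inv_flip N.parity_inv_flip Z.res_flip)
have m: "tres V N (map (%(h, w). (b*[Oz V] h, nabla G V w g)) ws) =
  map (%(h, w). (fr Z V N b*[Oz N] h, nabla G N w (mr G V N g))) (map (%(h, w). (fr Z V N h, vf_res W N w)) ws)"
 if "Tim V v ws" "b:cO V" for b ws v
 using that c V by(auto simp: tensor_res_def tan_image_iff Z.res_mult G.nabla_res)
show ?case using Cons.IH[OF c(3)] u[OF c(1)] m[OF w(1) c(1)] m[OF w(2) f(2)] by(simp only: p tensor_nabla_simps tres_simps f)
qed simp

lemma tensor_nabla_tens:
assumes V: "opn V" and w: "Tim V v0 ws0" "Tim V v1 ws1"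
 and u: "!!a. a:cO V ==> u V a:cO V" and l: "l:tens V"
shows "tensor_nabla Z G V u ws0 ws1 l:tens V"
using l
proof(induction l)
case (Cons p l)
interpret O: sring "Oz V" by(rule sc[OF V])
have "map (%(h, w). (b*[Oz V] h, nabla G V w g)) ws:tens V" if "Tim V v ws" "b:cO V" "g:cG V" for b ws v g
 using that V G.nabla_closed[of V] by(auto simp: tens_iff tan_image_iff)
thus ?case using Cons w u by(cases p) (auto simp: O.parity_inv_flip)
qed simp

lemma vf_res_parts:
assumes "vf_res Z V v = vf_add Z V v0 v1" "opn N" "N<=V"
shows "vf_res Z N v = vf_add Z N (vf_res Z N v0) (vf_res Z N v1)"
proof(rule Z.vf_eqI)
fix M f assume M: "opn M" "M<=N" "f:cO M"
hence "M<=V" using assms(3) by blast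
hence "vf_res Z V v M f = v M f" "vf_add Z V v0 v1 M f = v0 M f+[Oz M] v1 M f" using M by(simp_all add: Z.vf_res_app Z.vf_add_app)
thus "vf_res Z N v M f = vf_add Z N (vf_res Z N v0) (vf_res Z N v1) M f" using M assms(1) by(simp add: Z.vf_res_app Z.vf_add_app)
qed auto

text \<open>The connection is computed by any representatives of the section and of the vector field.\<close>

lemma nabla_rep:
assumes U: "opn U" and v: "v:TZ U" and V: "chart V ths" "V<=U"
 and l: "l:tens V" "rst s V = sec V l"
 and d: "v0:DZ V False" "v1:DZ V True" "vf_res Z V v = vf_add Z V v0 v1"
shows "rst (nabla R U v s) V = La V False v0 l+[Ts V] La V True v1 l"
proof -
note oV = c_opn[OF V(1)]
let ?P = "%p x. EX V l v0 v1 ws0 ws1. rep U s p V l & v0:DZ V False & v1:DZ V True & vf_res Z V v = vf_add Z V v0 v1 & Tim V v0 ws0 & Tim V v1 ws1 &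
 x = germ p V (tensor_nabla Z G V v ws0 ws1 l)"
have vV: "v N a = v0 N a+[Oz N] v1 N a" if "vf_res Z V v = vf_add Z V v0 v1" "opn N" "N<=V" "a:cO N" for V v0 v1 N a
 using fun_cong[OF fun_cong[OF that(1), of N], of a] that(2-) by(simp add: Z.vf_res_app Z.vf_add_app)
obtain ws0 ws1 where w: "Tim V v0 ws0" "Tim V v1 ws1" using tan_image_exists[OF V(1)] d(1,2) by blast
note e = sec_tensor_nabla[where u = v, OF V(1) d(1,2) vV[OF d(3) oV le] w l(1)]
have "(THE x. ?P p x) = germ p V (tensor_nabla Z G V v ws0 ws1 l)" if p: "p:V" for p
proof(rule the_equality)
 show "?P p (germ p V (tensor_nabla Z G V v ws0 ws1 l))" using oV p V(2) l d w unfolding rep_iff by blast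
 fix x assume "?P p x"
 then obtain A k u0 u1 us0 us1 where A: "rep U s p A k" "u0:DZ A False" "u1:DZ A True"
  "vf_res Z A v = vf_add Z A u0 u1" "Tim A u0 us0" "Tim A u1 us1"
  "x = germ p A (tensor_nabla Z G A v us0 us1 k)" by blast
 hence oA: "opn A" "p:A" "k:tens A" "A<=U" by(auto simp: rep_iff)
 have "germ p V l = s p" using fun_cong[OF l(2), of p] p by(simp add: sec_def)
 then obtain N where N: "opn N" "p:N" "N<=V" "N<=A" "teq N (tres V N l) (tres A N k)"
  using germ_eq_iff[OF oV p l(1) oA(1-3)] rep_germ[OF A(1)] by auto
 note ch = chart_res[OF V(1) N(1,3)]
 let ?r = "vf_res Z N" and ?m = "%B. map (%(h, w). (fr Z B N h, vf_res W N w))"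
 have eq: "?r v0 = ?r u0" "?r v1 = ?r u1" using Z.der_parts_unique[OF Z.vf_res_der[OF d(1) N(3)] Z.vf_res_der[OF d(2) N(3)]
   Z.vf_res_der[OF A(2) N(4)] Z.vf_res_der[OF A(3) N(4)]]
   vf_res_parts[OF d(3) N(1,3)] vf_res_parts[OF A(4) N(1,4)] by simp_all
 have vA: "fr Z B N (v B a) = v N (fr Z B N a)" if "opn B" "B<=U" "N<=B" "a:cO B" for B a
  using Z.tan_commute_res[OF v that(1,2) N(1) that(3,4)] .
 have st: "germ p N (tensor_nabla Z G N v (?m B ws0) (?m B ws1) (tres B N k)) = (La N False (?r v0) (tres B N k)+[Ts N] La N True (?r v1) (tres B N k)) p"
  if B: "opn B" "N<=B" and v: "v0:DZ B False" "v1:DZ B True" "vf_res Z B v = vf_add Z B v0 v1"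
   and w: "Tim B v0 ws0" "Tim B v1 ws1" and k: "k:tens B"
  for B v0 v1 ws0 ws1 k
 proof -
  have "v N a = ?r v0 N a+[Oz N] ?r v1 N a" if "a:cO N" for a using vV[OF v(3) N(1) B(2) that] that N(1) by(simp add: Z.vf_res_app)
  from fun_cong[OF conjunct2[OF sec_tensor_nabla[where u = v, OF ch Z.vf_res_der[OF v(1) B(2)] Z.vf_res_der[OF v(2) B(2)] this
    tan_image_res[OF B(1) N(1) B(2) w(1)] tan_image_res[OF B(1) N(1) B(2) w(2)] tres_tens[OF B(1) N(1) B(2) k]]], of p]
  show ?thesis using N(2) by(simp add: sec_def)
 qed
 have tA: "tensor_nabla Z G A v us0 us1 k:tens A" using tensor_nabla_tens[where u = v, OF oA(1) A(5,6) Z.tan_cl[OF v oA(1,4)] oA(3)] .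
 have "x = germ p N (tensor_nabla Z G N v (?m A us0) (?m A us1) (tres A N k))" using germ_res[OF oA(1) N(1,2,4) tA]
  by(simp only: A(7) tres_tensor_nabla[where u = v, OF oA(1) N(1,4) A(5,6) vA[OF oA(1,4) N(4)] oA(3)])
 also have "... = (La N False (?r v0) (tres V N l)+[Ts N] La N True (?r v1) (tres V N l)) p" unfolding st[OF oA(1) N(4) A(2-6) oA(3)] eq
  using La_teq[OF ch Z.vf_res_der[OF A(2) N(4)] N(5)] La_teq[OF ch Z.vf_res_der[OF A(3) N(4)] N(5)] by simp
 also have "... = germ p N (tensor_nabla Z G N v (?m V ws0) (?m V ws1) (tres V N l))" by(rule st[OF oV N(3) d w l(1), symmetric])
 also have "... = germ p V (tensor_nabla Z G V v ws0 ws1 l)" using germ_res[OF oV N(1-3) conjunct1[OF e]]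
  by(simp only: tres_tensor_nabla[where u = v, OF oV N(1,3) w vA[OF oV V(2) N(3)] l(1)])
 finally show "x = germ p V (tensor_nabla Z G V v ws0 ws1 l)" .
qed
hence "rst (nabla R U v s) V = sec V (tensor_nabla Z G V v ws0 ws1 l)"
 using V(2) by(auto simp: inverse_image_raw_def sec_def restrict_def fun_eq_iff)
thus ?thesis using e by simp
qed

lemma tan_parts_res:
assumes "v:TZ U" "opn V" "V<=U"
obtains v0 v1 where "v0:DZ V False" "v1:DZ V True" "vf_res Z V v = vf_add Z V v0 v1"
using Z.tanE[OF Z.tan_res[OF assms]] by blast

lemma R_nabla_res:
assumes U: "opn U" "opn V" "V<=U" and v: "v:TZ U" and s: "s:Ss U"
shows "rst (nabla R U v s) V = nabla R V (vf_res Z V v) (rst s V)" (is "?a = ?b")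
proof
fix p show "?a p = ?b p"
proof(cases "p:V")
 case True
 note sV = S_res[OF U(1) s U(2,3)]
 obtain N ths l where N: "chart N ths" "p:N" "N<=V" "l:tens N" "rst (rst s V) N = sec N l" using chart_rep[OF U(2) sV True] .
 note oN = c_opn[OF N(1)]
 have NU: "N<=U" using N U by blast
 have l: "rst s N = sec N l" using N(3,5) by(simp add: Int_absorb1)
 obtain v0 v1 where d: "v0:DZ N False" "v1:DZ N True" "vf_res Z N v = vf_add Z N v0 v1" using tan_parts_res[OF v oN NU] .
 have d': "vf_res Z N (vf_res Z V v) = vf_add Z N v0 v1" using Z.vf_res_res[OF v N(3)] d(3) by simp
 have "rst (nabla R U v s) N = rst ?b N"
  using nabla_rep[OF U(1) v N(1) NU N(4) l d] nabla_rep[OF U(2) Z.tan_res[OF v U(2,3)] N(1,3,4,5) d(1,2) d'] by simp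
 from fun_cong[OF this, of p] show ?thesis using N(2) True by simp
qed (simp add: inverse_image_raw_def)
qed

lemma La_cl: "chart V ths ==> v:DZ V i ==> l:tens V ==> La V i v l:Ss V"
proof -
assume V: "chart V ths" and v: "v:DZ V i" and l: "l:tens V"
have "La V i v l:cT V" by(rule abelian_group.lsum_cl[OF R_group[OF c_opn[OF V]]]) (use Lt_cl[OF V v] l in \<open>auto simp: tens_iff\<close>)
thus "La V i v l:Ss V" by(simp add: R_simps)
qed

lemma R_nabla_cl:
assumes U: "opn U" and v: "v:TZ U" and s: "s:Ss U" shows "nabla R U v s:Ss U"
proof(rule S_localI)
fix p assume "p:U"
obtain V ths l where V: "chart V ths" "p:V" "V<=U" "l:tens V" "rst s V = sec V l" using chart_rep[OF U s `p:U`] .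
note oV = c_opn[OF V(1)]
obtain v0 v1 where d: "v0:DZ V False" "v1:DZ V True" "vf_res Z V v = vf_add Z V v0 v1" using tan_parts_res[OF v oV V(3)] .
show "EX V. p:V & V<=U & rst (nabla R U v s) V:Ss V"
 using nabla_rep[OF U v V(1,3-5) d] add_cl[OF oV La_cl[OF V(1) d(1) V(4)] La_cl[OF V(1) d(2) V(4)]] V by metis
qed (simp add: inverse_image_raw_def)

end

context inv_im_of
begin

context
fixes V ths assumes V: "chart V ths"
begin

interpretation V: odd_extension "Oz V" "Ow V" "sg V" ths by(rule chart_self[OF V])
interpretation G: left_supermodule "Ow V" "Gs V" by(rule G_smod[OF oV[OF V]])
interpretation T: left_supermodule "Oz V" "Ts V" by(rule R_smod[OF oV[OF V]])

lemma La_zero: "l:tens V ==> La V i (Z.vf_zero V) l = 0[Ts V]"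
proof(rule T.M.lsum_zero)
fix p assume "l:tens V" "p:set l"
then obtain a g where p: "p = (a, g)" "a:cO V" "g:cG V" by(cases p) (auto simp: tens_iff)
note oV = oV[OF V]
have "Tim V (Z.vf_zero V) []" by(auto simp: tan_image_iff Z.vf_zero_app)
from K_image[OF V p(3) this] have K: "K V (Z.vf_zero V) g = 0[Ts V]" by(simp add: Kl_def R_simps)
have "ten V 0[Oz V] g = 0[Ts V]" using ten_unit[OF V V.zero_closed p(3)] unit_cl[OF V p(3)] by simp
thus "(case p of (a, g) => Lt V i (Z.vf_zero V) a g) = 0[Ts V]" using K p oV by(simp add: Lt_def Z.vf_zero_app)
qed

lemma nabla_tan_sec:
assumes d: "v0:DZ V False" "v1:DZ V True" and l: "l:tens V"
shows "nabla R V (vf_add Z V v0 v1) (sec V l) = La V False v0 l+[Ts V] La V True v1 l"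
proof -
have t: "vf_add Z V v0 v1:TZ V" using d unfolding tangent_def by blast
note s = sec_S[OF oV[OF V] l]
show ?thesis using nabla_rep[OF oV[OF V] t V le l S_ext[OF s] d Z.vf_res_id[OF t]] S_ext[OF R_nabla_cl[OF oV[OF V] t s]] by simp
qed

lemma nabla_sec:
assumes v: "v:DZ V i" and l: "l:tens V"
shows "nabla R V v (sec V l) = La V i v l"
proof -
have e: "vf_add Z V v (Z.vf_zero V) = v" "vf_add Z V (Z.vf_zero V) v = v"
proof(rule_tac[!] Z.vf_eqI[of V])
 fix N f assume N: "opn N" "N<=V" "f:cO N"
 interpret N: sring "Oz N" by(rule sc[OF N(1)])
 show "vf_add Z V v (Z.vf_zero V) N f = v N f" "vf_add Z V (Z.vf_zero V) v N f = v N f"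
  using N Z.der_cl[OF v N] by(simp_all add: Z.vf_add_app Z.vf_zero_app)
qed (use Z.vf_on_der[OF v] in auto)
have c: "La V i v l:cT V" using La_cl[OF V v l] by(simp add: R_simps)
show ?thesis
proof(cases i)
 case True
 thus ?thesis using nabla_tan_sec[OF Z.vf_zero_der _ l, of v] v c by(simp add: e La_zero[OF l])
next
 case False
 thus ?thesis using nabla_tan_sec[OF _ Z.vf_zero_der l, of v] v c by(simp add: e La_zero[OF l])
qed
qed

lemma nabla_ten:
assumes "v:DZ V i" "a:cO V" "g:cG V"
shows "nabla R V v (ten V a g) = Lt V i v a g"
using nabla_sec[OF assms(1), of "[(a, g)]"] Lt_cl[OF V assms] assms(2,3) by(simp add: ten_def)

lemma add_ext_ten:
assumes f: "addmap (Ts V) (Ts V) f" "addmap (Ts V) (Ts V) f'"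
 and eq: "!!a g. a:cO V ==> g:cG V ==> f (ten V a g) = f' (ten V a g)" and l: "l:tens V"
shows "f (sec V l) = f' (sec V l)"
using l
proof(induction l)
case Nil
show ?case using addmap_zero[OF T.M.ag T.M.ag] f by(simp add: R_simps)
next
case (Cons p l)
obtain a g where p: "p = (a, g)" by(cases p)
have c: "a:cO V" "g:cG V" "l:tens V" using Cons.prems p by auto
have "sec V l:cT V" using sec_S[OF oV[OF V] c(3)] by(simp add: R_simps)
thus ?case using Cons.IH[OF c(3)] eq[OF c(1,2)] c ten_cl[OF oV[OF V] c(1,2)]
 by(simp add: p sec_Cons[OF oV[OF V]] addmap_add[OF f(1)] addmap_add[OF f(2)])
qed

end

context
fixes U assumes U: "opn U"
begin

interpretation O: sring "Oz U" by(rule sc[OF U])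
interpretation T: left_supermodule "Oz U" "Ts U" by(rule R_smod[OF U])

lemma R_nabla_add:
assumes v: "v:TZ U" and s: "s:Ss U" "t:Ss U"
shows "nabla R U v (s+[Ts U] t) = nabla R U v s+[Ts U] nabla R U v t"
proof(rule S_eq_on_secs[OF U, of _ _ "[s, t]"])
note cl = add_cl[OF U] R_nabla_cl[OF U v]
show "nabla R U v (s+[Ts U] t):Ss U" "nabla R U v s+[Ts U] nabla R U v t:Ss U" using s cl by auto
fix N assume oN: "opn N" "N<=U" and "EX ths. chart N ths" and l: "!!x. x:set [s, t] ==> EX l:tens N. rst x N = sec N l"
then obtain ths where N: "chart N ths" by blast
interpret N: left_supermodule "Oz N" "Ts N" by(rule R_smod[OF oN(1)])
obtain k where k: "k:tens N" "rst s N = sec N k" using l[of s] by auto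
obtain m where m: "m:tens N" "rst t N = sec N m" using l[of t] by auto
obtain v0 v1 where d: "v0:DZ N False" "v1:DZ N True" "vf_res Z N v = vf_add Z N v0 v1" using tan_parts_res[OF v oN] .
have a: "La N i x (k @ m) = La N i x k+[Ts N] La N i x m" if "x:DZ N i" for i x
 by(rule N.M.lsum_append) (use Lt_cl[OF N that] k(1) m(1) in \<open>auto simp: tens_iff\<close>)
have c: "La N i x k:cT N" "La N i x m:cT N" if "x:DZ N i" for i x using La_cl[OF N that] k(1) m(1) by(auto simp: R_simps)
show "rst (nabla R U v (s+[Ts U] t)) N = rst (nabla R U v s+[Ts U] nabla R U v t) N"
 using s cl k m a[OF d(1)] a[OF d(2)] c[OF d(1)] c[OF d(2)] sec_append[OF oN(1) k(1) m(1), symmetric] nabla_tan_sec[OF N d(1,2)]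
 by(simp add: R_nabla_res[OF U oN v] add_res[OF U oN] d(3) N.M.a_ac)
qed (use s in auto)

lemma add_nabla_R: "v:TZ U ==> addmap (Ts U) (Ts U) (nabla R U v)" by(rule addmapI) (simp_all add: R_simps R_nabla_cl[OF U] R_nabla_add)

end

text \<open>Identities that are additive in the section are checked on pure tensors over charts.\<close>

lemma R_ext:
assumes U: "opn U" and s: "s:Ss U" and c: "f U s:Ss U" "f' U s:Ss U"
 and r: "!!V. opn V ==> V<=U ==> rst (f U s) V = f V (rst s V)" "!!V. opn V ==> V<=U ==> rst (f' U s) V = f' V (rst s V)"
 and f: "!!V. opn V ==> V<=U ==> addmap (Ts V) (Ts V) (f V)" "!!V. opn V ==> V<=U ==> addmap (Ts V) (Ts V) (f' V)"
 and eq: "!!V ths a g. chart V ths ==> V<=U ==> a:cO V ==> g:cG V ==> f V (ten V a g) = f' V (ten V a g)"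
shows "f U s = f' U s"
proof(rule S_eq_on_secs[OF U c, of "[s]"])
fix V assume V: "opn V" "V<=U" "EX ths. chart V ths" and "!!x. x:set [s] ==> EX l:tens V. rst x V = sec V l"
then obtain l where l: "l:tens V" "rst s V = sec V l" by auto
obtain ths where ch: "chart V ths" using V(3) ..
show "rst (f U s) V = rst (f' U s) V" unfolding r(1)[OF V(1,2)] r(2)[OF V(1,2)] l(2)
 by(rule add_ext_ten[OF ch f(1)[OF V(1,2)] f(2)[OF V(1,2)] eq[OF ch V(2)] l(1)])
qed (use s in auto)

lemma addmap_sum:
assumes "abelian_group T" "addmap S T f" "addmap S T g" shows "addmap S T (%x. f x+[T] g x)"
proof -
interpret T: abelian_group T by fact
show ?thesis using addmap_cl[OF assms(2)] addmap_cl[OF assms(3)]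
 by(intro addmapI) (simp_all add: addmap_add[OF assms(2)] addmap_add[OF assms(3)] T.a_ac)
qed

lemma R_nabla_vf_add:
assumes U: "opn U" and v: "v:TZ U" "w:TZ U" and s: "s:Ss U"
shows "nabla R U (vf_add Z U v w) s = nabla R U v s+[Ts U] nabla R U w s"
proof -
let ?r = "vf_res Z"
let ?f = "%V s. nabla R V (?r V (vf_add Z U v w)) s" and ?f' = "%V s. nabla R V (?r V v) s+[Ts V] nabla R V (?r V w) s"
note t = Z.vf_add_tan[OF v(1)]
have id: "?r U x = x" if "x:TZ U" for x by(rule Z.vf_res_id[OF that])
have rr: "rst (nabla R U x s) V = nabla R V (?r V x) (rst s V)" if "opn V" "V<=U" "x:TZ U" for V x by(rule R_nabla_res[OF U that s])
have "?f U s = ?f' U s"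
proof(rule R_ext[where f = ?f and f' = ?f', OF U s])
 show "?f U s:Ss U" "?f' U s:Ss U" using U s v t[OF v(2)] R_nabla_cl add_cl by(simp_all add: id)
 show "rst (?f U s) V = ?f V (rst s V)" "rst (?f' U s) V = ?f' V (rst s V)" if "opn V" "V<=U" for V
  using that U s v t[OF v(2)] R_nabla_cl by(simp_all add: id add_res rr)
 fix V assume V: "opn V" "V<=U"
 note a = add_nabla_R[OF V(1) Z.tan_res[OF _ V]]
 show "addmap (Ts V) (Ts V) (?f V)" by(rule a[OF t[OF v(2)]])
 show "addmap (Ts V) (Ts V) (?f' V)" by(rule addmap_sum[OF R_group[OF V(1)] a[OF v(1)] a[OF v(2)]])
next
 fix V ths a g assume V: "chart V ths" "V<=U" and c: "a:cO V" "g:cG V"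
 note oV = c_opn[OF V(1)]
 interpret T: left_supermodule "Oz V" "Ts V" by(rule R_smod[OF oV])
 obtain v0 v1 where d: "v0:DZ V False" "v1:DZ V True" "?r V v = vf_add Z V v0 v1" using tan_parts_res[OF v(1) oV V(2)] .
 obtain w0 w1 where e: "w0:DZ V False" "w1:DZ V True" "?r V w = vf_add Z V w0 w1" using tan_parts_res[OF v(2) oV V(2)] .
 have "?r V (vf_add Z U v w) = vf_add Z V (?r V v) (?r V w)"
 proof(rule Z.vf_eqI[of V])
  fix N f assume N: "opn N" "N<=V" "f:cO N"
  hence "N<=U" using V(2) by blast
  thus "?r V (vf_add Z U v w) N f = vf_add Z V (?r V v) (?r V w) N f" using N by(simp add: Z.vf_res_app Z.vf_add_app)
 qed auto
 hence r: "?r V (vf_add Z U v w) = vf_add Z V (vf_add Z V v0 w0) (vf_add Z V v1 w1)" using Z.vf_add_assoc_comm[OF d(1,2) e(1,2)] d(3) e(3) by simp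
 have L: "Lt V i (vf_add Z V x y) a g = Lt V i x a g+[Ts V] Lt V i y a g" "Lt V i x a g:cT V" "Lt V i y a g:cT V"
  if xy: "x:DZ V i" "y:DZ V i" for i x y
  using Lt_cl[OF V(1) _ c] xy Z.der_cl[OF xy(1) oV le c(1)] Z.der_cl[OF xy(2) oV le c(1)] K_cl[OF V(1) c(2)] c oV
  by(simp_all add: Lt_def K_vf_add[OF V(1) c(2) xy] Z.vf_add_app ten_add_left ten_cl T.smult_r_distr T.smult_closed T.M.a_ac)
 note n = nabla_tan_sec[OF V(1) _ _, of _ _ "[(a, g)]", folded ten_def]
 show "?f V (ten V a g) = ?f' V (ten V a g)"
  using n[OF d(1,2)] n[OF e(1,2)] n[OF Z.vf_add_der[OF d(1) e(1)] Z.vf_add_der[OF d(2) e(2)]] c L[OF d(1) e(1)] L[OF d(2) e(2)]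
  by(simp add: r d(3) e(3) T.M.a_ac)
qed
thus ?thesis using v t[OF v(2)] by(simp add: id)
qed

lemma R_nabla_vf_smult_homog:
assumes U: "opn U" and f: "f:grade (Oz U) q" and v: "v:DZ U i" and s: "s:Ss U"
shows "nabla R U (vf_smult Z U f v) s = f.*[Ts U] nabla R U v s"
proof -
let ?r = "vf_res Z"
let ?f = "%V s. nabla R V (?r V (vf_smult Z U f v)) s" and ?f' = "%V s. fr Z U V f.*[Ts V] nabla R V (?r V v) s"
interpret U: sring "Oz U" by(rule sc[OF U])
note fc = U.gr_car[OF f] and vd = Z.vf_smult_der[OF U f v]
note vt = Z.der_tan[OF v] and t = Z.der_tan[OF vd]
have id: "?r U x = x" if "x:TZ U" for x by(rule Z.vf_res_id[OF that])
have rr: "rst (nabla R U x s) V = nabla R V (?r V x) (rst s V)" if "opn V" "V<=U" "x:TZ U" for V x by(rule R_nabla_res[OF U that s])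
have "?f U s = ?f' U s"
proof(rule R_ext[where f = ?f and f' = ?f', OF U s])
 show "?f U s:Ss U" "?f' U s:Ss U" using U s vt t fc R_nabla_cl smult_closed by(simp_all add: id Z.res_id)
 show "rst (?f U s) V = ?f V (rst s V)" "rst (?f' U s) V = ?f' V (rst s V)" if "opn V" "V<=U" for V
  using that U s vt t fc R_nabla_cl by(simp_all add: id Z.res_id smult_res rr)
 fix V assume V: "opn V" "V<=U"
 interpret T: left_supermodule "Oz V" "Ts V" by(rule R_smod[OF V(1)])
 note a = add_nabla_R[OF V(1) Z.tan_res[OF _ V]]
 show "addmap (Ts V) (Ts V) (?f V)" by(rule a[OF t])
 show "addmap (Ts V) (Ts V) (?f' V)" by(rule addmap_comp[OF a[OF vt] T.add_smult_right[OF Z.res_closed[OF U V fc]]])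
next
 fix V ths a g assume V: "chart V ths" "V<=U" and c: "a:cO V" "g:cG V"
 note oV = c_opn[OF V(1)]
 interpret T: left_supermodule "Oz V" "Ts V" by(rule R_smod[OF oV])
 let ?v = "?r V v" and ?F = "fr Z U V f"
 have r: "?r V (vf_smult Z U f v) = vf_smult Z V ?F ?v"
 proof(rule Z.vf_eqI[of V])
  fix N h assume N: "opn N" "N<=V" "h:cO N"
  hence "N<=U" using V(2) by blast
  thus "?r V (vf_smult Z U f v) N h = vf_smult Z V ?F ?v N h" using N fc by(simp add: Z.vf_res_app Z.vf_smult_app Z.res_trans[OF U oV N(1,2) V(2)])
 qed auto
 note Fg = Z.res_grade[OF U oV V(2) f] and d = Z.vf_res_der[OF v V(2)]
 note F = T.R.gr_car[OF Fg] and da = Z.der_cl[OF d oV le c(1)] and K = K_cl[OF V(1) c(2) d]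
 have "fl V (q ~= i) a*[Oz V] ?F = ?F*[Oz V] fl V i a" using T.R.homog_commute[OF Fg, of "fl V i a"] c by(simp add: T.R.flip_flip)
 hence "Lt V (q ~= i) (vf_smult Z V ?F ?v) a g = ?F.*[Ts V] Lt V i ?v a g" using F da K c oV Z.vf_smult_app[OF oV le c(1), of ?F ?v]
  by(simp add: Lt_def K_vf_smult[OF V(1) c(2) F d] Z.res_id smult_ten ten_cl T.smult_r_distr T.smult_closed T.smult_assoc[symmetric])
 thus "?f V (ten V a g) = ?f' V (ten V a g)" using nabla_ten[OF V(1) d c] nabla_ten[OF V(1) Z.vf_smult_der[OF oV Fg d] c] by(simp add: r)
qed
thus ?thesis using vt t fc U by(simp add: id Z.res_id)
qed

lemma R_nabla_vf_smult:
assumes U: "opn U" and f: "f:cO U" and v: "v:TZ U" and s: "s:Ss U"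
shows "nabla R U (vf_smult Z U f v) s = f.*[Ts U] nabla R U v s"
proof -
interpret T: left_supermodule "Oz U" "Ts U" by(rule R_smod[OF U])
obtain v0 v1 where d: "v0:DZ U False" "v1:DZ U True" "v = vf_add Z U v0 v1" using v by(rule Z.tanE)
obtain f0 f1 where e: "f0:grade (Oz U) False" "f1:grade (Oz U) True" "f = f0+[Oz U] f1" using f by(rule T.R.decomposeE)
note dt = Z.der_tan[OF d(1)] Z.der_tan[OF d(2)]
have n: "nabla R U x s:cT U" if "x:TZ U" for x using R_nabla_cl[OF U that s] by(simp add: R_simps)
have t: "nabla R U (vf_smult Z U g v) s = g.*[Ts U] nabla R U v s" if g: "g:grade (Oz U) j" for g j
 using T.R.gr_car[OF g] n dt R_nabla_vf_smult_homog[OF U g d(1) s] R_nabla_vf_smult_homog[OF U g d(2) s]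
 by(simp add: d(3) Z.vf_smult_add_right[OF U _ dt] R_nabla_vf_add[OF U Z.vf_smult_tan[OF U _ dt(1)] Z.vf_smult_tan[OF U _ dt(2)] s]
   R_nabla_vf_add[OF U dt s] T.smult_r_distr)
show ?thesis using t[OF e(1)] t[OF e(2)] n[OF v] e(1,2)[THEN T.R.gr_car]
 by(simp add: e(3) Z.vf_smult_add_left[OF U _ _ v] R_nabla_vf_add[OF U Z.vf_smult_tan[OF U _ v] Z.vf_smult_tan[OF U _ v] s] T.smult_l_distr)
qed

lemma R_nabla_Leib:
assumes U: "opn U" and v: "v:DZ U i" and f: "f:cO U" and s: "s:Ss U"
shows "nabla R U v (f.*[Ts U] s) = v U f.*[Ts U] s+[Ts U] fl U i f.*[Ts U] nabla R U v s"
proof -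
let ?r = "vf_res Z"
let ?f = "%V s. nabla R V (?r V v) (fr Z U V f.*[Ts V] s)"
let ?f' = "%V s. fr Z U V (v U f).*[Ts V] s+[Ts V] fr Z U V (fl U i f).*[Ts V] nabla R V (?r V v) s"
interpret U: sring "Oz U" by(rule sc[OF U])
note vt = Z.der_tan[OF v] and vf = Z.der_cl[OF v U le f] and ff = U.flip_cl[OF f, of i]
note id = Z.vf_res_id[OF vt]
have rr: "rst (nabla R U v x) V = nabla R V (?r V v) (rst x V)" if "opn V" "V<=U" "x:Ss U" for V x by(rule R_nabla_res[OF U that(1,2) vt that(3)])
have "?f U s = ?f' U s"
proof(rule R_ext[where f = ?f and f' = ?f', OF U s])
 show "?f U s:Ss U" "?f' U s:Ss U" using U s vt f vf ff R_nabla_cl smult_closed add_cl by(simp_all add: id Z.res_id)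
 show "rst (?f U s) V = ?f V (rst s V)" "rst (?f' U s) V = ?f' V (rst s V)" if "opn V" "V<=U" for V
  using that U s vt f vf ff R_nabla_cl smult_closed by(simp_all add: id Z.res_id smult_res add_res rr)
 fix V assume V: "opn V" "V<=U"
 interpret T: left_supermodule "Oz V" "Ts V" by(rule R_smod[OF V(1)])
 note a = add_nabla_R[OF V(1) Z.tan_res[OF vt V]] and m = T.add_smult_right[OF Z.res_closed[OF U V]]
 show "addmap (Ts V) (Ts V) (?f V)" by(rule addmap_comp[OF m[OF f] a])
 show "addmap (Ts V) (Ts V) (?f' V)" by(rule addmap_sum[OF T.M.ag m[OF vf] addmap_comp[OF a m[OF ff]]])
next
 fix V ths a g assume V: "chart V ths" "V<=U" and c: "a:cO V" "g:cG V"
 note oV = c_opn[OF V(1)]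
 interpret T: left_supermodule "Oz V" "Ts V" by(rule R_smod[OF oV])
 let ?v = "?r V v" and ?F = "fr Z U V f"
 note d = Z.vf_res_der[OF v V(2)] and F = Z.res_closed[OF U oV V(2) f]
 note da = Z.der_cl[OF d oV le] and K = K_cl[OF V(1) c(2) d]
 have "fr Z U V (v U f) = ?v V ?F" "fr Z U V (fl U i f) = fl V i ?F"
  using Z.der_res[OF v U le oV V(2) f] Z.res_flip[OF U oV V(2) f] F oV by(simp_all add: Z.vf_res_app)
 thus "?f V (ten V a g) = ?f' V (ten V a g)" using F da c oV K nabla_ten[OF V(1) d c] nabla_ten[OF V(1) d T.R.m_closed[OF F c(1)] c(2)]
  by(simp add: smult_ten Lt_def Z.der_mult[OF d oV le] ten_add_left T.R.flip_mult ten_cl T.smult_r_distr T.smult_closed T.smult_assoc T.M.a_ac)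
qed
thus ?thesis using vt f vf ff U by(simp add: id Z.res_id)
qed

lemma R_nabla_grade:
assumes U: "opn U" and v: "v:DZ U i" and s: "s:mg (Ts U) j"
shows "nabla R U v s:mg (Ts U) (i ~= j)"
proof(rule R_grade_local[OF U])
note vt = Z.der_tan[OF v]
have sS: "s:Ss U" using s by(simp add: R_grade)
show "nabla R U v s:Ss U" by(rule R_nabla_cl[OF U vt sS])
fix p assume "p:U"
then obtain N l where N: "rep U s p N l" "hten N j l" using s unfolding R_grade by blast
hence "opn N" "p:N" by(auto simp: rep_iff)
then obtain V ths where V: "chart V ths" "p:V" "V<=N" using chart_exists[of N p] by blast
note oV = c_opn[OF V(1)]
let ?l = "tres N V l" and ?v = "vf_res Z V v"
note r = grade_rep_res[OF N oV V(2,3)]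
have VU: "V<=U" "?l:tens V" "rst s V = sec V ?l" using r(1) by(auto simp: rep_iff)
note d = Z.vf_res_der[OF v VU(1)]
interpret T: left_supermodule "Oz V" "Ts V" by(rule R_smod[OF oV])
interpret G: left_supermodule "Ow V" "Gs V" by(rule G_smod[OF oV])
have "La V i ?v ?l:mg (Ts V) (i ~= j)"
proof(rule T.M.gr_lsum)
 fix x assume x: "x:set ?l"
 obtain a g where [simp]: "x = (a, g)" by(cases x)
 obtain k where k: "a:grade (Oz V) k" "g:mg (Gs V) (j ~= k)" using r(2) x by(auto simp: hten_def)
 have e: "((i ~= j) ~= (i ~= k)) = (j ~= k)" "(k ~= (i ~= (j ~= k))) = (i ~= j)" by(cases i; cases j; cases k; simp)+
 have "hten V (i ~= j) [(?v V a, g)]" using Z.der_grade[OF d oV le k(1)] k(2)[folded e(1)] unfolding hten_def by auto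
 hence "ten V (?v V a) g:mg (Ts V) (i ~= j)" unfolding ten_def by(rule sec_grade[OF oV])
 moreover have "fl V i a.*[Ts V] K V ?v g:mg (Ts V) (i ~= j)"
  using T.mgrade_smult[OF T.R.flip_gr[OF k(1)] K_grade[OF V(1) d k(2)], of i] unfolding e(2) .
 ultimately show "(case x of (a, g) => Lt V i ?v a g):mg (Ts V) (i ~= j)" unfolding Lt_def by(simp add: T.M.gr_add)
qed
thus "EX V. opn V & p:V & V<=U & rst (nabla R U v s) V:mg (Ts V) (i ~= j)"
 using R_nabla_res[OF U oV VU(1) vt sS] nabla_sec[OF V(1) d VU(2)] VU oV V(2) by(intro exI[of _ V]) simp
qed

section \<open>Flatness of the pulled-back connection\<close>

context
fixes V ths assumes V: "chart V ths"
begin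

interpretation V: odd_extension "Oz V" "Ow V" "sg V" ths by(rule chart_self[OF V])
interpretation G: left_supermodule "Ow V" "Gs V" by(rule G_smod[OF oV[OF V]])
interpretation T: left_supermodule "Oz V" "Ts V" by(rule R_smod[OF oV[OF V]])

lemmas opV = oV[OF V] and opV2 = oV'[OF V]

definition flat_on :: "bool => ('p, 'a) vfield => bool => ('p, 'a) vfield => bool" where
"flat_on i v j u <-> (ALL g:cG V. K V (vf_br Z V i j v u) g =
  nabla R V v (K V u g) -[Ts V] koszul (Ts V) i j (nabla R V u (K V v g)))"

lemma n_cl: "v:DZ V i ==> x:cT V ==> nabla R V v x:cT V" using R_nabla_cl[OF opV Z.der_tan] by(simp add: R_simps)

lemma n_add: "v:DZ V i ==> x:cT V ==> y:cT V ==> nabla R V v (x+[Ts V] y) = nabla R V v x+[Ts V] nabla R V v y"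
using R_nabla_add[OF opV Z.der_tan] by(simp add: R_simps)

lemma n_vf_add: "v:DZ V i ==> u:DZ V i ==> x:cT V ==> nabla R V (vf_add Z V v u) x = nabla R V v x+[Ts V] nabla R V u x"
using R_nabla_vf_add[OF opV Z.der_tan Z.der_tan] by(simp add: R_simps)

lemma n_vf_smult: "v:DZ V i ==> f:cO V ==> x:cT V ==> nabla R V (vf_smult Z V f v) x = f.*[Ts V] nabla R V v x"
using R_nabla_vf_smult[OF opV _ Z.der_tan] by(simp add: R_simps)

lemma n_Leib: "v:DZ V i ==> f:cO V ==> x:cT V ==> nabla R V v (f.*[Ts V] x) = v V f.*[Ts V] x+[Ts V] fl V i f.*[Ts V] nabla R V v x"
using R_nabla_Leib[OF opV] by(simp add: R_simps)

lemma n_unit: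
assumes v: "v:DZ V i" and g: "g:cG V" shows "nabla R V v (unit V g) = K V v g"
proof -
have "v V 1[Oz V] = v V 1[Oz V]+[Oz V] v V 1[Oz V]"
 using Z.der_mult[OF v opV le V.one_closed V.one_closed] Z.der_cl[OF v opV le V.one_closed] by simp
hence "v V 1[Oz V] = 0[Oz V]" using V.add_self_cancel[of "v V 1[Oz V]"] Z.der_cl[OF v opV le V.one_closed] by metis
moreover have "ten V 0[Oz V] g = 0[Ts V]" using ten_unit[OF V V.zero_closed g] unit_cl[OF V g] by simp
ultimately show ?thesis using nabla_ten[OF V v V.one_closed g] K_cl[OF V g v] by(simp add: Lt_def T.smult_one)
qed

lemma flat_on_sym:
assumes v: "v:DZ V i" and u: "u:DZ V j" and f: "flat_on j u i v"
shows "flat_on i v j u"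
unfolding flat_on_def
proof
fix g assume g: "g:cG V"
let ?c = "-[Oz V] koszul (Oz V) i j 1[Oz V]"
note b = Z.vf_br_der[OF u v]
have "vf_br Z V i j v u = vf_smult Z V ?c (vf_br Z V j i u v)"
proof(rule Z.vf_eqI[of V])
 fix N h assume N: "opn N" "N<=V" "h:cO N"
 interpret N: sring "Oz N" by(rule sc[OF N(1)])
 have c: "v N (u N h):cO N" "u N (v N h):cO N" using Z.der_cl[OF v N(1,2)] Z.der_cl[OF u N(1,2)] N(3) by auto
 have "fr Z V N ?c = -[Oz N] koszul (Oz N) i j 1[Oz N]" by(simp add: Z.res_neg[OF opV N(1,2)] Z.res_ksz[OF opV N(1,2)] Z.res_one[OF opV N(1,2)])
 thus "vf_br Z V i j v u N h = vf_smult Z V ?c (vf_br Z V j i u v) N h"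
  using N c by(cases i; cases j) (simp_all add: Z.vf_smult_app Z.vf_br_app koszul_def N.l_minus N.minus_eq N.minus_add N.a_ac)
qed auto
hence "K V (vf_br Z V i j v u) g = ?c.*[Ts V] K V (vf_br Z V j i u v) g" using K_vf_smult[OF V g _ b, of ?c] by simp
moreover have "nabla R V u (K V v g):cT V" "nabla R V v (K V u g):cT V" using n_cl u v K_cl[OF V g] by blast+
ultimately show "K V (vf_br Z V i j v u) g = nabla R V v (K V u g) -[Ts V] koszul (Ts V) i j (nabla R V u (K V v g))" using f g unfolding flat_on_def
 by(cases i; cases j) (simp_all add: koszul_def T.smult_neg T.smult_one T.M.minus_eq T.M.minus_add T.M.a_ac)
qed

text \<open>The curvature is linear over functions, so it vanishes once it vanishes on generators.\<close>

lemma flat_on_smult: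
assumes f: "f:grade (Oz V) q" and v: "v:DZ V k" and u: "u:DZ V j" and fl: "flat_on k v j u"
shows "flat_on (q ~= k) (vf_smult Z V f v) j u"
unfolding flat_on_def
proof
fix g assume g: "g:cG V"
let ?i = "q ~= k"
let ?c = "-[Oz V] koszul (Oz V) ?i j (u V f)"
note fc = V.gr_car[OF f] and b = Z.vf_br_der[OF v u]
note uf = Z.der_cl[OF u opV le fc] and ug = Z.der_grade[OF u opV le f]
have cg: "?c:grade (Oz V) (j ~= q)" by(rule V.gr_neg[OF V.gr_ksz[OF ug]])
have jq: "((j ~= q) ~= k) = (?i ~= j)" "(q ~= (k ~= j)) = (?i ~= j)" by(cases q; cases k; cases j; simp)+
have e: "vf_br Z V ?i j (vf_smult Z V f v) u = vf_add Z V (vf_smult Z V f (vf_br Z V k j v u)) (vf_smult Z V ?c v)"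
proof(rule Z.vf_eqI[of V])
 fix N h assume N: "opn N" "N<=V" "h:cO N"
 interpret N: sring "Oz N" by(rule sc[OF N(1)])
 let ?F = "fr Z V N f"
 note vc = Z.der_cl[OF v N(1,2)] and uc = Z.der_cl[OF u N(1,2)]
 have c: "v N h:cO N" "u N h:cO N" "v N (u N h):cO N" "u N (v N h):cO N" using vc uc N(3) by auto
 note F = Z.res_closed[OF opV N(1,2) fc] and Fg = Z.res_grade[OF opV N(1,2) f]
 have r: "fr Z V N ?c = -[Oz N] koszul (Oz N) ?i j (u N ?F)"
  using uf Z.der_res[OF u opV le N(1,2) fc] by(simp add: Z.res_neg[OF opV N(1,2)] Z.res_ksz[OF opV N(1,2)])
 have m: "u N (?F*[Oz N] v N h) = u N ?F*[Oz N] v N h+[Oz N] koszul (Oz N) j q ?F*[Oz N] u N (v N h)"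
  using Z.der_mult[OF u N(1,2) F c(1)] N.flip_homog[OF Fg] by simp
 show "vf_br Z V ?i j (vf_smult Z V f v) u N h = vf_add Z V (vf_smult Z V f (vf_br Z V k j v u)) (vf_smult Z V ?c v) N h" using N c F uc[OF F] r m
  by(cases q; cases k; cases j)
   (simp_all add: Z.vf_smult_app Z.vf_br_app Z.vf_add_app koszul_def N.l_minus N.r_minus N.minus_eq N.minus_add N.r_distr N.a_ac)
qed auto
let ?x = "nabla R V v (K V u g)" and ?y = "nabla R V u (K V v g)"
have n: "?x:cT V" "?y:cT V" using n_cl u v K_cl[OF V g] by blast+
note Kv = K_cl[OF V g v] and Kb = K_cl[OF V g b]
have 1: "K V (vf_br Z V ?i j (vf_smult Z V f v) u) g = f.*[Ts V] (?x -[Ts V] koszul (Ts V) k j ?y)+[Ts V] ?c.*[Ts V] K V v g"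
 unfolding e K_vf_add[OF V g Z.vf_smult_der[OF opV f b] Z.vf_smult_der[OF opV cg v]]
 using K_vf_smult[OF V g fc b] K_vf_smult[OF V g V.gr_car[OF cg] v] fl g by(simp add: flat_on_def)
have 2: "nabla R V u (K V (vf_smult Z V f v) g) = u V f.*[Ts V] K V v g+[Ts V] koszul (Oz V) j q f.*[Ts V] ?y"
 using n_Leib[OF u fc Kv] V.flip_homog[OF f] K_vf_smult[OF V g fc v] by simp
have 3: "nabla R V (vf_smult Z V f v) (K V u g) = f.*[Ts V] ?x" by(rule n_vf_smult[OF v fc K_cl[OF V g u]])
show "K V (vf_br Z V ?i j (vf_smult Z V f v) u) g =
  nabla R V (vf_smult Z V f v) (K V u g) -[Ts V] koszul (Ts V) ?i j (nabla R V u (K V (vf_smult Z V f v) g))"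
 unfolding 1 2 3 using n fc uf Kv
 by(cases q; cases k; cases j) (simp_all add: koszul_def T.smult_neg T.smult_closed T.smult_r_distr T.M.minus_eq T.M.minus_add T.M.a_ac)
qed

lemma flat_on_add:
assumes v: "v:DZ V k" "v':DZ V k" and u: "u:DZ V j"
 and fl: "flat_on k v j u" "flat_on k v' j u"
shows "flat_on k (vf_add Z V v v') j u"
unfolding flat_on_def
proof
fix g assume g: "g:cG V"
have e: "vf_br Z V k j (vf_add Z V v v') u = vf_add Z V (vf_br Z V k j v u) (vf_br Z V k j v' u)"
proof(rule Z.vf_eqI[of V])
 fix N h assume N: "opn N" "N<=V" "h:cO N"
 interpret N: sring "Oz N" by(rule sc[OF N(1)])
 note c = Z.der_cl[OF v(1) N(1,2)] Z.der_cl[OF v(2) N(1,2)] Z.der_cl[OF u N(1,2)]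
 show "vf_br Z V k j (vf_add Z V v v') u N h = vf_add Z V (vf_br Z V k j v u) (vf_br Z V k j v' u) N h"
  using N c by(simp add: Z.vf_br_app Z.vf_add_app Z.der_add[OF u N(1,2)] koszul_def N.minus_eq N.minus_add N.a_ac)
qed auto
have n: "nabla R V v (K V u g):cT V" "nabla R V u (K V v g):cT V"
 "nabla R V v' (K V u g):cT V" "nabla R V u (K V v' g):cT V" using n_cl u v K_cl[OF V g] by blast+
show "K V (vf_br Z V k j (vf_add Z V v v') u) g =
  nabla R V (vf_add Z V v v') (K V u g) -[Ts V] koszul (Ts V) k j (nabla R V u (K V (vf_add Z V v v') g))"
 using fl g n
 unfolding e K_vf_add[OF V g Z.vf_br_der[OF v(1) u] Z.vf_br_der[OF v(2) u]] K_vf_add[OF V g v]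
  n_vf_add[OF v K_cl[OF V g u]] n_add[OF u K_cl[OF V g v(1)] K_cl[OF V g v(2)]]
 by(simp add: flat_on_def koszul_def T.M.minus_eq T.M.minus_add T.M.a_ac)
qed

lemma flat_on_lifts:
assumes v: "v:DZ V i" "w:DW V i" "lifts_to V v w"
 and u: "u:DZ V j" "y:DW V j" "lifts_to V u y"
shows "flat_on i v j u"
unfolding flat_on_def
proof
fix g assume g: "g:cG V"
note wb = W.vf_br_der[OF v(2) u(2)]
have "lifts_to V (vf_br Z V i j v u) (vf_br W V i j w y)" unfolding lifts_to_def
proof(intro allI impI)
 fix N b assume "opn N & N<=V & b:cW N"
 hence N: "opn N" "op_in W N" "N<=V" "b:cW N" by auto
 interpret B: sring "Ow N" by(rule scW[OF N(1)])
 note c = W.der_cl[OF v(2) N(2,3)] W.der_cl[OF u(2) N(2,3)]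
 show "vf_br Z V i j v u N (sg N b) = sg N (vf_br W V i j w y N b)"
  using N c v(3) u(3) by(simp add: Z.vf_br_app W.vf_br_app lifts_to_def sg_minus sg_ksz)
qed
from K_lift[OF V g this wb] have 1: "K V (vf_br Z V i j v u) g = unit V (nabla G V (vf_br W V i j w y) g)" .
have ad: "addmap (Gs V) (Ts V) (unit V)" by(rule addmapI) (simp_all add: unit_cl[OF V] ten_add_right[OF opV])
note n = nabla_G_cl[OF V v(2)] nabla_G_cl[OF V u(2)]
have 2: "nabla R V v (K V u g) = unit V (nabla G V w (nabla G V y g))" "nabla R V u (K V v g) = unit V (nabla G V y (nabla G V w g))"
 using n g by(simp_all add: K_lift[OF V _ v(3,2)] K_lift[OF V _ u(3,2)] n_unit[OF v(1)] n_unit[OF u(1)])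
show "K V (vf_br Z V i j v u) g = nabla R V v (K V u g) -[Ts V] koszul (Ts V) i j (nabla R V u (K V v g))"
 unfolding 1 2 G.nabla_flat[OF opV2 v(2) u(2) g]
 using n g by(simp add: addmap_minus[OF G.M.ag T.M.ag ad] addmap_ksz[OF G.M.ag T.M.ag ad])
qed

lemma flat_on_all:
assumes v: "v:DZ V i" and u: "u:DZ V j"
shows "flat_on i v j u"
proof -
have l: "flat_on i v j u" if u: "u:DZ V j" "y:DW V j" "lifts_to V u y" and v: "v:DZ V i" for i v j u y using V v
proof(induction rule: chart_der_induct)
 case (lift k v w)
 thus ?case using u by(rule flat_on_lifts)
next
 case (smult q f k v)
 show ?case by(rule flat_on_smult[OF smult(1,2) u(1) smult(3)])
next
 case (add k v v')
 show ?case by(rule flat_on_add[OF add(1,2) u(1) add(3,4)])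
qed
show ?thesis using V v
proof(induction rule: chart_der_induct)
 case (lift k v w)
 show ?case by(rule flat_on_sym[OF lift(1) u l[OF lift u]])
next
 case (smult q f k v)
 show ?case by(rule flat_on_smult[OF smult(1,2) u smult(3)])
next
 case (add k v v')
 show ?case by(rule flat_on_add[OF add(1,2) u add(3,4)])
qed
qed

end

end

lemma (in abelian_group) ksz_cancel:
assumes "x:C G" "y:C G" "p:C G" "q:C G" "m:C G" "n:C G"
shows "x \<oplus> p \<oplus> (koszul G i j q \<oplus> m) \<ominus> koszul G i j (y \<oplus> q \<oplus> (koszul G i j p \<oplus> n)) = (x \<ominus> koszul G i j y) \<oplus> (m \<ominus> koszul G i j n)"
proof(cases "i & j")
case True
have "x \<oplus> p \<oplus> (\<ominus> q \<oplus> m) \<ominus> \<ominus> (y \<oplus> q \<oplus> (\<ominus> p \<oplus> n)) = (x \<ominus> \<ominus> y) \<oplus> (m \<ominus> \<ominus> n)" using assms by algebra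
thus ?thesis using True by(simp add: koszul_def)
next
case False
have "x \<oplus> p \<oplus> (q \<oplus> m) \<ominus> (y \<oplus> q \<oplus> (p \<oplus> n)) = (x \<ominus> y) \<oplus> (m \<ominus> n)" using assms by algebra
thus ?thesis using False by(auto simp: koszul_def)
qed

context inv_im_of
begin

text \<open>By the Leibniz rule the curvature on $a \otimes g$ is $\pm a$ times the one on $1 \otimes g$.\<close>

lemma R_nabla_flat:
assumes U: "opn U" and v: "v:DZ U i" and w: "w:DZ U j" and s: "s:Ss U"
shows "nabla R U (vf_br Z U i j v w) s = nabla R U v (nabla R U w s) -[Ts U] koszul (Ts U) i j (nabla R U w (nabla R U v s))"
proof -
let ?r = "vf_res Z"
let ?f = "%V s. nabla R V (?r V (vf_br Z U i j v w)) s"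
let ?f' = "%V s. nabla R V (?r V v) (nabla R V (?r V w) s) -[Ts V] koszul (Ts V) i j (nabla R V (?r V w) (nabla R V (?r V v) s))"
note vt = Z.der_tan[OF v] and wt = Z.der_tan[OF w]
note bt = Z.der_tan[OF Z.vf_br_der[OF v w]]
have id: "?r U x = x" if "x:TZ U" for x by(rule Z.vf_res_id[OF that])
have rr: "rst (nabla R U x s) V = nabla R V (?r V x) (rst s V)" if "opn V" "V<=U" "x:TZ U" "s:Ss U" for V x s by(rule R_nabla_res[OF U that])
have cl: "x -[Ts V] koszul (Ts V) i j y:Ss V" if "opn V" "x:Ss V" "y:Ss V" for V x y
proof -
 interpret abelian_group "Ts V" by(rule R_group[OF that(1)])
 show ?thesis using minus_closed[of x "koszul (Ts V) i j y"] ksz_cl[of y i j] that(2,3) by(simp add: R_simps)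
qed
have "?f U s = ?f' U s"
proof(rule R_ext[where f = ?f and f' = ?f', OF U s])
 show "?f U s:Ss U" "?f' U s:Ss U" using U s vt wt bt R_nabla_cl cl by(simp_all add: id)
 fix V assume V: "opn V" "V<=U"
 have ad: "addmap (Ts U) (Ts V) (%s. rst s V)" by(rule addmapI) (simp_all add: R_simps S_res[OF U _ V] add_res[OF U V])
 have rk: "rst (koszul (Ts U) i j x) V = koszul (Ts V) i j (rst x V)" "koszul (Ts U) i j x:Ss U" if "x:Ss U" for x
  using addmap_ksz[OF R_group[OF U] R_group[OF V(1)] ad] abelian_group.ksz_cl[OF R_group[OF U], of x i j] that
  by(simp_all add: R_simps)
 show "rst (?f U s) V = ?f V (rst s V)" "rst (?f' U s) V = ?f' V (rst s V)" using V U s vt wt bt R_nabla_cl by(simp_all add: id rr restrict_minus rk)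
 note a = add_nabla_R[OF V(1) Z.tan_res[OF _ V]]
 interpret T: left_supermodule "Oz V" "Ts V" by(rule R_smod[OF V(1)])
 show "addmap (Ts V) (Ts V) (?f V)" by(rule a[OF bt])
 show "addmap (Ts V) (Ts V) (?f' V)" using addmap_cl[OF a[OF vt]] addmap_cl[OF a[OF wt]] by(intro addmapI)
   (simp_all add: addmap_add[OF a[OF vt]] addmap_add[OF a[OF wt]] T.M.ksz_add T.M.minus_eq T.M.minus_add T.M.a_ac)
next
 fix V ths a g assume V: "chart V ths" "V<=U" and c: "a:cO V" "g:cG V"
 note oV = c_opn[OF V(1)]
 interpret T: left_supermodule "Oz V" "Ts V" by(rule R_smod[OF oV])
 let ?v = "?r V v" and ?w = "?r V w"
 note d = Z.vf_res_der[OF v V(2)] and e = Z.vf_res_der[OF w V(2)]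
 note b = Z.vf_br_der[OF d e]
 have r: "?r V (vf_br Z U i j v w) = vf_br Z V i j ?v ?w"
 proof(rule Z.vf_eqI[of V])
  fix N h assume N: "opn N" "N<=V" "h:cO N"
  hence "N<=U" using V(2) by blast
  thus "?r V (vf_br Z U i j v w) N h = vf_br Z V i j ?v ?w N h"
   using N Z.der_cl[OF v N(1)] Z.der_cl[OF w N(1)] by(simp add: Z.vf_res_app Z.vf_br_app)
 qed auto
 note dc = Z.der_cl[OF d oV le] and ec = Z.der_cl[OF e oV le]
 note K = K_cl[OF V(1) c(2) d] K_cl[OF V(1) c(2) e] K_cl[OF V(1) c(2) b]
 have n: "nabla R V ?v (K V ?w g):cT V" "nabla R V ?w (K V ?v g):cT V" using n_cl[OF V(1) d K(2)] n_cl[OF V(1) e K(1)] by auto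
 have fl: "K V (vf_br Z V i j ?v ?w) g = nabla R V ?v (K V ?w g) -[Ts V] koszul (Ts V) i j (nabla R V ?w (K V ?v g))"
  using flat_on_all[OF V(1) d e] c(2) by(simp add: flat_on_def[OF V(1)])
 have 1: "nabla R V ?v (nabla R V ?w (ten V a g)) = ten V (?v V (?w V a)) g+[Ts V] fl V i (?w V a).*[Ts V] K V ?v g +[Ts V]
   (?v V (fl V j a).*[Ts V] K V ?w g+[Ts V] fl V i (fl V j a).*[Ts V] nabla R V ?v (K V ?w g))"
  using c ec K ten_cl[OF oV] n_add[OF V(1) d] n_Leib[OF V(1) d _ K(2)]
  by(simp add: nabla_ten[OF V(1) e c] Lt_def nabla_ten[OF V(1) d ec[OF c(1)] c(2)] T.smult_closed)
 have 2: "nabla R V ?w (nabla R V ?v (ten V a g)) = ten V (?w V (?v V a)) g+[Ts V] fl V j (?v V a).*[Ts V] K V ?w g +[Ts V]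
   (?w V (fl V i a).*[Ts V] K V ?v g+[Ts V] fl V j (fl V i a).*[Ts V] nabla R V ?w (K V ?v g))"
  using c dc K ten_cl[OF oV] n_add[OF V(1) e] n_Leib[OF V(1) e _ K(1)]
  by(simp add: nabla_ten[OF V(1) d c] Lt_def nabla_ten[OF V(1) e dc[OF c(1)] c(2)] T.smult_closed)
 have ad: "addmap (Oz V) (Ts V) (%x. ten V x g)" using c(2) oV by(intro addmapI) (simp_all add: ten_cl ten_add_left)
 let ?e = "fl V i (fl V j a)"
 have ee: "fl V j (fl V i a) = ?e" "fl V (i ~= j) a = ?e" "?e:cO V" using c(1) by(cases i; cases j; simp add: T.R.flip_flip)+
 note cc = dc ec c T.R.ksz_cl ten_cl[OF oV] K n T.smult_closed T.R.flip_cl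
 have t: "ten V (?v V (?w V a) -[Oz V] koszul (Oz V) i j (?w V (?v V a))) g =
   ten V (?v V (?w V a)) g -[Ts V] koszul (Ts V) i j (ten V (?w V (?v V a)) g)"
  using cc by(simp add: addmap_minus[OF T.R.ag T.M.ag ad] addmap_ksz[OF T.R.ag T.M.ag ad])
 have k: "?v V (fl V j a).*[Ts V] K V ?w g = koszul (Ts V) i j (fl V j (?v V a).*[Ts V] K V ?w g)"
  "?w V (fl V i a).*[Ts V] K V ?v g = koszul (Ts V) i j (fl V i (?w V a).*[Ts V] K V ?v g)"
  using cc by(simp_all add: Z.der_flip[OF d oV le] Z.der_flip[OF e oV le] T.smult_ksz ksz_sym[of "Ts V" j i])
 show "?f V (ten V a g) = ?f' V (ten V a g)" unfolding r nabla_ten[OF V(1) b c] Lt_def fl 1 2 Z.vf_br_app[OF oV le c(1)] t k ee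
  by(subst T.M.ksz_cancel) (use cc in \<open>simp_all add: T.M.minus_eq T.smult_r_distr T.smult_neg T.smult_ksz[symmetric]\<close>)
qed
thus ?thesis using vt wt bt by(simp add: id)
qed

lemma R_sheaf: "set_sheaf (base_top Z) (%U. cT U) (mr R)"
proof -
have "mr R = (%U V s. rst s V)" by(simp add: inverse_image_raw_def)
thus ?thesis using S_sheaf by(simp add: R_simps)
qed

lemma R_mod: "D_module L Z R"
proof(rule D_module.intro[OF R_sheaf], unfold R_simps)
fix U assume U: "opn U"
interpret T: left_supermodule "Oz U" "Ts U" by(rule R_smod[OF U])
show "left_supermodule (Oz U) (Ts U)" by(rule R_smod[OF U])
show "nabla R U v s:Ss U" if "v:TZ U" "s:Ss U" for v s using R_nabla_cl[OF U that] .
show "nabla R U v ` mg (Ts U) j <= mg (Ts U) (i ~= j)" if "v:DZ U i" for i j v using R_nabla_grade[OF U that, of _ j] by blast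
show "nabla R U v (s+[Ts U] t) = nabla R U v s+[Ts U] nabla R U v t" if "v:TZ U" "s:Ss U" "t:Ss U" for v s t using R_nabla_add[OF U that] .
show "nabla R U (vf_add Z U v w) s = nabla R U v s+[Ts U] nabla R U w s" if "v:TZ U" "w:TZ U" "s:Ss U" for v w s using R_nabla_vf_add[OF U that] .
show "nabla R U (vf_smult Z U f v) s = f.*[Ts U] nabla R U v s" if "f:cO U" "v:TZ U" "s:Ss U" for f v s using R_nabla_vf_smult[OF U that] .
show "nabla R U v (f.*[Ts U] s) = v U f.*[Ts U] s+[Ts U] koszul (Ts U) i j (f.*[Ts U] nabla R U v s)"
 if "v:DZ U i" "f:grade (Oz U) j" "s:Ss U" for i j v f s
 using R_nabla_Leib[OF U that(1) T.R.gr_car[OF that(2)] that(3)] T.R.gr_car[OF that(2)] R_nabla_cl[OF U Z.der_tan[OF that(1)] that(3)]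
 by(simp add: T.R.flip_homog[OF that(2)] T.smult_ksz R_simps)
show "nabla R U (vf_br Z U i j v w) s = nabla R U v (nabla R U w s) -[Ts U] koszul (Ts U) i j (nabla R U w (nabla R U v s))"
 if "v:DZ U i" "w:DZ U j" "s:Ss U" for i j v w s using R_nabla_flat[OF U that] .
fix V assume V: "opn V" "V<=U"
show "rst (s+[Ts U] t) V = rst s V+[Ts V] rst t V" if "s:Ss U" "t:Ss U" for s t using add_res[OF U V that] .
show "rst (f.*[Ts U] s) V = fr Z U V f.*[Ts V] rst s V" if "f:cO U" "s:Ss U" for f s using smult_res[OF U V that] .
show "(%s. rst s V) ` mg (Ts U) i <= mg (Ts V) i" for i using R_grade_res[OF U V, of _ i] by auto
show "rst (nabla R U v s) V = nabla R V (vf_res Z V v) (rst s V)" if "v:TZ U" "s:Ss U" for v s using R_nabla_res[OF U V that] .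
qed

section \<open>The unit\<close>

text \<open>$g \mapsto 1 \otimes g$ identifies a module on the base with the vertically flat sections of its
  pullback: on a chart a section is uniquely $\sum_I \theta_I \otimes g_I$, and it is flat iff
  $g_I = 0$ for $I \ne \emptyset$, because the $1 \otimes g_I$ and the section itself are flat.\<close>

lemma odd_dmod_R: "odd_dmod L Z W sg R" by(rule odd_dmodI[OF R_mod])

interpretation RD: odd_dmod L Z W sg R by(rule odd_dmod_R)

lemma unit_res: "opn U ==> opn V ==> V<=U ==> g:cG U ==> rst (unit U g) V = unit V (mr G U V g)"
proof -
assume U: "opn U" "opn V" "V<=U" and g: "g:cG U"
interpret O: sring "Oz U" by(rule sc[OF U(1)])
show ?thesis using ten_res[OF U O.one_closed g] Z.res_one[OF U] by simp
qed

lemma unit_S: "opn U ==> g:cG U ==> unit U g:Ss U"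
proof -
assume U: "opn U" and g: "g:cG U"
interpret O: sring "Oz U" by(rule sc[OF U])
show ?thesis using ten_S[OF U O.one_closed g] .
qed

lemma unit_ann:
assumes U: "opn U" and g: "g:cG U" shows "unit U g:RD.ann U"
proof(rule RD.annI[OF U])
show "unit U g:cT U" using unit_S[OF U g] by(simp add: R_simps)
fix V i v assume V: "opn V" "V<=U" and v: "v:DZ V i" "v:Vtan V"
note gV = gres_cl[OF U V g] and vt = Z.der_tan[OF v(1)]
have "nabla R V v (unit V (mr G U V g)) = sec V []"
proof(rule S_eqI)
 show "nabla R V v (unit V (mr G U V g)):Ss V" by(rule R_nabla_cl[OF V(1) vt unit_S[OF V(1) gV]])
 show "sec V []:Ss V" using V(1) by(simp add: sec_S)
 fix p assume "p:V"
 then obtain N ths where N: "chart N ths" "p:N" "N<=V" using chart_exists[OF V(1)] by blast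
 note oN = c_opn[OF N(1)] and vN = Z.vf_res_der[OF v(1) N(3)]
 have gN: "mr G U N g:cG N" using gres_cl[OF U oN _ g] N(3) V(2) by blast
 interpret G: left_supermodule "Ow N" "Gs N" by(rule G_smod[OF oN])
 interpret T: left_supermodule "Oz N" "Ts N" by(rule R_smod[OF oN])
 have oN': "op_in W N" using oN by simp
 have "lifts_to N (vf_res Z N v) (W.vf_zero N)" using RD.verticalD(2)[OF v(2)] N(3) oN by(auto simp: lifts_to_def W.vf_zero_app sg_zero Z.vf_res_app)
 hence "nabla R N (vf_res Z N v) (unit N (mr G U N g)) = unit N 0[Gs N]"
  using n_unit[OF N(1) vN gN] K_lift[OF N(1) gN _ W.vf_zero_der] G.nabla_vf_zero[OF oN' gN] by simp
 moreover have "unit N 0[Gs N] = 0[Ts N]" using ten_add_right[OF oN T.R.one_closed G.M.zero_closed G.M.zero_closed] unit_cl[OF N(1) G.M.zero_closed]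
  by(intro T.M.add_self_cancel) simp_all
 moreover have "rst (unit V (mr G U V g)) N = unit N (mr G U N g)" using unit_res[OF V(1) oN N(3) gV] G.mres_trans[of U V N g] U V N(3) oN g by simp
 ultimately show "EX N. p:N & rst (nabla R V v (unit V (mr G U V g))) N = rst (sec V []) N"
  using R_nabla_res[OF V(1) oN N(3) vt unit_S[OF V(1) gV]] sec_res[OF V(1) oN N(3), of "[]"] N(2)
  by(intro exI[of _ N]) (simp add: R_simps)
qed
thus "nabla R V v (mr R U V (unit U g)) = 0[Ts V]" using unit_res[OF U V g] by(simp add: R_simps)
qed

lemma unit_inj:
assumes U: "opn U" and g: "g:cG U" "g':cG U" and eq: "unit U g = unit U g'"
shows "g = g'"
proof(rule G.mlocal_eq[OF _ g])
fix p assume "p:U"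
then obtain V ths where V: "chart V ths" "p:V" "V<=U" using chart_exists[OF U] by blast
note oV = c_opn[OF V(1)]
interpret V: odd_extension "Oz V" "Ow V" "sg V" ths by(rule chart_self[OF V(1)])
interpret G: left_supermodule "Ow V" "Gs V" by(rule G_smod[OF oV])
note c = gres_cl[OF U oV V(3) g(1)] gres_cl[OF U oV V(3) g(2)]
have "sec V [(1[Oz V], mr G U V g)] = sec V [(1[Oz V], mr G U V g')]"
 using unit_res[OF U oV V(3) g(1)] unit_res[OF U oV V(3) g(2)] eq by(simp add: ten_def)
hence "tcoef V ths [(1[Oz V], mr G U V g)] {} = tcoef V ths [(1[Oz V], mr G U V g')] {}"
 using sec_eq_iff[OF V(1)] c V.one_closed empty_in_mons by auto
thus "EX V. op_in W V & p:V & V<=U & mr G U V g = mr G U V g'" using V oV c by(intro exI[of _ V]) (simp add: tcoef_def V.rc_one G.smult_one)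
qed (use U in simp)

lemma unit_surj:
assumes U: "opn U" and s: "s:RD.ann U"
shows "EX g:cG U. unit U g = s"
proof -
have sS: "s:Ss U" using RD.annD(1)[OF s] by(simp add: R_simps)
have loc: "EX V g. opn V & p:V & V<=U & g:cG V & unit V g = rst s V" if pU: "p:U" for p
proof -
 obtain V ths l where V: "chart V ths" "p:V" "V<=U" "l:tens V" "rst s V = sec V l" using chart_rep[OF U sS pU] .
 note oV = c_opn[OF V(1)]
 interpret V: odd_extension "Oz V" "Ow V" "sg V" ths by(rule chart_self[OF V(1)])
 interpret T: left_supermodule "Oz V" "Ts V" by(rule R_smod[OF oV])
 let ?t = "tcoef V ths l" and ?ms = "mons (length ths)"
 let ?d = "%I. if I = {} then sec V l else 0[Ts V]"
 let ?c = "%I. unit V (?t I) -[Ts V] ?d I"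
 have tc: "?t I:cG V" for I by(rule tcoef_cl[OF V(1,4)])
 have sa: "sec V l:RD.ann V" using RD.ann_res[OF U s oV V(3)] V(5) by(simp add: R_simps)
 note sc = RD.annD(1)[OF sa] and e = empty_in_mons[of "length ths"]
 have m1: "mon V ths {} = 1[Oz V]" by(simp add: odd_monomial_def)
 have dc: "?d I:cT V" "mon V ths I.*[Ts V] ?d I:cT V" if "I:set ?ms" for I using sc V.mon_cl[OF that] by(simp_all add: T.smult_closed)
 have uc: "unit V (?t I):cT V" for I by(rule unit_cl[OF V(1) tc])
 have "lsum (Ts V) (%I. mon V ths I.*[Ts V] ?c I) ?ms = lsum (Ts V) (%I. mon V ths I.*[Ts V] unit V (?t I) -[Ts V] mon V ths I.*[Ts V] ?d I) ?ms"
  by(rule lsum_cong) (use dc uc V.mon_cl in \<open>simp_all add: T.M.minus_eq T.smult_r_distr T.smult_neg\<close>)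
 also have "... = lsum (Ts V) (%I. mon V ths I.*[Ts V] unit V (?t I)) ?ms -[Ts V] lsum (Ts V) (%I. mon V ths I.*[Ts V] ?d I) ?ms"
  by(rule T.M.lsum_minus) (use dc(2) uc V.mon_cl T.smult_closed in auto)
 also have "lsum (Ts V) (%I. mon V ths I.*[Ts V] ?d I) ?ms = sec V l"
  using T.M.lsum_single[OF distinct_mons e, of "%I. mon V ths I.*[Ts V] ?d I"] dc(2)[OF e] sc V.mon_cl m1 by(simp add: T.smult_one)
 also have "lsum (Ts V) (%I. mon V ths I.*[Ts V] unit V (?t I)) ?ms = sec V l"
  unfolding sec_expand[OF V(1,4)] by(rule lsum_cong) (use V.mon_cl ten_unit[OF V(1) _ tc, symmetric] in auto)
 finally have z: "lsum (Ts V) (%I. mon V ths I.*[Ts V] ?c I) ?ms = 0[Ts V]" using sc by simp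
 have "?c {} = 0[Ts V]"
 proof(rule RD.ann_free[OF V(1) _ z e])
  show "?c I:RD.ann V" for I using RD.ann_add[OF oV unit_ann[OF oV tc] RD.ann_neg[OF oV]] sa RD.ann_zero[OF oV] by(simp add: T.M.minus_eq)
 qed
 hence "unit V (?t {}) = sec V l" using T.M.minus_zero_imp_eq[OF uc sc] by simp
 thus ?thesis using V oV tc by metis
qed
obtain g where g: "g:cG U" "!!V x. op_in W V ==> V<=U ==> x:cG V ==> unit V x = rst s V ==> mr G U V g = x"
proof(rule set_sheaf.glue_local[OF G.mod_sheaf, of U "%V x. unit V x = rst s V"])
 show "op_in W U" using U by simp
 show "EX V x. op_in W V & p:V & V<=U & x:cG V & unit V x = rst s V" if "p:U" for p using loc[OF that] by simp
 show "unit N (mr G V N x) = rst s N" if "op_in W V" "op_in W N" "N<=V" "V<=U" "x:cG V" "unit V x = rst s V" for V N x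
  using unit_res[of V N x] that by(simp add: Int_absorb1)
 show "x = y" if "op_in W V" "V<=U" "x:cG V" "y:cG V" "unit V x = rst s V" "unit V y = rst s V" for V x y using unit_inj[of V x y] that by simp
qed (blast intro: that)
have "unit U g = s"
proof(rule S_eqI[OF unit_S[OF U g(1)] sS])
 fix p assume "p:U"
 from loc[OF this] obtain V x where V: "opn V" "p:V" "V<=U" "x:cG V" "unit V x = rst s V" by blast
 thus "EX V. p:V & rst (unit U g) V = rst s V" using unit_res[OF U V(1,3) g(1)] g(2)[of V x] by(intro exI[of _ V]) simp
qed
thus ?thesis using g(1) by blast
qed

lemma unit_bij: "opn U ==> bij_betw (unit U) (cG U) (RD.ann U)"
using unit_inj unit_surj unit_ann by(auto simp: bij_betw_def inj_on_def image_iff) metis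

lemma unit_mor: "dmor L W G (dir R) unit"
proof(rule dmorI)
fix U assume "op_in W U"
hence U: "opn U" by simp
interpret G: left_supermodule "Ow U" "Gs U" by(rule G_smod[OF U])
interpret T: left_supermodule "Oz U" "Ts U" by(rule R_smod[OF U])
show "unit U g:C (Sec (dir R) U)" if "g:cG U" for g using unit_ann[OF U that] by simp
show "unit U g:mg (Sec (dir R) U) i" if "g:mg (Gs U) i" for g i
proof -
 have "hten U i [(1[Oz U], g)]" using T.R.one_even that by(auto simp: hten_def)
 thus ?thesis using sec_grade[OF U] unit_ann[OF U G.M.gr_car[OF that]] by(simp add: ten_def)
qed
show "unit U (g+[Gs U] g') = unit U g+[Sec (dir R) U] unit U g'" if "g:cG U" "g':cG U" for g g'
 using ten_add_right[OF U T.R.one_closed that] by simp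
show "unit U (b.*[Gs U] g) = b.*[Sec (dir R) U] unit U g" if "b:cW U" "g:cG U" for b g
 using ten_balanced[OF U T.R.one_closed that] smult_ten[OF U sg_cl[OF U that(1)] T.R.one_closed that(2)] that U by simp
show "unit V (mr G U V g) = mr (dir R) U V (unit U g)" if "op_in W V" "V<=U" "g:cG U" for V g
 using unit_res[OF U _ that(2,3)] that(1) by(simp add: R_simps)
show "unit U (nabla G U w g) = nabla (dir R) U w (unit U g)" if w: "w:TW U" and g: "g:cG U" for w g
proof(rule RD.nabla_N_eqI[OF U w unit_ann[OF U g], symmetric])
 have U': "op_in W U" using U by simp
 note wg = G.nabla_closed[OF U' w g]
 show "unit U (nabla G U w g):cT U" using unit_S[OF U wg] by(simp add: R_simps)
 fix p assume p: "p:U"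
 then obtain V ths where V: "chart V ths" "p:V" "V<=U" using chart_exists[OF U] by blast
 note oV = c_opn[OF V(1)]
 have oV': "op_in W V" using oV by simp
 interpret T1: left_supermodule "Oz V" "Ts V" by(rule R_smod[OF oV])
 obtain w0 w1 where d: "w0:DW V False" "w1:DW V True" "vf_res W V w = vf_add W V w0 w1" using W.tanE[OF W.tan_res[OF w oV' V(3)]] by blast
 obtain v0 where v0: "v0:DZ V False" "lifts_to V v0 w0" using lift_exists[OF V(1) d(1)] unfolding lifts_to_def by blast
 obtain v1 where v1: "v1:DZ V True" "lifts_to V v1 w1" using lift_exists[OF V(1) d(2)] unfolding lifts_to_def by blast
 note vt = Z.der_tan[OF v0(1)] Z.der_tan[OF v1(1)] and gV = gres_cl[OF U oV V(3) g]
 let ?v = "vf_add Z V v0 v1"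
 have "?v N (sg N b) = sg N (w N b)" if N: "opn N" "N<=V" and b: "b:cW N" for N b
 proof -
  have oN': "op_in W N" using N by simp
  have "w N b = w0 N b+[Ow N] w1 N b" using fun_cong[OF fun_cong[OF d(3), of N], of b] N b by(simp add: W.vf_res_app W.vf_add_app)
  thus ?thesis using N b v0(2) v1(2) W.der_cl[OF d(1) oN' N(2) b] W.der_cl[OF d(2) oN' N(2) b] by(simp add: Z.vf_add_app lifts_to_def sg_add)
 qed
 hence l: "?v:Lif V w" using Z.vf_add_tan[OF vt] by(simp add: lifts_def)
 let ?g = "mr G U V g"
 have "nabla R V ?v (unit V ?g) = unit V (nabla G V w0 ?g)+[Ts V] unit V (nabla G V w1 ?g)"
  using R_nabla_vf_add[OF oV vt unit_S[OF oV gV]] n_unit[OF V(1) v0(1) gV] n_unit[OF V(1) v1(1) gV]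
   K_lift[OF V(1) gV v0(2) d(1)] K_lift[OF V(1) gV v1(2) d(2)] by simp
 also have "... = unit V (nabla G V (vf_res W V w) ?g)" unfolding d(3) G.nabla_vf_add[OF oV' W.der_tan[OF d(1)] W.der_tan[OF d(2)] gV]
  using nabla_G_cl[OF V(1) d(1) gV] nabla_G_cl[OF V(1) d(2) gV] T1.R.one_closed
  by(subst ten_add_right[OF oV]) auto
 also have "... = rst (unit U (nabla G U w g)) V" using unit_res[OF U oV V(3) wg] G.nabla_res[OF U' oV' V(3) w g] by simp
 finally show "EX V v. opn V & p:V & V<=U & v:Lif V w & mr R U V (unit U (nabla G U w g)) = nabla R V v (mr R U V (unit U g))"
  using V oV l unit_res[OF U oV V(3) g] by(intro exI[of _ V] exI[of _ ?v]) (simp add: R_simps)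
qed
qed

end

context inv_im_of
begin

lemma R_car: "C (Sec R U) = Ss U" by(simp add: R_simps)

end

context odd_submersion
begin

lemma inv_im_ofI: "D_module L W G ==> inv_im_of L Z W sg G" by(intro inv_im_of.intro dmod.intro odd_submersion_axioms W.lambda_superspace_axioms)

section \<open>Pullback of morphisms\<close>

context
fixes G :: "('p, 'b, 'm) dmodule" and H :: "('p, 'b, 'm) dmodule" and h
assumes DG: "D_module L W G" and DH: "D_module L W H" and h: "dmor L W G H h"
begin

interpretation G: inv_im_of L Z W sg G by(rule inv_im_ofI[OF DG])
interpretation H: inv_im_of L Z W sg H by(rule inv_im_ofI[OF DH])

abbreviation hl :: "'p set => ('a \<times> 'm) list => ('a \<times> 'm) list" where "hl V == map (%(a, t). (a, h V t))"
abbreviation rh where "rh == inverse_image_raw_hom Z W sg G H h"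

lemma h_cl: "opn V ==> t:C (Sec G V) ==> h V t:C (Sec H V)" using mor_cl[OF h] by simp

lemma hl_tens: "opn V ==> l:G.tens V ==> hl V l:H.tens V" using h_cl by(auto simp: G.tens_iff H.tens_iff)

lemma raw_hom_rep:
assumes U: "opn U" and r: "G.rep U s p V l" shows "H.rep U (rh U s) p V (hl V l)"
proof -
have o: "opn V" "p:V" "V<=U" "l:G.tens V" using r by(auto simp: G.rep_iff)
have "rh U s q = H.germ q V (hl V l)" if q: "q:V" for q
proof -
 have "(THE x. EX V l. G.rep U s q V l & x = H.germ q V (hl V l)) = H.germ q V (hl V l)"
 proof(rule G.THE_rep[OF _ _ _ _ DH])
  show "G.rep U s q V l" using r q by(simp add: G.rep_iff)
  show "hl V l:H.tens V" if "opn V" "V<=U" "l:G.tens V" for V l by(rule hl_tens[OF that(1,3)])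
  show "H.tres V N (hl V l) = hl N (G.tres V N l)" if "opn V" "V<=U" "opn N" "N<=V" "l:G.tens V" for V N l
   using that mor_res[OF h, of V N] by(auto simp: tensor_res_def G.tens_iff)
  show "H.teq N (hl N l) (hl N l')" if N: "opn N" "N<=U" and eq: "G.teq N l l'" for N l l'
  proof(rule G.teq_map[OF N(1) N(1) addmap_id add_mor[OF h] _ eq])
   show "EX b':cW N. a*[Oz N] sg N b = a*[Oz N] sg N b' & h N (b.*[Sec G N] t) = b'.*[Sec H N] h N t" if "b:cW N" "t:C (Sec G N)" for a b t
    using mor_smult[OF h _ that] N(1) that(1) by(intro bexI[of _ b]) auto
  qed (use N in simp)
 qed
 thus ?thesis using q o(3) by(simp add: inverse_image_raw_hom_def subset_iff)
qed
thus ?thesis using o hl_tens by(auto simp: represents_def)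
qed

lemma raw_hom_cl: "opn U ==> s:G.Ss U ==> rh U s:H.Ss U"
proof -
assume U: "opn U" and s: "s:G.Ss U"
show "rh U s:H.Ss U" unfolding H.S_iff
proof(intro conjI ballI)
 show "rh U s:extensional U" by(simp add: inverse_image_raw_hom_def)
 show "EX V l. H.rep U (rh U s) p V l" if "p:U" for p using s that raw_hom_rep[OF U] unfolding G.S_iff by blast
qed
qed

lemma raw_hom_eqI:
assumes U: "opn U" and s: "s:G.Ss U" and t: "t:H.Ss U"
 and "!!p. p:U ==> EX V l. G.rep U s p V l & H.rep U t p V (hl V l)"
shows "rh U s = t"
proof(rule H.rep_eqI[OF raw_hom_cl[OF U s] t])
fix p assume "p:U"
then obtain V l where V: "G.rep U s p V l" "H.rep U t p V (hl V l)" using assms(4) by blast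
thus "EX V k l. H.rep U (rh U s) p V k & H.rep U t p V l & H.teq V k l" using raw_hom_rep[OF U V(1)] H.teq_refl[of "hl V l" V] by(metis H.rep_iff)
qed

lemma raw_hom_sec: "opn V ==> l:G.tens V ==> rh V (G.sec V l) = H.sec V (hl V l)"
by(rule raw_hom_eqI) (auto intro: G.sec_S H.sec_S G.sec_rep H.sec_rep hl_tens)

lemma raw_hom_res:
assumes U: "opn U" "opn V" "V<=U" and s: "s:G.Ss U"
shows "rh V (rst s V) = rst (rh U s) V"
proof(rule raw_hom_eqI[OF U(2) G.S_res[OF U(1) s U(2,3)] H.S_res[OF U(1) raw_hom_cl[OF U(1) s] U(2,3)]])
fix p assume p: "p:V"
then obtain N l where N: "G.rep U s p N l" using s U(3) unfolding G.S_iff by blast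
have o: "opn N" "p:N" using N by(auto simp: G.rep_iff)
let ?N = "N Int V"
have r: "G.rep U s p ?N (G.tres N ?N l)" by(rule G.rep_res[OF N]) (use o U p in auto)
note r' = raw_hom_rep[OF U(1) r]
have "G.rep V (rst s V) p ?N (G.tres N ?N l)" "H.rep V (rst (rh U s) V) p ?N (hl ?N (G.tres N ?N l))"
 using r r' by(auto simp: G.rep_iff H.rep_iff Int_absorb1 inf_commute inf_left_commute)
thus "EX N l. G.rep V (rst s V) p N l & H.rep V (rst (rh U s) V) p N (hl N l)" by blast
qed

lemma raw_hom_add:
assumes U: "opn U" and s: "s:G.Ss U" "t:G.Ss U"
shows "rh U (s+[G.Ts U] t) = rh U s+[H.Ts U] rh U t"
proof(rule raw_hom_eqI[OF U G.add_cl[OF U s] H.add_cl[OF U raw_hom_cl[OF U s(1)] raw_hom_cl[OF U s(2)]]])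
fix p assume p: "p:U"
obtain V k l where V: "G.rep U s p V k" "G.rep U t p V l" using G.S_local2[OF U s p] .
show "EX V l. G.rep U (s+[G.Ts U] t) p V l & H.rep U (rh U s+[H.Ts U] rh U t) p V (hl V l)"
 using G.add_rep[OF V] H.add_rep[OF raw_hom_rep[OF U V(1)] raw_hom_rep[OF U V(2)]] by(metis map_append)
qed

lemma raw_hom_smult:
assumes U: "opn U" and f: "f:cO U" and s: "s:G.Ss U"
shows "rh U (f.*[G.Ts U] s) = f.*[H.Ts U] rh U s"
proof(rule raw_hom_eqI[OF U G.smult_closed[OF U f s] H.smult_closed[OF U f raw_hom_cl[OF U s]]])
fix p assume p: "p:U"
then obtain V l where V: "G.rep U s p V l" using s unfolding G.S_iff by blast
let ?m = "map (%(a, t). (fr Z U V f*[Oz V] a, t))"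
have "hl V (?m l) = ?m (hl V l)" by auto
thus "EX V l. G.rep U (f.*[G.Ts U] s) p V l & H.rep U (f.*[H.Ts U] rh U s) p V (hl V l)"
 using G.smult_rep[OF U f V] H.smult_rep[OF U f raw_hom_rep[OF U V]] by metis
qed

lemma raw_hom_additive: "opn U ==> addmap (G.Ts U) (H.Ts U) (rh U)" by(rule addmapI) (simp_all add: G.R_simps H.R_simps raw_hom_cl raw_hom_add)

lemma raw_hom_La:
assumes V: "chart V ths" and v: "v:DZ V i" and l: "l:G.tens V"
shows "rh V (G.La V i v l) = H.La V i v (hl V l)"
proof -
note oV = c_opn[OF V]
interpret T: left_supermodule "Oz V" "G.Ts V" by(rule G.R_smod[OF oV])
interpret O: sring "Oz V" by(rule sc[OF oV])
have "rh V (G.La V i v l) = lsum (H.Ts V) (%p. rh V (case p of (a, g) => G.Lt V i v a g)) l"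
 by(rule addmap_lsum[OF G.R_group[OF oV] H.R_group[OF oV] raw_hom_additive[OF oV]]) (use l G.Lt_cl[OF V v] in \<open>auto simp: G.tens_iff\<close>)
also have "... = H.La V i v (hl V l)" unfolding lsum_map
proof(rule lsum_cong)
 fix p assume p: "p:set l"
 obtain a g where ag: "p = (a, g)" by(cases p)
 have c: "a:cO V" "g:C (Sec G V)" using l p ag by(auto simp: G.tens_iff)
 note vc = Z.der_cl[OF v oV le c(1)]
 obtain ws where w: "Tim V v ws" using tan_image_exists[OF V v] by blast
 have t: "rh V (G.ten V b g) = H.ten V b (h V g)" if "b:cO V" for b using raw_hom_sec[OF oV, of "[(b, g)]"] that c by(simp add: G.ten_def H.ten_def)
 have "hl V (map (%(h, w). (h, nabla G V w g)) ws) = map (%(k, w). (k, nabla H V w (h V g))) ws"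
  using w mor_nabla[OF h, of V _ g] c(2) oV by(auto simp: tan_image_iff)
 hence k: "rh V (G.K V v g) = H.K V v (h V g)" using raw_hom_sec[OF oV G.Kl_tens[OF V w c(2)]]
  by(simp only: G.K_image[OF V c(2) w] H.K_image[OF V h_cl[OF oV c(2)] w] G.Kl_def H.Kl_def)
 have cl: "G.ten V (v V a) g:G.Ss V" "G.K V v g:G.Ss V" "fl V i a.*[G.Ts V] G.K V v g:G.Ss V"
  using G.ten_S[OF oV vc c(2)] G.K_cl[OF V c(2) v] G.smult_closed[OF oV, of "fl V i a"] c by(simp_all add: G.R_simps)
 show "rh V (case p of (a, g) => G.Lt V i v a g) = (case (case p of (a, t) => (a, h V t)) of (a, g) => H.Lt V i v a g)"
  using c cl by(simp add: ag G.Lt_def H.Lt_def raw_hom_add[OF oV] raw_hom_smult[OF oV] t[OF vc] k)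
qed simp
finally show ?thesis .
qed

lemma raw_hom_mor: "dmor L Z G.R H.R rh"
proof(rule dmorI, unfold G.R_simps H.R_simps)
fix U assume U: "opn U"
show "rh U s:H.Ss U" if "s:G.Ss U" for s by(rule raw_hom_cl[OF U that])
show "rh U s:mg (H.Ts U) i" if s: "s:mg (G.Ts U) i" for s i unfolding H.R_grade
proof(intro conjI ballI)
 show "rh U s:H.Ss U" using raw_hom_cl[OF U] s by(simp add: G.R_grade)
 fix p assume "p:U"
 then obtain V l where V: "G.rep U s p V l" "G.hten V i l" using s unfolding G.R_grade by blast
 have "opn V" using V(1) by(simp add: G.rep_iff)
 hence "H.hten V i (hl V l)" using V(2) mor_grade[OF h, of V] by(fastforce simp: G.hten_def H.hten_def)
 thus "EX V l. H.rep U (rh U s) p V l & H.hten V i l" using raw_hom_rep[OF U V(1)] by blast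
qed
show "rh U (s+[G.Ts U] t) = rh U s+[H.Ts U] rh U t" if "s:G.Ss U" "t:G.Ss U" for s t by(rule raw_hom_add[OF U that])
show "rh U (f.*[G.Ts U] s) = f.*[H.Ts U] rh U s" if "f:cO U" "s:G.Ss U" for f s by(rule raw_hom_smult[OF U that])
show "rh V (rst s V) = rst (rh U s) V" if "opn V" "V<=U" "s:G.Ss U" for V s by(rule raw_hom_res[OF U that])
show "rh U (nabla G.R U v s) = nabla H.R U v (rh U s)" if v: "v:TZ U" and s: "s:G.Ss U" for v s
proof(rule H.S_eqI)
 note rs = raw_hom_cl[OF U s] and ns = G.R_nabla_cl[OF U v s]
 show "rh U (nabla G.R U v s):H.Ss U" "nabla H.R U v (rh U s):H.Ss U" using raw_hom_cl[OF U ns] H.R_nabla_cl[OF U v rs] by auto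
 fix p assume p: "p:U"
 obtain V ths l where V: "chart V ths" "p:V" "V<=U" "l:G.tens V" "rst s V = G.sec V l" using G.chart_rep[OF U s p] .
 note oV = c_opn[OF V(1)]
 obtain v0 v1 where d: "v0:DZ V False" "v1:DZ V True" "vf_res Z V v = vf_add Z V v0 v1" using G.tan_parts_res[OF v oV V(3)] .
 have "rst (rh U s) V = H.sec V (hl V l)" using raw_hom_res[OF U oV V(3) s] raw_hom_sec[OF oV V(4)] V(5) by simp
 from H.nabla_rep[OF U v V(1,3) hl_tens[OF oV V(4)] this d]
 have "rst (nabla H.R U v (rh U s)) V = rh V (G.La V False v0 l)+[H.Ts V] rh V (G.La V True v1 l)"
  by(simp only: raw_hom_La[OF V(1) d(1) V(4)] raw_hom_La[OF V(1) d(2) V(4)])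
 also have "... = rh V (rst (nabla G.R U v s) V)"
  using raw_hom_add[OF oV G.La_cl[OF V(1) d(1) V(4)] G.La_cl[OF V(1) d(2) V(4)]] G.nabla_rep[OF U v V(1,3-5) d] by simp
 also have "... = rst (rh U (nabla G.R U v s)) V" by(rule raw_hom_res[OF U oV V(3) ns])
 finally show "EX V. p:V & rst (rh U (nabla G.R U v s)) V = rst (nabla H.R U v (rh U s)) V" using V(2) by metis
qed
qed

lemma raw_hom_unit: "opn U ==> g:C (Sec G U) ==> rh U (G.unit U g) = H.unit U (h U g)"
proof -
assume U: "opn U" and g: "g:C (Sec G U)"
interpret O: sring "Oz U" by(rule sc[OF U])
show ?thesis using raw_hom_sec[OF U, of "[(1[Oz U], g)]"] g by(simp add: G.ten_def H.ten_def)
qed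

end

end

lemma ex1_unique: "EX! x. P x ==> P a ==> P b ==> a = b" by blast

section \<open>Transport of structure\<close>

context
fixes L :: "'l complex_superalgebra" and Z :: "('p, 'l, 'a) superspace" and F :: "('p, 'a, 'm) dmodule" and e :: "'m => 'n"
assumes Z: "lambda_superspace L Z" and F: "D_module L Z F"
 and inj: "!!U. op_in Z U ==> inj_on e (C (Sec F U))"
begin

interpretation F: D_module L Z F by(rule F)

abbreviation T where "T == transport e F"

lemma transp_eq_iff: "op_in Z U ==> s:C (Sec F U) ==> t:C (Sec F U) ==> e s = e t <-> s = t"
using inj[of U] by(auto simp: inj_on_def)

lemma transp_simps: "C (Sec T U) = e ` C (Sec F U)" "0[Sec T U] = e 0[Sec F U]" "mg (Sec T U) i = e ` mg (Sec F U) i" by(simp_all add: transport_def)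

context
fixes U assumes U: "op_in Z U"
begin

interpretation M: left_supermodule "fun_ring Z U" "Sec F U" by(rule F.mod_sections[OF U])

lemma transp_ops:
assumes s: "s:C (Sec F U)"
shows "t:C (Sec F U) ==> e s+[Sec T U] e t = e (s+[Sec F U] t)"
 and "f.*[Sec T U] e s = e (f.*[Sec F U] s)" "mr T U V (e s) = e (mr F U V s)" "nabla T U v (e s) = e (nabla F U v s)"
using s inv_into_f_f[OF inj[OF U]] by(simp_all add: transport_def)

lemma transp_group: "abelian_group (Sec T U)"
proof(rule abelian_groupI, unfold transp_simps)
note ops = transp_ops(1)
show "EX y:e ` C (Sec F U). y+[Sec T U] x = e 0[Sec F U]" if x: "x:e ` C (Sec F U)" for x
proof -
 obtain s where s: "s:C (Sec F U)" "x = e s" using x by blast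
 show ?thesis by(rule bexI[of _ "e (-[Sec F U] s)"]) (use s ops in \<open>auto simp: M.M.l_neg\<close>)
qed
qed (auto simp: transp_ops(1) M.M.a_ac)

lemma transp_minus:
assumes s: "s:C (Sec F U)"
shows "-[Sec T U] e s = e (-[Sec F U] s)"
 and "t:C (Sec F U) ==> e s -[Sec T U] e t = e (s -[Sec F U] t)"
 and "koszul (Sec T U) i j (e s) = e (koszul (Sec F U) i j s)"
proof -
interpret T: abelian_group "Sec T U" by(rule transp_group)
have n: "-[Sec T U] e s = e (-[Sec F U] s)" if s: "s:C (Sec F U)" for s
 by(rule T.minus_equality) (use s in \<open>simp_all add: transp_simps transp_ops M.M.l_neg\<close>)
thus "-[Sec T U] e s = e (-[Sec F U] s)" "koszul (Sec T U) i j (e s) = e (koszul (Sec F U) i j s)" using s by(simp_all add: koszul_def)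
show "e s -[Sec T U] e t = e (s -[Sec F U] t)" if "t:C (Sec F U)" using n[OF that] s that transp_ops(1) by(simp add: a_minus_def)
qed

lemma transp_smod: "left_supermodule (fun_ring Z U) (Sec T U)"
proof -
have g: "graded_group (Sec T U) (mg (Sec T U))" unfolding graded_group_def
proof(intro conjI allI ballI)
 fix i show "additive_subgroup (mg (Sec T U) i) (Sec T U)" by(rule add_subgroup_criterion[OF transp_group], unfold transp_simps)
   (use M.M.gr_car[of _ i] M.M.gr_add[of _ i] M.M.gr_neg[of _ i] M.M.gr_zero[of i] in \<open>auto simp: transp_ops transp_minus\<close>)
next
 fix x assume "x:C (Sec T U)"
 then obtain s where s: "s:C (Sec F U)" "x = e s" by(auto simp: transp_simps)
 obtain a where a: "a:mg (Sec F U) False" "s -[Sec F U] a:mg (Sec F U) True"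
  and u: "!!b. b:mg (Sec F U) False ==> s -[Sec F U] b:mg (Sec F U) True ==> b = a"
  using M.mgraded s(1) unfolding graded_group_def by blast
 show "EX! a. a:mg (Sec T U) False & x -[Sec T U] a:mg (Sec T U) True" unfolding transp_simps
 proof(rule ex1I[of _ "e a"])
  show "e a:e ` mg (Sec F U) False & x -[Sec T U] e a:e ` mg (Sec F U) True" using a s M.M.gr_car[OF a(1)] by(simp add: transp_minus)
  fix y assume y: "y:e ` mg (Sec F U) False & x -[Sec T U] y:e ` mg (Sec F U) True"
  then obtain b t where b: "b:mg (Sec F U) False" "y = e b" "t:mg (Sec F U) True" "x -[Sec T U] y = e t" by blast
  note c = M.M.gr_car[OF b(1)] M.M.gr_car[OF b(3)]
  have "s -[Sec F U] b = t" using b(4) s c transp_eq_iff[OF U, of "s -[Sec F U] b" t] by(simp add: b(2) transp_minus)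
  thus "y = e a" using u[OF b(1)] b by simp
 qed
qed
show ?thesis
proof(intro left_supermodule.intro left_supermodule_axioms.intro transp_group g M.R.supercommutative_ring_axioms, unfold transp_simps)
 fix i j a s assume a: "a:grade (fun_ring Z U) i" and "s:e ` mg (Sec F U) j"
 then obtain x where x: "x:mg (Sec F U) j" "s = e x" by blast
 show "a.*[Sec T U] s:e ` mg (Sec F U) (i ~= j)" unfolding x(2) transp_ops(2)[OF M.M.gr_car[OF x(1)]] by(rule imageI[OF M.mgrade_smult[OF a x(1)]])
qed (auto simp: transp_ops M.smult_closed M.smult_l_distr M.smult_r_distr M.smult_assoc M.smult_one)
qed

end

lemma transp_sheaf: "set_sheaf (base_top Z) (%U. C (Sec T U)) (mr T)"
proof
interpret S: set_sheaf "base_top Z" "%U. C (Sec F U)" "mr F" by(rule F.mod_sheaf)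
note ops = transp_ops(3)
show "mr T U V s:C (Sec T V)" if "op_in Z U" "op_in Z V" "V<=U" "s:C (Sec T U)" for U V s
 using that S.res_closed[OF that(1-3)] by(auto simp: transp_simps ops)
show "mr T U U s = s" if "op_in Z U" "s:C (Sec T U)" for U s using that S.res_id by(auto simp: transp_simps ops)
show "mr T V N (mr T U V s) = mr T U N s" if "op_in Z U" "op_in Z V" "op_in Z N" "N<=V" "V<=U" "s:C (Sec T U)" for U V N s
 using that S.res_closed[OF that(1,2,5)] S.res_trans[OF that(1-5)] by(auto simp: transp_simps ops)
fix Vt f
assume o: "!!V. V:Vt ==> op_in Z V" and f: "!!V. V:Vt ==> f V:C (Sec T V)"
 and c: "!!V N. V:Vt ==> N:Vt ==> mr T V (V Int N) (f V) = mr T N (V Int N) (f N)"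
have "ALL V. EX x. V:Vt --> x:C (Sec F V) & f V = e x" using f by(auto simp: transp_simps)
then obtain g where g: "!!V. V:Vt ==> g V:C (Sec F V)" "!!V. V:Vt ==> f V = e (g V)" by metis
have oU: "op_in Z (\<Union>Vt)" using o by blast
have c': "mr F V (V Int N) (g V) = mr F N (V Int N) (g N)" if "V:Vt" "N:Vt" for V N
proof -
 have oVN: "op_in Z (V Int N)" using o that by blast
 show ?thesis using c[OF that] g that o[of V] o[of N] oVN S.res_closed[of V "V Int N" "g V"] S.res_closed[of N "V Int N" "g N"] transp_eq_iff[OF oVN]
  by(simp add: ops)
qed
have ex: "EX! s. s:C (Sec F (\<Union>Vt)) & (ALL V:Vt. mr F (\<Union>Vt) V s = g V)" by(rule S.glue) (fact o g(1) c')+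
obtain s where s': "s:C (Sec F (\<Union>Vt)) & (ALL V:Vt. mr F (\<Union>Vt) V s = g V)" using ex1_implies_ex[OF ex] by(rule exE)
hence s: "s:C (Sec F (\<Union>Vt))" "!!V. V:Vt ==> mr F (\<Union>Vt) V s = g V" by simp_all
have u: "t = s" if "t:C (Sec F (\<Union>Vt))" "!!V. V:Vt ==> mr F (\<Union>Vt) V t = g V" for t by(rule ex1_unique[OF ex _ s']) (simp add: that)
show "EX! s. s:C (Sec T (\<Union>Vt)) & (ALL V:Vt. mr T (\<Union>Vt) V s = f V)"
proof(rule ex1I[of _ "e s"])
 show "e s:C (Sec T (\<Union>Vt)) & (ALL V:Vt. mr T (\<Union>Vt) V (e s) = f V)" using s g(2) oU by(simp add: transp_simps ops)
 fix y assume y: "y:C (Sec T (\<Union>Vt)) & (ALL V:Vt. mr T (\<Union>Vt) V y = f V)"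
 then obtain t where t: "t:C (Sec F (\<Union>Vt))" "y = e t" by(auto simp: transp_simps)
 have "mr F (\<Union>Vt) V t = g V" if "V:Vt" for V
 proof -
  have "V <= \<Union>Vt" using that by blast
  from S.res_closed[OF oU o[OF that] this t(1)] show ?thesis
   using y that t g[OF that] oU transp_eq_iff[OF o[OF that], of "mr F (\<Union>Vt) V t" "g V"] by(simp add: ops)
 qed
 from u[OF t(1) this] show "y = e s" using t(2) by simp
qed
qed

lemma transp_mod: "D_module L Z T"
proof(rule D_module.intro[OF transp_sheaf transp_smod])
fix U assume U: "op_in Z U"
interpret M: left_supermodule "fun_ring Z U" "Sec F U" by(rule F.mod_sections[OF U])
note [simp] = transp_ops[OF U] transp_minus[OF U] F.nabla_closed[OF U] transp_simps M.smult_closed M.M.gr_car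
{ fix v s assume v: "v:tangent L Z U" and "s:C (Sec T U)"
 then obtain x where x [simp]: "x:C (Sec F U)" "s = e x" by auto
 note [simp] = F.nabla_closed[OF U v]
 show "nabla T U v s:C (Sec T U)" by simp
 show "nabla T U v (s+[Sec T U] t) = nabla T U v s+[Sec T U] nabla T U v t" if "t:C (Sec T U)" for t using that by(auto simp: F.nabla_add[OF U v])
 show "nabla T U (vf_add Z U v w) s = nabla T U v s+[Sec T U] nabla T U w s" if "w:tangent L Z U" for w
  using that by(simp add: F.nabla_vf_add[OF U v])
 show "nabla T U (vf_smult Z U f v) s = f.*[Sec T U] nabla T U v s" if "f:C (fun_ring Z U)" for f
  using that by(simp add: F.nabla_vf_smult[OF U _ v])
 show "mr T U V (nabla T U v s) = nabla T V (vf_res Z V v) (mr T U V s)" if V: "op_in Z V" "V<=U" for V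
  using F.nabla_res[OF U V v x(1)] transp_ops(4)[OF V(1)] set_sheaf.res_closed[OF F.mod_sheaf U V x(1)] by simp }
{ fix V assume V: "op_in Z V" "V<=U"
 note [simp] = set_sheaf.res_closed[OF F.mod_sheaf U V] transp_ops[OF V(1)]
 show "mr T U V (s+[Sec T U] t) = mr T U V s+[Sec T V] mr T U V t"
  if "s:C (Sec T U)" "t:C (Sec T U)" for s t using that by(auto simp: F.mod_res_add[OF U V])
 show "mr T U V (f.*[Sec T U] s) = fr Z U V f.*[Sec T V] mr T U V s"
  if "f:C (fun_ring Z U)" "s:C (Sec T U)" for f s using that by(auto simp: F.mod_res_smult[OF U V])
 show "mr T U V ` mg (Sec T U) i <= mg (Sec T V) i" for i using F.mod_res_grade[OF U V, of i] by auto }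
fix v i assume v: "v:Der L Z U i"
note vt = lambda_superspace.der_tan[OF Z]
note [simp] = F.nabla_closed[OF U vt[OF v]]
show "nabla T U v ` mg (Sec T U) j <= mg (Sec T U) (i ~= j)" for j using F.nabla_grade[OF U v, of j] M.M.gr_car[of _ j] by force
fix s assume "s:C (Sec T U)"
then obtain x where x [simp]: "x:C (Sec F U)" "s = e x" by auto
show "nabla T U v (f.*[Sec T U] s) = v U f.*[Sec T U] s+[Sec T U] koszul (Sec T U) i j (f.*[Sec T U] nabla T U v s)"
 if f: "f:grade (fun_ring Z U) j" for f j
 using F.nabla_Leibniz[OF U v f x(1)] M.R.gr_car[OF f] lambda_superspace.der_cl[OF Z v U le M.R.gr_car[OF f]] by simp
show "nabla T U (vf_br Z U i j v w) s = nabla T U v (nabla T U w s) -[Sec T U] koszul (Sec T U) i j (nabla T U w (nabla T U v s))"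
 if w: "w:Der L Z U j" for j w
 using F.nabla_flat[OF U v w x(1)] F.nabla_closed[OF U vt[OF w]] by simp
qed

lemma transp_mor: "dmor L Z F T (%_. e)" by(rule dmorI) (auto simp: transp_simps transp_ops)

end

section \<open>Enumerating sections\<close>

text \<open>A section of the sheafified tensor product is determined by a tensor for each of its germs. The
  points, functions and elements that occur in these tensors are listed in the code: every entry of the code
  is a list made up of a point, two numbers in unary notation and one entry.\<close>

definition code_word :: "'p => nat => nat => ('p + 'a + 'j) list => ('p + 'a + 'j) list" where
"code_word p t i x = Inl p # replicate t (Inl p) @ [Inr (Inl undefined)] @ replicate i (Inl p) @ [Inr (Inl undefined)] @ x"

lemma replicate_append_inject:
assumes "a ~= b" shows "replicate m a @ b # x = replicate n a @ b # y <-> m = n & x = y"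
proof(induction m arbitrary: n)
case 0
thus ?case using assms by(cases n) auto
next
case (Suc m)
thus ?case using assms by(cases n) auto
qed

lemma code_word_inject: "code_word p t i x = code_word q t' i' x' <-> p = q & t = t' & i = i' & x = x'"
by(cases "p = q") (simp_all add: code_word_def replicate_append_inject)

definition tensor_entry :: "'p set \<times> ('a \<times> ('p, 'a, 'j) universe) list => nat => nat => ('p + 'a + 'j) list => bool" where
"tensor_entry = (%(V, l) t i x. t = 0 & (EX q:V. x = [Inl q]) | t = 1 & i < length l & x = [Inr (Inl (fst (l ! i)))] |
  t = 2 & i < length l & x:snd (l ! i))"

lemma tensor_entry_inject:
assumes "tensor_entry (V, l) = tensor_entry (V', l')" shows "V = V' & l = l'"
proof
have eq: "tensor_entry (V, l) t i x <-> tensor_entry (V', l') t i x" for t i x using assms by simp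
show "V = V'" using eq[of 0 0 "[Inl _]"] by(auto simp: tensor_entry_def)
have 1: "i < length l & x = fst (l ! i) <-> i < length l' & x = fst (l' ! i)" for i x
 using eq[of 1 i "[Inr (Inl x)]"] by(simp add: tensor_entry_def)
hence "i < length l <-> i < length l'" for i by blast
hence len: "length l = length l'" by(metis linorder_neqE_nat order_less_irrefl)
show "l = l'"
proof(rule nth_equalityI[OF len])
 fix i assume i: "i < length l"
 have "x:snd (l ! i) <-> x:snd (l' ! i)" for x using eq[of 2 i x] i len by(simp add: tensor_entry_def)
 thus "l ! i = l' ! i" using 1[of i "fst (l ! i)"] i by(intro prod_eqI set_eqI) auto
qed
qed

definition section_word :: "('p => ('p, 'a, ('p, 'a, 'j) universe) tensor_germ) => ('p, 'a, 'j) universe" where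
"section_word s = {code_word p t i x |p t i x. tensor_entry (SOME y. y:s p) t i x}"

lemma section_word_inject:
assumes "section_word s = section_word s'" shows "(SOME y. y:s p) = (SOME y. y:s' p)"
proof -
have "code_word p t i x:section_word s <-> tensor_entry (SOME y. y:s p) t i x" for s :: "'a => ('a, 'b, ('a, 'b, 'c) universe) tensor_germ" and t i x
 by(auto simp: section_word_def code_word_inject)
hence "tensor_entry (SOME y. y:s p) = tensor_entry (SOME y. y:s' p)" using assms by(intro ext) metis
thus ?thesis by(metis tensor_entry_inject prod.exhaust)
qed

lemma (in inv_im_of) germ_determined:
assumes "s:Ss U" "s':Ss U" "p:U" "(SOME y. y:s p) = (SOME y. y:s' p)"
shows "s p = s' p"
proof -
have *: "(SOME y. y:s p):s p & (ALL V l. (V, l):s p --> s p = germ p V l)" if sU: "s:Ss U" for s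
proof -
 obtain V l where r: "rep U s p V l" using sU assms(3) unfolding S_iff by blast
 have o: "opn V" "p:V" "l:tens V" using r by(auto simp: rep_iff)
 have "(V, l):s p" using o unfolding rep_germ[OF r] tensor_germ_def by(auto simp: tres_id intro!: exI[of _ V] teq_refl)
 moreover have "s p = germ p V' l'" if "(V', l'):s p" for V' l'
 proof -
  have "opn V' & p:V' & l':tens V' & (EX N. opn N & p:N & N<=V Int V' & teq N (tres V N l) (tres V' N l'))"
   using that unfolding rep_germ[OF r] tensor_germ_def by auto
  thus ?thesis unfolding rep_germ[OF r] using germ_eq_iff[OF o, of V' l'] by blast
 qed
 ultimately show ?thesis using someI[of "%y. y:s p"] by blast
qed
obtain V l where "(SOME y. y:s p) = (V, l)" by(cases "SOME y. y:s p")
thus ?thesis using *[OF assms(1)]*[OF assms(2)] assms(4) by metis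
qed

lemma section_code_inj:
fixes G :: "('p, 'b, ('p, 'a, 'j) universe) dmodule" and Z :: "('p, 'l, 'a) superspace"
assumes G: "inv_im_of L Z W sg G" and U: "op_in Z U"
shows "inj_on (section_code Z (inverse_image_raw L Z W sg G) :: _ => ('p, 'a, 'j) universe) (C (Sec (inverse_image_raw L Z W sg G) U))"
proof -
interpret inv_im_of L Z W sg G by(rule G)
have "ALL U. opn U --> inj_on (section_word :: _ => ('p, 'a, 'j) universe) (C (Sec R U))"
proof(intro allI impI inj_onI)
 fix U s s' assume U: "opn U" and s: "s:C (Sec R U)" "s':C (Sec R U)"
  and eq: "section_word s = (section_word s' :: ('p, 'a, 'j) universe)"
 hence sS: "s:Ss U" "s':Ss U" by(simp_all add: R_simps)
 show "s = s'"
 proof(rule extensionalityI[of s U s'])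
  show "s:extensional U" "s':extensional U" using sS by(simp_all add: S_iff)
  show "s p = s' p" if "p:U" for p by(rule germ_determined[OF sS that section_word_inject[OF eq]])
 qed
qed
thus ?thesis using someI[of "%e. ALL U. opn U --> inj_on e (C (Sec R U))" "section_word :: _ => ('p, 'a, 'j) universe"] U
 unfolding section_code_def by blast
qed

section \<open>The counit\<close>

text \<open>Sections of the pullback of \<open>\<sigma>\<^sub>+ F\<close> are locally $\sum a \otimes x$ with vertically flat \<open>x\<close>;
  the counit sends them to $\sum a x$. It is bijective since, on a chart, both sides are free over the
  flat sections with the monomials as basis.\<close>

context odd_dmod
begin

interpretation I: inv_im_of L Z W sg dF by(rule inv_im_ofI[OF dir_im_mod])

abbreviation E where "E V == lsum (Fs V) (%(a, x). a.*[Fs V] x)"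

lemma tens_ann: "l:I.tens V <-> (ALL (a, x):set l. a:cO V & x:ann V)" by(simp add: I.tens_iff)

lemma E_term: "opn V ==> l:I.tens V ==> y:set l ==> (case y of (a, x) => a.*[Fs V] x):cF V"
proof -
assume V: "opn V" and y: "l:I.tens V" "y:set l"
obtain a x where yy: "y = (a, x)" by(cases y)
have "a:cO V" "x:ann V" using y yy by(auto simp: tens_ann)
thus ?thesis unfolding yy prod.case using left_supermodule.smult_closed[OF M_smod[OF V]] annD(1) by blast
qed

lemma E_cl: "opn V ==> l:I.tens V ==> E V l:cF V" by(rule abelian_group.lsum_cl[OF F.M_ag E_term])

lemma E_append: "opn V ==> k:I.tens V ==> l:I.tens V ==> E V (k @ l) = E V k+[Fs V] E V l"
by(rule abelian_group.lsum_append[OF F.M_ag]) (use E_term in blast)+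

lemma E_res:
assumes V: "opn V" "opn N" "N<=V" and l: "l:I.tens V"
shows "mr F V N (E V l) = E N (I.tres V N l)"
proof -
have "mr F V N (E V l) = lsum (Fs N) (%y. mr F V N (case y of (a, x) => a.*[Fs V] x)) l" by(rule F.mres_lsum[OF V E_term[OF V(1) l]])
also have "... = E N (I.tres V N l)" unfolding tensor_res_def lsum_map
 by(rule lsum_cong) (use l annD(1) in \<open>auto simp: tens_ann F.mod_res_smult[OF V]\<close>)
finally show ?thesis .
qed

lemma E_teq:
assumes V: "opn V" and eq: "I.teq V l l'" shows "E V l = E V l'"
proof -
interpret M: left_supermodule "Oz V" "Fs V" by(rule M_smod[OF V])
have "l:I.tens V & l':I.tens V & E V l = E V l'" by(rule I.tensor_lift[OF V M.M.ag _ _ _ _ eq])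
  (use annD(1) V in \<open>simp_all add: M.smult_closed M.smult_l_distr M.smult_r_distr M.smult_assoc\<close>)
thus ?thesis by blast
qed

lemma E_sec:
assumes V: "opn V" and l: "l:I.tens V" "l':I.tens V" and eq: "I.sec V l = I.sec V l'"
shows "E V l = E V l'"
proof(rule F.mlocal_eq[OF V E_cl[OF V l(1)] E_cl[OF V l(2)]])
fix p assume p: "p:V"
have "I.germ p V l = I.germ p V l'" using fun_cong[OF eq, of p] p by(simp add: I.sec_def)
then obtain N where N: "opn N" "p:N" "N<=V" "I.teq N (I.tres V N l) (I.tres V N l')" using I.germ_eq_iff[OF V p l(1) V p l(2)] by blast
thus "EX N. opn N & p:N & N<=V & mr F V N (E V l) = mr F V N (E V l')"
 using E_teq[OF N(1,4)] by(intro exI[of _ N]) (simp add: E_res[OF V N(1,3)] l)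
qed

definition eps :: "'p set => ('p => ('p, 'a, 'm) tensor_germ) => 'm" where
"eps U s = (SOME t. t:cF U & (ALL V l. opn V --> V<=U --> l:I.tens V --> rst s V = I.sec V l --> mr F U V t = E V l))"

lemma eps:
assumes U: "opn U" and s: "s:I.Ss U"
shows "eps U s:cF U"
 and "opn V ==> V<=U ==> l:I.tens V ==> rst s V = I.sec V l ==> mr F U V (eps U s) = E V l"
proof -
obtain t where t: "t:cF U" "!!V x. opn V ==> V<=U ==> x:cF V ==> EX l:I.tens V. rst s V = I.sec V l & x = E V l ==> mr F U V t = x"
proof(rule set_sheaf.glue_local[OF F.mod_sheaf U, of "%V x. EX l:I.tens V. rst s V = I.sec V l & x = E V l"])
 show "EX V x. opn V & p:V & V<=U & x:cF V & (EX l:I.tens V. rst s V = I.sec V l & x = E V l)" if pU: "p:U" for p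
 proof -
  obtain V l where "opn V" "p:V" "V<=U" "l:I.tens V" "rst s V = I.sec V l" using I.S_local[OF U s pU] .
  thus ?thesis using E_cl by blast
 qed
 show "EX l:I.tens N. rst s N = I.sec N l & mr F V N x = E N l"
  if o: "opn V" "opn N" "N<=V" and x: "EX l:I.tens V. rst s V = I.sec V l & x = E V l" for V N x
 proof -
  obtain l where l: "l:I.tens V" "rst s V = I.sec V l" "x = E V l" using x by(rule bexE) simp
  have "rst s N = rst (rst s V) N" using o(3) by(simp add: Int_absorb1)
  thus ?thesis using I.sec_res[OF o l(1)] I.tres_tens[OF o l(1)] E_res[OF o l(1)] l(2,3) by(intro bexI[of _ "I.tres V N l"]) simp_all
 qed
 show "x = y" if "opn V" "EX l:I.tens V. rst s V = I.sec V l & x = E V l" "EX l:I.tens V. rst s V = I.sec V l & y = E V l" for V x y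
  using that E_sec[OF that(1)] by metis
qed (blast intro: that)
have "eps U s:cF U & (ALL V l. opn V --> V<=U --> l:I.tens V --> rst s V = I.sec V l --> mr F U V (eps U s) = E V l)"
 unfolding eps_def by(rule someI[of _ t]) (use t E_cl in blast)
thus "eps U s:cF U" "opn V ==> V<=U ==> l:I.tens V ==> rst s V = I.sec V l ==> mr F U V (eps U s) = E V l" by blast+
qed

lemma eps_rep: "opn U ==> s:I.Ss U ==> I.rep U s p V l ==> mr F U V (eps U s) = E V l" using eps(2) by(simp add: I.rep_iff)

lemma eps_eqI:
assumes U: "opn U" and s: "s:I.Ss U" and t: "t:cF U"
 and loc: "!!p. p:U ==> EX V l. I.rep U s p V l & mr F U V t = E V l"
shows "eps U s = t"
proof(rule F.mlocal_eq[OF U eps(1)[OF U s] t])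
fix p assume "p:U"
then obtain V l where V: "I.rep U s p V l" "mr F U V t = E V l" using loc by blast
thus "EX V. opn V & p:V & V<=U & mr F U V (eps U s) = mr F U V t" using eps_rep[OF U s V(1)] by(intro exI[of _ V]) (simp add: I.rep_iff)
qed

lemma eps_sec: "opn V ==> l:I.tens V ==> eps V (I.sec V l) = E V l"
proof -
assume V: "opn V" and l: "l:I.tens V"
have "eps V (I.sec V l) = mr F V V (eps V (I.sec V l))" using F.mres_id[OF V eps(1)[OF V I.sec_S[OF V l]]] by simp
also have "... = E V l" by(rule eps(2)[OF V I.sec_S[OF V l] V le l]) (use I.S_ext[OF I.sec_S[OF V l]] in simp)
finally show ?thesis .
qed

lemma E_tensor_nabla:
assumes V: "chart V ths" and v: "v0:DZ V False" "v1:DZ V True"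
 and u: "!!a. a:cO V ==> u V a = v0 V a+[Oz V] v1 V a"
 and w: "Tim V v0 ws0" "Tim V v1 ws1" and l: "l:I.tens V"
shows "E V (tensor_nabla Z dF V u ws0 ws1 l) = nabla F V v0 (E V l)+[Fs V] nabla F V v1 (E V l)"
using l
proof(induction l)
note oV = c_opn[OF V] and vt = Z.der_tan[OF v(1)] Z.der_tan[OF v(2)]
interpret M: left_supermodule "Oz V" "Fs V" by(rule M_smod[OF oV])
{
 case Nil
 show ?case by(simp add: F.nabla_zero[OF oV vt(1)] F.nabla_zero[OF oV vt(2)])
next
 case (Cons y l)
 obtain a x where y: "y = (a, x)" by(cases y)
 have c: "a:cO V" "x:ann V" "l:I.tens V" using Cons.prems y by(auto simp: tens_ann)
 note xc = annD(1)[OF c(2)] and vc = Z.der_cl[OF v(1) oV le c(1)] Z.der_cl[OF v(2) oV le c(1)]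
 note n = F.nabla_closed[OF oV vt(1)] F.nabla_closed[OF oV vt(2)]
 have k: "E V (map (%(h, w). (b*[Oz V] h, nabla dF V w x)) ws) = b.*[Fs V] nabla F V v x"
  "map (%(h, w). (b*[Oz V] h, nabla dF V w x)) ws:I.tens V"
  if b: "b:cO V" and ws: "Tim V v ws" and v: "v:DZ V i" for b ws v i
 proof -
  have wc: "h:cO V" "nabla dF V w x:ann V" if "(h, w):set ws" for h w using ws that nabla_N_ann[OF oV _ c(2)] by(auto simp: tan_image_iff)
  show "map (%(h, w). (b*[Oz V] h, nabla dF V w x)) ws:I.tens V" using wc b by(auto simp: tens_ann)
  show "E V (map (%(h, w). (b*[Oz V] h, nabla dF V w x)) ws) = b.*[Fs V] nabla F V v x" unfolding nabla_ann_image[OF V v ws c(2)] lsum_map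
   by(subst M.smult_lsum) (use b wc annD(1) in \<open>auto simp: M.smult_assoc intro!: M.smult_closed lsum_cong\<close>)
 qed
 note f = M.R.flip_cl[OF c(1), of True]
 note k0 = k[OF c(1) w(1) v(1)] and k1 = k[OF f w(2) v(2)]
 have tn: "tensor_nabla Z dF V u ws0 ws1 l:I.tens V" using I.sec_tensor_nabla[where u = u, OF V v u w c(3)] by blast
 have El: "E V l:cF V" "E V (tensor_nabla Z dF V u ws0 ws1 l):cF V" using E_cl[OF oV] c(3) tn by auto
 show ?case using Cons.IH[OF c(3)] k0 k1 tn El c xc vc f n[OF xc] n[OF El(1)] M.smult_closed[OF c(1) xc]
  by(simp add: y M.R.parity_inv_flip u E_append[OF oV] M.smult_closed M.smult_l_distr F.nabla_add[OF oV vt(1)] F.nabla_add[OF oV vt(2)]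
    F.nabla_Leib_flip[OF oV v(1) c(1) xc] F.nabla_Leib_flip[OF oV v(2) c(1) xc] M.M.a_ac)
}
qed

lemma eps_mor: "dmor L Z I.R F eps"
proof(rule dmorI, unfold I.R_simps)
fix U assume U: "opn U"
interpret M: left_supermodule "Oz U" "Fs U" by(rule M_smod[OF U])
note ec = eps(1)[OF U] and er = eps_rep[OF U]
show "eps U s:cF U" if "s:I.Ss U" for s by(rule ec[OF that])
show "eps U s:mg (Fs U) i" if s: "s:mg (I.Ts U) i" for s i
proof(rule F.mlocal_grade[OF U])
 have sS: "s:I.Ss U" using s by(simp add: I.R_grade)
 show "eps U s:cF U" by(rule ec[OF sS])
 fix p assume "p:U"
 then obtain V l where V: "I.rep U s p V l" "I.hten V i l" using s unfolding I.R_grade by blast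
 hence o: "opn V" "p:V" "V<=U" by(auto simp: I.rep_iff)
 interpret V: left_supermodule "Oz V" "Fs V" by(rule M_smod[OF o(1)])
 have "E V l:mg (Fs V) i"
 proof(rule V.M.gr_lsum)
  fix y assume "y:set l"
  then obtain a x j where y: "y = (a, x)" "a:grade (Oz V) j" "x:mg (Fs V) (i ~= j)" using V(2) by(auto simp: I.hten_def)
  have e: "(j ~= (i ~= j)) = i" by(cases i; cases j) simp_all
  show "(case y of (a, x) => a.*[Fs V] x):mg (Fs V) i" using V.mgrade_smult[OF y(2,3)] unfolding e y(1) by simp
 qed
 thus "EX V. opn V & p:V & V<=U & mr F U V (eps U s):mg (Fs V) i" using o er[OF sS V(1)] by(intro exI[of _ V]) simp
qed
show "eps U (s+[I.Ts U] t) = eps U s+[Fs U] eps U t" if s: "s:I.Ss U" "t:I.Ss U" for s t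
proof(rule eps_eqI[OF U I.add_cl[OF U s]])
 fix p assume p: "p:U"
 obtain V k l where V: "I.rep U s p V k" "I.rep U t p V l" using I.S_local2[OF U s p] .
 hence o: "opn V" "V<=U" "k:I.tens V" "l:I.tens V" by(auto simp: I.rep_iff)
 show "EX V l. I.rep U (s+[I.Ts U] t) p V l & mr F U V (eps U s+[Fs U] eps U t) = E V l"
  using I.add_rep[OF V] by(intro exI[of _ V] exI[of _ "k @ l"] conjI)
   (simp_all only: F.mod_res_add[OF U o(1,2) ec[OF s(1)] ec[OF s(2)]] er[OF s(1) V(1)] er[OF s(2) V(2)] E_append[OF o(1,3,4)])
qed (use ec s in simp)
show "eps U (f.*[I.Ts U] s) = f.*[Fs U] eps U s" if f: "f:cO U" and s: "s:I.Ss U" for f s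
proof(rule eps_eqI[OF U I.smult_closed[OF U f s]])
 fix p assume "p:U"
 then obtain V l where V: "I.rep U s p V l" using s unfolding I.S_iff by blast
 hence o: "opn V" "V<=U" "l:I.tens V" by(auto simp: I.rep_iff)
 interpret V: left_supermodule "Oz V" "Fs V" by(rule M_smod[OF o(1)])
 have "fr Z U V f.*[Fs V] E V l = E V (map (%(a, t). (fr Z U V f*[Oz V] a, t)) l)" unfolding lsum_map by(subst V.smult_lsum)
   (use Z.res_closed[OF U o(1,2) f] o(3) annD(1) in \<open>auto simp: tens_ann V.smult_assoc intro!: V.smult_closed lsum_cong\<close>)
 thus "EX V l. I.rep U (f.*[I.Ts U] s) p V l & mr F U V (f.*[Fs U] eps U s) = E V l"
  by(intro exI[of _ V] exI[of _ "map (%(a, t). (fr Z U V f*[Oz V] a, t)) l"] conjI I.smult_rep[OF U f V])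
   (simp only: F.mod_res_smult[OF U o(1,2) f ec[OF s]] er[OF s V])
qed (use ec[OF s] f in \<open>simp add: M.smult_closed\<close>)
show "eps V (rst s V) = mr F U V (eps U s)" if V: "opn V" "V<=U" and s: "s:I.Ss U" for V s
proof(rule eps_eqI[OF V(1) I.S_res[OF U s V]])
 fix p assume p: "p:V"
 obtain N l where N: "opn N" "p:N" "N<=V" "l:I.tens N" "rst (rst s V) N = I.sec N l" using I.S_local[OF V(1) I.S_res[OF U s V] p] .
 have NU: "N<=U" "rst s N = I.sec N l" using N(3,5) V(2) by(auto simp: Int_absorb1)
 show "EX N l. I.rep V (rst s V) p N l & mr F V N (mr F U V (eps U s)) = E N l"
  using N eps(2)[OF U s N(1) NU(1) N(4) NU(2)] F.mres_trans[OF U V(1) N(1,3) V(2) ec[OF s]] by(intro exI[of _ N] exI[of _ l]) (simp add: I.rep_iff)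
qed (use U V ec[OF s] in simp)
show "eps U (nabla I.R U v s) = nabla F U v (eps U s)" if v: "v:TZ U" and s: "s:I.Ss U" for v s
proof(rule eps_eqI[OF U I.R_nabla_cl[OF U v s] F.nabla_closed[OF U v ec[OF s]]])
 fix p assume p: "p:U"
 obtain V ths l where V: "chart V ths" "p:V" "V<=U" "l:I.tens V" "rst s V = I.sec V l" using I.chart_rep[OF U s p] .
 note oV = c_opn[OF V(1)]
 obtain v0 v1 where d: "v0:DZ V False" "v1:DZ V True" "vf_res Z V v = vf_add Z V v0 v1" using I.tan_parts_res[OF v oV V(3)] .
 obtain ws0 ws1 where w: "Tim V v0 ws0" "Tim V v1 ws1" using tan_image_exists[OF V(1)] d(1,2) by blast
 have u: "v V a = v0 V a+[Oz V] v1 V a" if "a:cO V" for a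
  using fun_cong[OF fun_cong[OF d(3), of V], of a] that oV by(simp add: Z.vf_res_app Z.vf_add_app)
 have t: "tensor_nabla Z dF V v ws0 ws1 l:I.tens V" "rst (nabla I.R U v s) V = I.sec V (tensor_nabla Z dF V v ws0 ws1 l)"
  using I.sec_tensor_nabla[where u = v, OF V(1) d(1,2) u w V(4)] I.nabla_rep[OF U v V(1,3,4,5) d] by simp_all
 have "mr F U V (nabla F U v (eps U s)) = nabla F V (vf_add Z V v0 v1) (E V l)"
  using F.nabla_res[OF U oV V(3) v ec[OF s]] eps(2)[OF U s oV V(3-5)] d(3) by simp
 also have "... = E V (tensor_nabla Z dF V v ws0 ws1 l)" using F.nabla_vf_add[OF oV Z.der_tan[OF d(1)] Z.der_tan[OF d(2)] E_cl[OF oV V(4)]]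
   E_tensor_nabla[where u = v, OF V(1) d(1,2) u w V(4)] by simp
 finally show "EX V l. I.rep U (nabla I.R U v s) p V l & mr F U V (nabla F U v (eps U s)) = E V l"
  using t V(2,3) oV by(intro exI[of _ V] exI[of _ "tensor_nabla Z dF V v ws0 ws1 l"]) (simp add: I.rep_iff)
qed
qed

lemma eps_zero:
assumes U: "opn U" and s: "s:I.Ss U" and z: "eps U s = 0[Fs U]" shows "s = I.sec U []"
proof(rule I.S_eqI[OF s])
show "I.sec U []:I.Ss U" using U by(simp add: I.sec_S)
fix p assume p: "p:U"
obtain V ths l where V: "chart V ths" "p:V" "V<=U" "l:I.tens V" "rst s V = I.sec V l" using I.chart_rep[OF U s p] .
note oV = c_opn[OF V(1)]
interpret V: odd_extension "Oz V" "Ow V" "sg V" ths by(rule chart_self[OF V(1)])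
let ?t = "I.tcoef V ths l" and ?ms = "mons (length ths)"
have ta: "?t I:ann V" for I using I.tcoef_cl[OF V(1,4)] by simp
have k: "map (%I. (mon V ths I, ?t I)) ?ms:I.tens V" using ta V.mon_cl by(auto simp: tens_ann)
have "I.sec V l = I.sec V (map (%I. (mon V ths I, ?t I)) ?ms)"
 unfolding I.sec_lsum[OF oV k] I.sec_expand[OF V(1,4)] lsum_map by(rule lsum_cong) simp_all
hence "lsum (Fs V) (%I. mon V ths I.*[Fs V] ?t I) ?ms = E V l" using E_sec[OF oV V(4) k] by simp
also have "... = 0[Fs V]" using eps(2)[OF U s oV V(3-5)] z F.mres_zero[OF U oV V(3)] by simp
finally have "?t I = 0[Fs V]" if "I:set ?ms" for I using ann_free[where c = ?t, OF V(1) ta _ that] by blast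
hence "I.sec V l = I.sec V []" using I.sec_eq_iff[OF V(1,4), of "[]"] by(simp add: I.tcoef_def)
thus "EX V. p:V & rst s V = rst (I.sec U []) V" using V I.sec_res[OF U oV V(3), of "[]"] by(intro exI[of _ V]) simp
qed

lemma eps_bij: "opn U ==> bij_betw (eps U) (I.Ss U) (cF U)"
proof -
have inj: "s = t" if U: "opn U" and s: "s:I.Ss U" "t:I.Ss U" and eq: "eps U s = eps U t" for U s t
proof -
 interpret T: abelian_group "I.Ts U" by(rule I.R_group[OF U])
 interpret M: abelian_group "Fs U" by(rule F.M_ag[OF U])
 have sc: "s:C (I.Ts U)" "t:C (I.Ts U)" using s by(simp_all add: I.R_simps)
 have "eps U (s -[I.Ts U] t) = 0[Fs U]" using addmap_minus[OF T.ag M.ag add_mor[OF eps_mor U] sc] eq eps(1)[OF U s(2)] by simp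
 hence "s -[I.Ts U] t = 0[I.Ts U]" using eps_zero[OF U] T.minus_closed[OF sc] by(simp add: I.R_simps)
 thus "s = t" by(rule T.minus_zero_imp_eq[OF sc])
qed
note em = mor_res[OF eps_mor, unfolded I.R_simps]
assume U: "opn U"
have "EX s:I.Ss U. eps U s = t" if t: "t:cF U" for t
proof -
 have loc: "EX V s. opn V & p:V & V<=U & s:I.Ss V & eps V s = mr F U V t" if pU: "p:U" for p
 proof -
  obtain V ths where V: "chart V ths" "p:V" "V<=U" using chart_exists[OF U pU] .
  note oV = c_opn[OF V(1)]
  interpret V: odd_extension "Oz V" "Ow V" "sg V" ths by(rule chart_self[OF V(1)])
  let ?ms = "mons (length ths)"
  obtain c where c: "ALL I:set ?ms. c I:ann V" "mr F U V t = lsum (Fs V) (%I. mon V ths I.*[Fs V] c I) ?ms"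
   using ann_span[OF V(1) F.mres_cl[OF U oV V(3) t]] by blast
  let ?l = "map (%I. (mon V ths I, c I)) ?ms"
  have l: "?l:I.tens V" using c(1) V.mon_cl by(auto simp: tens_ann)
  show ?thesis using V oV I.sec_S[OF oV l] eps_sec[OF oV l] c(2) by(intro exI[of _ V] exI[of _ "I.sec V ?l"]) simp
 qed
 obtain s where s: "s:I.Ss U" "!!V x. opn V ==> V<=U ==> x:I.Ss V ==> eps V x = mr F U V t ==> rst s V = x"
 proof(rule set_sheaf.glue_local[OF I.S_sheaf U, of "%V x. eps V x = mr F U V t"])
  show "EX V s. opn V & p:V & V<=U & s:I.Ss V & eps V s = mr F U V t" if "p:U" for p by(rule loc[OF that])
  show "eps N (rst x N) = mr F U N t" if "opn V" "opn N" "N<=V" "V<=U" "x:I.Ss V" "eps V x = mr F U V t" for V N x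
   using em[OF that(1-3,5)] that(6) F.mres_trans[OF U that(1-4) t] by simp
  show "x = y" if "opn V" "x:I.Ss V" "y:I.Ss V" "eps V x = mr F U V t" "eps V y = mr F U V t" for V x y using inj[OF that(1-3)] that(4,5) by simp
 qed (blast intro: that)
 have "eps U s = t"
 proof(rule F.mlocal_eq[OF U eps(1)[OF U s(1)] t])
  fix p assume "p:U"
  from loc[OF this] obtain V x where V: "opn V" "p:V" "V<=U" "x:I.Ss V" "eps V x = mr F U V t" by blast
  thus "EX V. opn V & p:V & V<=U & mr F U V (eps U s) = mr F U V t" using em[OF U V(1,3) s(1)] s(2)[OF V(1,3-5)] by(intro exI[of _ V]) simp
 qed
 thus ?thesis using s(1) by blast
qed
thus ?thesis using inj[OF U] eps(1)[OF U] by(auto simp: bij_betw_def inj_on_def image_iff)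
qed

end

section \<open>The categories of D-modules\<close>

lemma D_mod_simps [simp]: "obj (D_mod L Z) = {F. D_module L Z F}" "hom_set (D_mod L Z) = dmod_hom L Z"
"ident (D_mod L Z) = (%F. dmap_mk Z F (%U s. s))" "arr_comp (D_mod L Z) = (%F G H k h. dmap_mk Z F (%U s. k U (h U s)))"
by(simp_all add: D_mod_def)

lemma dmap_mk_cong: "(!!U s. op_in Z U ==> s:C (Sec F U) ==> h U s = k U s) ==> dmap_mk Z F h = dmap_mk Z F k" by(auto simp: dmap_mk_def fun_eq_iff)

lemma dmap_mk_app: "op_in Z U ==> s:C (Sec F U) ==> dmap_mk Z F h U s = h U s" by(simp add: dmap_mk_def)

lemma dmap_mk_hom: "D_module L Z F ==> dmor L Z F G h ==> dmap_mk Z F h:dmod_hom L Z F G"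
using mor_dmap_mk[of L Z F G h] by(simp add: dmod_hom_iff) (simp add: dmap_mk_def fun_eq_iff)

lemma D_mod_category: "category (D_mod L Z)"
proof(rule category.intro, unfold D_mod_simps mem_Collect_eq)
show "dmap_mk Z F (%U s. s):dmod_hom L Z F F" if "D_module L Z F" for F by(rule dmap_mk_hom[OF that mor_id])
show "dmap_mk Z F (%U s. k U (h U s)):dmod_hom L Z F H" if "D_module L Z F" "h:dmod_hom L Z F G" "k:dmod_hom L Z G H" for F G H h k
 using that mor_comp by(intro dmap_mk_hom) (auto simp: dmod_hom_iff)
fix F G h assume h: "h:dmod_hom L Z F G"
hence e: "h = dmap_mk Z F h" and m: "dmor L Z F G h" by(simp_all add: dmod_hom_iff)
show "dmap_mk Z F (%U s. h U (dmap_mk Z F (%U s. s) U s)) = h" by(subst (2) e) (rule dmap_mk_cong, simp add: dmap_mk_app)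
show "dmap_mk Z F (%U s. dmap_mk Z G (%U s. s) U (h U s)) = h" by(subst (2) e) (rule dmap_mk_cong, simp add: dmap_mk_app mor_cl[OF m])
show "dmap_mk Z F (%U s. l U (dmap_mk Z F (%U s. k U (h U s)) U s)) = dmap_mk Z F (%U s. dmap_mk Z G (%U s. l U (k U s)) U (h U s))" for k l
 by(rule dmap_mk_cong) (simp add: dmap_mk_app mor_cl[OF m])
qed

lemma bijective_iso:
assumes F: "D_module L Z F" and G: "D_module L Z G" and h: "dmor L Z F G h"
 and bij: "!!U. op_in Z U ==> bij_betw (h U) (C (Sec F U)) (C (Sec G U))"
shows "dmap_mk Z F h:isos (D_mod L Z) F G"
unfolding isos_def
proof(intro CollectI conjI, unfold D_mod_simps)
let ?k = "%U. inv_into (C (Sec F U)) (h U)"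
show "dmap_mk Z F h:dmod_hom L Z F G" by(rule dmap_mk_hom[OF F h])
show "EX g:dmod_hom L Z G F. dmap_mk Z F (%U s. g U (dmap_mk Z F h U s)) = dmap_mk Z F (%U s. s) &
  dmap_mk Z G (%U s. dmap_mk Z F h U (g U s)) = dmap_mk Z G (%U s. s)"
proof(intro bexI[OF _ dmap_mk_hom[OF G mor_inverse[OF F G h bij]]] conjI dmap_mk_cong)
 fix U s assume U: "op_in Z U"
 show "dmap_mk Z G ?k U (dmap_mk Z F h U s) = s" if "s:C (Sec F U)"
  using that U mor_cl[OF h U] bij_betw_inv_into_left[OF bij[OF U]] by(simp add: dmap_mk_app)
 show "dmap_mk Z F h U (dmap_mk Z G ?k U s) = s" if "s:C (Sec G U)"
  using that U bij_betw_inv_into_right[OF bij[OF U]] bij_betwE[OF bij_betw_inv_into[OF bij[OF U]]] by(simp add: dmap_mk_app)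
qed
qed

context odd_submersion
begin

lemma dir_im_car: "C (Sec (dir F) U) = vertical_ann L Z W sg F U" by(simp add: direct_image_obj_def)

lemma dir_mod: "D_module L Z F ==> D_module L W (dir F)" using odd_dmod.dir_im_mod[OF odd_dmodI] .

lemma dir_im_functor: "category_functor (D_mod L Z) (D_mod L W) (direct_image L Z W sg)"
proof(intro category_functor.intro category_functor_axioms.intro D_mod_category, unfold D_mod_simps mem_Collect_eq direct_image_def functor_data.simps)
have ac: "s:C (Sec F U)" if "s:vertical_ann L Z W sg F U" for s U and F :: "('p, 'a, 'm) dmodule" using that by(simp add: vertical_ann_def)
fix F :: "('p, 'a, 'm) dmodule" assume F: "D_module L Z F"
show "D_module L W (dir F)" by(rule dir_mod[OF F])
show "dmap_mk W (dir F) (dmap_mk Z F (%U s. s)) = dmap_mk W (dir F) (%U s. s)" by(rule dmap_mk_cong) (simp add: dmap_mk_app ac dir_im_car)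
fix G :: "('p, 'a, 'm) dmodule" and h assume G: "D_module L Z G" and "h:dmod_hom L Z F G"
hence h: "dmor L Z F G h" by(simp add: dmod_hom_iff)
note dh = dir_im_mor[OF F G h]
show "dmap_mk W (dir F) h:dmod_hom L W (dir F) (dir G)" by(rule dmap_mk_hom[OF dir_mod[OF F] dh])
show "dmap_mk W (dir F) (dmap_mk Z F (%U s. k U (h U s))) = dmap_mk W (dir F) (%U s. dmap_mk W (dir G) k U (dmap_mk W (dir F) h U s))" for k
proof(rule dmap_mk_cong)
 fix U s assume U: "op_in W U" and s: "s:C (Sec (dir F) U)"
 show "dmap_mk Z F (%U s. k U (h U s)) U s = dmap_mk W (dir G) k U (dmap_mk W (dir F) h U s)"
  using U s mor_cl[OF dh U s] ac[of s F U] by(simp add: dmap_mk_app dir_im_car)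
qed
qed

abbreviation inv_raw where "inv_raw == inverse_image_raw L Z W sg"
abbreviation inv_obj where "inv_obj == inverse_image_obj L Z W sg"
abbreviation code where "code G == section_code Z (inv_raw G)"

context
fixes G :: "('p, 'b, ('p, 'a, 'j) universe) dmodule" assumes G: "D_module L W G"
begin

interpretation G: inv_im_of L Z W sg G by(rule inv_im_ofI[OF G])

lemma code_inj: "opn U ==> inj_on (code G :: _ => ('p, 'a, 'j) universe) (C (Sec (inv_raw G) U))" by(rule section_code_inj[OF G.inv_im_of_axioms])

lemma inv_obj_mod: "D_module L Z (inv_obj G :: ('p, 'a, ('p, 'a, 'j) universe) dmodule)"
unfolding inverse_image_obj_def by(rule transp_mod[OF Z.lambda_superspace_axioms G.R_mod code_inj])

lemma code_mor: "dmor L Z (inv_raw G) (inv_obj G) (%_. code G :: _ => ('p, 'a, 'j) universe)"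
unfolding inverse_image_obj_def by(rule transp_mor[OF Z.lambda_superspace_axioms G.R_mod code_inj])

lemma code_bij: "opn U ==> bij_betw (code G :: _ => ('p, 'a, 'j) universe) (C (Sec (inv_raw G) U)) (C (Sec (inv_obj G) U))"
using code_inj by(simp add: bij_betw_def inverse_image_obj_def transport_def)

lemma decode_mor: "dmor L Z (inv_obj G) (inv_raw G) (%U. inv_into (C (Sec (inv_raw G) U)) (code G :: _ => ('p, 'a, 'j) universe))"
by(rule mor_inverse[OF G.R_mod inv_obj_mod code_mor code_bij])

definition unit_map :: "'p set => ('p, 'a, 'j) universe => ('p, 'a, 'j) universe" where "unit_map U g = code G (G.unit U g)"

lemma unit_map_mor: "dmor L W G (dir (inv_obj G)) unit_map" using mor_comp[OF G.unit_mor dir_im_mor[OF G.R_mod inv_obj_mod code_mor]]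
by(simp add: unit_map_def[abs_def])

lemma unit_map_bij:
assumes U: "opn U" shows "bij_betw (unit_map U) (C (Sec G U)) (C (Sec (dir (inv_obj G)) U))"
proof -
let ?A = "vertical_ann L Z W sg (inv_raw G) U"
have sub: "?A<=C (Sec (inv_raw G) U)" by(auto simp: vertical_ann_def)
have "code G ` ?A = C (Sec (dir (inv_obj G :: ('p, 'a, ('p, 'a, 'j) universe) dmodule)) U)"
proof
 show "code G ` ?A<=C (Sec (dir (inv_obj G)) U)" using mor_cl[OF dir_im_mor[OF G.R_mod inv_obj_mod code_mor], of U] U by(auto simp: dir_im_car)
 show "C (Sec (dir (inv_obj G)) U) <= code G ` ?A"
 proof
  fix t :: "('p, 'a, 'j) universe" assume t: "t:C (Sec (dir (inv_obj G)) U)"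
  let ?s = "inv_into (C (Sec (inv_raw G) U)) (code G) t"
  have "?s:?A" using mor_cl[OF dir_im_mor[OF inv_obj_mod G.R_mod decode_mor], of U] U t by(simp add: dir_im_car)
  moreover have "code G ?s = t" using bij_betw_inv_into_right[OF code_bij[OF U]] t by(auto simp: dir_im_car vertical_ann_def)
  ultimately show "t:code G ` ?A" by(metis imageI)
 qed
qed
moreover have "inj_on (code G :: _ => ('p, 'a, 'j) universe) ?A" by(rule inj_on_subset[OF code_inj[OF U] sub])
ultimately have "bij_betw (code G) ?A (C (Sec (dir (inv_obj G :: ('p, 'a, ('p, 'a, 'j) universe) dmodule)) U))" by(simp add: bij_betw_def)
from bij_betw_trans[OF G.unit_bij[OF U] this] show ?thesis by(simp add: unit_map_def[abs_def] comp_def)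
qed

end


abbreviation dec where "dec G U == inv_into (C (Sec (inv_raw G) U)) (code G)"
abbreviation raw_hom where "raw_hom == inverse_image_raw_hom Z W sg"

lemma raw_hom_id:
assumes G: "D_module L W G" and U: "opn U" and s: "s:C (Sec (inv_raw G) U)"
shows "raw_hom G G (dmap_mk W G (%U s. s)) U s = s"
proof -
interpret G: inv_im_of L Z W sg G by(rule inv_im_ofI[OF G])
have sS: "s:G.Ss U" using s by(simp add: G.R_simps)
show ?thesis
proof(rule raw_hom_eqI[OF G G mor_dmap_mk[OF G mor_id] U sS sS])
 fix p assume "p:U"
 then obtain V l where V: "G.rep U s p V l" using sS unfolding G.S_iff by blast
 hence "map (%(a, t). (a, dmap_mk W G (%U s. s) V t)) l = l" by(intro map_idI) (auto simp: G.rep_iff G.tens_iff dmap_mk_app)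
 thus "EX V l. G.rep U s p V l & G.rep U s p V (map (%(a, t). (a, dmap_mk W G (%U s. s) V t)) l)" using V by metis
qed
qed

lemma raw_hom_comp:
assumes G: "D_module L W G" and H: "D_module L W H" and K: "D_module L W K"
 and h: "dmor L W G H h" and k: "dmor L W H K k"
 and U: "opn U" and s: "s:C (Sec (inv_raw G) U)"
shows "raw_hom G K (dmap_mk W G (%U s. k U (h U s))) U s = raw_hom H K k U (raw_hom G H h U s)"
proof -
interpret G: inv_im_of L Z W sg G by(rule inv_im_ofI[OF G])
interpret K: inv_im_of L Z W sg K by(rule inv_im_ofI[OF K])
have sS: "s:G.Ss U" using s by(simp add: G.R_simps)
show ?thesis
proof(rule raw_hom_eqI[OF G K mor_dmap_mk[OF G mor_comp[OF h k]] U sS raw_hom_cl[OF H K k U raw_hom_cl[OF G H h U sS]]])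
 fix p assume "p:U"
 then obtain V l where V: "G.rep U s p V l" using sS unfolding G.S_iff by blast
 have e: "map (%(a, t). (a, k V t)) (map (%(a, t). (a, h V t)) l) = map (%(a, t). (a, dmap_mk W G (%U s. k U (h U s)) V t)) l"
  using V by(auto simp: G.rep_iff G.tens_iff dmap_mk_app)
 show "EX V l. G.rep U s p V l & K.rep U (raw_hom H K k U (raw_hom G H h U s)) p V (map (%(a, t). (a, dmap_mk W G (%U s. k U (h U s)) V t)) l)"
  using V raw_hom_rep[OF H K k U raw_hom_rep[OF G H h U V]] unfolding e by blast
qed
qed

abbreviation J :: "(('p, 'b, ('p, 'a, 'j) universe) dmodule, ('p, ('p, 'a, 'j) universe) dmod_map,
 ('p, 'a, ('p, 'a, 'j) universe) dmodule, ('p, ('p, 'a, 'j) universe) dmod_map) functor_data" where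
"J == inverse_image L Z W sg"

lemma J_simps: "on_obj J = inv_obj" "on_hom J G H h = dmap_mk Z (inv_obj G) (%U x. code H (raw_hom G H h U (dec G U x)))"
by(simp_all add: inverse_image_def)

lemma dec_cl: "D_module L W G ==> opn U ==> x:C (Sec (inv_obj G) U) ==> dec G U (x :: ('p, 'a, 'j) universe):C (Sec (inv_raw G) U)"
using mor_cl[OF decode_mor] by blast

lemma code_dec: "D_module L W G ==> opn U ==> x:C (Sec (inv_obj G) U) ==> code G (dec G U x) = (x :: ('p, 'a, 'j) universe)"
by(rule bij_betw_inv_into_right[OF code_bij])

lemma dec_code:
fixes G :: "('p, 'b, ('p, 'a, 'j) universe) dmodule"
assumes "D_module L W G" "opn U" "s:C (Sec (inv_raw G) U)"
shows "dec G U (code G s :: ('p, 'a, 'j) universe) = s"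
by(rule inv_into_f_f[OF code_inj[OF assms(1,2)] assms(3)])

lemma J_mor:
fixes G H :: "('p, 'b, ('p, 'a, 'j) universe) dmodule"
assumes "D_module L W G" "D_module L W H" "dmor L W G H h"
shows "dmor L Z (inv_obj G) (inv_obj H) (%U x. code H (raw_hom G H h U (dec G U x)))"
by(rule mor_comp[OF mor_comp[OF decode_mor[OF assms(1)] raw_hom_mor[OF assms]] code_mor[OF assms(2)]])

lemma inv_im_functor: "category_functor (D_mod L W) (D_mod L Z) J"
proof(intro category_functor.intro category_functor_axioms.intro D_mod_category, unfold D_mod_simps mem_Collect_eq J_simps)
fix G :: "('p, 'b, ('p, 'a, 'j) universe) dmodule" assume G: "D_module L W G"
show "D_module L Z (inv_obj G)" by(rule inv_obj_mod[OF G])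
show "dmap_mk Z (inv_obj G) (%U x. code G (raw_hom G G (dmap_mk W G (%U s. s)) U (dec G U x))) = dmap_mk Z (inv_obj G) (%U s. s)"
 by(rule dmap_mk_cong) (simp add: raw_hom_id[OF G _ dec_cl[OF G]] code_dec[OF G])
fix H :: "('p, 'b, ('p, 'a, 'j) universe) dmodule" and h assume H: "D_module L W H" and "h:dmod_hom L W G H"
hence h: "dmor L W G H h" by(simp add: dmod_hom_iff)
note Jh = J_mor[OF G H h]
show "dmap_mk Z (inv_obj G) (%U x. code H (raw_hom G H h U (dec G U x))):dmod_hom L Z (inv_obj G) (inv_obj H)"
 by(rule dmap_mk_hom[OF inv_obj_mod[OF G] Jh])
fix K :: "('p, 'b, ('p, 'a, 'j) universe) dmodule" and k assume K: "D_module L W K" and "k:dmod_hom L W H K"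
hence k: "dmor L W H K k" by(simp add: dmod_hom_iff)
show "dmap_mk Z (inv_obj G) (%U x. code K (raw_hom G K (dmap_mk W G (%U s. k U (h U s))) U (dec G U x))) =
  dmap_mk Z (inv_obj G) (%U s. dmap_mk Z (inv_obj H) (%U x. code K (raw_hom H K k U (dec H U x))) U
   (dmap_mk Z (inv_obj G) (%U x. code H (raw_hom G H h U (dec G U x))) U s))"
proof(rule dmap_mk_cong)
 fix U and x :: "('p, 'a, 'j) universe" assume U: "opn U" and x: "x:C (Sec (inv_obj G) U)"
 note d = dec_cl[OF G U x]
 note r = mor_cl[OF raw_hom_mor[OF G H h] U d]
 show "code K (raw_hom G K (dmap_mk W G (%U s. k U (h U s))) U (dec G U x)) = dmap_mk Z (inv_obj H) (%U x. code K (raw_hom H K k U (dec H U x))) U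
    (dmap_mk Z (inv_obj G) (%U x. code H (raw_hom G H h U (dec G U x))) U x)"
  using U x mor_cl[OF Jh U x] raw_hom_comp[OF G H K h k U d] dec_code[OF H U r] by(simp add: dmap_mk_app)
qed
qed

lemma eps_natural:
fixes F F' :: "('p, 'a, 'm) dmodule"
assumes F: "D_module L Z F" and F': "D_module L Z F'" and h: "dmor L Z F F' h"
 and U: "opn U" and s: "s:C (Sec (inv_raw (dir F)) U)"
shows "odd_dmod.eps L Z W sg F' U (raw_hom (dir F) (dir F') (dmap_mk W (dir F) h) U s) = h U (odd_dmod.eps L Z W sg F U s)"
proof -
interpret F: odd_dmod L Z W sg F by(rule odd_dmodI[OF F])
interpret F': odd_dmod L Z W sg F' by(rule odd_dmodI[OF F'])
interpret I: inv_im_of L Z W sg "dir F" by(rule inv_im_ofI[OF F.dir_im_mod])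
interpret I': inv_im_of L Z W sg "dir F'" by(rule inv_im_ofI[OF F'.dir_im_mod])
have sS: "s:I.Ss U" using s by(simp add: I.R_simps)
let ?h = "dmap_mk W (dir F) h"
note m = F.dir_im_mod F'.dir_im_mod mor_dmap_mk[OF F.dir_im_mod dir_im_mor[OF F F' h]]
show ?thesis
proof(rule F'.eps_eqI[OF U raw_hom_cl[OF m U sS] mor_cl[OF h U F.eps(1)[OF U sS]]])
 fix p assume "p:U"
 then obtain V l where V: "I.rep U s p V l" using sS unfolding I.S_iff by blast
 hence o: "opn V" "V<=U" "l:I.tens V" by(auto simp: I.rep_iff)
 have c: "a:cO V" "x:F.ann V" "x:C (Sec F V)" if "(a, x):set l" for a x using that o(3) F.annD(1) by(auto simp: F.tens_ann)
 have "mr F' U V (h U (F.eps U s)) = h V (F.E V l)" using mor_res[OF h U o(1,2) F.eps(1)[OF U sS]] F.eps_rep[OF U sS V] by simp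
 also have "... = lsum (Sec F' V) (%y. h V (case y of (a, x) => a.*[Sec F V] x)) l"
  by(rule addmap_lsum[OF F.F.M_ag[OF o(1)] F'.F.M_ag[OF o(1)] add_mor[OF h o(1)] F.E_term[OF o(1,3)]])
 also have "... = F'.E V (map (%(a, t). (a, ?h V t)) l)"
  unfolding lsum_map by(rule lsum_cong) (use c o(1) in \<open>auto simp: mor_smult[OF h o(1)] dmap_mk_app\<close>)
 finally show "EX V l. I'.rep U (raw_hom (dir F) (dir F') ?h U s) p V l & mr F' U V (h U (F.eps U s)) = F'.E V l"
  using raw_hom_rep[OF m U V] by blast
qed
qed

theorem equivalence: "inverse_equivalences (D_mod L W) (D_mod L Z) J (direct_image L Z W sg)"
proof(intro inverse_equivalences.intro inverse_equivalences_axioms.intro inv_im_functor dir_im_functor)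
let ?D = "direct_image L Z W sg :: (('p, 'a, ('p, 'a, 'j) universe) dmodule, ('p, ('p, 'a, 'j) universe) dmod_map, ('p, 'b, ('p, 'a, 'j) universe) dmodule, ('p, ('p, 'a, 'j) universe) dmod_map) functor_data"
have D: "on_obj ?D = dir" "on_hom ?D F F' h = dmap_mk W (dir F) h" for F F' h by(simp_all add: direct_image_def)
have ac: "s:C (Sec F U)" if "s:C (Sec (dir F) U)" for s U and F :: "('p, 'a, ('p, 'a, 'j) universe) dmodule"
 using that by(simp add: dir_im_car vertical_ann_def)
show "naturally_isomorphic (D_mod L W) (D_mod L W) identity_functor (functor_comp ?D J)"
 unfolding naturally_isomorphic_def identity_functor_def functor_comp_def D J_simps functor_data.simps
proof(intro exI[of _ "%G. dmap_mk W G (unit_map G)"] conjI ballI, unfold D_mod_simps mem_Collect_eq)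
 fix G :: "('p, 'b, ('p, 'a, 'j) universe) dmodule" assume G: "D_module L W G"
 show "dmap_mk W G (unit_map G):isos (D_mod L W) G (dir (inv_obj G))"
  using unit_map_bij[OF G] by(intro bijective_iso[OF G dir_mod[OF inv_obj_mod[OF G]] unit_map_mor[OF G]]) simp
 fix H :: "('p, 'b, ('p, 'a, 'j) universe) dmodule" and h assume H: "D_module L W H" and "h:dmod_hom L W G H"
 hence h: "dmor L W G H h" by(simp add: dmod_hom_iff)
 interpret G: inv_im_of L Z W sg G by(rule inv_im_ofI[OF G])
 show "dmap_mk W G (%U s. dmap_mk W H (unit_map H) U (h U s)) =
   dmap_mk W G (%U s. dmap_mk W (dir (inv_obj G)) (dmap_mk Z (inv_obj G) (%U x. code H (raw_hom G H h U (dec G U x)))) U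
    (dmap_mk W G (unit_map G) U s))"
 proof(rule dmap_mk_cong)
  fix U s assume U: "op_in W U" and s: "s:C (Sec G U)"
  hence oU: "opn U" by simp
  have u: "unit_map G U s:C (Sec (dir (inv_obj G)) U)" by(rule mor_cl[OF unit_map_mor[OF G] U s])
  have uc: "G.unit U s:C (Sec (inv_raw G) U)" using G.unit_S[OF oU s] by(simp add: G.R_simps)
  have "code H (raw_hom G H h U (dec G U (unit_map G U s))) = unit_map H U (h U s)"
   unfolding unit_map_def[OF G] unit_map_def[OF H] dec_code[OF G oU uc] raw_hom_unit[OF G H h oU s] ..
  thus "dmap_mk W H (unit_map H) U (h U s) =
    dmap_mk W (dir (inv_obj G)) (dmap_mk Z (inv_obj G) (%U x. code H (raw_hom G H h U (dec G U x)))) U (dmap_mk W G (unit_map G) U s)"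
   using U oU s u ac[OF u] mor_cl[OF h U s] by(simp add: dmap_mk_app)
 qed
qed
let ?e = "%F U x. odd_dmod.eps L Z W sg F U (dec (dir F) U (x :: ('p, 'a, 'j) universe))"
show "naturally_isomorphic (D_mod L Z) (D_mod L Z) (functor_comp J ?D) identity_functor"
 unfolding naturally_isomorphic_def identity_functor_def functor_comp_def D J_simps functor_data.simps
proof(intro exI[of _ "%F. dmap_mk Z (inv_obj (dir F)) (?e F)"] conjI ballI, unfold D_mod_simps mem_Collect_eq)
 fix F :: "('p, 'a, ('p, 'a, 'j) universe) dmodule" assume F: "D_module L Z F"
 interpret F: odd_dmod L Z W sg F by(rule odd_dmodI[OF F])
 interpret I: inv_im_of L Z W sg "dir F" by(rule inv_im_ofI[OF F.dir_im_mod])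
 note dF = F.dir_im_mod
 note e = mor_comp[OF decode_mor[OF dF] F.eps_mor]
 show "dmap_mk Z (inv_obj (dir F)) (?e F):isos (D_mod L Z) (inv_obj (dir F)) F"
 proof(rule bijective_iso[OF inv_obj_mod[OF dF] F e])
  fix U assume U: "opn U"
  from bij_betw_trans[OF bij_betw_inv_into[OF code_bij[OF dF U]] F.eps_bij[OF U, folded I.R_car]]
  show "bij_betw (?e F U) (C (Sec (inv_obj (dir F)) U)) (C (Sec F U))" by(simp add: comp_def)
 qed
 fix F' :: "('p, 'a, ('p, 'a, 'j) universe) dmodule" and h assume F': "D_module L Z F'" and "h:dmod_hom L Z F F'"
 hence h: "dmor L Z F F' h" by(simp add: dmod_hom_iff)
 note dF' = dir_mod[OF F']
 let ?h = "dmap_mk W (dir F) h"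
 note hm = mor_dmap_mk[OF dF dir_im_mor[OF F F' h]]
 show "dmap_mk Z (inv_obj (dir F)) (%U s. dmap_mk Z (inv_obj (dir F')) (?e F') U
    (dmap_mk Z (inv_obj (dir F)) (%U x. code (dir F') (raw_hom (dir F) (dir F') ?h U (dec (dir F) U x))) U s)) =
   dmap_mk Z (inv_obj (dir F)) (%U s. h U (dmap_mk Z (inv_obj (dir F)) (?e F) U s))"
 proof(rule dmap_mk_cong)
  fix U and x :: "('p, 'a, 'j) universe" assume U: "opn U" and x: "x:C (Sec (inv_obj (dir F)) U)"
  note d = dec_cl[OF dF U x]
  note r = mor_cl[OF raw_hom_mor[OF dF dF' hm] U d]
  show "dmap_mk Z (inv_obj (dir F')) (?e F') U
    (dmap_mk Z (inv_obj (dir F)) (%U x. code (dir F') (raw_hom (dir F) (dir F') ?h U (dec (dir F) U x))) U x) =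
    h U (dmap_mk Z (inv_obj (dir F)) (?e F) U x)"
   using U x mor_cl[OF J_mor[OF dF dF' hm] U x] eps_natural[OF F F' h U d] dec_code[OF dF' U r] by(simp add: dmap_mk_app)
 qed
qed
qed

end

theorem theorem1:
  fixes \<tau> :: setting
    and \<Lambda> :: "'l complex_superalgebra"
    and Z :: "('p, 'l, 'a) superspace"
    and W :: "('p, 'l, 'b) superspace"
    and \<sigma> :: "'p set \<Rightarrow> 'b \<Rightarrow> 'a"
  assumes "nilpotent_extension \<Lambda>"
    and "smooth_superscheme \<tau> \<Lambda> Z"
    and "smooth_superscheme \<tau> \<Lambda> W"
    and "purely_odd_submersion \<Lambda> Z W \<sigma>"
  shows "inverse_equivalences
    (D_mod \<Lambda> W :: (('p, 'b, ('p, 'a, 'j) universe) dmodule,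
                    ('p, ('p, 'a, 'j) universe) dmod_map) category_data)
    (D_mod \<Lambda> Z)
    (inverse_image \<Lambda> Z W \<sigma>)
    (direct_image \<Lambda> Z W \<sigma>)"
proof -
  have "odd_submersion \<Lambda> Z W \<sigma>"
    using assms by (intro odd_submersion.intro lambda_superspace.intro lambda_superspace_axioms.intro)
      (auto dest: smooth_superscheme.axioms)
  then show ?thesis by (rule odd_submersion.equivalence)
qed

end
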